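(* Let $Q\subset\mathbb{R}^d$ be a bounded, open, connected region whose boundary $\partial Q$ is a Lyapunov surface of class $C^{1,\lambda}$. Let $B=(b_{ij})_{1\le i,j\le d}$ be a constant real matrix with rows $b_i=(b_{i1},\dots,b_{id})$, and put $\sigma=B^{T}B=(\sigma_{ij})$. Assume there is $\mu>0$ with $\sum_{i,j}\sigma_{ij}z_iz_j\ge \mu|z|^2$ for all $z\in\mathbb{R}^d$. For each $\tau>0$ let $N(\cdot,\tau)$ be a deterministic finite counting measure on $Q$, i.e. $N(\cdot,\tau)=\sum_{k=1}^{N(Q,\tau)}\delta_{\gamma_k}$ for points $\gamma_1,\dots,\gamma_{N(Q,\tau)}\in Q$ (depending on $\tau$), with $N(Q,\tau)<\infty$. Let $W^{(1)},\dots,W^{(N(Q,\tau))}$ be mutually independent $d$-dimensional standard Wiener processes, and for each $k$ let $\xi_k$ be the solution of $d\xi_k(t)=\sum_{i=1}^d b_i\,dw^{(k)}_i(t)$, $\xi_k(0)=\gamma_k$, absorbed (killed) upon hitting $\partial Q$. Let $\eta(\tau)$ be the number of indices $k$ such that $\xi_k$ has not been absorbed by time $\tau$ (i.e. $\xi_k(t)\in Q$ for all $t\in[0,\tau]$). Let $0<\lambda_1<\lambda_2<\cdots$ be the distinct eigenvalues of the Dirichlet problem $\sum_{i,j}\sigma_{ij}\frac{\partial^2 u}{\partial x_i\partial x_j}=-\lambda u$ in $Q$, $u|_{\partial Q}=0$, and let $f_{11},\dots,f_{1n_1}$ be an $L_2(Q)$-orthonormal basis of the eigenspace of $\lambda_1$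 ($n_1$ its multiplicity). Set $c_{1i}=\int_Q f_{1i}(x)\,dx$ and $F(x)=\sum_{i=1}^{n_1}c_{1i}f_{1i}(x)$. Define the measures $\nu_\tau(B')=e^{-\tau\lambda_1/2}N(B',\tau)$ for Borel $B'\subset Q$. Suppose $\nu$ is a finite measure on $Q$ such that $\nu_\tau\Rightarrow\nu$ weakly as $\tau\to\infty$. Then $\eta(\tau)$ converges in distribution, as $\tau\to\infty$, to a Poisson random variable with parameter $a=\int_Q F(x)\,d\nu(x)$.
   Context: Weak convergence $\nu_\tau\Rightarrow\nu$ of finite measures means $\int g\,d\nu_\tau\to\int g\,d\nu$ for every bounded continuous function $g$ on $\bar Q$. The absorbed processes $\xi_k$ evolve independently of one another. *)

theory Defs
  imports "HOL-Probability.Probability"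
begin

definition lyapunov_boundary :: "(real^('d::finite)) set \<Rightarrow> real \<Rightarrow> bool" where
  "lyapunov_boundary Q lam \<longleftrightarrow> 0 < lam \<and> lam \<le> 1 \<and>
     (\<forall>p\<in>frontier Q. \<exists>r>0. \<exists>(\<phi>::real^'d \<Rightarrow> real) (g::real^'d \<Rightarrow> real^'d) (C::real).
        (\<forall>x\<in>ball p r. (\<phi> has_derivative (\<lambda>h. g x \<bullet> h)) (at x)) \<and>
        (\<forall>x\<in>ball p r. \<forall>y\<in>ball p r. norm (g x - g y) \<le> C * dist x y powr lam) \<and>
        g p \<noteq> 0 \<and>
        Q \<inter> ball p r = {x\<in>ball p r. \<phi> x < 0})"

definition pderiv_vec :: "'d \<Rightarrow> (real^'d \<Rightarrow> real) \<Rightarrow> real^'d \<Rightarrow> real" where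
  "pderiv_vec i u x = deriv (\<lambda>t. u (x + t *\<^sub>R axis i 1)) 0"

definition C2_on :: "(real^'d) set \<Rightarrow> (real^'d \<Rightarrow> real) \<Rightarrow> bool" where
  "C2_on Q u \<longleftrightarrow> u differentiable_on Q \<and>
     (\<forall>j. pderiv_vec j u differentiable_on Q) \<and>
     (\<forall>i j. continuous_on Q (pderiv_vec i (pderiv_vec j u)))"

definition dirichlet_solution ::
    "real^'d^'d \<Rightarrow> (real^'d) set \<Rightarrow> real \<Rightarrow> (real^'d \<Rightarrow> real) \<Rightarrow> bool" where
  "dirichlet_solution \<sigma> Q l u \<longleftrightarrow>
     C2_on Q u \<and> continuous_on (closure Q) u \<and>
     (\<forall>x\<in>Q. (\<Sum>i\<in>UNIV. \<Sum>j\<in>UNIV. \<sigma> $ i $ j * pderiv_vec i (pderiv_vec j u) x) = - l * u x) \<and>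
     (\<forall>x\<in>frontier Q. u x = 0)"

definition dirichlet_eigenvalue :: "real^'d^'d \<Rightarrow> (real^'d) set \<Rightarrow> real \<Rightarrow> bool" where
  "dirichlet_eigenvalue \<sigma> Q l \<longleftrightarrow> (\<exists>u. dirichlet_solution \<sigma> Q l u \<and> (\<exists>x\<in>Q. u x \<noteq> 0))"

definition std_wiener_1d :: "'a measure \<Rightarrow> (real \<Rightarrow> 'a \<Rightarrow> real) \<Rightarrow> bool" where
  "std_wiener_1d M w \<longleftrightarrow>
     (\<forall>t. w t \<in> borel_measurable M) \<and>
     (\<forall>\<omega>\<in>space M. w 0 \<omega> = 0 \<and> continuous_on {0..} (\<lambda>t. w t \<omega>)) \<and>
     (\<forall>s t. 0 \<le> s \<and> s < t \<longrightarrow>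
        distributed M lborel (\<lambda>\<omega>. w t \<omega> - w s \<omega>) (normal_density 0 (sqrt (t - s)))) \<and>
     (\<forall>ts::real list. sorted ts \<and> distinct ts \<and> (\<forall>t\<in>set ts. 0 \<le> t) \<longrightarrow>
        prob_space.indep_vars M (\<lambda>_. borel)
          (\<lambda>i \<omega>. w (ts ! Suc i) \<omega> - w (ts ! i) \<omega>) {..<length ts - 1})"

definition std_wiener :: "'a measure \<Rightarrow> (real \<Rightarrow> 'a \<Rightarrow> real^'d) \<Rightarrow> bool" where
  "std_wiener M W \<longleftrightarrow>
     (\<forall>i. std_wiener_1d M (\<lambda>t \<omega>. W t \<omega> $ i)) \<and>
     prob_space.indep_vars M (\<lambda>_. PiM UNIV (\<lambda>_::real. borel :: real measure))
        (\<lambda>i \<omega>. \<lambda>t. W t \<omega> $ i) (UNIV :: 'd set)"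

definition indep_processes :: "'a measure \<Rightarrow> (nat \<Rightarrow> real \<Rightarrow> 'a \<Rightarrow> real^'d) \<Rightarrow> nat set \<Rightarrow> bool" where
  "indep_processes M W K \<longleftrightarrow>
     prob_space.indep_vars M (\<lambda>_. PiM UNIV (\<lambda>_::real. borel :: (real^'d) measure))
        (\<lambda>k \<omega>. \<lambda>t. W k t \<omega>) K"

end

theory Submission
  imports Defs
begin

text \<open>Let \<open>P\<^sub>k\<close> be the transition operator over the time \<open>1 / 2 ^ k\<close> of the process \<open>x + b (W t)\<close> killed outside
  \<open>Q\<close>. It is obtained as a limit of iterates of \<open>f \<mapsto> 1\<^sub>K G\<^sub>s (1\<^sub>K f)\<close>, where \<open>G\<^sub>s\<close> is the Gaussian operator without killing, so
  that \<open>P\<^sub>k ^ j 1\<close> is the probability of survival up to the time \<open>j / 2 ^ k\<close>. Being symmetric and bounded from \<open>L\<^sub>2\<close>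
  to bounded functions, \<open>P\<^sub>k\<close> admits power iteration: \<open>P\<^sub>k ^ n 1 / \<rho> ^ n\<close> converges uniformly to some \<open>h \<ge> 0\<close>
  with \<open>P\<^sub>k h = \<rho> h\<close>, where \<open>\<rho> = exp (- \<mu> / 2 / 2 ^ k)\<close>, and neither \<open>h\<close> nor \<open>\<mu>\<close> depends on \<open>k\<close>.

  Inside \<open>Q\<close>, the operators \<open>P\<^sub>k\<close> and \<open>G\<^sub>s\<close> for \<open>s = 1 / 2 ^ k\<close> differ by \<open>O (s ^ 3)\<close>. Hence every common eigenfunction
  of the \<open>P\<^sub>k\<close> is a \<open>C\<^sup>2\<close> solution of the differential equation, and \<open>h\<close> vanishes continuously at the boundary because of the exterior
  cones provided by the Lyapunov condition. Conversely Taylor expansion turns Dirichlet eigenfunctions into eigenfunctions of the \<open>P\<^sub>k\<close>.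
  Comparing growth rates gives \<open>\<mu> = \<lambda>\<^sub>1\<close>, and \<open>\<langle>h, f\<^sub>1\<^sub>i\<rangle> = lim \<rho> ^ (- n) \<langle>P\<^sub>k ^ n 1, f\<^sub>1\<^sub>i\<rangle> = \<langle>1, f\<^sub>1\<^sub>i\<rangle>\<close>
  by symmetry, so that \<open>h = F\<close>.

  The survival probabilities multiplied by \<open>exp (\<tau> \<lambda>\<^sub>1 / 2)\<close> thus converge uniformly to \<open>F\<close>: the number of survivors is a sum of
  independent indicators of uniformly rare events whose probabilities add up to a quantity tending to \<open>a\<close>.\<close>

section \<open>The standard Gaussian measure\<close>

text \<open>The Markov property is never invoked. Of a single Wiener process only the start at 0,
  independent Gaussian increments on finite grids and continuity of paths are used, so the killed
  process is met only through operators: a walk on a grid whose positions are checked in a compact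
  set. Checking more often kills more, a larger compact set kills less, and these two monotone
  limits produce \<open>P k\<close>. Dyadic times turn every composition into a doubling.

  No spectral theorem is invoked either. Moments of a symmetric operator that is a square are
  log-convex, which yields the growth rate \<open>\<rho>\<close> and Cauchy iterates; the bound from
  \<open>L2\<close> to bounded functions makes the limit uniform and keeps it from being zero.

  The exponent 3 of the exit error is dictated by regularity: derivatives of the heat kernel up to
  order two are estimated at the cost \<open>s ^ -2\<close>, and the remaining power of
  \<open>s = 1 / 2 ^ k\<close> makes the derivatives of successive approximations converge
  geometrically. It stems from a sixth moment, because Gaussian displacements scale like the square
  root of \<open>s\<close>.\<close>

definition gauss :: "(real^'d) measure" where
  "gauss = density lborel (\<lambda>z. ennreal (\<Prod>i\<in>UNIV. std_normal_density (z $ i)))"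

lemma measurable_vec_PiM [measurable]:
  "(\<lambda>f. \<chi> i. f i) \<in> measurable (PiM UNIV (\<lambda>_::'d::finite. borel::real measure)) (borel :: (real^'d) measure)"
proof (subst borel_measurable_euclidean_space, intro ballI)
  fix b :: "real^'d" assume "b \<in> Basis"
  then obtain i where "b = axis i 1" by (auto simp: Basis_vec_def)
  then show "(\<lambda>f. (\<chi> i. f i) \<bullet> b) \<in> borel_measurable (PiM UNIV (\<lambda>_. borel))"
    by (simp add: inner_axis)
qed

text \<open>Carries product measures on functions over to vectors. Lebesgue measure is determined by
  its values on boxes, and a box pulls back to a product of intervals.\<close>

lemma lborel_vec:
  "distr (PiM UNIV (\<lambda>_::'d::finite. lborel::real measure)) borel (\<lambda>f. \<chi> i. f i) = (lborel::(real^'d) measure)"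
proof (rule lborel_eqI[symmetric])
  let ?P = "PiM UNIV (\<lambda>_::'d. lborel::real measure)"
  interpret product_sigma_finite "\<lambda>_::'d. lborel::real measure"
    by (simp add: product_sigma_finite_def sigma_finite_lborel)
  have m: "(\<lambda>f. \<chi> i. f i) \<in> measurable ?P (borel :: (real^'d) measure)"
    using measurable_vec_PiM by (simp cong: measurable_cong_sets)
  fix l u :: "real^'d" assume le: "\<And>b. b \<in> Basis \<Longrightarrow> l \<bullet> b \<le> u \<bullet> b"
  have le': "l $ i \<le> u $ i" for i using le[of "axis i 1"] by (auto simp: Basis_vec_def inner_axis)
  have eq: "(\<lambda>f. \<chi> i. f i) -` box l u \<inter> space ?P = PiE UNIV (\<lambda>i. {l $ i <..< u $ i})"
    by (auto simp: mem_box_cart space_PiM PiE_iff)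
  have "emeasure (distr ?P borel (\<lambda>f. \<chi> i. f i)) (box l u) = emeasure ?P (PiE UNIV (\<lambda>i. {l $ i <..< u $ i}))"
    using m by (subst emeasure_distr) (auto simp: eq)
  also have "\<dots> = (\<Prod>i\<in>UNIV. emeasure lborel {l $ i <..< u $ i})"
    by (subst emeasure_PiM) auto
  also have "\<dots> = (\<Prod>i\<in>UNIV. ennreal (u $ i - l $ i))"
    using le' by (intro prod.cong) auto
  also have "\<dots> = ennreal (\<Prod>i\<in>UNIV. u $ i - l $ i)"
    using le' by (subst prod_ennreal) auto
  also have "(\<Prod>i\<in>UNIV. u $ i - l $ i) = (\<Prod>b\<in>Basis. (u - l) \<bullet> b)"
  proof -
    have B: "(Basis :: (real^'d) set) = (\<lambda>i. axis i 1) ` UNIV" by (auto simp: Basis_vec_def)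
    have "inj (\<lambda>i::'d. axis i (1::real))" by (auto simp: inj_on_def axis_eq_axis)
    then show ?thesis unfolding B by (subst prod.reindex) (auto simp: inner_axis)
  qed
  finally show "emeasure (distr ?P borel (\<lambda>f. \<chi> i. f i)) (box l u) = (\<Prod>b\<in>Basis. (u - l) \<bullet> b)" .
qed simp

text \<open>A product measure is determined by rectangles, on which the integral of a product of
  one-variable functions factors. Total mass 1 makes the factor measures sigma-finite.\<close>

lemma PiM_density_real:
  fixes f :: "real \<Rightarrow> ennreal"
  assumes [measurable]: "f \<in> borel_measurable borel" and P: "prob_space (density lborel f)"
  shows "PiM UNIV (\<lambda>_::'d::finite. density lborel f) = density (PiM UNIV (\<lambda>_. lborel)) (\<lambda>x. \<Prod>i\<in>UNIV. f (x i))"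
proof -
  interpret product_sigma_finite "\<lambda>_::'d. lborel::real measure"
    by (simp add: product_sigma_finite_def sigma_finite_lborel)
  interpret D: prob_space "density lborel f" by (rule P)
  interpret PP: product_sigma_finite "\<lambda>_::'d. density lborel f"
    by (simp add: product_sigma_finite_def D.sigma_finite_measure)
  let ?P = "PiM UNIV (\<lambda>_::'d. lborel::real measure)"
  show ?thesis
  proof (rule sym, rule PP.PiM_eqI)
    show "finite (UNIV::'d set)" by simp
    show "sets (density ?P (\<lambda>x. \<Prod>i\<in>UNIV. f (x i))) = sets (PiM UNIV (\<lambda>_::'d. density lborel f))"
      by (auto cong: sets_PiM_cong)
    fix A :: "'d \<Rightarrow> real set" assume A: "\<And>i. i \<in> UNIV \<Longrightarrow> A i \<in> sets (density lborel f)"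
    then have A'[measurable]: "\<And>i. A i \<in> sets borel" by auto
    have ind: "indicator (PiE UNIV A) x = (\<Prod>i\<in>UNIV. indicator (A i) (x i) :: ennreal)" for x
      by (auto simp: indicator_def PiE_iff prod_zero_iff)
    have "emeasure (density ?P (\<lambda>x. \<Prod>i\<in>UNIV. f (x i))) (PiE UNIV A) =
        (\<integral>\<^sup>+x. (\<Prod>i\<in>UNIV. f (x i)) * indicator (PiE UNIV A) x \<partial>?P)"
      by (rule emeasure_density) auto
    also have "\<dots> = (\<integral>\<^sup>+x. (\<Prod>i\<in>UNIV. f (x i) * indicator (A i) (x i)) \<partial>?P)"
      by (simp add: ind prod.distrib)
    also have "\<dots> = (\<Prod>i\<in>UNIV. \<integral>\<^sup>+x. f x * indicator (A i) x \<partial>lborel)"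
      by (rule product_nn_integral_prod) auto
    also have "\<dots> = (\<Prod>i\<in>UNIV. emeasure (density lborel f) (A i))"
      by (intro prod.cong) (auto simp: emeasure_density)
    finally show "emeasure (density ?P (\<lambda>x. \<Prod>i\<in>UNIV. f (x i))) (PiE UNIV A) =
      (\<Prod>i\<in>UNIV. emeasure (density lborel f) (A i))" .
  qed
qed

text \<open>Independence of the coordinates in usable form: total mass 1, the moments, and the law
  of a scaled Wiener increment are all read off from it.\<close>

lemma gauss_PiM:
  "(gauss :: (real^'d) measure) = distr (PiM UNIV (\<lambda>_::'d::finite. density lborel std_normal_density)) borel (\<lambda>f. \<chi> i. f i)"
proof -
  let ?P = "PiM UNIV (\<lambda>_::'d. lborel::real measure)"
  have m: "(\<lambda>f. \<chi> i. f i) \<in> measurable ?P (borel :: (real^'d) measure)"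
    using measurable_vec_PiM by (simp cong: measurable_cong_sets)
  have "gauss = density (distr ?P borel (\<lambda>f. \<chi> i. f i)) (\<lambda>z::real^'d. ennreal (\<Prod>i\<in>UNIV. std_normal_density (z $ i)))"
    unfolding gauss_def lborel_vec ..
  also have "\<dots> = distr (density ?P (\<lambda>x. ennreal (\<Prod>i\<in>UNIV. std_normal_density (x i)))) borel (\<lambda>f. \<chi> i. f i)"
    by (subst density_distr[OF _ m]) auto
  also have "density ?P (\<lambda>x. ennreal (\<Prod>i\<in>UNIV. std_normal_density (x i))) =
      PiM UNIV (\<lambda>_::'d. density lborel std_normal_density)"
    by (subst PiM_density_real) (auto simp: prod_ennreal prob_space_normal_density)
  finally show ?thesis .
qed

definition gauss_density :: "real^'d \<Rightarrow> real" where
  "gauss_density z = (1 / sqrt (2 * pi)) ^ CARD('d) * exp (- (norm z)\<^sup>2 / 2)"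

lemma norm_vec_sq: "(norm (z::real^'d))\<^sup>2 = (\<Sum>i\<in>UNIV. (z $ i)\<^sup>2)"
  unfolding power2_norm_eq_inner inner_vec_def by (simp add: power2_eq_square)

lemma gauss_density_prod: "(\<Prod>i\<in>UNIV. std_normal_density (z $ i)) = gauss_density (z::real^'d)"
proof -
  have "(\<Prod>i\<in>UNIV. std_normal_density (z $ i)) = (\<Prod>i\<in>(UNIV::'d set). 1 / sqrt (2*pi)) * (\<Prod>i\<in>UNIV. exp (- (z$i)\<^sup>2/2))"
    unfolding std_normal_density_def by (rule prod.distrib)
  also have "(\<Prod>i\<in>UNIV. exp (- (z$i)\<^sup>2/2)) = exp (- (norm z)\<^sup>2/2)"
    by (simp add: norm_vec_sq exp_sum[symmetric] sum_divide_distrib sum_negf)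
  finally show ?thesis by (simp add: gauss_density_def)
qed

lemma gauss_density_pos: "0 < gauss_density z"
  by (simp add: gauss_density_def)

lemma gauss_density_nonneg [simp]: "0 \<le> gauss_density z"
  using gauss_density_pos[of z] by simp

lemma gauss_density_measurable [measurable]: "gauss_density \<in> borel_measurable borel"
  unfolding gauss_density_def by measurable

lemma gauss_eq_density: "gauss = density lborel (\<lambda>z::real^'d. ennreal (gauss_density z))"
  by (simp add: gauss_def gauss_density_prod)

lemma sets_gauss [simp, measurable_cong]: "sets gauss = sets borel"
  by (simp add: gauss_def)

lemma space_gauss [simp]: "space gauss = UNIV"
  by (simp add: gauss_def)

lemma prob_space_gauss: "prob_space (gauss :: (real^'d) measure)"
proof -
  have "prob_space (PiM UNIV (\<lambda>_::'d. density lborel std_normal_density))"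
    by (intro prob_space_PiM prob_space_normal_density) auto
  moreover have "(\<lambda>f. \<chi> i. f i) \<in> measurable (PiM UNIV (\<lambda>_::'d. density lborel std_normal_density)) (borel :: (real^'d) measure)"
    using measurable_vec_PiM by (simp cong: measurable_cong_sets sets_PiM_cong)
  ultimately show ?thesis unfolding gauss_PiM by (intro prob_space.prob_space_distr)
qed

interpretation gauss: prob_space "gauss :: (real^'d) measure"
  by (rule prob_space_gauss)

lemma nn_integral_lborel_affine:
  fixes f :: "real^'d \<Rightarrow> ennreal"
  assumes [measurable]: "f \<in> borel_measurable borel" and c: "c \<noteq> 0"
  shows "(\<integral>\<^sup>+x. f x \<partial>lborel) = ennreal (\<bar>c\<bar> ^ CARD('d)) * (\<integral>\<^sup>+x. f (t + c *\<^sub>R x) \<partial>lborel)"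
proof -
  have "(\<integral>\<^sup>+x. f x \<partial>lborel) = (\<integral>\<^sup>+x. f x \<partial>density (distr lborel borel (\<lambda>x. t + c *\<^sub>R x)) (\<lambda>_. ennreal (\<bar>c\<bar> ^ CARD('d))))"
    using lborel_affine[of c t] c by (simp add: ennreal_power)
  also have "\<dots> = ennreal (\<bar>c\<bar> ^ CARD('d)) * (\<integral>\<^sup>+x. f x \<partial>(distr lborel borel (\<lambda>x. t + c *\<^sub>R x)))"
    by (subst nn_integral_density) (auto simp: nn_integral_cmult)
  also have "(\<integral>\<^sup>+x. f x \<partial>(distr lborel borel (\<lambda>x. t + c *\<^sub>R x))) = (\<integral>\<^sup>+x. f (t + c *\<^sub>R x) \<partial>lborel)"
    by (subst nn_integral_distr) auto
  finally show ?thesis .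
qed

lemma nn_integral_gauss:
  "f \<in> borel_measurable borel \<Longrightarrow> (\<integral>\<^sup>+z. f z \<partial>gauss) = (\<integral>\<^sup>+z. ennreal (gauss_density z) * f z \<partial>lborel)"
  unfolding gauss_eq_density by (subst nn_integral_density) auto

lemma nn_integral_gauss_uminus:
  fixes f :: "real^'d \<Rightarrow> ennreal"
  assumes [measurable]: "f \<in> borel_measurable borel"
  shows "(\<integral>\<^sup>+z. f (- z) \<partial>gauss) = (\<integral>\<^sup>+z. f z \<partial>gauss)"
proof -
  have "(\<integral>\<^sup>+z. f z \<partial>gauss) = (\<integral>\<^sup>+z. ennreal (gauss_density z) * f z \<partial>lborel)"
    by (simp add: nn_integral_gauss)
  also have "\<dots> = ennreal (\<bar>-1\<bar> ^ CARD('d)) * (\<integral>\<^sup>+z. ennreal (gauss_density (0 + (-1) *\<^sub>R z)) * f (0 + (-1) *\<^sub>R z) \<partial>lborel)"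
    by (rule nn_integral_lborel_affine) auto
  also have "\<dots> = (\<integral>\<^sup>+z. f (- z) \<partial>gauss)"
    by (subst nn_integral_gauss) (auto simp: gauss_density_def)
  finally show ?thesis ..
qed

lemma distr_gauss_uminus: "distr gauss borel uminus = (gauss :: (real^'d) measure)"
proof (rule measure_eqI)
  fix A :: "(real^'d) set" assume "A \<in> sets (distr gauss borel uminus)"
  then have [measurable]: "A \<in> sets borel" by simp
  have "emeasure (distr gauss borel uminus) A = (\<integral>\<^sup>+z. indicator A z \<partial>distr gauss borel uminus)"
    by simp
  also have "\<dots> = (\<integral>\<^sup>+z. indicator A (- z) \<partial>gauss)" by (subst nn_integral_distr) auto
  also have "\<dots> = (\<integral>\<^sup>+z. indicator A z \<partial>gauss)" by (rule nn_integral_gauss_uminus) auto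
  also have "\<dots> = emeasure gauss A" by simp
  finally show "emeasure (distr gauss borel uminus) A = emeasure gauss A" .
qed simp

text \<open>Completing the square in the coordinates \<open>w = z + z'\<close> splits the exponent
  into a function of \<open>w / sqrt 2\<close> and one of \<open>sqrt 2 (z' - w / 2)\<close>, so the
  integral over \<open>z'\<close> is a constant. With dyadic times this is the only composition law
  needed.\<close>

lemma nn_integral_gauss_add:
  fixes F :: "real^'d \<Rightarrow> ennreal"
  assumes [measurable]: "F \<in> borel_measurable borel"
  shows "(\<integral>\<^sup>+z'. (\<integral>\<^sup>+z. F (z + z') \<partial>gauss) \<partial>gauss) = (\<integral>\<^sup>+z. F (sqrt 2 *\<^sub>R z) \<partial>gauss)"
proof -
  let ?g = "\<lambda>z::real^'d. ennreal (gauss_density z)"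
  have split: "?g (w - z') * ?g z' = ?g ((1/sqrt 2) *\<^sub>R w) * ?g (sqrt 2 *\<^sub>R (z' - (1/2) *\<^sub>R w))" for w z' :: "real^'d"
  proof -
    have "(norm (w - z'))\<^sup>2 + (norm z')\<^sup>2 = (norm ((1/sqrt 2) *\<^sub>R w))\<^sup>2 + (norm (sqrt 2 *\<^sub>R (z' - (1/2) *\<^sub>R w)))\<^sup>2"
      by (simp add: power_mult_distrib power_divide) (simp add: power2_norm_eq_inner inner_diff_left inner_diff_right inner_commute field_simps)
    then have "gauss_density (w - z') * gauss_density z' = gauss_density ((1/sqrt 2) *\<^sub>R w) * gauss_density (sqrt 2 *\<^sub>R (z' - (1/2) *\<^sub>R w))"
      unfolding gauss_density_def by (simp add: exp_add[symmetric] mult_exp_exp field_simps)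
    then show ?thesis by (simp add: ennreal_mult[symmetric])
  qed
  have one: "(\<integral>\<^sup>+z. ?g z \<partial>lborel) = 1"
    using gauss.emeasure_space_1 by (simp add: gauss_eq_density emeasure_density)
  \<comment> \<open>The constant comes from rescaling the total mass \<open>one\<close>; the shift
    by \<open>w / 2\<close> has no influence.\<close>
  have half: "(\<integral>\<^sup>+z'. ?g (sqrt 2 *\<^sub>R (z' - (1/2) *\<^sub>R w)) \<partial>lborel) = ennreal (1 / sqrt 2 ^ CARD('d))" for w :: "real^'d"
  proof -
    have "1 = ennreal (\<bar>sqrt 2\<bar> ^ CARD('d)) * (\<integral>\<^sup>+z'. ?g (- (sqrt 2 / 2) *\<^sub>R w + sqrt 2 *\<^sub>R z') \<partial>lborel)"
      by (subst one[symmetric], rule nn_integral_lborel_affine) auto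
    also have "(\<lambda>z'. ?g (- (sqrt 2 / 2) *\<^sub>R w + sqrt 2 *\<^sub>R z')) = (\<lambda>z'. ?g (sqrt 2 *\<^sub>R (z' - (1/2) *\<^sub>R w)))"
      by (simp add: scaleR_diff_right)
    finally have "ennreal (1 / sqrt 2 ^ CARD('d)) * 1 = ennreal (1 / sqrt 2 ^ CARD('d)) * (ennreal (sqrt 2 ^ CARD('d)) * (\<integral>\<^sup>+z'. ?g (sqrt 2 *\<^sub>R (z' - (1/2) *\<^sub>R w)) \<partial>lborel))"
      by simp
    also have "\<dots> = (ennreal (1 / sqrt 2 ^ CARD('d)) * ennreal (sqrt 2 ^ CARD('d))) * (\<integral>\<^sup>+z'. ?g (sqrt 2 *\<^sub>R (z' - (1/2) *\<^sub>R w)) \<partial>lborel)"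
      by (simp only: mult.assoc)
    also have "ennreal (1 / sqrt 2 ^ CARD('d)) * ennreal (sqrt 2 ^ CARD('d)) = 1"
      by (subst ennreal_mult[symmetric]) auto
    finally show ?thesis by simp
  qed
  have "(\<integral>\<^sup>+z'. (\<integral>\<^sup>+z. F (z + z') \<partial>gauss) \<partial>gauss) = (\<integral>\<^sup>+z'. ?g z' * (\<integral>\<^sup>+z. ?g z * F (z + z') \<partial>lborel) \<partial>lborel)"
    by (simp add: nn_integral_gauss)
  also have "\<dots> = (\<integral>\<^sup>+z'. ?g z' * (\<integral>\<^sup>+w. ?g (w - z') * F w \<partial>lborel) \<partial>lborel)"
  proof (intro nn_integral_cong)
    fix z' :: "real^'d"
    have "(\<integral>\<^sup>+z. ?g z * F (z + z') \<partial>lborel) = ennreal (\<bar>1\<bar> ^ CARD('d)) * (\<integral>\<^sup>+w. ?g (- z' + 1 *\<^sub>R w) * F ((- z' + 1 *\<^sub>R w) + z') \<partial>lborel)"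
      by (rule nn_integral_lborel_affine[where f="\<lambda>z. ?g z * F (z + z')"]) auto
    then show "?g z' * (\<integral>\<^sup>+z. ?g z * F (z + z') \<partial>lborel) = ?g z' * (\<integral>\<^sup>+w. ?g (w - z') * F w \<partial>lborel)"
      by simp
  qed
  also have "\<dots> = (\<integral>\<^sup>+z'. (\<integral>\<^sup>+w. ?g (w - z') * ?g z' * F w \<partial>lborel) \<partial>lborel)"
    by (subst nn_integral_cmult[symmetric]) (auto simp: mult_ac)
  also have "\<dots> = (\<integral>\<^sup>+w. (\<integral>\<^sup>+z'. ?g (w - z') * ?g z' * F w \<partial>lborel) \<partial>lborel)"
    by (rule lborel_pair.Fubini') measurable
  also have "\<dots> = (\<integral>\<^sup>+w. (\<integral>\<^sup>+z'. (?g ((1/sqrt 2) *\<^sub>R w) * F w) * ?g (sqrt 2 *\<^sub>R (z' - (1/2) *\<^sub>R w)) \<partial>lborel) \<partial>lborel)"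
    by (subst split) (simp add: mult_ac)
  also have "\<dots> = (\<integral>\<^sup>+w. (?g ((1/sqrt 2) *\<^sub>R w) * F w) * ennreal (1 / sqrt 2 ^ CARD('d)) \<partial>lborel)"
    by (subst nn_integral_cmult) (auto simp: half)
  also have "\<dots> = (\<integral>\<^sup>+w. ?g ((1/sqrt 2) *\<^sub>R w) * F w \<partial>lborel) * ennreal (1 / sqrt 2 ^ CARD('d))"
    by (rule nn_integral_multc) auto
  also have "(\<integral>\<^sup>+w. ?g ((1/sqrt 2) *\<^sub>R w) * F w \<partial>lborel) =
     ennreal (\<bar>sqrt 2\<bar> ^ CARD('d)) * (\<integral>\<^sup>+w. ?g ((1/sqrt 2) *\<^sub>R (0 + sqrt 2 *\<^sub>R w)) * F (0 + sqrt 2 *\<^sub>R w) \<partial>lborel)"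
    by (rule nn_integral_lborel_affine) auto
  also have "\<dots> = ennreal (sqrt 2 ^ CARD('d)) * (\<integral>\<^sup>+z. F (sqrt 2 *\<^sub>R z) \<partial>gauss)"
    by (simp add: nn_integral_gauss)
  also have "\<dots> * ennreal (1 / sqrt 2 ^ CARD('d)) = (ennreal (sqrt 2 ^ CARD('d)) * ennreal (1 / sqrt 2 ^ CARD('d))) * (\<integral>\<^sup>+z. F (sqrt 2 *\<^sub>R z) \<partial>gauss)"
    by (simp only: mult_ac)
  also have "ennreal (sqrt 2 ^ CARD('d)) * ennreal (1 / sqrt 2 ^ CARD('d)) = 1"
    by (subst ennreal_mult[symmetric]) auto
  finally show ?thesis by simp
qed

section \<open>Moments of the Gaussian measure, and positivity on balls\<close>

lemma gauss_coord: "distr gauss borel (\<lambda>z::real^'d. z $ i) = density lborel std_normal_density"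
proof -
  interpret P: product_prob_space "\<lambda>_::'d. density lborel std_normal_density" UNIV
    by (intro product_prob_spaceI prob_space_normal_density) auto
  have m: "(\<lambda>f. \<chi> i. f i) \<in> measurable (PiM UNIV (\<lambda>_::'d. density lborel std_normal_density)) (borel :: (real^'d) measure)"
    using measurable_vec_PiM by (simp cong: measurable_cong_sets sets_PiM_cong)
  have "distr gauss borel (\<lambda>z::real^'d. z $ i) = distr (PiM UNIV (\<lambda>_::'d. density lborel std_normal_density)) borel (\<lambda>f. f i)"
    unfolding gauss_PiM by (subst distr_distr[OF _ m]) (auto simp: comp_def)
  also have "\<dots> = distr (PiM UNIV (\<lambda>_::'d. density lborel std_normal_density)) (density lborel std_normal_density) (\<lambda>f. f i)"
    by (rule distr_cong) auto
  also have "\<dots> = density lborel std_normal_density" by (rule P.PiM_component) simp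
  finally show ?thesis .
qed

lemma gauss_coord_integrable_power: "integrable gauss (\<lambda>z::real^'d. \<bar>z $ i\<bar> ^ k)"
proof -
  have "integrable (distr gauss borel (\<lambda>z::real^'d. z $ i)) (\<lambda>x. \<bar>x\<bar> ^ k)"
    unfolding gauss_coord using integrable_std_normal_moment_abs[of k]
    by (subst integrable_real_density) auto
  then show ?thesis by (subst (asm) integrable_distr_eq) auto
qed

lemma gauss_norm_power_integrable: "integrable gauss (\<lambda>z::real^'d. norm z ^ k)"
proof (rule Bochner_Integration.integrable_bound)
  show "integrable gauss (\<lambda>z::real^'d. \<Sum>i\<in>UNIV. real CARD('d) ^ k * \<bar>z $ i\<bar> ^ k)"
    by (intro Bochner_Integration.integrable_sum integrable_mult_right gauss_coord_integrable_power)
  show "AE z in gauss. norm (norm z ^ k) \<le> norm (\<Sum>i\<in>UNIV. real CARD('d) ^ k * \<bar>(z::real^'d) $ i\<bar> ^ k)"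
  proof (rule AE_I2)
    fix z :: "real^'d"
    \<comment> \<open>The largest coordinate \<open>i\<close> bounds the \<open>l1\<close> norm by
      the dimension times one term; summing over all coordinates in the majorant removes the
      dependence of \<open>i\<close> on \<open>z\<close>.\<close>
    have "Max (range (\<lambda>j. \<bar>z $ j\<bar>)) \<in> range (\<lambda>j. \<bar>z $ j\<bar>)" by (rule Max_in) auto
    then obtain i where "Max (range (\<lambda>j. \<bar>z $ j\<bar>)) = \<bar>z $ i\<bar>" by (rule imageE)
    then have i: "\<bar>z $ j\<bar> \<le> \<bar>z $ i\<bar>" for j
      using Max_ge[of "range (\<lambda>j. \<bar>z $ j\<bar>)" "\<bar>z $ j\<bar>"] by simp
    have "norm z \<le> (\<Sum>j\<in>UNIV. \<bar>z $ j\<bar>)" by (rule norm_le_l1_cart)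
    also have "\<dots> \<le> real CARD('d) * \<bar>z $ i\<bar>" using sum_bounded_above[of UNIV "\<lambda>j. \<bar>z $ j\<bar>", OF i] by simp
    finally have "norm z ^ k \<le> (real CARD('d) * \<bar>z $ i\<bar>) ^ k" by (intro power_mono) auto
    also have "\<dots> = real CARD('d) ^ k * \<bar>z $ i\<bar> ^ k" by (simp add: power_mult_distrib)
    also have "\<dots> \<le> (\<Sum>i\<in>UNIV. real CARD('d) ^ k * \<bar>z $ i\<bar> ^ k)"
      by (rule member_le_sum) auto
    finally show "norm (norm z ^ k) \<le> norm (\<Sum>i\<in>UNIV. real CARD('d) ^ k * \<bar>z $ i\<bar> ^ k)"
      by (simp add: sum_nonneg)
  qed
qed simp

lemma gauss_integral_coord: "(\<integral>z. (z::real^'d) $ i \<partial>gauss) = 0"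
proof -
  have "(\<integral>z. (z::real^'d) $ i \<partial>gauss) = (\<integral>x. x \<partial>distr gauss borel (\<lambda>z::real^'d. z $ i))"
    by (subst integral_distr) auto
  also have "\<dots> = 0" unfolding gauss_coord using integral_std_normal_moment_odd[of 0]
    by (subst integral_real_density) auto
  finally show ?thesis .
qed

lemma gauss_integral_coord_sq: "(\<integral>z. (z::real^'d) $ i * z $ i \<partial>gauss) = 1"
proof -
  have "(\<integral>z. (z::real^'d) $ i * z $ i \<partial>gauss) = (\<integral>x. x * x \<partial>distr gauss borel (\<lambda>z::real^'d. z $ i))"
    by (subst integral_distr) auto
  also have "\<dots> = 1" unfolding gauss_coord using integral_std_normal_moment_even[of 1]
    by (subst integral_real_density) (auto simp: power2_eq_square)
  finally show ?thesis .
qed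

lemma gauss_integral_coord_mult:
  assumes "i \<noteq> j" shows "(\<integral>z. (z::real^'d) $ i * z $ j \<partial>gauss) = 0"
proof -
  interpret P: product_prob_space "\<lambda>_::'d. density lborel std_normal_density" UNIV
    by (intro product_prob_spaceI prob_space_normal_density) auto
  have m: "(\<lambda>f. \<chi> i. f i) \<in> measurable (PiM UNIV (\<lambda>_::'d. density lborel std_normal_density)) (borel :: (real^'d) measure)"
    using measurable_vec_PiM by (simp cong: measurable_cong_sets sets_PiM_cong)
  have i1: "integrable (density lborel std_normal_density) (\<lambda>x. x)"
    using integrable_std_normal_moment[of 1] by (subst integrable_real_density) auto
  have i0: "integrable (density lborel std_normal_density) (\<lambda>x. 1::real)"
    using prob_space.finite_measure[OF prob_space_normal_density[of 1 0]] by (intro finite_measure.integrable_const) auto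
  have z: "(\<integral>x. x \<partial>density lborel std_normal_density) = 0"
    using integral_std_normal_moment_odd[of 0] by (subst integral_real_density) auto
  have *: "(\<integral>z. (z::real^'d) $ i * z $ j \<partial>gauss) = (\<integral>f. f i * f j \<partial>PiM UNIV (\<lambda>_::'d. density lborel std_normal_density))"
    unfolding gauss_PiM by (subst integral_distr[OF m]) auto
  \<comment> \<open>Factors 1 in the remaining coordinates bring the integrand into product
    form.\<close>
  have **: "(\<lambda>f. f i * f j) = (\<lambda>f. \<Prod>k\<in>UNIV. (if k = i \<or> k = j then (\<lambda>x. x) else (\<lambda>x. 1)) (f k) :: real)"
  proof
    fix f :: "'d \<Rightarrow> real"
    have "(\<Prod>k\<in>UNIV. (if k = i \<or> k = j then (\<lambda>x. x) else (\<lambda>x. 1)) (f k)) = (\<Prod>k\<in>{i,j}. f k)"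
      by (rule prod.mono_neutral_cong_right) auto
    also have "\<dots> = f i * f j" using assms by simp
    finally show "f i * f j = (\<Prod>k\<in>UNIV. (if k = i \<or> k = j then (\<lambda>x. x) else (\<lambda>x. 1)) (f k))" ..
  qed
  have "(\<integral>f. (\<Prod>k\<in>UNIV. (if k = i \<or> k = j then (\<lambda>x. x) else (\<lambda>x. 1)) (f k)) \<partial>PiM UNIV (\<lambda>_::'d. density lborel std_normal_density))
     = (\<Prod>k\<in>UNIV. (\<integral>x. (if k = i \<or> k = j then (\<lambda>x. x) else (\<lambda>x. 1)) x \<partial>density lborel std_normal_density))"
    by (rule P.product_integral_prod) (auto simp: i1 i0)
  also have "\<dots> = 0"
    by (rule prod_zero) (auto intro!: bexI[of _ i] simp: z)
  finally show ?thesis unfolding * ** .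
qed

lemma gauss_density_not_le [simp]: "\<not> gauss_density z \<le> 0"
  using gauss_density_pos[of z] by simp

text \<open>Source of the positive exit probabilities, both from all of \<open>Q\<close> in a fixed
  time and into an exterior cone at the boundary.\<close>

lemma gauss_ball_pos:
  assumes "r > 0" shows "0 < measure gauss (ball (z0::real^'d) r)"
proof -
  have "emeasure gauss (ball z0 r) \<noteq> 0"
  proof
    assume "emeasure gauss (ball z0 r) = 0"
    then have "ball z0 r \<in> null_sets (density lborel (\<lambda>z::real^'d. ennreal (gauss_density z)))"
      by (auto simp: gauss_eq_density null_sets_def)
    then have "AE x in lborel. x \<in> ball z0 r \<longrightarrow> False"
      by (subst (asm) null_sets_density_iff) (auto simp: ennreal_eq_0_iff)
    then have "emeasure lborel (ball z0 r) = 0"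
      by (subst (asm) AE_iff_measurable[of "ball z0 r"]) auto
    then have "measure lborel (ball z0 r) = 0" by (simp add: measure_def)
    then show False using content_ball_pos[OF assms, of z0] by simp
  qed
  then show ?thesis by (simp add: gauss.emeasure_eq_measure zero_less_measure_iff)
qed

section \<open>Principal eigenfunctions by power iteration\<close>

text \<open>Log-convexity says that the ratios of successive terms increase. Being at most 1 they
  converge to their supremum, which is why the limit \<open>\<rho>\<close> also bounds each of
  them.\<close>

lemma iterate_ratio_limit:
  fixes a :: "nat \<Rightarrow> real"
  assumes pos: "\<And>n. 0 < a n" and lc: "\<And>n. (a (Suc n))\<^sup>2 \<le> a n * a (Suc (Suc n))"
    and dec: "\<And>n. a (Suc n) \<le> a n"
  obtains \<rho> where "0 < \<rho>" "\<rho> \<le> 1" "(\<lambda>n. a (Suc n) / a n) \<longlonglongrightarrow> \<rho>" "\<And>n. a (Suc n) \<le> \<rho> * a n"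
proof -
  let ?r = "\<lambda>n. a (Suc n) / a n"
  have inc: "incseq ?r"
  proof (rule incseq_SucI)
    fix n show "?r n \<le> ?r (Suc n)"
      using lc[of n] pos[of n] pos[of "Suc n"] by (simp add: divide_simps power2_eq_square mult_ac)
  qed
  have le1: "?r n \<le> 1" for n using dec[of n] pos[of n] by simp
  obtain \<rho> where r: "?r \<longlonglongrightarrow> \<rho>" "\<And>n. ?r n \<le> \<rho>"
    using incseq_convergent[OF inc, of 1] le1 by auto
  have "0 < ?r 0" using pos by simp
  then have "0 < \<rho>" using r(2)[of 0] by linarith
  moreover have "\<rho> \<le> 1" using r(1) le1 by (intro LIMSEQ_le_const2) auto
  moreover have "a (Suc n) \<le> \<rho> * a n" for n using r(2)[of n] pos[of n] by (simp add: divide_simps mult_ac)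
  ultimately show ?thesis using r(1) that by blast
qed

text \<open>If \<open>C * b m < 1\<close>, squaring along \<open>m, 2 m, 4 m, ...\<close> makes
  \<open>b\<close> decay exponentially in the index, whereas ratios tending to 1 exclude every
  exponential rate.\<close>

lemma doubling_lower_bound:
  fixes b :: "nat \<Rightarrow> real"
  assumes pos: "\<And>n. 0 < b n" and ratio: "(\<lambda>n. b (Suc n) / b n) \<longlonglongrightarrow> 1"
    and C: "0 < C" and dbl: "\<And>n. n \<ge> n0 \<Longrightarrow> b (2 * n) \<le> C * (b n)\<^sup>2" and m: "n0 \<le> m" "0 < m"
  shows "1 \<le> C * b m"
proof (rule ccontr)
  assume "\<not> 1 \<le> C * b m"
  then have lt: "C * b m < 1" by simp
  have Cb: "0 < C * b m" using C pos by simp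
  have iter: "C * b (2 ^ j * m) \<le> (C * b m) ^ (2 ^ j)" for j
  proof (induction j)
    case (Suc j)
    have "n0 \<le> 2 ^ j * m" using m by (metis One_nat_def Suc_leI dual_order.trans le_add1 mult.left_neutral mult_le_mono1 zero_less_numeral zero_less_power)
    then have "C * b (2 * (2 ^ j * m)) \<le> (C * b (2 ^ j * m))\<^sup>2"
      using dbl[of "2 ^ j * m"] C by (simp add: power_mult_distrib power2_eq_square mult_ac)
    also have "\<dots> \<le> ((C * b m) ^ (2 ^ j))\<^sup>2"
      using Suc C pos by (intro power_mono) (auto intro: less_imp_le)
    finally show ?case by (simp add: power_mult[symmetric] mult_ac)
  qed simp
  \<comment> \<open>The exponential rate: by the choice of the \<open>m\<close>-th root, the bound
    at index \<open>2 ^ j * m\<close> is \<open>\<theta>\<close> to that index.\<close>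
  define \<theta> where "\<theta> = root m (C * b m)"
  have th: "0 < \<theta>" "\<theta> < 1" "\<theta> ^ m = C * b m"
    using lt Cb m by (auto simp: \<theta>_def real_root_lt_1_iff)
  \<comment> \<open>Strictly between \<open>\<theta>\<close> and 1. The ratios eventually exceed
    \<open>q\<close>, so \<open>b\<close> decays no faster than the powers of
    \<open>q\<close>.\<close>
  define q where "q = (1 + \<theta>) / 2"
  have q: "0 < q" "q < 1" "\<theta> < q" using th by (auto simp: q_def)
  have "eventually (\<lambda>n. q < b (Suc n) / b n) sequentially"
    using ratio q by (intro order_tendstoD) auto
  then obtain n1 where n1: "\<And>n. n \<ge> n1 \<Longrightarrow> q < b (Suc n) / b n" by (auto simp: eventually_sequentially)
  have low: "q ^ k * b n1 \<le> b (n1 + k)" for k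
  proof (induction k)
    case (Suc k)
    have "q * b (n1 + k) \<le> b (Suc (n1 + k))" using n1[of "n1 + k"] pos[of "n1 + k"] by (simp add: field_simps)
    moreover have "q * (q ^ k * b n1) \<le> q * b (n1 + k)" using Suc q by (intro mult_left_mono) auto
    ultimately show ?case by (simp add: mult_ac)
  qed simp
  have "(\<lambda>j. (\<theta> / q) ^ j) \<longlonglongrightarrow> 0" using th q by (intro LIMSEQ_realpow_zero) auto
  then have "eventually (\<lambda>j. (\<theta> / q) ^ j < C * b n1) sequentially"
    using C pos by (intro order_tendstoD) auto
  then obtain j0 where j0: "\<And>j. j \<ge> j0 \<Longrightarrow> (\<theta> / q) ^ j < C * b n1" by (auto simp: eventually_sequentially)
  \<comment> \<open>An index of the form \<open>2 ^ j * m\<close> beyond both thresholds.\<close>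
  define N where "N = 2 ^ (j0 + n1) * m"
  have "j0 + n1 < 2 ^ (j0 + n1)" by simp
  also have "\<dots> \<le> N" using m by (simp add: N_def)
  finally have N: "N \<ge> j0" "N \<ge> n1" by auto
  have "C * b N \<le> \<theta> ^ N"
    using iter[of "j0 + n1"] by (simp add: N_def th(3)[symmetric] power_mult[symmetric] mult_ac)
  moreover have "q ^ N * b n1 \<le> b N"
  proof -
    have "q ^ N \<le> q ^ (N - n1)" using q by (intro power_decreasing) auto
    then have "q ^ N * b n1 \<le> q ^ (N - n1) * b n1" using pos[of n1] by (intro mult_right_mono) auto
    also have "\<dots> \<le> b N" using low[of "N - n1"] N by simp
    finally show ?thesis .
  qed
  then have "C * (q ^ N * b n1) \<le> C * b N" using C by simp
  ultimately have "C * b n1 \<le> (\<theta> / q) ^ N" using q by (simp add: power_divide field_simps)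
  then show False using j0[OF N(1)] by simp
qed

text \<open>Bounded Borel functions take the place of classes in \<open>L2\<close>: iterates and
  limits are then defined at every point, as required for survival probabilities from a given
  start.\<close>

definition bm :: "('a::topological_space \<Rightarrow> real) \<Rightarrow> bool" where
  "bm f \<longleftrightarrow> f \<in> borel_measurable borel \<and> (\<exists>C. \<forall>x. \<bar>f x\<bar> \<le> C)"

lemma bm_measurable [measurable_dest]: "bm f \<Longrightarrow> f \<in> borel_measurable borel"
  by (simp add: bm_def)

lemma bm_bounded: assumes "bm f" obtains C where "0 \<le> C" "\<And>x. \<bar>f x\<bar> \<le> C"
  using assms unfolding bm_def by (metis abs_ge_zero dual_order.trans)

lemma bm_const [simp, intro]: "bm (\<lambda>_. c)"
  by (auto simp: bm_def)

lemma bm_lin: assumes "bm f" "bm g" shows "bm (\<lambda>x. f x + c * g x)"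
proof -
  obtain A B where A: "\<And>x. \<bar>f x\<bar> \<le> A" and B: "\<And>x. \<bar>g x\<bar> \<le> B" using assms bm_bounded by metis
  have "\<bar>f x + c * g x\<bar> \<le> A + \<bar>c\<bar> * B" for x
  proof -
    have "\<bar>c * g x\<bar> \<le> \<bar>c\<bar> * B" unfolding abs_mult by (rule mult_left_mono[OF B]) auto
    then show ?thesis using A[of x] by linarith
  qed
  then show ?thesis using assms unfolding bm_def by auto
qed

lemma bm_mult [intro]: assumes "bm f" "bm g" shows "bm (\<lambda>x. f x * g x)"
proof -
  obtain A B where A: "\<And>x. \<bar>f x\<bar> \<le> A" and B: "\<And>x. \<bar>g x\<bar> \<le> B" using assms bm_bounded by metis
  have "\<bar>f x * g x\<bar> \<le> A * B" for x
    unfolding abs_mult by (rule mult_mono[OF A B]) (use A[of x] in auto)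
  then show ?thesis using assms unfolding bm_def by auto
qed

lemma bm_add [intro]: "bm f \<Longrightarrow> bm g \<Longrightarrow> bm (\<lambda>x. f x + g x)"
  using bm_lin[of f g 1] by simp

lemma bm_diff [intro]: "bm f \<Longrightarrow> bm g \<Longrightarrow> bm (\<lambda>x. f x - g x)"
  using bm_lin[of f g "-1"] by simp

lemma bm_cmult [intro]: "bm f \<Longrightarrow> bm (\<lambda>x. c * f x)"
  using bm_mult[of "\<lambda>_. c" f] by auto

lemma bm_abs [intro]: "bm f \<Longrightarrow> bm (\<lambda>x. \<bar>f x\<bar>)"
  by (auto simp: bm_def)

lemma bm_indicator [intro]: "K \<in> sets borel \<Longrightarrow> bm (\<lambda>x. indicator K x)"
  by (auto simp: bm_def indicator_def intro!: exI[of _ 1])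

lemma bm_indicator_mult [intro]: "K \<in> sets borel \<Longrightarrow> bm f \<Longrightarrow> bm (\<lambda>x. indicator K x * f x)"
  by (intro bm_mult bm_indicator)

lemma bm_integrable:
  assumes "finite_measure M" "sets M = sets borel" "bm f" shows "integrable M f"
proof -
  interpret finite_measure M by fact
  obtain C where "\<And>x. \<bar>f x\<bar> \<le> C" using bm_bounded[OF assms(3)] by metis
  moreover have "f \<in> borel_measurable M" using assms by (simp add: bm_def cong: measurable_cong_sets)
  ultimately show ?thesis by (intro integrable_const_bound[where B=C]) auto
qed

text \<open>The quadratic polynomial in \<open>s\<close> is evaluated at its minimiser
  \<open>A / B\<close>.\<close>

lemma Cauchy_Schwarz_integral_aux:
  fixes A B D :: real
  assumes "0 < B" "\<And>s. 0 \<le> s\<^sup>2 * B - 2 * s * A + D" shows "A\<^sup>2 \<le> B * D"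
proof -
  have "0 \<le> (A / B)\<^sup>2 * B - 2 * (A / B) * A + D" by (rule assms)
  also have "\<dots> = D - A\<^sup>2 / B" using assms(1) by (simp add: field_simps power2_eq_square)
  finally show ?thesis using assms(1) by (simp add: field_simps)
qed

text \<open>With \<open>R\<close> symmetric, inner products of iterates depend only on the sum of
  the exponents, and the square \<open>P\<close> is nonnegative. Cauchy-Schwarz makes its moments
  log-convex, which gives \<open>\<rho>\<close>. The normalised iterates are Cauchy in
  \<open>L2\<close>, because their distances are second differences of a convergent sequence, and
  one more \<open>P\<close> makes the convergence uniform. The doubling argument shows that the
  limit is not zero.\<close>

lemma principal_eigenfunction:
  fixes P R :: "('a::topological_space \<Rightarrow> real) \<Rightarrow> 'a \<Rightarrow> real"
  assumes M: "finite_measure M" "sets M = sets borel"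
    and bmR: "\<And>f. bm f \<Longrightarrow> bm (R f)"
    and lin: "\<And>f g c. bm f \<Longrightarrow> bm g \<Longrightarrow> R (\<lambda>x. f x + c * g x) = (\<lambda>x. R f x + c * R g x)"
    and posR: "\<And>f x. bm f \<Longrightarrow> (\<And>y. 0 \<le> f y) \<Longrightarrow> 0 \<le> R f x"
    and R1: "\<And>x. R (\<lambda>_. 1) x \<le> 1"
    and sym: "\<And>f g. bm f \<Longrightarrow> bm g \<Longrightarrow> (\<integral>x. R f x * g x \<partial>M) = (\<integral>x. f x * R g x \<partial>M)"
    and P: "P = (\<lambda>f. R (R f))"
    and L2: "\<And>f x. bm f \<Longrightarrow> \<bar>P f x\<bar> \<le> C * sqrt (\<integral>x. (f x)\<^sup>2 \<partial>M)"
    and nz: "0 < (\<integral>x. P (\<lambda>_. 1) x \<partial>M)"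
  obtains \<rho> h where "0 < \<rho>" "\<rho> \<le> 1" "bm h" "\<And>x. 0 \<le> h x" "0 < (\<integral>x. h x \<partial>M)"
    "uniform_limit UNIV (\<lambda>n x. (P ^^ n) (\<lambda>_. 1) x / \<rho> ^ n) h sequentially"
    "\<And>x. P h x = \<rho> * h x"
proof -
  interpret finite_measure M by fact
  note int = bm_integrable[OF M]
  define r where "r n = (R ^^ n) (\<lambda>_. 1)" for n
  have r0: "r 0 = (\<lambda>_. 1)" and rS: "r (Suc n) = R (r n)" for n by (auto simp: r_def)
  have bmr: "bm (r n)" for n by (induction n) (auto simp: r0 rS intro: bmR)
  have monoR: "R f x \<le> R g x" if "bm f" "bm g" "\<And>y. f y \<le> g y" for f g x
  proof -
    have "0 \<le> R (\<lambda>y. g y + (-1) * f y) x" using that by (intro posR bm_lin) auto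
    then show ?thesis using lin[of g f "-1"] that by simp
  qed
  have r_nn: "0 \<le> r n x" for n x
    by (induction n arbitrary: x) (auto simp: r0 rS intro!: posR bmr)
  have r_dec: "r (Suc n) x \<le> r n x" for n x
  proof (induction n arbitrary: x)
    case 0 show ?case using R1 by (simp add: rS r0)
  next
    case (Suc n) then show ?case by (subst (1 2) rS) (intro monoR bmr, auto)
  qed
  have Pr: "(P ^^ n) (\<lambda>_. 1) = r (2 * n)" for n
    by (induction n) (auto simp: r0 rS P)
  define \<alpha> where "\<alpha> n = (\<integral>x. r n x \<partial>M)" for n
  have ip: "(\<integral>x. r i x * r j x \<partial>M) = \<alpha> (i + j)" for i j
  proof (induction i arbitrary: j)
    case 0 then show ?case by (simp add: r0 \<alpha>_def)
  next
    case (Suc i)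
    have "(\<integral>x. r (Suc i) x * r j x \<partial>M) = (\<integral>x. r i x * r (Suc j) x \<partial>M)"
      unfolding rS by (rule sym) (rule bmr)+
    then show ?case using Suc[of "Suc j"] by simp
  qed
  have quad: "(\<integral>x. (s * r i x - t * r j x)\<^sup>2 \<partial>M) = s\<^sup>2 * \<alpha> (2 * i) - 2 * s * t * \<alpha> (i + j) + t\<^sup>2 * \<alpha> (2 * j)" for s t i j
  proof -
    have "(\<integral>x. (s * r i x - t * r j x)\<^sup>2 \<partial>M) = (\<integral>x. s\<^sup>2 * (r i x * r i x) - 2 * s * t * (r i x * r j x) + t\<^sup>2 * (r j x * r j x) \<partial>M)"
      by (rule Bochner_Integration.integral_cong) (auto simp: power2_eq_square algebra_simps)
    also have "\<dots> = s\<^sup>2 * \<alpha> (i + i) - 2 * s * t * \<alpha> (i + j) + t\<^sup>2 * \<alpha> (j + j)"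
      by (simp add: int bmr bm_mult ip)
    finally show ?thesis unfolding mult_2[of i] mult_2[of j] .
  qed
  \<comment> \<open>By \<open>ip\<close> these are the squared \<open>L2\<close> norms of
    \<open>r n\<close>, which is why only even exponents are taken.\<close>
  define a where "a n = \<alpha> (2 * n)" for n
  have lc0: "(a (Suc n))\<^sup>2 \<le> a n * a (Suc (Suc n))" if "0 < a n" for n
  proof (rule Cauchy_Schwarz_integral_aux[OF that])
    fix s
    have "0 \<le> (\<integral>x. (s * r n x - 1 * r (n + 2) x)\<^sup>2 \<partial>M)" by (rule integral_nonneg_AE) auto
    also have "\<dots> = s\<^sup>2 * a n - 2 * s * a (Suc n) + a (Suc (Suc n))"
    proof -
      have e: "n + (n + 2) = 2 * Suc n" "2 * (n + 2) = 2 * Suc (Suc n)" by auto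
      show ?thesis unfolding quad a_def e by simp
    qed
    finally show "0 \<le> s\<^sup>2 * a n - 2 * s * a (Suc n) + a (Suc (Suc n))" .
  qed
  have a_dec: "a (Suc n) \<le> a n" for n
  proof -
    have "r (2 * Suc n) x \<le> r (2 * n) x" for x
      using r_dec[of "2 * n" x] r_dec[of "Suc (2 * n)" x] by simp
    then show ?thesis unfolding a_def \<alpha>_def by (intro integral_mono int bmr)
  qed
  have a1: "0 < a 1" using nz Pr[of 1] by (simp add: a_def \<alpha>_def)
  \<comment> \<open>Log-convexity excludes a first zero: the square of \<open>a (n + 1)\<close> is
    at most \<open>a n * a (n + 2)\<close>. Two consecutive terms are carried along because
    \<open>lc0\<close> presupposes \<open>0 < a n\<close>.\<close>
  have a_pos2: "0 < a n \<and> 0 < a (Suc n)" for n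
  proof (induction n)
    case 0 show ?case using a1 a_dec[of 0] by auto
  next
    case (Suc n)
    then have "0 < (a (Suc n))\<^sup>2" by simp
    also have "\<dots> \<le> a n * a (Suc (Suc n))" using Suc by (intro lc0) auto
    finally show ?case using Suc by (auto simp: zero_less_mult_iff)
  qed
  then have a_pos: "0 < a n" for n by auto
  obtain \<rho> where rho: "0 < \<rho>" "\<rho> \<le> 1" "(\<lambda>n. a (Suc n) / a n) \<longlonglongrightarrow> \<rho>" "\<And>n. a (Suc n) \<le> \<rho> * a n"
    using iterate_ratio_limit[of a] a_pos lc0 a_dec by blast
  \<comment> \<open>Moments of the normalised iterates. They decrease, and the crux is that their
    limit is positive.\<close>
  define b where "b n = a n / \<rho> ^ n" for n
  have b_pos: "0 < b n" for n using a_pos rho by (simp add: b_def)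
  have b_dec: "b (Suc n) \<le> b n" for n
    using rho(4)[of n] rho(1) by (simp add: b_def divide_simps mult_ac)
  have bdecseq: "decseq b" by (rule decseq_SucI) (rule b_dec)
  obtain \<beta> where beta: "b \<longlonglongrightarrow> \<beta>" "\<And>n. \<beta> \<le> b n"
    using decseq_convergent[OF bdecseq, of 0] b_pos by (metis less_imp_le)
  have b_ratio: "(\<lambda>n. b (Suc n) / b n) \<longlonglongrightarrow> 1"
  proof -
    have "(\<lambda>n. (a (Suc n) / a n) / \<rho>) \<longlonglongrightarrow> \<rho> / \<rho>" using rho by (intro tendsto_divide) auto
    moreover have "(a (Suc n) / a n) / \<rho> = b (Suc n) / b n" for n using rho(1) by (simp add: b_def)
    ultimately show ?thesis using rho(1) by simp
  qed
  have C0: "0 \<le> C"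
  proof -
    have "\<exists>x. P (\<lambda>_. 1) x \<noteq> 0" using nz by (rule_tac ccontr) simp
    then obtain x where "P (\<lambda>_. 1) x \<noteq> 0" by auto
    then have "0 < \<bar>P (\<lambda>_. 1) x\<bar>" by simp
    also have "\<dots> \<le> C * sqrt (\<integral>x. (1::real)\<^sup>2 \<partial>M)" using L2[of "\<lambda>_. 1" x] by simp
    finally have "0 < C * sqrt (\<integral>x. (1::real)\<^sup>2 \<partial>M)" .
    moreover have "0 \<le> sqrt (\<integral>x. (1::real)\<^sup>2 \<partial>M)" by simp
    ultimately show ?thesis by (metis linorder_not_less mult_nonpos_nonneg less_imp_le)
  qed
  define h where "h n x = r (2 * n) x / \<rho> ^ n" for n x
  have bmh: "bm (h n)" for n unfolding h_def using bm_cmult[OF bmr[of "2*n"], of "1/\<rho>^n"] by simp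
  have linP: "P (\<lambda>x. f x + c * g x) = (\<lambda>x. P f x + c * P g x)" if "bm f" "bm g" for f g c
    unfolding P using that lin bmR by auto
  have Ph: "P (h n) x = \<rho> * h (Suc n) x" for n x
  proof -
    have "h n = (\<lambda>x. 0 + (1/\<rho>^n) * r (2 * n) x)" by (auto simp: h_def)
    then have "P (h n) = (\<lambda>x. P (\<lambda>_. 0) x + (1/\<rho>^n) * P (r (2*n)) x)" using linP[OF bm_const[of 0] bmr[of "2*n"], of "1/\<rho>^n"] by (simp only:)
    moreover have "P (\<lambda>_. 0) = (\<lambda>_. 0)" using linP[of "\<lambda>_. 0" "\<lambda>_. 0" "-1"] by auto
    moreover have "P (r (2*n)) = r (2 * Suc n)" by (simp add: P rS)
    ultimately show ?thesis using rho(1) by (simp add: h_def)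
  qed
  \<comment> \<open>All three indices become large, so the right side tends to
    \<open>\<beta> - 2 \<beta> + \<beta> = 0\<close>.\<close>
  have hdist: "(\<integral>x. (h n x - h m x)\<^sup>2 \<partial>M) = b (2 * n) - 2 * b (n + m) + b (2 * m)" for n m
  proof -
    have "(\<integral>x. (h n x - h m x)\<^sup>2 \<partial>M) = (\<integral>x. ((1/\<rho>^n) * r (2*n) x - (1/\<rho>^m) * r (2*m) x)\<^sup>2 \<partial>M)"
      by (simp add: h_def)
    also have "\<dots> = b (2 * n) - 2 * b (n + m) + b (2 * m)"
      unfolding quad b_def a_def by (simp add: power_add power_divide power_mult mult.commute[of n] mult.commute[of m] distrib_left) (simp add: power_mult[symmetric] mult.commute)
    finally show ?thesis .
  qed
  \<comment> \<open>One further application of \<open>P\<close> trades the \<open>L2\<close>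
    distance for a uniform one, at the price \<open>C / \<rho>\<close>.\<close>
  have hC: "\<bar>h (Suc n) x - h (Suc m) x\<bar> \<le> C / \<rho> * sqrt (b (2 * n) - 2 * b (n + m) + b (2 * m))" for n m x
  proof -
    have "\<rho> * (h (Suc n) x - h (Suc m) x) = P (\<lambda>x. h n x + (-1) * h m x) x"
      using linP[of "h n" "h m" "-1"] bmh Ph by (simp add: algebra_simps)
    then have "\<rho> * \<bar>h (Suc n) x - h (Suc m) x\<bar> = \<bar>P (\<lambda>x. h n x + (-1) * h m x) x\<bar>"
      using rho(1) by (metis abs_mult abs_of_pos)
    also have "\<dots> \<le> C * sqrt (\<integral>x. (h n x + (-1) * h m x)\<^sup>2 \<partial>M)" by (intro L2 bm_lin bmh)
    also have "(\<integral>x. (h n x + (-1) * h m x)\<^sup>2 \<partial>M) = b (2 * n) - 2 * b (n + m) + b (2 * m)" using hdist by simp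
    finally show ?thesis using rho(1) by (simp add: field_simps)
  qed
  have ucauchy: "uniformly_Cauchy_on UNIV h"
  proof (rule uniformly_Cauchy_onI)
    fix e :: real assume e: "0 < e"
    define d where "d = (e / (2 * (C / \<rho> + 1)))\<^sup>2 / 2"
    have K: "0 < C / \<rho> + 1" using C0 rho(1) by (simp add: add_nonneg_pos)
    have d: "0 < d" using e K unfolding d_def by simp
    have "eventually (\<lambda>n. b n < \<beta> + d) sequentially" using beta(1) d by (intro order_tendstoD) auto
    then obtain N where N: "\<And>n. n \<ge> N \<Longrightarrow> b n < \<beta> + d" by (auto simp: eventually_sequentially)
    show "\<exists>M. \<forall>x\<in>UNIV. \<forall>m\<ge>M. \<forall>n\<ge>M. dist (h m x) (h n x) < e"
    proof (intro exI ballI allI impI)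
      fix x m n assume "m \<ge> Suc N" "n \<ge> Suc N"
      then obtain m' n' where mn: "m = Suc m'" "n = Suc n'" "m' \<ge> N" "n' \<ge> N" by (metis Suc_le_D Suc_le_mono)
      have "b (2 * m') - 2 * b (m' + n') + b (2 * n') \<le> 2 * d"
        using N[of "2*m'"] N[of "2*n'"] beta(2)[of "m' + n'"] mn by auto
      then have "sqrt (b (2 * m') - 2 * b (m' + n') + b (2 * n')) \<le> e / (2 * (C / \<rho> + 1))"
        using e K unfolding d_def by (intro real_le_lsqrt) (auto intro: divide_nonneg_pos)
      then have "C / \<rho> * sqrt (b (2 * m') - 2 * b (m' + n') + b (2 * n')) \<le> C / \<rho> * (e / (2 * (C / \<rho> + 1)))"
        using C0 rho(1) by (intro mult_left_mono) auto
      also have "\<dots> \<le> (C / \<rho> + 1) * (e / (2 * (C / \<rho> + 1)))"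
        using e K by (intro mult_right_mono) auto
      also have "\<dots> = e / 2" using K by (metis less_irrefl nonzero_mult_divide_mult_cancel_left times_divide_eq_right mult.commute)
      also have "\<dots> < e" using e by simp
      finally show "dist (h m x) (h n x) < e" using hC[of m' x n'] mn by (simp add: dist_real_def)
    qed
  qed
  then obtain H where H: "uniform_limit UNIV h H sequentially"
    using Cauchy_uniformly_convergent unfolding uniformly_convergent_on_def by blast
  have Hx: "(\<lambda>n. h n x) \<longlonglongrightarrow> H x" for x using tendsto_uniform_limitI[OF H] by simp
  have near: "\<exists>N. \<forall>n\<ge>N. \<forall>x. \<bar>h n x - H x\<bar> < e" if "0 < e" for e
    using uniform_limitD[OF H that] by (auto simp: eventually_sequentially dist_real_def)
  have bmH: "bm H"
  proof -
    obtain N where N: "\<And>x. \<bar>h N x - H x\<bar> < 1" using near[of 1] by auto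
    obtain D where D: "\<And>x. \<bar>h N x\<bar> \<le> D" using bm_bounded[OF bmh] by metis
    have "\<bar>H x\<bar> \<le> D + 1" for x using N[of x] D[of x] by linarith
    moreover have "H \<in> borel_measurable borel"
      by (rule borel_measurable_LIMSEQ_real[OF Hx]) (use bmh in \<open>auto simp: bm_def\<close>)
    ultimately show ?thesis unfolding bm_def by blast
  qed
  have P1: "P (\<lambda>_. 1) x \<le> 1" for x using r_dec[of 0 x] r_dec[of 1 x] Pr[of 1] by (simp add: r0 numeral_2_eq_2)
  have P_bound: "\<bar>P f x\<bar> \<le> e" if f: "bm f" and e: "\<And>y. \<bar>f y\<bar> \<le> e" for f e x
  proof -
    have e0: "0 \<le> e" using e[of x] by linarith
    have P0: "P (\<lambda>_. 0) = (\<lambda>_. 0)" using linP[of "\<lambda>_. 0" "\<lambda>_. 0" "-1"] by auto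
    have eP: "P (\<lambda>_. e) x = e * P (\<lambda>_. 1) x" using linP[of "\<lambda>_. 0" "\<lambda>_. 1" e] P0 by simp
    have meP: "P (\<lambda>_. - e) x = - e * P (\<lambda>_. 1) x" using linP[of "\<lambda>_. 0" "\<lambda>_. 1" "-e"] P0 by simp
    have "P f x \<le> P (\<lambda>_. e) x" unfolding P using f e by (intro monoR bmR bm_const) (auto simp: abs_le_iff)
    moreover have "P (\<lambda>_. - e) x \<le> P f x" unfolding P using f e by (intro monoR bmR bm_const) (auto simp: abs_le_iff minus_le_iff)
    moreover have "e * P (\<lambda>_. 1) x \<le> e * 1" using P1 e0 by (intro mult_left_mono) auto
    ultimately show ?thesis using eP meP by (simp add: abs_le_iff)
  qed
  have PH: "P H x = \<rho> * H x" for x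
  proof (rule LIMSEQ_unique)
    show "(\<lambda>n. P (h n) x) \<longlonglongrightarrow> \<rho> * H x"
      unfolding Ph using Hx[of x] by (intro tendsto_mult_left) (rule LIMSEQ_Suc)
    show "(\<lambda>n. P (h n) x) \<longlonglongrightarrow> P H x"
    proof (rule LIMSEQ_I)
      fix e :: real assume e: "0 < e"
      obtain N where N: "\<And>n x. n \<ge> N \<Longrightarrow> \<bar>h n x - H x\<bar> < e/2" using near[of "e/2"] e by auto
      have "norm (P (h n) x - P H x) < e" if "n \<ge> N" for n
      proof -
        have "P (h n) x - P H x = P (\<lambda>x. h n x + (-1) * H x) x" using linP[of "h n" H "-1"] bmh bmH by simp
        also have "\<bar>\<dots>\<bar> \<le> e/2" using N[OF that] by (intro P_bound bm_lin bmh bmH) (auto intro: less_imp_le)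
        finally show ?thesis using e by simp
      qed
      then show "\<exists>no. \<forall>n\<ge>no. norm (P (h n) x - P H x) < e" by blast
    qed
  qed
  have H_nn: "0 \<le> H x" for x
    using Hx r_nn rho(1) by (intro LIMSEQ_le_const[OF Hx]) (auto simp: h_def)
  have intH: "(\<integral>x. H x \<partial>M) = \<beta>"
  proof (rule LIMSEQ_unique)
    show "b \<longlonglongrightarrow> \<beta>" by (rule beta)
    obtain D where D: "\<And>x. \<bar>H x\<bar> \<le> D" using bm_bounded[OF bmH] by metis
    obtain N where N: "\<And>n x. n \<ge> N \<Longrightarrow> \<bar>h n x - H x\<bar> < 1" using near[of 1] by auto
    have "(\<lambda>n. \<integral>x. h (n + N) x \<partial>M) \<longlonglongrightarrow> (\<integral>x. H x \<partial>M)"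
    proof (rule integral_dominated_convergence[where w="\<lambda>_. D + 1"])
      show "AE x in M. (\<lambda>n. h (n + N) x) \<longlonglongrightarrow> H x" by (intro AE_I2 LIMSEQ_ignore_initial_segment Hx)
      show "AE x in M. norm (h (n + N) x) \<le> D + 1" for n
      proof (rule AE_I2)
        fix x show "norm (h (n + N) x) \<le> D + 1" using N[of "n + N" x] D[of x] by simp
      qed
    qed (use bmH bmh M in \<open>auto simp: bm_def cong: measurable_cong_sets\<close>)
    moreover have "(\<integral>x. h n x \<partial>M) = b n" for n by (simp add: h_def b_def a_def \<alpha>_def)
    ultimately show "b \<longlonglongrightarrow> (\<integral>x. H x \<partial>M)" by (simp add: LIMSEQ_offset)
  qed
  \<comment> \<open>Everything so far is compatible with \<open>\<beta> = 0\<close>; the bound from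
    \<open>L2\<close> to bounded functions has to be used once more to exclude it.\<close>
  have b_pos': "0 < \<beta>"
  proof -
    have "eventually (\<lambda>n. 1/2 < b (Suc n) / b n) sequentially"
      using b_ratio by (intro order_tendstoD) auto
    then obtain n1 where n1: "\<And>n. n \<ge> n1 \<Longrightarrow> 1/2 < b (Suc n) / b n" by (auto simp: eventually_sequentially)
    have half: "b n \<le> 2 * b (Suc n)" if "n \<ge> n1" for n
      using n1[OF that] b_pos[of n] by (simp add: field_simps)
    define K where "K = 2 * C / \<rho>"
    have K0: "0 \<le> K" using C0 rho(1) by (simp add: K_def)
    \<comment> \<open>In the squared norm \<open>a (2 n)\<close> one factor is bounded uniformly
      through \<open>L2\<close>, which leaves the first power \<open>a n\<close>. Solving for the
      square root of \<open>b (2 n)\<close> then gives a doubling inequality.\<close>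
    have key: "b (2 * n) \<le> (K\<^sup>2 + 1) * (b n)\<^sup>2" if n: "n \<ge> Suc n1" for n
    proof -
      obtain k where k: "n = Suc k" "k \<ge> n1" using n by (metis Suc_le_D Suc_le_mono)
      have sup: "r (2 * n) x \<le> C * sqrt (a (2 * k))" for x
      proof -
        have "r (2 * n) x \<le> \<bar>P (r (2 * k)) x\<bar>" by (simp add: k P rS)
        also have "\<dots> \<le> C * sqrt (\<integral>x. (r (2 * k) x)\<^sup>2 \<partial>M)" by (rule L2) (rule bmr)
        also have "(\<integral>x. (r (2 * k) x)\<^sup>2 \<partial>M) = a (2 * k)"
          using ip[of "2*k" "2*k"] by (simp add: power2_eq_square a_def mult_2)
        finally show ?thesis .
      qed
      have "a (2 * n) = (\<integral>x. r (2 * n) x * r (2 * n) x \<partial>M)" using ip[of "2*n" "2*n"] by (simp add: a_def mult_2)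
      also have "\<dots> \<le> (\<integral>x. C * sqrt (a (2 * k)) * r (2 * n) x \<partial>M)"
        using sup r_nn by (intro integral_mono int bm_mult bm_cmult bmr mult_right_mono) auto
      also have "\<dots> = C * sqrt (a (2 * k)) * a n" by (simp add: a_def \<alpha>_def)
      finally have 1: "a (2 * n) \<le> C * sqrt (a (2 * k)) * a n" .
      have a_b: "a j = \<rho> ^ j * b j" for j using rho(1) by (simp add: b_def)
      have "sqrt (a (2 * k)) = \<rho> ^ k * sqrt (b (2 * k))"
        unfolding a_b[of "2*k"] power_even_eq using rho(1) by (simp add: real_sqrt_mult)
      then have "\<rho> ^ (2 * n) * b (2 * n) \<le> C * (\<rho> ^ k * sqrt (b (2 * k))) * (\<rho> ^ n * b n)"
        using 1 unfolding a_b[of "2*n"] a_b[of n] by simp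
      moreover have "2 * n = k + n + 1" using k by simp
      then have "\<rho> ^ (2 * n) = \<rho> ^ k * \<rho> ^ n * \<rho>" by (simp only: power_add power_one_right)
      ultimately have "(\<rho> ^ k * \<rho> ^ n) * (\<rho> * b (2 * n)) \<le> (\<rho> ^ k * \<rho> ^ n) * (C * sqrt (b (2 * k)) * b n)"
        by (simp add: mult_ac)
      then have 2: "\<rho> * b (2 * n) \<le> C * sqrt (b (2 * k)) * b n"
        using rho(1) by (simp add: mult_le_cancel_left_pos)
      \<comment> \<open>Since \<open>2 n = 2 k + 2\<close>, \<open>half\<close> is applied twice;
        after taking roots this is the factor 2 in \<open>K\<close>.\<close>
      have "b (2 * k) \<le> 4 * b (2 * n)"
        using half[of "2 * k"] half[of "Suc (2 * k)"] k by simp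
      then have "sqrt (b (2 * k)) \<le> sqrt (4 * b (2 * n))" by simp
      also have "\<dots> = 2 * sqrt (b (2 * n))" by (simp add: real_sqrt_mult)
      finally have "C * sqrt (b (2 * k)) * b n \<le> C * (2 * sqrt (b (2 * n))) * b n"
        using C0 b_pos[of n] by (intro mult_right_mono mult_left_mono) auto
      then have "\<rho> * b (2 * n) \<le> 2 * C * b n * sqrt (b (2 * n))" using 2 by (simp add: mult_ac)
      then have 3: "b (2 * n) \<le> K * b n * sqrt (b (2 * n))" using rho(1) by (simp add: K_def field_simps)
      have "sqrt (b (2 * n)) * sqrt (b (2 * n)) \<le> K * b n * sqrt (b (2 * n))" using 3 b_pos[of "2*n"] by simp
      then have "sqrt (b (2 * n)) \<le> K * b n" using b_pos[of "2 * n"]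
        by (intro mult_right_le_imp_le[of "sqrt (b (2 * n))" "sqrt (b (2 * n))"]) auto
      then have "(sqrt (b (2 * n)))\<^sup>2 \<le> (K * b n)\<^sup>2" using b_pos[of "2 * n"] by (intro power_mono) auto
      then have "b (2 * n) \<le> K\<^sup>2 * (b n)\<^sup>2" using b_pos[of "2 * n"] by (simp add: power_mult_distrib)
      also have "\<dots> \<le> (K\<^sup>2 + 1) * (b n)\<^sup>2" by (intro mult_right_mono) auto
      finally show ?thesis .
    qed
    have "1 \<le> (K\<^sup>2 + 1) * b m" if "m \<ge> Suc n1" for m
      by (rule doubling_lower_bound[OF b_pos b_ratio _ key that]) (use that in \<open>auto intro: add_nonneg_pos\<close>)
    then have "1 / (K\<^sup>2 + 1) \<le> b m" if "m \<ge> Suc n1" for m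
      using that by (simp add: pos_divide_le_eq add_nonneg_pos mult.commute)
    then have "1 / (K\<^sup>2 + 1) \<le> \<beta>" by (intro LIMSEQ_le_const[OF beta(1)]) auto
    moreover have "0 < 1 / (K\<^sup>2 + 1)" by (simp add: add_nonneg_pos)
    ultimately show ?thesis by linarith
  qed
  have "uniform_limit UNIV (\<lambda>n x. (P ^^ n) (\<lambda>_. 1) x / \<rho> ^ n) H sequentially"
    using H by (simp add: Pr h_def[abs_def])
  then show ?thesis using that[OF rho(1,2) bmH H_nn _ _ PH] intH b_pos' by auto
qed

section \<open>Sums of independent rare events\<close>

lemma sums_integral_pmf_nat:
  fixes f :: "nat \<Rightarrow> 'b::{banach,second_countable_topology}"
  assumes "\<And>k. norm (f k) \<le> B"
  shows "(\<lambda>k. pmf p k *\<^sub>R f k) sums (\<integral>k. f k \<partial>measure_pmf p)"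
proof -
  have "integrable (measure_pmf p) f"
    by (rule measure_pmf.integrable_const_bound[where B=B]) (use assms in auto)
  then have "integrable (count_space UNIV) (\<lambda>k. pmf p k *\<^sub>R f k)"
    unfolding measure_pmf_eq_density by (subst (asm) integrable_density) auto
  from sums_integral_count_space_nat[OF this]
  show ?thesis unfolding measure_pmf_eq_density by (subst integral_density) auto
qed

text \<open>\<open>pmf_poisson\<close> requires a positive rate. For rate 0 the formula describes
  the point mass at 0, by \<open>0 ^ 0 = 1\<close>.\<close>

lemma ex_poisson_pmf:
  assumes "0 \<le> (a::real)"
  obtains p where "\<And>k. pmf p k = a ^ k / fact k * exp (- a)"
proof (cases "a = 0")
  case True
  then have "pmf (return_pmf 0) k = a ^ k / fact k * exp (- a)" for k :: nat
    by (cases k) auto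
  then show ?thesis by (rule that)
next
  case False
  then have "0 < a" using assms by simp
  then show ?thesis using that pmf_poisson by blast
qed

lemma char_poisson:
  assumes p: "\<And>k. pmf p k = a ^ k / fact k * exp (- a)"
  shows "char (distr (measure_pmf p) borel real) t = exp (of_real a * (iexp t - 1))"
proof -
  have "char (distr (measure_pmf p) borel real) t = (\<integral>k. iexp (t * real k) \<partial>measure_pmf p)"
    unfolding char_def by (subst integral_distr) auto
  moreover have "(\<lambda>k. pmf p k *\<^sub>R iexp (t * real k)) sums (\<integral>k. iexp (t * real k) \<partial>measure_pmf p)"
    by (rule sums_integral_pmf_nat[where B=1]) simp
  moreover have "(\<lambda>k. pmf p k *\<^sub>R iexp (t * real k)) sums exp (of_real a * (iexp t - 1))"
  proof -
    have "(\<lambda>k. (of_real a * iexp t) ^ k /\<^sub>R fact k) sums exp (of_real a * iexp t)"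
      by (rule exp_converges)
    then have "(\<lambda>k. exp (- of_real a) * ((of_real a * iexp t) ^ k /\<^sub>R fact k)) sums (exp (- of_real a) * exp (of_real a * iexp t))"
      by (rule sums_mult)
    moreover have "exp (- of_real a) * ((of_real a * iexp t) ^ k /\<^sub>R fact k) = pmf p k *\<^sub>R iexp (t * real k)" for k
    proof -
      have "iexp (t * real k) = iexp t ^ k" by (simp add: exp_of_nat_mult[symmetric] mult_ac)
      moreover have "complex_of_real (exp (- a)) = exp (- of_real a)" by (simp add: exp_of_real[symmetric])
      ultimately show ?thesis unfolding p
        by (simp add: scaleR_conv_of_real power_mult_distrib divide_inverse mult_ac)
    qed
    moreover have "exp (- of_real a) * exp (of_real a * iexp t) = exp (of_real a * (iexp t - 1))"
      by (simp add: exp_add[symmetric] algebra_simps)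
    ultimately show ?thesis by simp
  qed
  ultimately show ?thesis using sums_unique2 by metis
qed

lemma (in prob_space) char_indicator:
  assumes [measurable]: "E \<in> events"
  shows "char (distr M borel (indicator E)) t = 1 + of_real (prob E) * (iexp t - 1)"
proof -
  have "char (distr M borel (indicator E)) t = (\<integral>x. iexp (t * indicator E x) \<partial>M)"
    unfolding char_def by (subst integral_distr) auto
  also have "\<dots> = (\<integral>x. 1 + indicator E x *\<^sub>R (iexp t - 1) \<partial>M)"
    by (rule Bochner_Integration.integral_cong) (auto simp: indicator_def)
  also have "\<dots> = 1 + of_real (prob E) * (iexp t - 1)"
    by (subst Bochner_Integration.integral_add) (auto simp: emeasure_eq_measure scaleR_conv_of_real prob_space)
  finally show ?thesis .
qed

lemma norm_bernoulli_char_le: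
  assumes "0 \<le> p" "p \<le> 1" shows "norm (1 + of_real p * (iexp t - 1)) \<le> 1"
proof -
  have "1 + of_real p * (iexp t - 1) = of_real (1 - p) + of_real p * iexp t" by (simp add: algebra_simps)
  also have "norm \<dots> \<le> norm (of_real (1 - p) :: complex) + norm (of_real p * iexp t)" by (rule norm_triangle_ineq)
  also have "\<dots> = 1" using assms by (simp add: norm_mult del: of_real_diff)
  finally show ?thesis .
qed

lemma norm_poisson_char_le:
  assumes "0 \<le> p" shows "norm (exp (of_real p * (iexp t - 1))) \<le> 1"
proof -
  have "Re (of_real p * (iexp t - 1)) = p * (cos t - 1)" by (simp add: Re_exp)
  also have "\<dots> \<le> 0" using assms by (simp add: mult_nonneg_nonpos)
  finally show ?thesis by (simp add: norm_exp_eq_Re)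
qed

text \<open>\<open>1 + z\<close> and \<open>exp z\<close> differ at second order, and here
  \<open>norm z\<close> is at most \<open>2 * p\<close>, hence at most 2; this explains the factors
  4 and \<open>exp 2\<close>.\<close>

lemma norm_bernoulli_poisson_char_diff:
  assumes "0 \<le> p" "p \<le> 1"
  shows "norm (1 + of_real p * (iexp t - 1) - exp (of_real p * (iexp t - 1))) \<le> 4 * exp 2 * p\<^sup>2"
proof -
  let ?z = "of_real p * (iexp t - 1) :: complex"
  have "norm (iexp t - 1) \<le> 2" using norm_triangle_ineq4[of "iexp t" 1] by simp
  then have nz: "norm ?z \<le> 2 * p" using assms mult_left_mono[of "norm (iexp t - 1)" 2 p] by (simp add: norm_mult mult.commute)
  have "norm (exp ?z - (1 + ?z)) \<le> exp \<bar>Re ?z\<bar> * norm ?z ^ 2"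
    using Taylor_exp[of ?z 1] by (simp add: numeral_2_eq_2)
  also have "\<dots> \<le> exp 2 * (2 * p) ^ 2"
  proof (intro mult_mono power_mono nz)
    have "\<bar>Re ?z\<bar> \<le> norm ?z" by (rule abs_Re_le_cmod)
    also have "\<dots> \<le> 2" using nz assms by simp
    finally show "exp \<bar>Re ?z\<bar> \<le> exp 2" by simp
  qed auto
  finally show ?thesis by (simp add: norm_minus_commute power_mult_distrib mult_ac)
qed

text \<open>By Levy's continuity theorem. Products of numbers of modulus at most 1 differ by at most
  the sum of the differences of their factors; each factor is within a multiple of
  \<open>p ^ 2\<close> of its Poisson counterpart, and the sum of the squares is at most the largest
  probability times the bounded sum.\<close>

lemma (in prob_space) poisson_limit_sequence:
  fixes h :: "real \<Rightarrow> real" and E :: "nat \<Rightarrow> nat \<Rightarrow> 'a set" and n :: "nat \<Rightarrow> nat"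
  assumes ev: "\<And>i k. k < n i \<Longrightarrow> E i k \<in> events"
    and ind: "\<And>i. indep_vars (\<lambda>_. borel) (\<lambda>k. indicator (E i k) :: 'a \<Rightarrow> real) {..<n i}"
    and sum: "(\<lambda>i. \<Sum>k<n i. prob (E i k)) \<longlonglongrightarrow> a"
    and small: "\<And>e. e > 0 \<Longrightarrow> eventually (\<lambda>i. \<forall>k<n i. prob (E i k) \<le> e) sequentially"
    and h: "continuous_on UNIV h" "bounded (range h)"
  shows "(\<lambda>i. expectation (\<lambda>\<omega>. h (\<Sum>k<n i. indicator (E i k) \<omega>))) \<longlonglongrightarrow> (\<Sum>m. h (real m) * a ^ m / fact m * exp (- a))"
proof -
  have a0: "0 \<le> a" by (rule LIMSEQ_le_const[OF sum]) (intro exI[of _ 0] allI impI sum_nonneg, simp)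
  obtain p where p: "\<And>k. pmf p k = a ^ k / fact k * exp (- a)" using ex_poisson_pmf[OF a0] by blast
  define S where "S i \<omega> = (\<Sum>k<n i. indicator (E i k) \<omega> :: real)" for i \<omega>
  have S[measurable]: "S i \<in> borel_measurable M" for i
    unfolding S_def using ev by (intro borel_measurable_sum borel_measurable_indicator) auto
  let ?\<mu> = "\<lambda>i. distr M borel (S i)" and ?M = "distr (measure_pmf p) borel real"
  have rd: "real_distribution (?\<mu> i)" for i
    by (auto simp: real_distribution_def real_distribution_axioms_def intro!: prob_space_distr)
  have rdM: "real_distribution ?M"
    by (auto simp: real_distribution_def real_distribution_axioms_def intro!: measure_pmf.prob_space_distr)
  have "weak_conv_m ?\<mu> ?M"
  proof (rule levy_continuity[OF rd rdM])
    fix t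
    let ?w = "iexp t - 1 :: complex"
    let ?P = "\<lambda>i. \<Prod>k<n i. exp (of_real (prob (E i k)) * ?w)"
    have c: "char (?\<mu> i) t = (\<Prod>k<n i. 1 + of_real (prob (E i k)) * ?w)" for i
    proof -
      have "char (?\<mu> i) t = (\<Prod>k<n i. char (distr M borel (indicator (E i k))) t)"
        unfolding S_def by (rule char_distr_sum[OF ind])
      also have "\<dots> = (\<Prod>k<n i. 1 + of_real (prob (E i k)) * ?w)"
        using ev by (intro prod.cong char_indicator) auto
      finally show ?thesis .
    qed
    have P: "?P i = exp (of_real (\<Sum>k<n i. prob (E i k)) * ?w)" for i
      by (simp add: exp_sum sum_distrib_right)
    have limP: "?P \<longlonglongrightarrow> exp (of_real a * ?w)"
      unfolding P by (intro tendsto_intros sum)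
    have dif: "(\<lambda>i. char (?\<mu> i) t - ?P i) \<longlonglongrightarrow> 0"
    proof (rule LIMSEQ_I)
      fix r :: real assume r: "0 < r"
      \<comment> \<open>A bound on the individual probabilities that pushes the total error below
        \<open>r\<close> as soon as their sum is below \<open>a + 1\<close>.\<close>
      define e where "e = r / (4 * exp 2 * (a + 1) + 1)"
      have K: "0 < 4 * exp 2 * (a + 1) + 1" using a0 by (intro add_nonneg_pos) auto
      have e: "0 < e" using r K by (simp add: e_def)
      have "eventually (\<lambda>i. (\<Sum>k<n i. prob (E i k)) < a + 1) sequentially"
        using sum by (intro order_tendstoD) auto
      with small[OF e] have "eventually (\<lambda>i. norm (char (?\<mu> i) t - ?P i) < r) sequentially"
      proof eventually_elim
        case (elim i)
        have "norm (char (?\<mu> i) t - ?P i) \<le> (\<Sum>k<n i. norm (1 + of_real (prob (E i k)) * ?w - exp (of_real (prob (E i k)) * ?w)))"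
          unfolding c
          by (rule norm_prod_diff; (rule norm_bernoulli_char_le | rule norm_poisson_char_le); simp)
        also have "\<dots> \<le> (\<Sum>k<n i. 4 * exp 2 * e * prob (E i k))"
        proof (rule sum_mono)
          fix k assume k: "k \<in> {..<n i}"
          have "norm (1 + of_real (prob (E i k)) * ?w - exp (of_real (prob (E i k)) * ?w)) \<le> 4 * exp 2 * (prob (E i k))\<^sup>2"
            by (rule norm_bernoulli_poisson_char_diff) auto
          also have "(prob (E i k))\<^sup>2 \<le> e * prob (E i k)"
            unfolding power2_eq_square using elim k by (intro mult_right_mono) auto
          finally show "norm (1 + of_real (prob (E i k)) * ?w - exp (of_real (prob (E i k)) * ?w)) \<le> 4 * exp 2 * e * prob (E i k)"
            by (simp add: mult_ac)
        qed
        also have "\<dots> = 4 * exp 2 * e * (\<Sum>k<n i. prob (E i k))" by (simp add: sum_distrib_left)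
        also have "\<dots> \<le> 4 * exp 2 * e * (a + 1)" using elim e by (intro mult_left_mono) auto
        also have "\<dots> < (4 * exp 2 * (a + 1) + 1) * e" using e by (simp add: algebra_simps)
        also have "\<dots> = r" using K by (simp add: e_def)
        finally show ?case .
      qed
      then show "\<exists>no. \<forall>i\<ge>no. norm (char (?\<mu> i) t - ?P i - 0) < r" by (simp add: eventually_sequentially)
    qed
    have "(\<lambda>i. (char (?\<mu> i) t - ?P i) + ?P i) \<longlonglongrightarrow> 0 + exp (of_real a * ?w)"
      by (rule tendsto_add[OF dif limP])
    then show "(\<lambda>i. char (?\<mu> i) t) \<longlonglongrightarrow> char ?M t" by (simp add: char_poisson[OF p])
  qed
  moreover obtain B where B: "\<And>x. norm (h x) \<le> B" using h(2) unfolding bounded_iff by auto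
  ultimately have "(\<lambda>i. integral\<^sup>L (?\<mu> i) h) \<longlonglongrightarrow> integral\<^sup>L ?M h"
    using h(1) rd rdM by (intro weak_conv_imp_integral_bdd_continuous_conv) (auto simp: continuous_on_eq_continuous_at)
  moreover have hm[measurable]: "h \<in> borel_measurable borel" using h(1) by (rule borel_measurable_continuous_onI)
  then have "integral\<^sup>L (?\<mu> i) h = expectation (\<lambda>\<omega>. h (S i \<omega>))" for i by (subst integral_distr) auto
  moreover have "integral\<^sup>L ?M h = (\<Sum>m. h (real m) * a ^ m / fact m * exp (- a))"
  proof -
    have "integral\<^sup>L ?M h = (\<integral>k. h (real k) \<partial>measure_pmf p)" by (subst integral_distr) auto
    moreover have "(\<lambda>k. pmf p k *\<^sub>R h (real k)) sums (\<integral>k. h (real k) \<partial>measure_pmf p)"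
      by (rule sums_integral_pmf_nat[where B=B]) (rule B)
    ultimately show ?thesis unfolding p by (simp add: sums_iff mult_ac)
  qed
  ultimately show ?thesis unfolding S_def by simp
qed

section \<open>Gaussian transition operators\<close>

text \<open>The process started at \<open>x\<close> is \<open>x + b (W t)\<close>; ellipticity
  enters as injectivity of \<open>b\<close>.\<close>

locale elliptic_domain =
  fixes b :: "real^'d \<Rightarrow> real^'d" and Q :: "(real^'d) set"
  assumes linear_b: "linear b" and inj_b: "inj b" and open_Q: "open Q" and bounded_Q: "bounded Q"
begin

lemma continuous_b: "continuous_on UNIV b"
  using linear_b by (rule linear_continuous_on_compose[OF continuous_on_id, simplified])

lemma b_measurable [measurable]: "b \<in> borel_measurable borel"
  using continuous_b by (rule borel_measurable_continuous_onI)

lemma Q_measurable [measurable]: "Q \<in> sets borel"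
  using open_Q by simp

lemma gauss_UNIV [simp]: "measure (gauss :: (real^'d) measure) UNIV = 1"
  using gauss.prob_space by simp

definition Gop :: "real \<Rightarrow> (real^'d \<Rightarrow> real) \<Rightarrow> real^'d \<Rightarrow> real" where
  "Gop s f x = (\<integral>z. f (x + sqrt s *\<^sub>R b z) \<partial>gauss)"

text \<open>The \<open>ennreal\<close> version admits unbounded integrands, such as the sixth power
  of a distance, and composes without integrability conditions.\<close>

definition nnG :: "real \<Rightarrow> (real^'d \<Rightarrow> ennreal) \<Rightarrow> real^'d \<Rightarrow> ennreal" where
  "nnG s f x = (\<integral>\<^sup>+z. f (x + sqrt s *\<^sub>R b z) \<partial>gauss)"

lemma bm_shift: assumes "bm f" shows "bm (\<lambda>z. f (x + sqrt s *\<^sub>R b z))"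
proof -
  have [measurable]: "f \<in> borel_measurable borel" using assms by (rule bm_measurable)
  obtain C where "\<And>x. \<bar>f x\<bar> \<le> C" using bm_bounded[OF assms] by metis
  then show ?thesis unfolding bm_def by auto
qed

lemma integrable_gauss_bm: "bm f \<Longrightarrow> integrable gauss f"
  by (rule bm_integrable) (auto intro: gauss.finite_measure)

lemma integrable_shift: "bm f \<Longrightarrow> integrable gauss (\<lambda>z. f (x + sqrt s *\<^sub>R b z))"
  by (intro integrable_gauss_bm bm_shift)

lemma Gop_mono: "bm f \<Longrightarrow> bm g \<Longrightarrow> (\<And>y. f y \<le> g y) \<Longrightarrow> Gop s f x \<le> Gop s g x"
  unfolding Gop_def by (intro integral_mono integrable_shift)

lemma Gop_lin: "bm f \<Longrightarrow> bm g \<Longrightarrow> Gop s (\<lambda>x. f x + c * g x) = (\<lambda>x. Gop s f x + c * Gop s g x)"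
  unfolding Gop_def by (auto simp: integrable_shift)

lemma Gop_const [simp]: "Gop s (\<lambda>_. c) x = c"
  unfolding Gop_def by simp

lemma Gop_nonneg: "(\<And>y. 0 \<le> f y) \<Longrightarrow> 0 \<le> Gop s f x"
  unfolding Gop_def by (intro integral_nonneg_AE) auto

lemma Gop_abs: "\<bar>Gop s f x\<bar> \<le> Gop s (\<lambda>y. \<bar>f y\<bar>) x"
  unfolding Gop_def using integral_norm_bound[of gauss "\<lambda>z. f (x + sqrt s *\<^sub>R b z)"] by simp

lemma Gop_bound: assumes "bm f" "\<And>y. \<bar>f y\<bar> \<le> C" shows "\<bar>Gop s f x\<bar> \<le> C"
proof -
  have "Gop s (\<lambda>y. \<bar>f y\<bar>) x \<le> Gop s (\<lambda>_. C) x" using assms by (intro Gop_mono bm_abs) auto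
  then show ?thesis using Gop_abs[of s f x] by simp
qed

lemma Gop_bm: assumes "bm f" shows "bm (Gop s f)"
proof -
  have [measurable]: "f \<in> borel_measurable borel" using assms by (rule bm_measurable)
  obtain C where C: "\<And>x. \<bar>f x\<bar> \<le> C" using bm_bounded[OF assms] by metis
  have "(\<lambda>x. \<integral>z. f (x + sqrt s *\<^sub>R b z) \<partial>gauss) \<in> borel_measurable borel"
    by (rule gauss.borel_measurable_lebesgue_integral) measurable
  then have "Gop s f \<in> borel_measurable borel" unfolding Gop_def[abs_def] .
  moreover have "\<bar>Gop s f x\<bar> \<le> C" for x by (rule Gop_bound[OF assms C])
  ultimately show ?thesis unfolding bm_def by blast
qed

lemma nnG_measurable [measurable]: assumes [measurable]: "f \<in> borel_measurable borel" shows "nnG s f \<in> borel_measurable borel"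
  unfolding nnG_def[abs_def] by (rule gauss.borel_measurable_nn_integral) measurable

lemma nnG_mono: "(\<And>y. f y \<le> g y) \<Longrightarrow> nnG s f x \<le> nnG s g x"
  unfolding nnG_def by (intro nn_integral_mono) auto

lemma nnG_Gop: assumes "bm f" "\<And>y. 0 \<le> f y" shows "nnG s (\<lambda>y. ennreal (f y)) x = ennreal (Gop s f x)"
  unfolding nnG_def Gop_def by (intro nn_integral_eq_integral integrable_shift) (use assms in auto)

lemma nnG_double:
  assumes [measurable]: "f \<in> borel_measurable borel" and s: "0 \<le> s"
  shows "nnG s (nnG s f) x = nnG (2 * s) f x"
proof -
  have "nnG s (nnG s f) x = (\<integral>\<^sup>+z'. (\<integral>\<^sup>+z. f (x + sqrt s *\<^sub>R b (z + z')) \<partial>gauss) \<partial>gauss)"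
    unfolding nnG_def by (simp add: linear_add[OF linear_b] scaleR_add_right add_ac)
  also have "\<dots> = (\<integral>\<^sup>+z. f (x + sqrt s *\<^sub>R b (sqrt 2 *\<^sub>R z)) \<partial>gauss)"
    by (rule nn_integral_gauss_add[where F="\<lambda>u. f (x + sqrt s *\<^sub>R b u)"]) measurable
  also have "\<dots> = nnG (2 * s) f x"
    unfolding nnG_def by (simp add: linear_scale[OF linear_b] real_sqrt_mult mult.commute)
  finally show ?thesis .
qed

text \<open>Adding a constant makes \<open>f\<close> nonnegative and reduces the claim to
  \<open>nnG\<close>.\<close>

lemma Gop_double:
  assumes f: "bm f" and s: "0 \<le> s"
  shows "Gop s (Gop s f) x = Gop (2 * s) f x"
proof -
  obtain C where C: "\<And>x. \<bar>f x\<bar> \<le> C" using bm_bounded[OF f] by metis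
  define g where "g y = f y + C * 1" for y
  have g: "bm g" "\<And>y. 0 \<le> g y" using f C unfolding g_def by (auto intro!: bm_lin simp: abs_le_iff) (smt (verit) C abs_le_iff)
  have Gg: "Gop s g y = Gop s f y + C" for s y
    using Gop_lin[OF f bm_const[of 1], of s C] by (simp add: g_def[abs_def])
  have "ennreal (Gop s (Gop s g) x) = nnG s (\<lambda>y. ennreal (Gop s g y)) x"
    by (rule nnG_Gop[symmetric]) (auto intro: Gop_bm Gop_nonneg g)
  also have "\<dots> = nnG s (nnG s (\<lambda>y. ennreal (g y))) x"
    using nnG_Gop[OF g, of s] by (auto simp: nnG_def)
  also have "\<dots> = nnG (2 * s) (\<lambda>y. ennreal (g y)) x"
    using g s by (intro nnG_double) (auto simp: bm_def)
  also have "\<dots> = ennreal (Gop (2 * s) g x)" by (rule nnG_Gop[OF g])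
  finally have "Gop s (Gop s g) x = Gop (2 * s) g x"
    using Gop_nonneg[OF g(2)] Gop_nonneg[of "Gop s g"] by simp
  moreover have "Gop s (Gop s g) x = Gop s (Gop s f) x + C"
    using Gop_lin[OF Gop_bm[OF f, of s] bm_const[of 1], of s C] unfolding Gg[abs_def] by simp
  ultimately show ?thesis using Gg by simp
qed

lemma integrable_bounded_support:
  fixes f :: "real^'d \<Rightarrow> real"
  assumes "bm f" "bounded A" "A \<in> sets borel" "\<And>x. x \<notin> A \<Longrightarrow> f x = 0"
  shows "integrable lborel f"
proof -
  obtain C where C: "\<And>x. \<bar>f x\<bar> \<le> C" using bm_bounded[OF assms(1)] by metis
  have "emeasure lborel A < \<infinity>" using assms(2) by (rule emeasure_bounded_finite)
  then have "integrable lborel (\<lambda>x. C * indicator A x :: real)" using assms(3) by auto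
  then show ?thesis
    by (rule Bochner_Integration.integrable_bound) (use assms(1,4) C in \<open>auto simp: bm_def indicator_def intro!: AE_I2 order_trans[OF C]\<close>)
qed

text \<open>Translation by \<open>sqrt s *\<^sub>R b z\<close> preserves Lebesgue measure and the
  Gaussian measure is even; the common bounded support makes Fubini applicable.\<close>

lemma Gop_sym:
  assumes f: "bm f" and g: "bm g" and A: "bounded A" "A \<in> sets borel"
    and f0: "\<And>x. x \<notin> A \<Longrightarrow> f x = 0" and g0: "\<And>x. x \<notin> A \<Longrightarrow> g x = 0"
  shows "(\<integral>x. Gop s f x * g x \<partial>lborel) = (\<integral>x. f x * Gop s g x \<partial>lborel)"
proof -
  have [measurable]: "f \<in> borel_measurable borel" "g \<in> borel_measurable borel" using f g by (auto simp: bm_def)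
  interpret p: pair_sigma_finite "lborel :: (real^'d) measure" "gauss :: (real^'d) measure"
    by (simp add: pair_sigma_finite_def sigma_finite_lborel gauss.sigma_finite_measure)
  let ?v = "\<lambda>z. sqrt s *\<^sub>R b z"
  obtain C where C: "\<And>x. \<bar>f x\<bar> \<le> C" using bm_bounded[OF f] by metis
  obtain D where D: "\<And>x. \<bar>g x\<bar> \<le> D" using bm_bounded[OF g] by metis
  have ig: "integrable lborel (\<lambda>x. \<bar>g x\<bar>)" "integrable lborel (\<lambda>x. \<bar>f x\<bar>)"
    using integrable_bounded_support[OF bm_abs[OF g] A] integrable_bounded_support[OF bm_abs[OF f] A] f0 g0 by auto
  have int: "integrable (lborel \<Otimes>\<^sub>M gauss) (\<lambda>(x, z). u (x + t *\<^sub>R ?v z) * w x)"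
    if u: "bm u" and w: "bm w" "integrable lborel (\<lambda>x. \<bar>w x\<bar>)" for u w t
  proof -
    have [measurable]: "u \<in> borel_measurable borel" "w \<in> borel_measurable borel" using u w by (auto simp: bm_def)
    obtain C where C: "\<And>x. \<bar>u x\<bar> \<le> C" using bm_bounded[OF u] by metis
    have bmu: "bm (\<lambda>z. u (x + t *\<^sub>R ?v z))" for x using C unfolding bm_def by auto
    show ?thesis
    proof (rule p.Fubini_integrable)
      show "(\<lambda>(x, z). u (x + t *\<^sub>R ?v z) * w x) \<in> borel_measurable (lborel \<Otimes>\<^sub>M gauss)" by measurable
      show "AE x in lborel. integrable gauss (\<lambda>z. (\<lambda>(x, z). u (x + t *\<^sub>R ?v z) * w x) (x, z))"
        using integrable_gauss_bm[OF bmu] by auto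
      have "integrable lborel (\<lambda>x. C * \<bar>w x\<bar>)" using w by auto
      then have "integrable lborel (\<lambda>x. \<integral>z. \<bar>u (x + t *\<^sub>R ?v z)\<bar> * \<bar>w x\<bar> \<partial>gauss)"
      proof (rule Bochner_Integration.integrable_bound)
        show "(\<lambda>x. \<integral>z. \<bar>u (x + t *\<^sub>R ?v z)\<bar> * \<bar>w x\<bar> \<partial>gauss) \<in> borel_measurable lborel"
          by (intro gauss.borel_measurable_lebesgue_integral) measurable
        show "AE x in lborel. norm (\<integral>z. \<bar>u (x + t *\<^sub>R ?v z)\<bar> * \<bar>w x\<bar> \<partial>gauss) \<le> norm (C * \<bar>w x\<bar>)"
        proof (rule AE_I2)
          fix x
          have "(\<integral>z. \<bar>u (x + t *\<^sub>R ?v z)\<bar> \<partial>gauss) \<le> (\<integral>z. C \<partial>(gauss :: (real^'d) measure))"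
            using C by (intro integral_mono integrable_gauss_bm bm_abs bmu) auto
          then have "(\<integral>z. \<bar>u (x + t *\<^sub>R ?v z)\<bar> \<partial>gauss) \<le> C" by (simp add: gauss.prob_space)
          moreover have "0 \<le> (\<integral>z. \<bar>u (x + t *\<^sub>R ?v z)\<bar> \<partial>gauss)" by (intro integral_nonneg_AE) auto
          ultimately show "norm (\<integral>z. \<bar>u (x + t *\<^sub>R ?v z)\<bar> * \<bar>w x\<bar> \<partial>gauss) \<le> norm (C * \<bar>w x\<bar>)"
            by (auto simp: abs_mult intro!: mult_right_mono)
        qed
      qed
      then show "integrable lborel (\<lambda>x. \<integral>z. norm ((\<lambda>(x, z). u (x + t *\<^sub>R ?v z) * w x) (x, z)) \<partial>gauss)"
        by (simp add: abs_mult)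
    qed
  qed
  have "(\<integral>x. Gop s f x * g x \<partial>lborel) = (\<integral>x. (\<integral>z. f (x + 1 *\<^sub>R ?v z) * g x \<partial>gauss) \<partial>lborel)"
    by (simp add: Gop_def)
  also have "\<dots> = (\<integral>z. (\<integral>x. f (x + 1 *\<^sub>R ?v z) * g x \<partial>lborel) \<partial>gauss)"
    using p.Fubini_integral[OF int[OF f g ig(1)], of 1] by simp
  also have "\<dots> = (\<integral>z. (\<integral>x. g (x + (-1) *\<^sub>R ?v z) * f x \<partial>lborel) \<partial>gauss)"
  proof (rule Bochner_Integration.integral_cong[OF refl])
    fix z
    have "(\<integral>x. g (x + (-1) *\<^sub>R ?v z) * f x \<partial>lborel) = (\<integral>x. g (x + (-1) *\<^sub>R ?v z) * f x \<partial>distr lborel borel ((+) (?v z)))"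
      by (simp add: lborel_distr_plus)
    also have "\<dots> = (\<integral>x. f (x + 1 *\<^sub>R ?v z) * g x \<partial>lborel)"
      by (subst integral_distr) (auto simp: add.commute mult.commute)
    finally show "(\<integral>x. f (x + 1 *\<^sub>R ?v z) * g x \<partial>lborel) = (\<integral>x. g (x + (-1) *\<^sub>R ?v z) * f x \<partial>lborel)" ..
  qed
  also have "\<dots> = (\<integral>x. (\<integral>z. g (x + (-1) *\<^sub>R ?v z) * f x \<partial>gauss) \<partial>lborel)"
    using p.Fubini_integral[OF int[OF g f ig(2)], of "-1"] by simp
  also have "\<dots> = (\<integral>x. Gop s g x * f x \<partial>lborel)"
  proof (rule Bochner_Integration.integral_cong[OF refl])
    fix x
    have "Gop s g x = (\<integral>z. g (x + ?v z) \<partial>distr gauss borel uminus)" by (simp add: Gop_def distr_gauss_uminus)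
    also have "\<dots> = (\<integral>z. g (x + (-1) *\<^sub>R ?v z) \<partial>gauss)"
      by (subst integral_distr) (auto simp: linear_neg[OF linear_b])
    finally show "(\<integral>z. g (x + (-1) *\<^sub>R ?v z) * f x \<partial>gauss) = Gop s g x * f x" by simp
  qed
  finally show ?thesis by (simp add: mult.commute)
qed

section \<open>The heat kernel as density of the Gaussian operators\<close>

definition a :: "real^'d \<Rightarrow> real^'d" where "a = inv b"

lemma bij_b: "bij b"
  using linear_injective_imp_surjective[OF linear_b inj_b] inj_b by (simp add: bij_def)

lemma a_b [simp]: "a (b z) = z"
  unfolding a_def using inj_b by simp

lemma b_a [simp]: "b (a z) = z"
  unfolding a_def using bij_b by (simp add: bij_is_surj surj_f_inv_f)

lemma linear_a: "linear a"
proof (rule linearI)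
  show "a (x + y) = a x + a y" for x y
    by (rule injD[OF inj_b]) (simp add: linear_add[OF linear_b])
  show "a (c *\<^sub>R x) = c *\<^sub>R a x" for c x
    by (rule injD[OF inj_b]) (simp add: linear_scale[OF linear_b])
qed

lemma a_measurable [measurable]: "a \<in> borel_measurable borel"
  by (rule borel_measurable_continuous_onI[OF linear_continuous_on[OF linear_conv_bounded_linear[THEN iffD1, OF linear_a]]])

lemma nn_integral_lborel_translate:
  fixes f :: "real^'d \<Rightarrow> ennreal"
  assumes "f \<in> borel_measurable borel"
  shows "(\<integral>\<^sup>+x. f (x + t) \<partial>lborel) = (\<integral>\<^sup>+x. f x \<partial>lborel)"
  using nn_integral_lborel_affine[OF assms, of 1 t] by (simp add: add.commute)

lemma nn_integral_lborel_reflect: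
  fixes f :: "real^'d \<Rightarrow> ennreal"
  assumes "f \<in> borel_measurable borel"
  shows "(\<integral>\<^sup>+y. f (x - y) \<partial>lborel) = (\<integral>\<^sup>+y. f y \<partial>lborel)"
  using nn_integral_lborel_affine[OF assms, of "-1" x] by simp

text \<open>Uniqueness of Haar measure, by Fubini; the change of variables theorem of the library is
  restricted to index types of class \<open>wellorder\<close>.\<close>

lemma ex_distr_b:
  obtains \<kappa> where "0 < \<kappa>" "distr lborel borel b = density lborel (\<lambda>_. ennreal \<kappa>)"
proof -
  let ?\<mu> = "distr lborel borel b"
  define V where "V = (ball 0 1 :: (real^'d) set)"
  have V[measurable]: "V \<in> sets borel" by (simp add: V_def)
  \<comment> \<open>By linearity a translation of the image is a translation before
    \<open>b\<close>, under which \<open>lborel\<close> is invariant.\<close>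
  have inv: "(\<integral>\<^sup>+x. f (x - t) \<partial>?\<mu>) = (\<integral>\<^sup>+x. f x \<partial>?\<mu>)" if [measurable]: "f \<in> borel_measurable borel" for f :: "real^'d \<Rightarrow> ennreal" and t
  proof -
    have "(\<integral>\<^sup>+x. f (x - t) \<partial>?\<mu>) = (\<integral>\<^sup>+x. f (b x - t) \<partial>lborel)" by (subst nn_integral_distr) auto
    also have "\<dots> = (\<integral>\<^sup>+x. f (b (x + a (- t))) \<partial>lborel)" by (simp add: linear_add[OF linear_b])
    also have "\<dots> = (\<integral>\<^sup>+x. f (b x) \<partial>lborel)" by (rule nn_integral_lborel_translate[where f="\<lambda>x. f (b x)"]) measurable
    also have "\<dots> = (\<integral>\<^sup>+x. f x \<partial>?\<mu>)" by (subst nn_integral_distr) auto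
    finally show ?thesis .
  qed
  have sf: "sigma_finite_measure ?\<mu>"
  proof (rule sigma_finite_measure.intro, intro exI conjI)
    let ?A = "range (\<lambda>n::nat. ball (0::real^'d) (real n))"
    show "countable ?A" "?A \<subseteq> sets ?\<mu>" by auto
    show "\<Union>?A = space ?\<mu>" by (auto intro: reals_Archimedean2)
    show "\<forall>a\<in>?A. emeasure ?\<mu> a \<noteq> \<infinity>"
    proof
      fix S assume "S \<in> ?A"
      then have S: "bounded S" "S \<in> sets borel" by auto
      have "b -` S = a ` S" by (auto simp: image_iff) (metis a_b)
      then have "bounded (b -` S)" using bounded_linear_image[OF S(1) linear_conv_bounded_linear[THEN iffD1, OF linear_a]] by simp
      then have "emeasure lborel (b -` S) < \<infinity>" by (rule emeasure_bounded_finite)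
      then show "emeasure ?\<mu> S \<noteq> \<infinity>" using S by (subst emeasure_distr) auto
    qed
  qed
  interpret p: pair_sigma_finite ?\<mu> "lborel :: (real^'d) measure"
    using sf by (simp add: pair_sigma_finite_def sigma_finite_lborel)
  \<comment> \<open>The function \<open>f x * indicator V (y + x)\<close> is integrated in both
    orders. In one of them the \<open>y\<close>-integral is the volume of \<open>V\<close>; in the
    other the invariance of \<open>?\<mu>\<close> first moves the shift onto
    \<open>f\<close>.\<close>
  have key: "(\<integral>\<^sup>+x. f x \<partial>?\<mu>) * emeasure lborel V = emeasure ?\<mu> V * (\<integral>\<^sup>+x. f x \<partial>lborel)"
    if [measurable]: "f \<in> borel_measurable borel" for f :: "real^'d \<Rightarrow> ennreal"
  proof -
    let ?g = "indicator V :: real^'d \<Rightarrow> ennreal"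
    have "(\<integral>\<^sup>+x. f x \<partial>?\<mu>) * emeasure lborel V = (\<integral>\<^sup>+x. f x * emeasure lborel V \<partial>?\<mu>)"
      by (rule nn_integral_multc[symmetric]) auto
    also have "\<dots> = (\<integral>\<^sup>+x. (\<integral>\<^sup>+y. f x * ?g (y + x) \<partial>lborel) \<partial>?\<mu>)"
      by (subst nn_integral_cmult) (auto simp: nn_integral_lborel_translate)
    also have "\<dots> = (\<integral>\<^sup>+y. (\<integral>\<^sup>+x. f x * ?g (y + x) \<partial>?\<mu>) \<partial>lborel)"
      by (rule p.Fubini'[symmetric]) measurable
    also have "\<dots> = (\<integral>\<^sup>+y. (\<integral>\<^sup>+x. f (x - y) * ?g x \<partial>?\<mu>) \<partial>lborel)"
    proof (rule nn_integral_cong)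
      fix y show "(\<integral>\<^sup>+x. f x * ?g (y + x) \<partial>?\<mu>) = (\<integral>\<^sup>+x. f (x - y) * ?g x \<partial>?\<mu>)"
        using inv[of "\<lambda>x. f x * ?g (y + x)" y] by simp
    qed
    also have "\<dots> = (\<integral>\<^sup>+x. (\<integral>\<^sup>+y. f (x - y) * ?g x \<partial>lborel) \<partial>?\<mu>)"
      by (rule p.Fubini') measurable
    also have "\<dots> = (\<integral>\<^sup>+x. (\<integral>\<^sup>+y. f y \<partial>lborel) * ?g x \<partial>?\<mu>)"
      by (subst nn_integral_multc) (auto simp: nn_integral_lborel_reflect)
    also have "\<dots> = emeasure ?\<mu> V * (\<integral>\<^sup>+x. f x \<partial>lborel)"
      by (subst nn_integral_cmult) (auto simp: mult.commute)
    finally show ?thesis .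
  qed
  have Vl: "emeasure lborel V = ennreal (measure lborel V)"
    unfolding V_def by (rule emeasure_eq_ennreal_measure) (use emeasure_bounded_finite[of "ball (0::real^'d) 1"] in auto)
  have Vl0: "0 < measure lborel V" unfolding V_def using content_ball_pos[of 1 "0::real^'d"] by simp
  have imV: "b -` V = a ` V" by (auto simp: image_iff) (metis a_b)
  have "bounded V" by (simp add: V_def)
  then have "bounded (b -` V)" unfolding imV
    by (rule bounded_linear_image) (rule linear_conv_bounded_linear[THEN iffD1, OF linear_a])
  then have fin: "emeasure lborel (b -` V) < \<infinity>" by (rule emeasure_bounded_finite)
  have muV: "emeasure ?\<mu> V = emeasure lborel (b -` V)" by (subst emeasure_distr) auto
  have "open (b -` V)" unfolding V_def using continuous_b by (auto intro: open_vimage)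
  moreover have "0 \<in> b -` V" by (simp add: V_def linear_0[OF linear_b])
  ultimately obtain e where e: "0 < e" "ball 0 e \<subseteq> b -` V" by (metis open_contains_ball)
  have bV[measurable]: "b -` V \<in> sets borel" using \<open>open (b -` V)\<close> by simp
  have "0 < measure lborel (ball (0::real^'d) e)" using content_ball_pos[OF e(1), of "0::real^'d"] by simp
  also have "\<dots> \<le> measure lborel (b -` V)"
    using e(2) fin by (intro measure_mono_fmeasurable) (auto simp: fmeasurable_def)
  finally have muV0: "0 < measure lborel (b -` V)" .
  \<comment> \<open>The ratio of the two measures on the unit ball \<open>V\<close>, where both are
    finite and positive.\<close>
  define \<kappa> where "\<kappa> = measure lborel (b -` V) / measure lborel V"
  have k: "0 < \<kappa>" using muV0 Vl0 by (simp add: \<kappa>_def)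
  have muV': "emeasure ?\<mu> V = ennreal (measure lborel (b -` V))"
    unfolding muV using fin by (intro emeasure_eq_ennreal_measure) auto
  have "?\<mu> = density lborel (\<lambda>_. ennreal \<kappa>)"
  proof (rule measure_eqI)
    fix X :: "(real^'d) set" assume "X \<in> sets ?\<mu>"
    then have [measurable]: "X \<in> sets borel" by simp
    have "emeasure ?\<mu> X * ennreal (measure lborel V) = ennreal (measure lborel (b -` V)) * emeasure lborel X"
      using key[of "indicator X"] unfolding Vl muV' by simp
    then have "(emeasure ?\<mu> X * ennreal (measure lborel V)) * ennreal (1 / measure lborel V) =
        (ennreal (measure lborel (b -` V)) * emeasure lborel X) * ennreal (1 / measure lborel V)" by simp
    moreover have "(emeasure ?\<mu> X * ennreal (measure lborel V)) * ennreal (1 / measure lborel V) = emeasure ?\<mu> X"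
      using Vl0 by (simp add: mult.assoc ennreal_mult[symmetric])
    moreover have "(ennreal (measure lborel (b -` V)) * emeasure lborel X) * ennreal (1 / measure lborel V) = ennreal \<kappa> * emeasure lborel X"
    proof -
      have "ennreal (measure lborel (b -` V)) * ennreal (1 / measure lborel V) = ennreal \<kappa>"
        using Vl0 by (simp add: ennreal_mult[symmetric] \<kappa>_def)
      then show ?thesis by (simp only: mult_ac)
    qed
    ultimately show "emeasure ?\<mu> X = emeasure (density lborel (\<lambda>_. ennreal \<kappa>)) X"
      by (simp add: emeasure_density_const)
  qed simp
  then show ?thesis using k that by blast
qed

text \<open>This is \<open>1 / |det b|\<close>; positivity and the density property are all that is
  used.\<close>

definition kap :: real where
  "kap = (SOME \<kappa>. 0 < \<kappa> \<and> distr lborel borel b = density lborel (\<lambda>_. ennreal \<kappa>))"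

lemma kap: "0 < kap" "distr lborel borel b = density lborel (\<lambda>_. ennreal kap)"
proof -
  have "\<exists>\<kappa>. 0 < \<kappa> \<and> distr lborel borel b = density lborel (\<lambda>_. ennreal \<kappa>)" using ex_distr_b by metis
  from someI_ex[OF this] show "0 < kap" "distr lborel borel b = density lborel (\<lambda>_. ennreal kap)"
    unfolding kap_def by auto
qed

text \<open>The heat kernel: the density of \<open>sqrt s *\<^sub>R b z\<close> for Gaussian
  \<open>z\<close>, that is, of the displacement over time \<open>s\<close>.\<close>

definition hk :: "real \<Rightarrow> real^'d \<Rightarrow> real" where
  "hk s v = kap * (1 / sqrt s) ^ CARD('d) * gauss_density (a ((1 / sqrt s) *\<^sub>R v))"

lemma hk_measurable [measurable]: "hk s \<in> borel_measurable borel"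
  unfolding hk_def[abs_def] by measurable

lemma hk_nonneg [simp]: "0 < s \<Longrightarrow> 0 \<le> hk s v"
  unfolding hk_def using kap(1) by auto

lemma nnG_hk:
  assumes [measurable]: "f \<in> borel_measurable borel" and s: "0 < s"
  shows "nnG s f x = (\<integral>\<^sup>+w. ennreal (hk s (w - x)) * f w \<partial>lborel)"
proof -
  have "nnG s f x = (\<integral>\<^sup>+z. ennreal (gauss_density (a (b z))) * f (x + sqrt s *\<^sub>R b z) \<partial>lborel)"
    unfolding nnG_def by (subst nn_integral_gauss) auto
  also have "\<dots> = (\<integral>\<^sup>+y. ennreal (gauss_density (a y)) * f (x + sqrt s *\<^sub>R y) \<partial>distr lborel borel b)"
    by (subst nn_integral_distr) auto
  also have "\<dots> = ennreal kap * (\<integral>\<^sup>+y. ennreal (gauss_density (a y)) * f (x + sqrt s *\<^sub>R y) \<partial>lborel)"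
    unfolding kap(2) by (subst nn_integral_density) (auto simp: nn_integral_cmult)
  also have "(\<integral>\<^sup>+y. ennreal (gauss_density (a y)) * f (x + sqrt s *\<^sub>R y) \<partial>lborel) =
     ennreal (\<bar>1 / sqrt s\<bar> ^ CARD('d)) * (\<integral>\<^sup>+w. ennreal (gauss_density (a ((-1 / sqrt s) *\<^sub>R x + (1 / sqrt s) *\<^sub>R w))) *
       f (x + sqrt s *\<^sub>R ((-1 / sqrt s) *\<^sub>R x + (1 / sqrt s) *\<^sub>R w)) \<partial>lborel)"
    using s by (intro nn_integral_lborel_affine) auto
  also have "\<dots> = ennreal ((1 / sqrt s) ^ CARD('d)) * (\<integral>\<^sup>+w. ennreal (gauss_density (a ((1 / sqrt s) *\<^sub>R (w - x)))) * f w \<partial>lborel)"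
    using s by (simp add: scaleR_add_right scaleR_diff_right)
  finally have "nnG s f x = ennreal kap * (ennreal ((1 / sqrt s) ^ CARD('d)) * (\<integral>\<^sup>+w. ennreal (gauss_density (a ((1 / sqrt s) *\<^sub>R (w - x)))) * f w \<partial>lborel))" .
  also have "\<dots> = (\<integral>\<^sup>+w. ennreal (hk s (w - x)) * f w \<partial>lborel)"
    using kap(1) s by (subst nn_integral_cmult[symmetric], measurable)+
      (auto simp: hk_def ennreal_mult mult_ac intro!: nn_integral_cong)
  finally show ?thesis .
qed

lemma Gop_hk:
  assumes "bm f" and s: "0 < s"
  shows "Gop s f x = (\<integral>w. hk s (w - x) * f w \<partial>lborel)" "integrable lborel (\<lambda>w. hk s (w - x) * f w)"
proof -
  have [measurable]: "f \<in> borel_measurable borel" using assms by (rule_tac bm_measurable)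
  have eq: "distr gauss borel (\<lambda>z. x + sqrt s *\<^sub>R b z) = density lborel (\<lambda>w. ennreal (hk s (w - x)))"
  proof (rule measure_eqI)
    fix X :: "(real^'d) set" assume "X \<in> sets (distr gauss borel (\<lambda>z. x + sqrt s *\<^sub>R b z))"
    then have [measurable]: "X \<in> sets borel" by simp
    have "emeasure (distr gauss borel (\<lambda>z. x + sqrt s *\<^sub>R b z)) X = (\<integral>\<^sup>+y. indicator X y \<partial>distr gauss borel (\<lambda>z. x + sqrt s *\<^sub>R b z))"
      by simp
    also have "\<dots> = nnG s (indicator X) x" unfolding nnG_def by (subst nn_integral_distr) auto
    also have "\<dots> = emeasure (density lborel (\<lambda>w. ennreal (hk s (w - x)))) X"
      using s by (subst nnG_hk) (auto simp: emeasure_density)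
    finally show "emeasure (distr gauss borel (\<lambda>z. x + sqrt s *\<^sub>R b z)) X = emeasure (density lborel (\<lambda>w. ennreal (hk s (w - x)))) X" .
  qed simp
  have "Gop s f x = (\<integral>y. f y \<partial>distr gauss borel (\<lambda>z. x + sqrt s *\<^sub>R b z))"
    unfolding Gop_def by (subst integral_distr) auto
  also have "\<dots> = (\<integral>w. hk s (w - x) * f w \<partial>lborel)"
    unfolding eq using s by (subst integral_real_density) auto
  finally show "Gop s f x = (\<integral>w. hk s (w - x) * f w \<partial>lborel)" .
  have "integrable (distr gauss borel (\<lambda>z. x + sqrt s *\<^sub>R b z)) f"
    by (subst integrable_distr_eq) (auto intro: integrable_shift assms)
  then show "integrable lborel (\<lambda>w. hk s (w - x) * f w)"
    unfolding eq using s by (subst (asm) integrable_real_density) auto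
qed

text \<open>The kernel \<open>hk s\<close> is bounded by its value at 0. Applied to squares, this
  becomes the bound from \<open>L2\<close> to bounded functions.\<close>

lemma Gop_L1_bound:
  assumes s: "0 < s"
  obtains C where "0 < C" "\<And>f A x. bm f \<Longrightarrow> (\<And>y. 0 \<le> f y) \<Longrightarrow> integrable lborel f \<Longrightarrow> Gop s f x \<le> C * (\<integral>y. f y \<partial>lborel)"
proof -
  define C where "C = kap * (1 / sqrt s) ^ CARD('d) * (1 / sqrt (2 * pi)) ^ CARD('d)"
  have C: "0 < C" using kap(1) s by (simp add: C_def)
  have h: "hk s v \<le> C" for v
    unfolding hk_def C_def gauss_density_def using kap(1) s by (intro mult_left_mono) (auto intro!: mult_left_le)
  show ?thesis
  proof (rule that[OF C])
    fix f :: "real^'d \<Rightarrow> real" and x assume f: "bm f" "\<And>y. 0 \<le> f y" "integrable lborel f"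
    have "Gop s f x \<le> (\<integral>y. C * f y \<partial>lborel)"
      unfolding Gop_hk(1)[OF f(1) s] using f Gop_hk(2)[OF f(1) s] h
      by (intro integral_mono mult_right_mono) auto
    then show "Gop s f x \<le> C * (\<integral>y. f y \<partial>lborel)" by simp
  qed
qed

text \<open>The case of Jensen's inequality that amounts to nonnegativity of a variance.\<close>

lemma Gop_square: assumes "bm f" shows "(Gop s f x)\<^sup>2 \<le> Gop s (\<lambda>y. (f y)\<^sup>2) x"
proof -
  define m where "m = Gop s f x"
  have f2: "bm (\<lambda>y. (f y)\<^sup>2)" using assms by (simp add: power2_eq_square bm_mult)
  have "0 \<le> Gop s (\<lambda>y. (f y)\<^sup>2 + (-2 * m) * f y + m\<^sup>2 * 1) x"
  proof (rule Gop_nonneg)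
    fix y have "(f y)\<^sup>2 + (-2 * m) * f y + m\<^sup>2 * 1 = (f y - m)\<^sup>2" by (simp add: power2_diff)
    then show "0 \<le> (f y)\<^sup>2 + (-2 * m) * f y + m\<^sup>2 * 1" by simp
  qed
  also have "\<dots> = Gop s (\<lambda>y. (f y)\<^sup>2) x + (-2 * m) * Gop s f x + m\<^sup>2"
    using Gop_lin[OF bm_lin[OF f2 assms, of "-2*m"] bm_const[of 1], of s "m\<^sup>2"] Gop_lin[OF f2 assms, of s "-2*m"] by simp
  finally show ?thesis unfolding m_def by (simp add: power2_eq_square)
qed

end

section \<open>The semigroup killed outside the domain\<close>

context elliptic_domain begin

text \<open>The common features of all approximations of the semigroup killed outside \<open>Q\<close>.\<close>

definition opc :: "real \<Rightarrow> ((real^'d \<Rightarrow> real) \<Rightarrow> real^'d \<Rightarrow> real) \<Rightarrow> bool" where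
  "opc t T \<longleftrightarrow> (\<forall>f. bm f \<longrightarrow> bm (T f)) \<and>
     (\<forall>f g c. bm f \<longrightarrow> bm g \<longrightarrow> T (\<lambda>x. f x + c * g x) = (\<lambda>x. T f x + c * T g x)) \<and>
     (\<forall>f x. bm f \<longrightarrow> (\<forall>y. 0 \<le> f y) \<longrightarrow> 0 \<le> T f x \<and> T f x \<le> Gop t f x) \<and>
     (\<forall>f x. bm f \<longrightarrow> x \<notin> Q \<longrightarrow> T f x = 0) \<and>
     (\<forall>f. bm f \<longrightarrow> T (\<lambda>x. indicator Q x * f x) = T f)"

lemma
  assumes T: "opc t T" and f: "bm f"
  shows opc_bm: "bm (T f)"
    and opc_lin: "bm g \<Longrightarrow> T (\<lambda>x. f x + c * g x) = (\<lambda>x. T f x + c * T g x)"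
    and opc_nonneg: "(\<And>y. 0 \<le> f y) \<Longrightarrow> 0 \<le> T f x"
    and opc_le: "(\<And>y. 0 \<le> f y) \<Longrightarrow> T f x \<le> Gop t f x"
    and opc_off: "x \<notin> Q \<Longrightarrow> T f x = 0"
    and opc_ind: "T (\<lambda>x. indicator Q x * f x) = T f"
proof -
  note * = T[unfolded opc_def]
  show "bm (T f)" using *[THEN conjunct1, THEN spec, THEN mp, OF f] .
  show "T (\<lambda>x. f x + c * g x) = (\<lambda>x. T f x + c * T g x)" if "bm g"
    using *[THEN conjunct2, THEN conjunct1, THEN spec, THEN spec, THEN spec, THEN mp, THEN mp, OF f that] .
  show "0 \<le> T f x" "T f x \<le> Gop t f x" if "\<And>y. 0 \<le> f y"
    using *[THEN conjunct2, THEN conjunct2, THEN conjunct1, THEN spec, THEN spec, THEN mp, THEN mp, OF f allI[OF that], of x] by blast+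
  show "T f x = 0" if "x \<notin> Q"
    using *[THEN conjunct2, THEN conjunct2, THEN conjunct2, THEN conjunct1, THEN spec, THEN spec, THEN mp, THEN mp, OF f that] .
  show "T (\<lambda>x. indicator Q x * f x) = T f"
    using *[THEN conjunct2, THEN conjunct2, THEN conjunct2, THEN conjunct2, THEN spec, THEN mp, OF f] .
qed

lemma opc_diff: "opc t T \<Longrightarrow> bm f \<Longrightarrow> bm g \<Longrightarrow> T (\<lambda>x. f x - g x) x = T f x - T g x"
  using opc_lin[of t T f g "-1"] by simp

lemma opc_0: "opc t T \<Longrightarrow> T (\<lambda>_. 0) x = 0"
  using opc_diff[of t T "\<lambda>_. 0" "\<lambda>_. 0" x] by simp

lemma opc_cmult: "opc t T \<Longrightarrow> bm f \<Longrightarrow> T (\<lambda>x. c * f x) x = c * T f x"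
  using opc_lin[of t T "\<lambda>_. 0" f c] opc_0[of t T x] by simp

lemma opc_mono: "opc t T \<Longrightarrow> bm f \<Longrightarrow> bm g \<Longrightarrow> (\<And>y. f y \<le> g y) \<Longrightarrow> T f x \<le> T g x"
  using opc_nonneg[of t T "\<lambda>y. g y - f y" x] opc_diff[of t T g f x] by (auto intro: bm_diff)

lemma opc_abs: assumes "opc t T" "bm f" shows "\<bar>T f x\<bar> \<le> T (\<lambda>y. \<bar>f y\<bar>) x"
proof -
  have "T f x \<le> T (\<lambda>y. \<bar>f y\<bar>) x" by (rule opc_mono[OF assms(1)]) (use assms in auto)
  moreover have "- T f x \<le> T (\<lambda>y. \<bar>f y\<bar>) x"
    using opc_mono[OF assms(1) bm_cmult[OF assms(2), of "-1"] bm_abs[OF assms(2)], of x] opc_cmult[OF assms, of "-1" x] by simp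
  ultimately show ?thesis by linarith
qed

lemma opc_abs_Gop: assumes "opc t T" "bm f" shows "\<bar>T f x\<bar> \<le> Gop t (\<lambda>y. \<bar>f y\<bar>) x"
  using opc_abs[OF assms, of x] opc_le[OF assms(1) bm_abs[OF assms(2)], of x] by auto

lemma opc_bound: assumes "opc t T" "bm f" "\<And>y. \<bar>f y\<bar> \<le> C" shows "\<bar>T f x\<bar> \<le> C"
proof -
  have "Gop t (\<lambda>y. \<bar>f y\<bar>) x \<le> Gop t (\<lambda>_. C) x" using assms by (intro Gop_mono bm_abs) auto
  then show ?thesis using opc_abs_Gop[OF assms(1,2), of x] by simp
qed

lemma opc_comp:
  assumes T: "opc t T" and U: "opc t U" and t: "0 \<le> t"
  shows "opc (2 * t) (\<lambda>f. T (U f))"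
  unfolding opc_def
proof (intro conjI allI impI)
  fix f :: "real^'d \<Rightarrow> real" and x assume f: "bm f" "\<forall>y. 0 \<le> f y"
  have Uf: "0 \<le> U f y" "U f y \<le> Gop t f y" for y using opc_nonneg[OF U] opc_le[OF U] f by auto
  show "0 \<le> T (U f) x" using Uf by (intro opc_nonneg[OF T] opc_bm[OF U] f)
  have "T (U f) x \<le> Gop t (U f) x" using Uf by (intro opc_le[OF T] opc_bm[OF U] f)
  also have "\<dots> \<le> Gop t (Gop t f) x" using Uf f by (intro Gop_mono opc_bm[OF U] Gop_bm) auto
  also have "\<dots> = Gop (2 * t) f x" using f t by (intro Gop_double)
  finally show "T (U f) x \<le> Gop (2 * t) f x" .
next
  fix f g :: "real^'d \<Rightarrow> real" and c assume fg: "bm f" "bm g"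
  show "T (U (\<lambda>x. f x + c * g x)) = (\<lambda>x. T (U f) x + c * T (U g) x)"
    unfolding opc_lin[OF U fg] by (rule opc_lin[OF T opc_bm[OF U fg(1)] opc_bm[OF U fg(2)]])
next
  fix f :: "real^'d \<Rightarrow> real" assume f: "bm f"
  show "bm (T (U f))" by (intro opc_bm[OF T] opc_bm[OF U] f)
  show "T (U (\<lambda>x. indicator Q x * f x)) = T (U f)" unfolding opc_ind[OF U f] ..
  show "T (U f) x = 0" if "x \<notin> Q" for x by (rule opc_off[OF T opc_bm[OF U f] that])
qed

lemma opc_funpow_bm: "opc t T \<Longrightarrow> bm f \<Longrightarrow> bm ((T ^^ j) f)"
  by (induction j) (simp_all add: opc_bm[of t T])

lemma opc_funpow_bound: "opc t T \<Longrightarrow> bm f \<Longrightarrow> (\<And>y. \<bar>f y\<bar> \<le> C) \<Longrightarrow> \<bar>(T ^^ j) f x\<bar> \<le> C"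
  by (induction j arbitrary: x) (simp_all add: opc_bound[of t T] opc_funpow_bm[of t T])

text \<open>Operators and arguments may converge together, because the change of argument is
  controlled by \<open>Gop t\<close>, a bound independent of \<open>n\<close> to which dominated
  convergence applies.\<close>

lemma opc_seq_limit:
  assumes T: "\<And>n. opc t (T n)" and lim: "\<And>f x. bm f \<Longrightarrow> (\<lambda>n. T n f x) \<longlonglongrightarrow> T' f x"
    and u: "\<And>n. bm (u n)" "\<And>n y. \<bar>u n y\<bar> \<le> C" "bm v" "\<And>y. (\<lambda>n. u n y) \<longlonglongrightarrow> v y"
  shows "(\<lambda>n. T n (u n) x) \<longlonglongrightarrow> T' v x"
proof -
  have [measurable]: "\<And>n. u n \<in> borel_measurable borel" "v \<in> borel_measurable borel" using u by (auto simp: bm_def)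
  have vC: "\<bar>v y\<bar> \<le> C" for y
    using tendsto_rabs[OF u(4)[of y]] by (rule LIMSEQ_le_const2) (use u(2) in auto)
  have d: "bm (\<lambda>y. \<bar>u n y - v y\<bar>)" for n by (intro bm_abs bm_diff u)
  have "(\<lambda>n. Gop t (\<lambda>y. \<bar>u n y - v y\<bar>) x) \<longlonglongrightarrow> (\<integral>z. 0 \<partial>(gauss :: (real^'d) measure))"
    unfolding Gop_def
  proof (rule integral_dominated_convergence[where w="\<lambda>_. 2 * C"])
    show "AE z in gauss. (\<lambda>n. \<bar>u n (x + sqrt t *\<^sub>R b z) - v (x + sqrt t *\<^sub>R b z)\<bar>) \<longlonglongrightarrow> 0"
      using u(4) by (intro AE_I2 tendsto_rabs_zero) (simp add: LIM_zero)
    show "AE z in gauss. norm \<bar>u n (x + sqrt t *\<^sub>R b z) - v (x + sqrt t *\<^sub>R b z)\<bar> \<le> 2 * C" for n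
      using u(2)[of n] vC by (intro AE_I2) (smt (verit) real_norm_def)
  qed auto
  then have g0: "(\<lambda>n. Gop t (\<lambda>y. \<bar>u n y - v y\<bar>) x) \<longlonglongrightarrow> 0" by simp
  have "(\<lambda>n. T n (u n) x - T n v x) \<longlonglongrightarrow> 0"
  proof (rule tendsto_0_le[OF g0, of _ 1], rule always_eventually, rule allI)
    fix n
    have "T n (u n) x - T n v x = T n (\<lambda>y. u n y - v y) x" using opc_diff[OF T u(1) u(3)] by simp
    also have "\<bar>\<dots>\<bar> \<le> Gop t (\<lambda>y. \<bar>u n y - v y\<bar>) x" by (intro opc_abs_Gop[OF T] bm_diff u)
    finally show "norm (T n (u n) x - T n v x) \<le> norm (Gop t (\<lambda>y. \<bar>u n y - v y\<bar>) x) * 1" by simp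
  qed
  from tendsto_add[OF this lim[OF u(3), of x]] show ?thesis by simp
qed

text \<open>Every clause passes to pointwise limits, so the class accompanies both limits that lead
  from killed walks to \<open>P\<close>.\<close>

lemma opc_limit:
  assumes T: "\<And>n::nat. opc t (T n)" and lim: "\<And>f x. bm f \<Longrightarrow> (\<lambda>n. T n f x) \<longlonglongrightarrow> T' f x"
  shows "opc t T'"
  unfolding opc_def
proof (intro conjI allI impI)
  fix f :: "real^'d \<Rightarrow> real" assume f: "bm f"
  obtain C where C: "\<And>x. \<bar>f x\<bar> \<le> C" using bm_bounded[OF f] by metis
  have "T' f \<in> borel_measurable borel"
    by (rule borel_measurable_LIMSEQ_real[OF lim[OF f]]) (use opc_bm[OF T f] in \<open>auto simp: bm_def\<close>)
  moreover have "\<bar>T' f x\<bar> \<le> C" for x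
    using tendsto_rabs[OF lim[OF f, of x]] by (rule LIMSEQ_le_const2) (use opc_bound[OF T f C] in auto)
  ultimately show "bm (T' f)" unfolding bm_def by blast
next
  fix f g :: "real^'d \<Rightarrow> real" and c assume fg: "bm f" "bm g"
  show "T' (\<lambda>x. f x + c * g x) = (\<lambda>x. T' f x + c * T' g x)"
  proof
    fix x
    have "(\<lambda>n. T n f x + c * T n g x) \<longlonglongrightarrow> T' f x + c * T' g x" by (intro tendsto_intros lim fg)
    moreover have "(\<lambda>n. T n (\<lambda>x. f x + c * g x) x) \<longlonglongrightarrow> T' (\<lambda>x. f x + c * g x) x" by (intro lim bm_lin fg)
    ultimately show "T' (\<lambda>x. f x + c * g x) x = T' f x + c * T' g x"
      unfolding opc_lin[OF T fg] using LIMSEQ_unique by blast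
  qed
next
  fix f :: "real^'d \<Rightarrow> real" and x assume f: "bm f" "\<forall>y. 0 \<le> f y"
  show "0 \<le> T' f x" by (rule LIMSEQ_le_const[OF lim[OF f(1)]]) (use opc_nonneg[OF T] f in auto)
  show "T' f x \<le> Gop t f x" by (rule LIMSEQ_le_const2[OF lim[OF f(1)]]) (use opc_le[OF T] f in auto)
next
  fix f :: "real^'d \<Rightarrow> real" and x assume f: "bm f" "x \<notin> Q"
  show "T' f x = 0" using lim[OF f(1), of x] opc_off[OF T f] by (simp add: LIMSEQ_const_iff)
next
  fix f :: "real^'d \<Rightarrow> real" assume f: "bm f"
  show "T' (\<lambda>x. indicator Q x * f x) = T' f"
  proof
    fix x show "T' (\<lambda>x. indicator Q x * f x) x = T' f x"
      using lim[OF bm_indicator_mult[OF Q_measurable f], of x] lim[OF f, of x] unfolding opc_ind[OF T f] using LIMSEQ_unique by blast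
  qed
qed

lemma opc_funpow_limit:
  assumes T: "\<And>n::nat. opc t (T n)" and lim: "\<And>f x. bm f \<Longrightarrow> (\<lambda>n. T n f x) \<longlonglongrightarrow> T' f x" and f: "bm f"
  shows "(\<lambda>n. (T n ^^ j) f x) \<longlonglongrightarrow> (T' ^^ j) f x"
proof (induction j arbitrary: x)
  case (Suc j)
  obtain C where C: "\<And>x. \<bar>f x\<bar> \<le> C" using bm_bounded[OF f] by metis
  show ?case unfolding funpow.simps comp_def
    by (rule opc_seq_limit[OF T lim opc_funpow_bm[OF T f] opc_funpow_bound[OF T f C] opc_funpow_bm[OF opc_limit[OF T lim] f] Suc])
qed simp

definition symm :: "((real^'d \<Rightarrow> real) \<Rightarrow> real^'d \<Rightarrow> real) \<Rightarrow> bool" where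
  "symm T \<longleftrightarrow> (\<forall>f g. bm f \<longrightarrow> bm g \<longrightarrow> (\<integral>x. T f x * g x \<partial>lborel) = (\<integral>x. f x * T g x \<partial>lborel))"

lemma symmD: "symm T \<Longrightarrow> bm f \<Longrightarrow> bm g \<Longrightarrow> (\<integral>x. T f x * g x \<partial>lborel) = (\<integral>x. f x * T g x \<partial>lborel)"
  by (simp add: symm_def)

lemma symm_comp: "opc t T \<Longrightarrow> symm T \<Longrightarrow> symm (\<lambda>f. T (T f))"
  by (simp add: symm_def opc_bm)

text \<open>Off \<open>Q\<close> the integrands vanish, so a constant on the bounded set
  \<open>Q\<close> dominates them.\<close>

lemma symm_limit:
  assumes T: "\<And>n::nat. opc t (T n)" and lim: "\<And>f x. bm f \<Longrightarrow> (\<lambda>n. T n f x) \<longlonglongrightarrow> T' f x"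
    and sym: "\<And>n. symm (T n)"
  shows "symm T'"
  unfolding symm_def
proof (intro allI impI)
  fix f g :: "real^'d \<Rightarrow> real" assume fg: "bm f" "bm g"
  have l: "(\<lambda>n. \<integral>x. T n f x * g x \<partial>lborel) \<longlonglongrightarrow> (\<integral>x. T' f x * g x \<partial>lborel)" if f: "bm f" and g: "bm g" for f g
  proof -
    obtain C where C: "\<And>x. \<bar>f x\<bar> \<le> C" using bm_bounded[OF f] by metis
    obtain D where D: "\<And>x. \<bar>g x\<bar> \<le> D" using bm_bounded[OF g] by metis
    have C0: "0 \<le> C" using C[of undefined] by linarith
    have m: "T n f \<in> borel_measurable lborel" "T' f \<in> borel_measurable lborel" "g \<in> borel_measurable lborel" for n
      using opc_bm[OF T f] opc_bm[OF opc_limit[OF T lim] f] g by (auto simp: bm_def)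
    have "integrable lborel (\<lambda>x. indicator Q x * (C * D))"
      by (rule integrable_bounded_support[OF _ bounded_Q]) (auto intro!: bm_indicator_mult)
    then show ?thesis
    proof (rule integral_dominated_convergence[rotated 2])
      show "AE x in lborel. (\<lambda>n. T n f x * g x) \<longlonglongrightarrow> T' f x * g x" by (intro AE_I2 tendsto_intros lim f)
      show "AE x in lborel. norm (T n f x * g x) \<le> indicator Q x * (C * D)" for n
      proof (rule AE_I2)
        fix x
        show "norm (T n f x * g x) \<le> indicator Q x * (C * D)"
        proof (cases "x \<in> Q")
          case True
          have "\<bar>T n f x\<bar> * \<bar>g x\<bar> \<le> C * D" by (intro mult_mono opc_bound[OF T f C] D C0) auto
          then show ?thesis using True by (simp add: abs_mult)
        qed (simp add: opc_off[OF T f])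
      qed
    qed (use m in auto)
  qed
  have "(\<lambda>n. \<integral>x. T n f x * g x \<partial>lborel) \<longlonglongrightarrow> (\<integral>x. T' g x * f x \<partial>lborel)"
    using l[OF fg(2,1)] symmD[OF sym fg] by (simp add: mult.commute)
  then show "(\<integral>x. T' f x * g x \<partial>lborel) = (\<integral>x. f x * T' g x \<partial>lborel)"
    using LIMSEQ_unique[OF l[OF fg]] by (simp add: mult.commute)
qed

text \<open>Domination by \<open>Gop t\<close> hands the bounded kernel, by way of Jensen's
  inequality, to all operators of the class at once. The constant depends on \<open>t\<close> only
  and so survives all limits.\<close>

lemma opc_L2_bound:
  assumes t: "0 < t"
  obtains C where "0 < C" "\<And>T f x. opc t T \<Longrightarrow> bm f \<Longrightarrow> \<bar>T f x\<bar> \<le> C * sqrt (\<integral>x. indicator Q x * (f x)\<^sup>2 \<partial>lborel)"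
proof -
  obtain C where C: "0 < C" "\<And>f x. bm f \<Longrightarrow> (\<And>y. 0 \<le> f y) \<Longrightarrow> integrable lborel f \<Longrightarrow> Gop t f x \<le> C * (\<integral>y. f y \<partial>lborel)"
    using Gop_L1_bound[OF t] by metis
  show ?thesis
  proof (rule that[of "sqrt C"])
    fix T x and f :: "real^'d \<Rightarrow> real" assume T: "opc t T" and f: "bm f"
    let ?f = "\<lambda>y. indicator Q y * f y"
    have f1: "bm ?f" "bm (\<lambda>y. \<bar>?f y\<bar>)" by (intro bm_abs bm_indicator_mult f Q_measurable)+
    have f2: "bm (\<lambda>y. indicator Q y * (f y)\<^sup>2)"
      unfolding power2_eq_square by (intro bm_mult bm_indicator_mult f Q_measurable)
    have "\<bar>T f x\<bar> = \<bar>T ?f x\<bar>" by (simp add: opc_ind[OF T f])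
    also have "\<dots> \<le> Gop t (\<lambda>y. \<bar>?f y\<bar>) x" by (rule opc_abs_Gop[OF T f1(1)])
    finally have 1: "\<bar>T f x\<bar> \<le> Gop t (\<lambda>y. \<bar>?f y\<bar>) x" .
    have "\<bar>T f x\<bar>\<^sup>2 \<le> (Gop t (\<lambda>y. \<bar>?f y\<bar>) x)\<^sup>2" using 1 by (intro power_mono) auto
    also have "\<dots> \<le> Gop t (\<lambda>y. \<bar>?f y\<bar>\<^sup>2) x" by (rule Gop_square[OF f1(2)])
    also have "(\<lambda>y. \<bar>?f y\<bar>\<^sup>2) = (\<lambda>y. indicator Q y * (f y)\<^sup>2)" by (auto simp: indicator_def)
    also have "Gop t \<dots> x \<le> C * (\<integral>y. indicator Q y * (f y)\<^sup>2 \<partial>lborel)"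
      by (intro C(2) f2 integrable_bounded_support[OF f2 bounded_Q]) auto
    finally have "sqrt (\<bar>T f x\<bar>\<^sup>2) \<le> sqrt (C * (\<integral>y. indicator Q y * (f y)\<^sup>2 \<partial>lborel))"
      by (rule real_sqrt_le_mono)
    then show "\<bar>T f x\<bar> \<le> sqrt C * sqrt (\<integral>x. indicator Q x * (f x)\<^sup>2 \<partial>lborel)" by (simp add: real_sqrt_mult)
  qed (use C in auto)
qed

text \<open>Killing at both ends of the step, not only at its end, keeps the operator
  symmetric.\<close>

definition Sop :: "(real^'d) set \<Rightarrow> real \<Rightarrow> (real^'d \<Rightarrow> real) \<Rightarrow> real^'d \<Rightarrow> real" where
  "Sop K s f x = indicator K x * Gop s (\<lambda>y. indicator K y * f y) x"

lemma Sop_opc: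
  assumes K: "K \<in> sets borel" "K \<subseteq> Q" shows "opc s (Sop K s)"
  unfolding opc_def
proof (intro conjI allI impI)
  fix f :: "real^'d \<Rightarrow> real" assume f: "bm f"
  show "bm (Sop K s f)" unfolding Sop_def[abs_def] by (intro bm_indicator_mult Gop_bm K f)
  have "(\<lambda>y. indicator K y * (indicator Q y * f y)) = (\<lambda>y. indicator K y * f y)"
    using K(2) by (auto simp: fun_eq_iff indicator_def)
  then show "Sop K s (\<lambda>x. indicator Q x * f x) = Sop K s f" by (simp add: Sop_def[abs_def])
next
  fix f g :: "real^'d \<Rightarrow> real" and c assume fg: "bm f" "bm g"
  have "(\<lambda>y. indicator K y * (f y + c * g y)) = (\<lambda>y. indicator K y * f y + c * (indicator K y * g y))"
    by (auto simp: algebra_simps)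
  then have "Gop s (\<lambda>y. indicator K y * (f y + c * g y)) = (\<lambda>x. Gop s (\<lambda>y. indicator K y * f y) x + c * Gop s (\<lambda>y. indicator K y * g y) x)"
    using Gop_lin[OF bm_indicator_mult[OF K(1) fg(1)] bm_indicator_mult[OF K(1) fg(2)], of s c] by simp
  then show "Sop K s (\<lambda>x. f x + c * g x) = (\<lambda>x. Sop K s f x + c * Sop K s g x)"
    unfolding Sop_def[abs_def] by (auto simp: algebra_simps)
next
  fix f :: "real^'d \<Rightarrow> real" and x assume f: "bm f" "\<forall>y. 0 \<le> f y"
  show "0 \<le> Sop K s f x" unfolding Sop_def using f by (intro mult_nonneg_nonneg Gop_nonneg) auto
  have "Gop s (\<lambda>y. indicator K y * f y) x \<le> Gop s f x"
    by (intro Gop_mono bm_indicator_mult K f) (use K f in \<open>auto simp: indicator_def\<close>)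
  moreover have "0 \<le> Gop s f x" using f by (intro Gop_nonneg) auto
  ultimately show "Sop K s f x \<le> Gop s f x" unfolding Sop_def by (auto simp: indicator_def)
next
  fix f :: "real^'d \<Rightarrow> real" and x assume "x \<notin> Q" then show "Sop K s f x = 0" using K by (auto simp: Sop_def indicator_def)
qed

lemma Sop_symm:
  assumes K: "K \<in> sets borel" "K \<subseteq> Q" shows "symm (Sop K s)"
  unfolding symm_def
proof (intro allI impI)
  fix f g :: "real^'d \<Rightarrow> real" assume fg: "bm f" "bm g"
  have "(\<integral>x. Gop s (\<lambda>y. indicator K y * f y) x * (indicator K x * g x) \<partial>lborel) = (\<integral>x. (indicator K x * f x) * Gop s (\<lambda>y. indicator K y * g y) x \<partial>lborel)"
    by (rule Gop_sym[where A=K]) (use fg K bounded_subset[OF bounded_Q] in auto)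
  then show "(\<integral>x. Sop K s f x * g x \<partial>lborel) = (\<integral>x. f x * Sop K s g x \<partial>lborel)"
    unfolding Sop_def by (simp add: mult_ac)
qed

text \<open>Dropping the check at the midpoint can only increase the value.\<close>

lemma Sop_double_le:
  assumes K: "K \<in> sets borel" "K \<subseteq> Q" and s: "0 \<le> s" and f: "bm f" "\<And>y. 0 \<le> f y"
  shows "Sop K s (Sop K s f) x \<le> Sop K (2 * s) f x"
proof -
  let ?f = "\<lambda>y. indicator K y * f y"
  have f': "bm ?f" "\<And>y. 0 \<le> ?f y" using f by (auto intro!: bm_indicator_mult K)
  have "Gop s (\<lambda>y. indicator K y * Sop K s f y) x \<le> Gop s (Gop s ?f) x"
    using f' K Gop_nonneg[of ?f s] by (intro Gop_mono bm_indicator_mult Gop_bm opc_bm[OF Sop_opc] f) (auto simp: Sop_def indicator_def)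
  also have "\<dots> = Gop (2 * s) ?f x" by (rule Gop_double[OF f'(1) s])
  finally show ?thesis unfolding Sop_def[of K _ _ x] by (intro mult_left_mono) auto
qed

lemma Sop_subset_le:
  assumes K: "K \<in> sets borel" "K' \<in> sets borel" "K \<subseteq> K'" and f: "bm f" "\<And>y. 0 \<le> f y"
  shows "Sop K s f x \<le> Sop K' s f x"
proof -
  have "Gop s (\<lambda>y. indicator K y * f y) x \<le> Gop s (\<lambda>y. indicator K' y * f y) x"
    by (intro Gop_mono bm_indicator_mult K f) (use K f in \<open>auto simp: indicator_def\<close>)
  moreover have "0 \<le> Gop s (\<lambda>y. indicator K y * f y) x" using f by (intro Gop_nonneg) auto
  ultimately show ?thesis using K(3) unfolding Sop_def by (auto simp: indicator_def)
qed

text \<open>An exhaustion of \<open>Q\<close>: the sets are compact, and every compact subset of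
  \<open>Q\<close> lies in one of them.\<close>

definition Kc :: "nat \<Rightarrow> (real^'d) set" where
  "Kc m = {x. 1 / (real m + 1) \<le> infdist x (- Q)}"

lemma Q_compl_nonempty: "- Q \<noteq> {}"

proof
  assume "- Q = {}"
  then have "Q = UNIV" by auto
  then show False using bounded_Q not_bounded_UNIV[where 'a="real^'d"] by simp
qed

lemma closed_Kc: "closed (Kc m)"
  unfolding Kc_def by (intro closed_Collect_le continuous_intros)

lemma Kc_measurable [measurable]: "Kc m \<in> sets borel"
  using closed_Kc by simp

lemma Kc_subset: "Kc m \<subseteq> Q"
proof
  fix x assume "x \<in> Kc m"
  then have "0 < infdist x (- Q)" unfolding Kc_def by (simp add: less_le_trans[of 0 "1 / (real m + 1)"])
  then show "x \<in> Q" by (metis ComplI infdist_zero less_irrefl)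
qed

lemma Kc_mono: "m \<le> m' \<Longrightarrow> Kc m \<subseteq> Kc m'"
  unfolding Kc_def by (auto elim!: order_trans[rotated] simp: frac_le)

lemma Kc_eventually:
  assumes "0 < e" obtains m where "{x. e \<le> infdist x (- Q)} \<subseteq> Kc m"
proof -
  obtain m where "1 / (real m + 1) < e" using reals_Archimedean[OF assms] by (auto simp: inverse_eq_divide add.commute)
  then have "{x. e \<le> infdist x (- Q)} \<subseteq> Kc m" by (auto simp: Kc_def)
  then show ?thesis by (rule that)
qed

text \<open>\<open>2 ^ n\<close> steps of length \<open>1 / 2 ^ (n + k)\<close>: refining the grid
  through \<open>n\<close> leaves the total time \<open>1 / 2 ^ k\<close> unchanged.\<close>

definition Ap :: "nat \<Rightarrow> nat \<Rightarrow> nat \<Rightarrow> (real^'d \<Rightarrow> real) \<Rightarrow> real^'d \<Rightarrow> real" where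
  "Ap m n k = Sop (Kc m) (1 / 2 ^ (n + k)) ^^ (2 ^ n)"

lemma Ap_0: "Ap m 0 k = Sop (Kc m) (1 / 2 ^ k)"
  by (simp add: Ap_def)

lemma Ap_Suc: "Ap m (Suc n) k = (\<lambda>f. Ap m n (Suc k) (Ap m n (Suc k) f))"
  unfolding Ap_def power_Suc mult_2 funpow_add by (simp add: comp_def)

lemma Ap_opc: "opc (1 / 2 ^ k) (Ap m n k)"
proof (induction n arbitrary: k)
  case 0 show ?case unfolding Ap_0 by (intro Sop_opc Kc_measurable Kc_subset)
next
  case (Suc n)
  show ?case using opc_comp[OF Suc[of "Suc k"] Suc[of "Suc k"]] unfolding Ap_Suc by simp
qed

lemma Ap_symm: "symm (Ap m n k)"
proof (induction n arbitrary: k)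
  case 0 show ?case unfolding Ap_0 by (intro Sop_symm Kc_measurable Kc_subset)
next
  case (Suc n)
  show ?case unfolding Ap_Suc by (rule symm_comp[OF Ap_opc Suc])
qed

text \<open>A finer grid checks the position more often. The coarsest case is
  \<open>Sop_double_le\<close>, and \<open>Ap_Suc\<close> together with monotonicity propagates
  it.\<close>

lemma Ap_dec: "bm f \<Longrightarrow> (\<And>y. 0 \<le> f y) \<Longrightarrow> Ap m (Suc n) k f x \<le> Ap m n k f x"
proof (induction n arbitrary: k f x)
  case 0
  show ?case using Sop_double_le[OF Kc_measurable Kc_subset, of "1 / 2 ^ Suc k" f m x] 0 unfolding Ap_Suc Ap_0 by simp
next
  case (Suc n)
  have nn: "0 \<le> Ap m j k f y" for j k y by (intro opc_nonneg[OF Ap_opc] Suc)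
  have "Ap m (Suc (Suc n)) k f x \<le> Ap m (Suc n) (Suc k) (Ap m n (Suc k) f) x"
    unfolding Ap_Suc[of m "Suc n"] by (intro opc_mono[OF Ap_opc] opc_bm[OF Ap_opc] Suc)
  also have "\<dots> \<le> Ap m n (Suc k) (Ap m n (Suc k) f) x"
    by (intro Suc.IH opc_bm[OF Ap_opc] Suc.prems nn)
  finally show ?case unfolding Ap_Suc[of m n] .
qed

lemma Ap_inc: "bm f \<Longrightarrow> (\<And>y. 0 \<le> f y) \<Longrightarrow> Ap m n k f x \<le> Ap (Suc m) n k f x"
proof (induction n arbitrary: k f x)
  case 0
  show ?case unfolding Ap_0 using Kc_mono[of m "Suc m"] by (intro Sop_subset_le 0) auto
next
  case (Suc n)
  have nn: "0 \<le> Ap m n k f y" for m k y by (intro opc_nonneg[OF Ap_opc] Suc)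
  have "Ap m (Suc n) k f x \<le> Ap m n (Suc k) (Ap (Suc m) n (Suc k) f) x"
    unfolding Ap_Suc by (intro opc_mono[OF Ap_opc] opc_bm[OF Ap_opc] Suc)
  also have "\<dots> \<le> Ap (Suc m) n (Suc k) (Ap (Suc m) n (Suc k) f) x"
    by (intro Suc.IH opc_bm[OF Ap_opc] Suc.prems nn)
  finally show ?case unfolding Ap_Suc .
qed

text \<open>Monotonicity in the approximation is available for nonnegative arguments; adding a
  constant covers the others.\<close>

lemma convergent_from_nonneg:
  assumes T: "\<And>n::nat. opc t (T n)" and c: "\<And>f. bm f \<Longrightarrow> (\<And>y. 0 \<le> f y) \<Longrightarrow> convergent (\<lambda>n. T n f x)" and f: "bm f"
  shows "convergent (\<lambda>n. T n f x)"
proof -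
  obtain C where C: "0 \<le> C" "\<And>x. \<bar>f x\<bar> \<le> C" using bm_bounded[OF f] by metis
  let ?g = "\<lambda>y. f y + C * 1"
  have g: "bm ?g" "\<And>y. 0 \<le> ?g y" using bm_lin[OF f bm_const[of 1], of C] C(2) by (simp, smt (verit) C(2) abs_le_iff)
  have "convergent (\<lambda>n. T n ?g x - C * T n (\<lambda>_. 1) x)"
    using c[OF g] c[of "\<lambda>_. 1"] by (intro convergent_diff convergent_mult convergent_const) auto
  moreover have "T n ?g x - C * T n (\<lambda>_. 1) x = T n f x" for n
    using opc_lin[OF T f bm_const[of 1], of n C] by simp
  ultimately show ?thesis by simp
qed

lemma Ap_convergent: assumes "bm f" shows "convergent (\<lambda>n. Ap m n k f x)"
proof (rule convergent_from_nonneg[OF Ap_opc _ assms])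
  fix f :: "real^'d \<Rightarrow> real" assume f: "bm f" "\<And>y. 0 \<le> f y"
  have "decseq (\<lambda>n. Ap m n k f x)" by (rule decseq_SucI) (rule Ap_dec[OF f])
  then show "convergent (\<lambda>n. Ap m n k f x)"
    by (rule decseq_convergent[where B=0]) (auto intro!: opc_nonneg[OF Ap_opc] f convergentI)
qed

definition Pm :: "nat \<Rightarrow> nat \<Rightarrow> (real^'d \<Rightarrow> real) \<Rightarrow> real^'d \<Rightarrow> real" where
  "Pm m k f x = lim (\<lambda>n. Ap m n k f x)"

lemma Pm_tendsto: "bm f \<Longrightarrow> (\<lambda>n. Ap m n k f x) \<longlonglongrightarrow> Pm m k f x"
  unfolding Pm_def by (rule convergent_LIMSEQ_iff[THEN iffD1]) (rule Ap_convergent)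

lemma Pm_opc: "opc (1 / 2 ^ k) (Pm m k)"
  by (rule opc_limit[where T="\<lambda>n. Ap m n k"]) (rule Ap_opc, erule Pm_tendsto)

lemma Pm_symm: "symm (Pm m k)"
  by (rule symm_limit[where T="\<lambda>n. Ap m n k"]) (rule Ap_opc, erule Pm_tendsto, rule Ap_symm)

lemma Pm_inc: "bm f \<Longrightarrow> (\<And>y. 0 \<le> f y) \<Longrightarrow> Pm m k f x \<le> Pm (Suc m) k f x"
  by (rule LIMSEQ_le[OF Pm_tendsto[of f m k x] Pm_tendsto[of f "Suc m" k x]]) (auto intro!: Ap_inc)

text \<open>Both sides are limits of \<open>Ap m (n + 1) k\<close>, which \<open>Ap_Suc\<close>
  splits into two operators of half the time on the same grid.\<close>

lemma Pm_semigroup: assumes f: "bm f" shows "Pm m k f x = Pm m (Suc k) (Pm m (Suc k) f) x"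
proof (rule LIMSEQ_unique)
  show "(\<lambda>n. Ap m (Suc n) k f x) \<longlonglongrightarrow> Pm m k f x" by (rule LIMSEQ_Suc[OF Pm_tendsto[OF f, of m k x]])
  obtain C where C: "\<And>x. \<bar>f x\<bar> \<le> C" using bm_bounded[OF f] by metis
  show "(\<lambda>n. Ap m (Suc n) k f x) \<longlonglongrightarrow> Pm m (Suc k) (Pm m (Suc k) f) x"
    unfolding Ap_Suc
    by (rule opc_seq_limit[where T="\<lambda>n. Ap m n (Suc k)" and u="\<lambda>n. Ap m n (Suc k) f" and C=C])
      (rule Ap_opc, erule Pm_tendsto, rule opc_bm[OF Ap_opc f], rule opc_bound[OF Ap_opc f C], rule opc_bm[OF Pm_opc f], rule Pm_tendsto[OF f])
qed

lemma Pm_convergent: assumes "bm f" shows "convergent (\<lambda>m. Pm m k f x)"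
proof (rule convergent_from_nonneg[OF Pm_opc _ assms])
  fix f :: "real^'d \<Rightarrow> real" assume f: "bm f" "\<And>y. 0 \<le> f y"
  have "incseq (\<lambda>m. Pm m k f x)" by (rule incseq_SucI) (rule Pm_inc[OF f])
  then show "convergent (\<lambda>m. Pm m k f x)"
    by (rule incseq_convergent[where B="Gop (1 / 2 ^ k) f x"]) (auto intro!: opc_le[OF Pm_opc] f convergentI)
qed

text \<open>The killed semigroup at time \<open>1 / 2 ^ k\<close>. Exhausting \<open>Q\<close> by compact sets before refining the
  time grid ensures that a path touching the boundary between grid points is killed.\<close>

definition P :: "nat \<Rightarrow> (real^'d \<Rightarrow> real) \<Rightarrow> real^'d \<Rightarrow> real" where
  "P k f x = lim (\<lambda>m. Pm m k f x)"

lemma P_tendsto: "bm f \<Longrightarrow> (\<lambda>m. Pm m k f x) \<longlonglongrightarrow> P k f x"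
  unfolding P_def by (rule convergent_LIMSEQ_iff[THEN iffD1]) (rule Pm_convergent)

lemma P_opc: "opc (1 / 2 ^ k) (P k)"
  by (rule opc_limit[where T="\<lambda>m. Pm m k"]) (rule Pm_opc, erule P_tendsto)

lemma P_symm: "symm (P k)"
  by (rule symm_limit[where T="\<lambda>m. Pm m k"]) (rule Pm_opc, erule P_tendsto, rule Pm_symm)

lemma P_semigroup: assumes f: "bm f" shows "P k f x = P (Suc k) (P (Suc k) f) x"
proof (rule LIMSEQ_unique)
  show "(\<lambda>m. Pm m k f x) \<longlonglongrightarrow> P k f x" using P_tendsto[OF f] .
  obtain C where C: "\<And>x. \<bar>f x\<bar> \<le> C" using bm_bounded[OF f] by metis
  show "(\<lambda>m. Pm m k f x) \<longlonglongrightarrow> P (Suc k) (P (Suc k) f) x"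
    unfolding Pm_semigroup[OF f, of _ k]
    by (rule opc_seq_limit[where T="\<lambda>m. Pm m (Suc k)" and u="\<lambda>m. Pm m (Suc k) f" and C=C])
      (rule Pm_opc, erule P_tendsto, rule opc_bm[OF Pm_opc f], rule opc_bound[OF Pm_opc f C], rule opc_bm[OF P_opc f], rule P_tendsto[OF f])
qed

lemma P_power_tendsto: "bm f \<Longrightarrow> (\<lambda>m. (Pm m k ^^ j) f x) \<longlonglongrightarrow> (P k ^^ j) f x"
  by (rule opc_funpow_limit[where T="\<lambda>m. Pm m k"]) (rule Pm_opc, erule P_tendsto)

lemma Pm_power_tendsto: "bm f \<Longrightarrow> (\<lambda>n. (Ap m n k ^^ j) f x) \<longlonglongrightarrow> (Pm m k ^^ j) f x"
  by (rule opc_funpow_limit[where T="\<lambda>n. Ap m n k"]) (rule Ap_opc, erule Pm_tendsto)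

end

section \<open>Taylor expansion of the transition operators\<close>

text \<open>\<open>pderiv_vec\<close> is built on \<open>deriv\<close>, whose value is meaningful
  only where a derivative exists; total differentiability provides it and assembles the partial
  derivatives into the gradient.\<close>

lemma has_derivative_pderiv_vec:
  fixes u :: "real^'d \<Rightarrow> real"
  assumes "u differentiable at x"
  shows "(u has_derivative (\<lambda>v. \<Sum>j\<in>UNIV. v $ j * pderiv_vec j u x)) (at x)"
proof -
  obtain D where D: "(u has_derivative D) (at x)" using assms unfolding differentiable_def by blast
  have lin: "linear D" using D by (rule has_derivative_linear)
  have pd: "pderiv_vec j u x = D (axis j 1)" for j
  proof -
    have "((\<lambda>t. x + t *\<^sub>R axis j 1) has_derivative (\<lambda>t. t *\<^sub>R axis j 1)) (at (0::real))"
      by (auto intro!: derivative_eq_intros)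
    moreover have "(u has_derivative D) (at (x + 0 *\<^sub>R axis j 1))" using D by simp
    ultimately have "((\<lambda>t. u (x + t *\<^sub>R axis j 1)) has_derivative (\<lambda>t. D (t *\<^sub>R axis j 1))) (at 0)"
      by (rule has_derivative_compose)
    then have "((\<lambda>t. u (x + t *\<^sub>R axis j 1)) has_field_derivative D (axis j 1)) (at 0)"
      unfolding has_field_derivative_def by (simp add: linear_scale[OF lin] mult.commute[of _ "D _"])
    then show ?thesis unfolding pderiv_vec_def by (rule DERIV_imp_deriv)
  qed
  have "D v = (\<Sum>j\<in>UNIV. v $ j * pderiv_vec j u x)" for v
  proof -
    have "D v = D (\<Sum>j\<in>UNIV. v $ j *s axis j 1)" by (simp add: basis_expansion)
    also have "\<dots> = (\<Sum>j\<in>UNIV. v $ j * D (axis j 1))"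
      by (simp add: linear_sum[OF lin] linear_scale[OF lin] scalar_mult_eq_scaleR)
    finally show ?thesis by (simp add: pd)
  qed
  then have "D = (\<lambda>v. \<Sum>j\<in>UNIV. v $ j * pderiv_vec j u x)" by auto
  then show ?thesis using D by simp
qed

lemma pderiv_vec_eqI:
  fixes u :: "real^'d \<Rightarrow> real"
  assumes "(u has_derivative (\<lambda>v. \<Sum>j\<in>UNIV. v $ j * g j)) (at x)"
  shows "pderiv_vec i u x = g i"
proof -
  have "u differentiable at x" using assms unfolding differentiable_def by blast
  then have "(u has_derivative (\<lambda>v. \<Sum>j\<in>UNIV. v $ j * pderiv_vec j u x)) (at x)"
    by (rule has_derivative_pderiv_vec)
  then have "(\<lambda>v. \<Sum>j\<in>UNIV. v $ j * pderiv_vec j u x) = (\<lambda>v. \<Sum>j\<in>UNIV. v $ j * g j)"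
    using assms by (rule has_derivative_unique)
  then have "(\<Sum>j\<in>UNIV. axis i 1 $ j * pderiv_vec j u x) = (\<Sum>j\<in>UNIV. axis i 1 $ j * g j)" by metis
  moreover have "(\<Sum>j\<in>UNIV. axis i 1 $ j * c j) = c i" for c :: "'d \<Rightarrow> real"
    using inner_axis'[of i "1::real" "\<chi> j. c j"] by (simp add: inner_vec_def)
  ultimately show ?thesis by simp
qed

lemma pderiv_vec_cong:
  fixes u w :: "real^'d \<Rightarrow> real"
  assumes "open S" "x \<in> S" "\<And>y. y \<in> S \<Longrightarrow> u y = w y"
  shows "pderiv_vec i u x = pderiv_vec i w x"
proof -
  have "isCont (\<lambda>t::real. x + t *\<^sub>R axis i 1) 0" by (intro continuous_intros)
  then have "eventually (\<lambda>t::real. x + t *\<^sub>R axis i 1 \<in> S) (nhds 0)"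
    using assms(1,2) unfolding isCont_def by (intro topological_tendstoD[where S=S]) (auto simp: filterlim_at tendsto_nhds_iff)
  then have "eventually (\<lambda>t. u (x + t *\<^sub>R axis i 1) = w (x + t *\<^sub>R axis i 1)) (nhds 0)"
    by eventually_elim (rule assms(3))
  then show ?thesis unfolding pderiv_vec_def by (rule deriv_cong_ev) simp
qed

text \<open>Iterated partial derivatives depend on values in a neighbourhood only, so extending a
  solution by zero beyond \<open>Q\<close> does not change them inside.\<close>

lemma C2_on_cong:
  fixes u w :: "real^'d \<Rightarrow> real"
  assumes S: "open S" "\<And>y. y \<in> S \<Longrightarrow> u y = w y" and u: "C2_on S u"
  shows "C2_on S w" "\<And>x. x \<in> S \<Longrightarrow> pderiv_vec i (pderiv_vec j w) x = pderiv_vec i (pderiv_vec j u) x"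
proof -
  have p1: "pderiv_vec j w x = pderiv_vec j u x" if "x \<in> S" for j x
    by (rule pderiv_vec_cong[OF S(1) that]) (simp add: S(2))
  have p2: "pderiv_vec i (pderiv_vec j w) x = pderiv_vec i (pderiv_vec j u) x" if "x \<in> S" for i j x
    by (rule pderiv_vec_cong[OF S(1) that]) (rule p1)
  show "pderiv_vec i (pderiv_vec j w) x = pderiv_vec i (pderiv_vec j u) x" if "x \<in> S" for x using p2[OF that] .
  have d: "v differentiable_on S" if "v' differentiable_on S" "\<And>y. y \<in> S \<Longrightarrow> v y = v' y" for v v' :: "real^'d \<Rightarrow> real"
    unfolding differentiable_on_def
  proof
    fix x assume x: "x \<in> S"
    then have "v' differentiable (at x within S)" using that(1) by (simp add: differentiable_on_def)
    then obtain D where "(v' has_derivative D) (at x within S)" unfolding differentiable_def by blast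
    then have "(v has_derivative D) (at x within S)"
      by (rule has_derivative_transform[OF x that(2), rotated])
    then show "v differentiable (at x within S)" unfolding differentiable_def by blast
  qed
  show "C2_on S w" unfolding C2_on_def
  proof (intro conjI allI)
    show "w differentiable_on S" using u by (rule_tac d[of u]) (auto simp: C2_on_def S(2))
    show "pderiv_vec j w differentiable_on S" for j using u by (rule_tac d[of "pderiv_vec j u"]) (auto simp: C2_on_def p1)
    show "continuous_on S (pderiv_vec i (pderiv_vec j w))" for i j
    proof (rule continuous_on_eq)
      show "continuous_on S (pderiv_vec i (pderiv_vec j u))" using u by (simp add: C2_on_def)
    qed (rule p2[symmetric])
  qed
qed

lemma C2_taylor:
  fixes u :: "real^'d \<Rightarrow> real"
  assumes S: "open S" and u: "C2_on S u" and seg: "\<And>t. 0 \<le> t \<Longrightarrow> t \<le> 1 \<Longrightarrow> x + t *\<^sub>R v \<in> S"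
  obtains t where "0 < t" "t < 1"
    "u (x + v) = u x + (\<Sum>j\<in>UNIV. v $ j * pderiv_vec j u x) +
       (\<Sum>j\<in>UNIV. \<Sum>i\<in>UNIV. v $ j * v $ i * pderiv_vec i (pderiv_vec j u) (x + t *\<^sub>R v)) / 2"
proof -
  define \<phi>1 where "\<phi>1 t = (\<Sum>j\<in>UNIV. v $ j * pderiv_vec j u (x + t *\<^sub>R v))" for t
  define \<phi>2 where "\<phi>2 t = (\<Sum>j\<in>UNIV. \<Sum>i\<in>UNIV. v $ j * v $ i * pderiv_vec i (pderiv_vec j u) (x + t *\<^sub>R v))" for t
  have at: "w differentiable at y" if "w differentiable_on S" "y \<in> S" for w :: "real^'d \<Rightarrow> real" and y
    using that(1)[unfolded differentiable_on_def, rule_format, OF that(2)] unfolding at_within_open[OF that(2) S] .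
  have line: "((\<lambda>t. w (x + t *\<^sub>R v)) has_field_derivative (\<Sum>j\<in>UNIV. v $ j * pderiv_vec j w (x + t *\<^sub>R v))) (at t)"
    if w: "w differentiable_on S" and t: "0 \<le> t" "t \<le> 1" for w :: "real^'d \<Rightarrow> real" and t
  proof -
    have "((\<lambda>t. x + t *\<^sub>R v) has_derivative (\<lambda>t. t *\<^sub>R v)) (at t)" by (auto intro!: derivative_eq_intros)
    moreover have "(w has_derivative (\<lambda>h. \<Sum>j\<in>UNIV. h $ j * pderiv_vec j w (x + t *\<^sub>R v))) (at (x + t *\<^sub>R v))"
      by (intro has_derivative_pderiv_vec at[OF w] seg t)
    ultimately have "((\<lambda>t. w (x + t *\<^sub>R v)) has_derivative (\<lambda>h. \<Sum>j\<in>UNIV. (h *\<^sub>R v) $ j * pderiv_vec j w (x + t *\<^sub>R v))) (at t)"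
      by (rule has_derivative_compose)
    moreover have "(\<lambda>h. \<Sum>j\<in>UNIV. (h *\<^sub>R v) $ j * pderiv_vec j w (x + t *\<^sub>R v)) =
        (*) (\<Sum>j\<in>UNIV. v $ j * pderiv_vec j w (x + t *\<^sub>R v))"
      by (auto simp: fun_eq_iff sum_distrib_left sum_distrib_right mult_ac)
    ultimately show ?thesis unfolding has_field_derivative_def by simp
  qed
  have d0: "((\<lambda>t. u (x + t *\<^sub>R v)) has_field_derivative \<phi>1 t) (at t)" if "0 \<le> t" "t \<le> 1" for t
    unfolding \<phi>1_def by (rule line) (use u that in \<open>auto simp: C2_on_def\<close>)
  have d1: "(\<phi>1 has_field_derivative \<phi>2 t) (at t)" if "0 \<le> t" "t \<le> 1" for t
  proof -
    have "((\<lambda>t. \<Sum>j\<in>UNIV. v $ j * pderiv_vec j u (x + t *\<^sub>R v)) has_field_derivative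
        (\<Sum>j\<in>UNIV. v $ j * (\<Sum>i\<in>UNIV. v $ i * pderiv_vec i (pderiv_vec j u) (x + t *\<^sub>R v)))) (at t)"
      by (intro DERIV_sum DERIV_cmult line) (use u that in \<open>auto simp: C2_on_def\<close>)
    then show ?thesis unfolding \<phi>1_def[abs_def] \<phi>2_def by (simp add: sum_distrib_left mult_ac)
  qed
  define df where "df m = (if m = 0 then (\<lambda>t. u (x + t *\<^sub>R v)) else if m = 1 then \<phi>1 else \<phi>2)" for m :: nat
  have "\<exists>t>0. t < 1 \<and> u (x + 1 *\<^sub>R v) = (\<Sum>m<2. df m 0 / fact m * 1 ^ m) + df 2 t / fact 2 * 1 ^ 2"
    by (rule Maclaurin[where f="\<lambda>t. u (x + t *\<^sub>R v)"]) (use d0 d1 in \<open>auto simp: df_def less_2_cases_iff\<close>)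
  then obtain t where t: "0 < t" "t < 1" "u (x + v) = u x + \<phi>1 0 + \<phi>2 t / 2"
    by (auto simp: df_def numeral_2_eq_2)
  then show ?thesis using that[of t] by (simp add: \<phi>1_def \<phi>2_def)
qed

context elliptic_domain begin

text \<open>The covariance matrix of \<open>b z\<close> for standard Gaussian \<open>z\<close>; in
  the theorem it is \<open>transpose B ** B\<close>.\<close>

definition sg :: "'d \<Rightarrow> 'd \<Rightarrow> real" where
  "sg i j = (\<Sum>k\<in>UNIV. b (axis k 1) $ i * b (axis k 1) $ j)"

definition Lop :: "(real^'d \<Rightarrow> real) \<Rightarrow> real^'d \<Rightarrow> real" where
  "Lop u x = (\<Sum>i\<in>UNIV. \<Sum>j\<in>UNIV. sg i j * pderiv_vec i (pderiv_vec j u) x)"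

lemma b_coord: "b z $ i = (\<Sum>k\<in>UNIV. z $ k * b (axis k 1) $ i)"
proof -
  have "b z = b (\<Sum>k\<in>UNIV. z $ k *s axis k 1)" by (simp add: basis_expansion)
  also have "\<dots> = (\<Sum>k\<in>UNIV. z $ k *\<^sub>R b (axis k 1))"
    by (simp add: linear_sum[OF linear_b] linear_scale[OF linear_b] scalar_mult_eq_scaleR)
  finally show ?thesis by simp
qed

lemma integrable_b_norm_power: "integrable gauss (\<lambda>z. norm (b z) ^ k)"
proof -
  obtain B where B: "\<And>z. norm (b z) \<le> B * norm z" "0 < B"
    using linear_bounded_pos[OF linear_b] by blast
  show ?thesis
  proof (rule Bochner_Integration.integrable_bound)
    show "integrable gauss (\<lambda>z::real^'d. B ^ k * norm z ^ k)" by (intro integrable_mult_right gauss_norm_power_integrable)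
    show "AE z in gauss. norm (norm (b z) ^ k) \<le> norm (B ^ k * norm z ^ k)"
      using B by (intro AE_I2) (simp add: power_mult_distrib[symmetric] power_mono)
  qed simp
qed

lemma integrable_coord: "integrable gauss (\<lambda>z::real^'d. z $ i)"
proof (rule Bochner_Integration.integrable_bound[OF gauss_norm_power_integrable[of 1]])
  show "AE z in gauss. norm ((z::real^'d) $ i) \<le> norm (norm z ^ 1)" by (intro AE_I2) (simp add: component_le_norm_cart)
qed simp

lemma integrable_coord_mult: "integrable gauss (\<lambda>z::real^'d. z $ i * z $ j)"
proof (rule Bochner_Integration.integrable_bound[OF gauss_norm_power_integrable[of 2]])
  show "AE z in gauss. norm ((z::real^'d) $ i * z $ j) \<le> norm (norm z ^ 2)"
    by (intro AE_I2) (simp add: abs_mult power2_eq_square mult_mono component_le_norm_cart)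
qed simp

lemma integral_b_coord: "(\<integral>z. b z $ i \<partial>gauss) = 0"
proof -
  have "(\<lambda>z. b z $ i) = (\<lambda>z. \<Sum>k\<in>UNIV. z $ k * b (axis k 1) $ i)" by (rule ext) (rule b_coord)
  then show ?thesis by (simp add: integrable_coord gauss_integral_coord)
qed

lemma integral_b_coord_mult: "(\<integral>z. b z $ i * b z $ j \<partial>gauss) = sg i j"
proof -
  have "(\<integral>z. b z $ i * b z $ j \<partial>gauss) = (\<integral>z. (\<Sum>k\<in>UNIV. \<Sum>l\<in>UNIV. (b (axis k 1) $ i * b (axis l 1) $ j) * (z $ k * z $ l)) \<partial>gauss)"
  proof (rule Bochner_Integration.integral_cong[OF refl])
    fix z
    have "b z $ i * b z $ j = (\<Sum>k\<in>UNIV. z $ k * b (axis k 1) $ i) * (\<Sum>k\<in>UNIV. z $ k * b (axis k 1) $ j)"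
      by (rule arg_cong2[where f="(*)"]) (rule b_coord)+
    then show "b z $ i * b z $ j = (\<Sum>k\<in>UNIV. \<Sum>l\<in>UNIV. (b (axis k 1) $ i * b (axis l 1) $ j) * (z $ k * z $ l))"
      by (simp add: sum_product mult_ac)
  qed
  also have "\<dots> = (\<Sum>k\<in>UNIV. \<Sum>l\<in>UNIV. (b (axis k 1) $ i * b (axis l 1) $ j) * (\<integral>z. (z::real^'d) $ k * z $ l \<partial>gauss))"
    by (simp add: integrable_coord_mult)
  also have "\<dots> = (\<Sum>k\<in>UNIV. \<Sum>l\<in>UNIV. if k = l then b (axis k 1) $ i * b (axis l 1) $ j else 0)"
    by (intro sum.cong refl) (auto simp: gauss_integral_coord_sq gauss_integral_coord_mult)
  also have "\<dots> = sg i j" by (simp add: sg_def)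
  finally show ?thesis .
qed

lemma integrable_b_coord: "integrable gauss (\<lambda>z. b z $ i)"
proof -
  have "(\<lambda>z. b z $ i) = (\<lambda>z. \<Sum>k\<in>UNIV. z $ k * b (axis k 1) $ i)" by (rule ext) (rule b_coord)
  then show ?thesis by (simp add: integrable_coord)
qed

lemma integrable_b_coord_mult: "integrable gauss (\<lambda>z. b z $ i * b z $ j)"
proof (rule Bochner_Integration.integrable_bound[OF integrable_b_norm_power[of 2]])
  show "AE z in gauss. norm (b z $ i * b z $ j) \<le> norm (norm (b z) ^ 2)"
    by (intro AE_I2) (simp add: abs_mult power2_eq_square mult_mono component_le_norm_cart)
qed (use borel_measurable_integrable[OF integrable_b_coord] in auto)

lemma taylor_remainder_bound:
  fixes u :: "real^'d \<Rightarrow> real"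
  assumes u: "C2_on Q u" "bm u" and K: "compact K" "K \<subseteq> Q" and \<eta>: "0 < \<eta>"
  obtains C where "0 \<le> C"
    "\<And>x v. x \<in> K \<Longrightarrow> \<bar>u (x + v) - u x - (\<Sum>j\<in>UNIV. v $ j * pderiv_vec j u x) -
        (\<Sum>j\<in>UNIV. \<Sum>i\<in>UNIV. v $ j * v $ i * pderiv_vec i (pderiv_vec j u) x) / 2\<bar> \<le> \<eta> * norm v ^ 2 + C * norm v ^ 4"
proof -
  let ?n = "real CARD('d)"
  define H where "H x = (\<chi> i j. pderiv_vec i (pderiv_vec j u) x)" for x
  have Hij: "H x $ i $ j = pderiv_vec i (pderiv_vec j u) x" for x i j by (simp add: H_def)
  have Hc: "continuous_on Q H" unfolding H_def using u by (intro continuous_on_vec_lambda) (auto simp: C2_on_def)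
  have Dc: "continuous_on Q (\<lambda>x. \<chi> j. pderiv_vec j u x)"
    using u by (intro continuous_on_vec_lambda) (auto simp: C2_on_def intro: differentiable_imp_continuous_on)
  obtain \<delta> where \<delta>: "0 < \<delta>" "(\<Union>x\<in>K. cball x \<delta>) \<subseteq> Q"
    using compact_subset_open_imp_cball_epsilon_subset[OF K(1) open_Q K(2)] by blast
  define K' where "K' = {x + y |x y. x \<in> K \<and> y \<in> cball 0 \<delta>}"
  have K': "compact K'" unfolding K'_def by (rule compact_sums[OF K(1) compact_cball])
  have K'Q: "K' \<subseteq> Q"
  proof
    fix z assume "z \<in> K'"
    then obtain x y where z: "z = x + y" "x \<in> K" "norm y \<le> \<delta>" by (auto simp: K'_def)
    then have "z \<in> cball x \<delta>" by (simp add: dist_norm)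
    then show "z \<in> Q" using \<delta>(2) z(2) by blast
  qed
  \<comment> \<open>Chosen so that \<open>?n * ?n * \<eta>' / 2 = \<eta>\<close>: the Hessian has
    \<open>?n * ?n\<close> entries and Taylor's formula brings the factor
    \<open>1 / 2\<close>.\<close>
  define \<eta>' where "\<eta>' = 2 * \<eta> / (?n * ?n)"
  have eta': "0 < \<eta>'" using \<eta> by (simp add: \<eta>'_def)
  have "uniformly_continuous_on K' H"
    by (rule compact_uniformly_continuous[OF continuous_on_subset[OF Hc K'Q] K'])
  then obtain d0 where d0: "0 < d0" "\<And>x y. x \<in> K' \<Longrightarrow> y \<in> K' \<Longrightarrow> dist y x < d0 \<Longrightarrow> dist (H y) (H x) < \<eta>'"
    using eta' unfolding uniformly_continuous_on_def by metis
  define d where "d = min \<delta> (d0 / 2)"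
  have d: "0 < d" "d \<le> \<delta>" "d < d0" using \<delta>(1) d0(1) by (auto simp: d_def)
  obtain M0 where M0: "0 \<le> M0" "\<And>x. \<bar>u x\<bar> \<le> M0" using bm_bounded[OF u(2)] by metis
  have "bounded ((\<lambda>x. \<chi> j. pderiv_vec j u x) ` K)"
    by (intro compact_imp_bounded compact_continuous_image continuous_on_subset[OF Dc K(2)] K(1))
  then obtain M1 where M1: "\<And>x. x \<in> K \<Longrightarrow> norm (\<chi> j. pderiv_vec j u x) \<le> M1" "0 < M1" unfolding bounded_pos by auto
  have "bounded (H ` K)"
    by (intro compact_imp_bounded compact_continuous_image continuous_on_subset[OF Hc K(2)] K(1))
  then obtain M2 where M2: "\<And>x. x \<in> K \<Longrightarrow> norm (H x) \<le> M2" "0 < M2" unfolding bounded_pos by auto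
  have D1: "\<bar>pderiv_vec j u x\<bar> \<le> M1" if "x \<in> K" for x j
    using component_le_norm_cart[of "\<chi> j. pderiv_vec j u x" j] M1(1)[OF that] by simp
  have cH: "\<bar>A $ i $ j\<bar> \<le> norm A" for A :: "real^'d^'d" and i j
    using component_le_norm_cart[of "A $ i" j] Finite_Cartesian_Product.norm_nth_le[of A i] by linarith
  have D2: "\<bar>pderiv_vec i (pderiv_vec j u) x\<bar> \<le> M2" if "x \<in> K" for x i j
    using cH[of "H x" i j] M2(1)[OF that] by (simp add: Hij)
  have quad: "\<bar>\<Sum>j\<in>UNIV. \<Sum>i\<in>UNIV. v $ j * v $ i * A i j\<bar> \<le> ?n * ?n * (norm v ^ 2 * m)"
    if "\<And>i j. \<bar>A i j\<bar> \<le> m" for A :: "'d \<Rightarrow> 'd \<Rightarrow> real" and m and v :: "real^'d"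
  proof -
    have "\<bar>\<Sum>j\<in>UNIV. \<Sum>i\<in>UNIV. v $ j * v $ i * A i j\<bar> \<le> (\<Sum>j\<in>UNIV. \<Sum>i\<in>UNIV. \<bar>v $ j * v $ i * A i j\<bar>)"
      by (intro order_trans[OF sum_abs] sum_mono order_refl)
    also have "\<dots> \<le> (\<Sum>j\<in>(UNIV::'d set). \<Sum>i\<in>(UNIV::'d set). norm v * norm v * m)"
      unfolding abs_mult by (intro sum_mono mult_mono component_le_norm_cart that) auto
    also have "\<dots> = ?n * ?n * (norm v ^ 2 * m)" by (simp add: power2_eq_square)
    finally show ?thesis .
  qed
  \<comment> \<open>The summands belong to the increment of \<open>u\<close>, the gradient term and
    the Hessian term, each compared with the fourth power by means of
    \<open>1 <= norm v / d\<close>.\<close>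
  define C where "C = 2 * M0 / d ^ 4 + ?n * M1 / d ^ 3 + ?n * ?n * M2 / d ^ 2"
  have C0: "0 \<le> C" using M0 M1 M2 d by (simp add: C_def)
  show ?thesis
  proof (rule that[OF C0])
    fix x v assume x: "x \<in> K"
    let ?D = "\<Sum>j\<in>UNIV. v $ j * pderiv_vec j u x"
    let ?H = "\<lambda>y. \<Sum>j\<in>UNIV. \<Sum>i\<in>UNIV. v $ j * v $ i * pderiv_vec i (pderiv_vec j u) y"
    show "\<bar>u (x + v) - u x - ?D - ?H x / 2\<bar> \<le> \<eta> * norm v ^ 2 + C * norm v ^ 4"
    proof (cases "norm v \<le> d")
      case True
      have seg: "x + t *\<^sub>R v \<in> K'" if "0 \<le> t" "t \<le> 1" for t
      proof -
        have "norm (t *\<^sub>R v) \<le> 1 * norm v" using that by (simp add: mult_right_mono mult_left_le_one_le)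
        then have "t *\<^sub>R v \<in> cball 0 \<delta>" using True d(2) by simp
        then show ?thesis using x unfolding K'_def by blast
      qed
      obtain t where t: "0 < t" "t < 1" "u (x + v) = u x + ?D + ?H (x + t *\<^sub>R v) / 2"
        using C2_taylor[OF open_Q u(1), of x v] seg K'Q by blast
      have "u (x + v) - u x - ?D - ?H x / 2 = (\<Sum>j\<in>UNIV. \<Sum>i\<in>UNIV. v $ j * v $ i * (pderiv_vec i (pderiv_vec j u) (x + t *\<^sub>R v) - pderiv_vec i (pderiv_vec j u) x)) / 2"
        unfolding t(3) by (simp add: right_diff_distrib sum_subtractf diff_divide_distrib)
      also have "\<bar>\<dots>\<bar> \<le> ?n * ?n * (norm v ^ 2 * \<eta>') / 2"
      proof -
        have "dist (x + t *\<^sub>R v) x < d0"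
        proof -
          have "norm (t *\<^sub>R v) \<le> 1 * norm v" using t by (simp add: mult_right_mono mult_left_le_one_le)
          then show ?thesis using True d(3) by (simp add: dist_norm)
        qed
        then have "dist (H (x + t *\<^sub>R v)) (H x) < \<eta>'" using d0(2)[OF _ seg[of t]] seg[of 0] t by auto
        then have "norm (H (x + t *\<^sub>R v) - H x) < \<eta>'" by (simp add: dist_norm)
        then have "\<bar>pderiv_vec i (pderiv_vec j u) (x + t *\<^sub>R v) - pderiv_vec i (pderiv_vec j u) x\<bar> \<le> \<eta>'" for i j
          using cH[of "H (x + t *\<^sub>R v) - H x" i j] by (simp add: Hij)
        from quad[OF this, of v] show ?thesis by simp
      qed
      also have "\<dots> = \<eta> * norm v ^ 2" by (simp add: \<eta>'_def)
      also have "\<dots> \<le> \<eta> * norm v ^ 2 + C * norm v ^ 4" using C0 by simp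
      finally show ?thesis .
    next
      case False
      then have v: "d < norm v" by simp
      have q: "1 \<le> norm v / d" using v d(1) by simp
      have p4: "1 \<le> norm v ^ 4 / d ^ 4" using one_le_power[OF q, of 4] by (simp add: power_divide)
      have p3: "norm v \<le> norm v ^ 4 / d ^ 3"
        using mult_left_mono[OF one_le_power[OF q, of 3], of "norm v"] by (simp add: power_divide power_numeral_reduce)
      have p2: "norm v ^ 2 \<le> norm v ^ 4 / d ^ 2"
        using mult_left_mono[OF one_le_power[OF q, of 2], of "norm v ^ 2"] by (simp add: power_divide power_add[symmetric])
      have b1: "\<bar>?D\<bar> \<le> ?n * (norm v * M1)"
      proof -
        have "\<bar>?D\<bar> \<le> (\<Sum>j\<in>UNIV. \<bar>v $ j * pderiv_vec j u x\<bar>)" by (rule sum_abs)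
        also have "\<dots> \<le> (\<Sum>j\<in>(UNIV::'d set). norm v * M1)"
          unfolding abs_mult by (intro sum_mono mult_mono component_le_norm_cart D1 x) auto
        finally show ?thesis by simp
      qed
      have b2: "\<bar>?H x\<bar> \<le> ?n * ?n * (norm v ^ 2 * M2)" by (rule quad) (rule D2[OF x])
      have "\<bar>u (x + v) - u x - ?D - ?H x / 2\<bar> \<le> 2 * M0 + ?n * (norm v * M1) + ?n * ?n * (norm v ^ 2 * M2)"
        using M0(2)[of "x + v"] M0(2)[of x] b1 b2 by linarith
      also have "\<dots> \<le> 2 * M0 * (norm v ^ 4 / d ^ 4) + ?n * M1 * (norm v ^ 4 / d ^ 3) + ?n * ?n * M2 * (norm v ^ 4 / d ^ 2)"
      proof (intro add_mono)
        show "2 * M0 \<le> 2 * M0 * (norm v ^ 4 / d ^ 4)" using mult_left_mono[OF p4, of "2 * M0"] M0 by simp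
        show "?n * (norm v * M1) \<le> ?n * M1 * (norm v ^ 4 / d ^ 3)" using mult_left_mono[OF p3, of "?n * M1"] M1 by (simp add: mult_ac)
        show "?n * ?n * (norm v ^ 2 * M2) \<le> ?n * ?n * M2 * (norm v ^ 4 / d ^ 2)" using mult_left_mono[OF p2, of "?n * ?n * M2"] M2 by (simp add: mult_ac)
      qed
      also have "\<dots> = C * norm v ^ 4" by (simp add: C_def algebra_simps)
      also have "\<dots> \<le> \<eta> * norm v ^ 2 + C * norm v ^ 4" using \<eta> by simp
      finally show ?thesis .
    qed
  qed
qed

text \<open>First moments vanish and second moments produce \<open>s / 2 * Lop u\<close>. The
  generator is thus half of \<open>Lop\<close>, which is why eigenvalues appear halved in all
  exponents.\<close>

lemma Gop_expansion:
  fixes u :: "real^'d \<Rightarrow> real"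
  assumes u: "C2_on Q u" "bm u" and K: "compact K" "K \<subseteq> Q" and e: "0 < e"
  obtains s0 where "0 < s0" "\<And>s x. 0 < s \<Longrightarrow> s \<le> s0 \<Longrightarrow> x \<in> K \<Longrightarrow> \<bar>Gop s u x - u x - s / 2 * Lop u x\<bar> \<le> e * s"
proof -
  define m2 where "m2 = (\<integral>z. norm (b z) ^ 2 \<partial>gauss)"
  define m4 where "m4 = (\<integral>z. norm (b z) ^ 4 \<partial>gauss)"
  have m: "0 \<le> m2" "0 \<le> m4" unfolding m2_def m4_def by (auto intro: integral_nonneg_AE)
  \<comment> \<open>The quadratic part of the remainder is to cost at most \<open>e / 2\<close> per
    unit of \<open>s\<close>; the added 1 avoids a vanishing denominator.\<close>
  define \<eta> where "\<eta> = e / (2 * (m2 + 1))"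
  have \<eta>: "0 < \<eta>" using e m by (simp add: \<eta>_def add_nonneg_pos)
  have \<eta>m: "\<eta> * m2 \<le> e / 2"
  proof -
    have "\<eta> * m2 \<le> \<eta> * (m2 + 1)" using \<eta> by (intro mult_left_mono) auto
    also have "\<dots> = e / 2" using m by (simp add: \<eta>_def field_simps add_nonneg_eq_0_iff)
    finally show ?thesis .
  qed
  obtain C where C: "0 \<le> C"
    "\<And>x v. x \<in> K \<Longrightarrow> \<bar>u (x + v) - u x - (\<Sum>j\<in>UNIV. v $ j * pderiv_vec j u x) -
        (\<Sum>j\<in>UNIV. \<Sum>i\<in>UNIV. v $ j * v $ i * pderiv_vec i (pderiv_vec j u) x) / 2\<bar> \<le> \<eta> * norm v ^ 2 + C * norm v ^ 4"
    using taylor_remainder_bound[OF u K \<eta>] by blast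
  define k where "k = C * m4 + 1"
  \<comment> \<open>The quartic part is of order \<open>s ^ 2\<close>, so for \<open>s <= s0\<close>
    it stays within the other half of \<open>e * s\<close>.\<close>
  define s0 where "s0 = e / (2 * k)"
  have Cm: "0 < k" using C(1) m by (simp add: k_def add_nonneg_pos)
  have s0: "0 < s0" using e Cm by (simp add: s0_def)
  have s0m: "C * m4 * s0 \<le> e / 2"
  proof -
    have "C * m4 * s0 \<le> k * s0" using s0 by (intro mult_right_mono) (auto simp: k_def)
    also have "\<dots> = e / 2" using Cm by (simp add: s0_def)
    finally show ?thesis .
  qed
  show ?thesis
  proof (rule that[OF s0])
    fix s x assume s: "0 < s" "s \<le> s0" and x: "x \<in> K"
    let ?v = "\<lambda>z. sqrt s *\<^sub>R b z"
    let ?A = "\<lambda>i j. pderiv_vec i (pderiv_vec j u) x"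
    define R where "R z = u (x + ?v z) - u x - (\<Sum>j\<in>UNIV. ?v z $ j * pderiv_vec j u x) -
        (\<Sum>j\<in>UNIV. \<Sum>i\<in>UNIV. ?v z $ j * ?v z $ i * ?A i j) / 2" for z
    have R_eq: "R z = u (x + ?v z) - u x - (\<Sum>j\<in>UNIV. (sqrt s * pderiv_vec j u x) * b z $ j) -
        (\<Sum>j\<in>UNIV. \<Sum>i\<in>UNIV. (s / 2 * ?A i j) * (b z $ i * b z $ j))" for z
    proof -
      have "sqrt s * sqrt s = s" using s by simp
      then have e: "?v z $ j * ?v z $ i * ?A i j / 2 = (s / 2 * ?A i j) * (b z $ i * b z $ j)" for i j
        by (simp add: mult_ac)
      show ?thesis unfolding R_def by (simp only: sum_divide_distrib e) (simp add: mult_ac)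
    qed
    have "(\<integral>z. R z \<partial>gauss) = Gop s u x - u x - (\<Sum>j\<in>UNIV. (sqrt s * pderiv_vec j u x) * (\<integral>z. b z $ j \<partial>gauss)) -
        (\<Sum>j\<in>UNIV. \<Sum>i\<in>UNIV. (s / 2 * ?A i j) * (\<integral>z. b z $ i * b z $ j \<partial>gauss))"
      unfolding R_eq Gop_def using integrable_shift[OF u(2), of x s]
      by (simp add: integrable_b_coord integrable_b_coord_mult)
    also have "\<dots> = Gop s u x - u x - s / 2 * Lop u x"
      unfolding integral_b_coord integral_b_coord_mult Lop_def
      by (subst sum.swap) (simp add: sum_distrib_left mult_ac)
    finally have RI: "(\<integral>z. R z \<partial>gauss) = Gop s u x - u x - s / 2 * Lop u x" .
    have vn: "norm (?v z) ^ 2 = s * norm (b z) ^ 2" "norm (?v z) ^ 4 = s\<^sup>2 * norm (b z) ^ 4" for z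
    proof -
      show a: "norm (?v z) ^ 2 = s * norm (b z) ^ 2" using s by (simp add: power_mult_distrib)
      have "norm (?v z) ^ 4 = (norm (?v z) ^ 2)\<^sup>2" by (simp add: power_mult[symmetric])
      also have "\<dots> = s\<^sup>2 * norm (b z) ^ 4" unfolding a by (simp add: power_mult_distrib power_mult[symmetric])
      finally show "norm (?v z) ^ 4 = s\<^sup>2 * norm (b z) ^ 4" .
    qed
    have Rb: "\<bar>R z\<bar> \<le> (\<eta> * s) * norm (b z) ^ 2 + (C * s\<^sup>2) * norm (b z) ^ 4" for z
      using C(2)[OF x, of "?v z"] unfolding R_def vn by (simp add: mult_ac)
    have "\<bar>\<integral>z. R z \<partial>gauss\<bar> \<le> (\<integral>z. \<bar>R z\<bar> \<partial>gauss)" by (rule integral_abs_bound)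
    also have "\<dots> \<le> (\<integral>z. (\<eta> * s) * norm (b z) ^ 2 + (C * s\<^sup>2) * norm (b z) ^ 4 \<partial>gauss)"
    proof (rule integral_mono)
      show "integrable gauss (\<lambda>z. \<bar>R z\<bar>)" unfolding R_eq using integrable_shift[OF u(2), of x s]
        by (intro integrable_abs Bochner_Integration.integrable_diff Bochner_Integration.integrable_sum integrable_mult_right integrable_b_coord integrable_b_coord_mult) auto
    qed (use Rb in \<open>auto intro!: integrable_b_norm_power\<close>)
    also have "\<dots> = (\<eta> * s) * m2 + (C * s\<^sup>2) * m4"
      by (simp add: integrable_b_norm_power m2_def m4_def)
    also have "\<dots> = s * (\<eta> * m2 + C * m4 * s)" by (simp add: algebra_simps power2_eq_square)
    also have "\<dots> \<le> s * (e / 2 + e / 2)"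
    proof (intro mult_left_mono add_mono \<eta>m)
      have "C * m4 * s \<le> C * m4 * s0" using s C(1) m by (intro mult_left_mono) auto
      then show "C * m4 * s \<le> e / 2" using s0m by simp
    qed (use s in auto)
    finally show "\<bar>Gop s u x - u x - s / 2 * Lop u x\<bar> \<le> e * s" unfolding RI by (simp add: mult.commute)
  qed
qed

end

section \<open>Dirichlet eigenfunctions and the killed semigroup\<close>

context elliptic_domain begin

lemma cball_infdist:
  assumes "cball x e \<subseteq> Q" shows "e \<le> infdist x (- Q)"
  unfolding infdist_notempty[OF Q_compl_nonempty]
proof (rule cINF_greatest[OF Q_compl_nonempty])
  fix y assume "y \<in> - Q"
  then have "y \<notin> cball x e" using assms by auto
  then show "e \<le> dist x y" by simp
qed

lemma compact_subset_Kc: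
  assumes "compact C" "C \<subseteq> Q"
  obtains m where "\<And>m'. m \<le> m' \<Longrightarrow> C \<subseteq> Kc m'"
proof -
  obtain e where e: "0 < e" "(\<Union>x\<in>C. cball x e) \<subseteq> Q"
    using compact_subset_open_imp_cball_epsilon_subset[OF assms(1) open_Q assms(2)] by blast
  obtain m where m: "{x. e \<le> infdist x (- Q)} \<subseteq> Kc m" by (rule Kc_eventually[OF e(1)])
  have "C \<subseteq> {x. e \<le> infdist x (- Q)}" using e(2) by (auto intro: cball_infdist)
  then have "C \<subseteq> Kc m'" if "m \<le> m'" for m' using m Kc_mono[OF that] by blast
  then show ?thesis by (rule that)
qed

lemma compact_Kc: "compact (Kc m)"
  using closed_Kc bounded_subset[OF bounded_Q Kc_subset] by (simp add: compact_eq_bounded_closed)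

text \<open>The error \<open>e\<close> is incurred at every step inside \<open>K\<close> and
  accumulates. The boundary error \<open>d\<close> is paid only once, on leaving \<open>K\<close>,
  and is therefore weighted by the exit probability \<open>1 - (Sop K s ^^ j) 1\<close> instead of
  the number of steps.\<close>

lemma Sop_iterate_bound:
  assumes K: "K \<in> sets borel" "K \<subseteq> Q" and w: "bm w" and d: "0 \<le> d" and e: "0 \<le> e"
    and G: "\<And>x. x \<in> K \<Longrightarrow> \<bar>Gop s w x - \<theta> * w x\<bar> \<le> e"
    and off: "\<And>x. x \<notin> K \<Longrightarrow> \<bar>w x\<bar> \<le> d"
    and th: "0 \<le> \<theta>" "\<And>j. j \<le> N \<Longrightarrow> \<theta> ^ j \<le> \<Theta>"
  shows "j \<le> N \<Longrightarrow> x \<in> K \<Longrightarrow> \<bar>(Sop K s ^^ j) w x - \<theta> ^ j * w x\<bar> \<le> \<Theta> * (real j * e + d * (1 - (Sop K s ^^ j) (\<lambda>_. 1) x))"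
proof (induction j arbitrary: x)
  case 0 show ?case by simp
next
  case (Suc j)
  have S: "opc s (Sop K s)" by (rule Sop_opc[OF K])
  have Th: "0 \<le> \<Theta>" "\<theta> ^ j \<le> \<Theta>" using th(2)[of 0] th(2)[of j] Suc.prems by auto
  define A where "A = (Sop K s ^^ j) w"
  define o1 where "o1 = (Sop K s ^^ j) (\<lambda>_. 1)"
  have A: "bm A" and o1: "bm o1" unfolding A_def o1_def by (auto intro!: opc_funpow_bm[OF S] w)
  let ?A = "\<lambda>y. indicator K y * A y" and ?o = "\<lambda>y. indicator K y * o1 y"
  have bA: "bm ?A" and bo: "bm ?o" by (intro bm_indicator_mult K A o1)+
  have A1: "(Sop K s ^^ Suc j) w x = Gop s ?A x" and o2: "(Sop K s ^^ Suc j) (\<lambda>_. 1) x = Gop s ?o x"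
    using Suc.prems by (simp_all add: A_def o1_def Sop_def)
  have bd: "bm (\<lambda>y. ?A y + (- (\<theta> ^ j)) * w y)" by (intro bm_lin bA w)
  have "\<bar>Gop s ?A x - \<theta> ^ j * Gop s w x\<bar> = \<bar>Gop s (\<lambda>y. ?A y + (- (\<theta> ^ j)) * w y) x\<bar>"
    using Gop_lin[OF bA w, of s "- (\<theta> ^ j)"] by simp
  also have "\<dots> \<le> Gop s (\<lambda>y. \<bar>?A y + (- (\<theta> ^ j)) * w y\<bar>) x" by (rule Gop_abs)
  also have "\<dots> \<le> Gop s (\<lambda>y. (\<Theta> * (real j * e + d)) * 1 + (- (\<Theta> * d)) * ?o y) x"
  proof (rule Gop_mono)
    show "bm (\<lambda>y. \<bar>?A y + (- (\<theta> ^ j)) * w y\<bar>)" by (intro bm_abs bd)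
    show "bm (\<lambda>y. (\<Theta> * (real j * e + d)) * 1 + (- (\<Theta> * d)) * ?o y)" by (intro bm_lin bm_cmult bm_const bo)
    fix y show "\<bar>?A y + (- (\<theta> ^ j)) * w y\<bar> \<le> (\<Theta> * (real j * e + d)) * 1 + (- (\<Theta> * d)) * ?o y"
    proof (cases "y \<in> K")
      case True
      have "\<bar>A y - \<theta> ^ j * w y\<bar> \<le> \<Theta> * (real j * e + d * (1 - o1 y))"
        unfolding A_def o1_def using Suc.prems True by (intro Suc.IH) auto
      then show ?thesis using True by (simp add: algebra_simps)
    next
      case False
      have "\<theta> ^ j * \<bar>w y\<bar> \<le> \<Theta> * d" using off[OF False] Th th(1) d by (intro mult_mono) auto
      also have "\<dots> \<le> \<Theta> * (real j * e + d)" using Th e by (intro mult_left_mono) auto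
      finally show ?thesis using False th(1) by (simp add: abs_mult)
    qed
  qed
  also have "\<dots> = \<Theta> * (real j * e + d) - \<Theta> * d * Gop s ?o x"
    using Gop_lin[OF bm_const bo, of s "\<Theta> * (real j * e + d)" "- (\<Theta> * d)"] by simp
  finally have 1: "\<bar>Gop s ?A x - \<theta> ^ j * Gop s w x\<bar> \<le> \<Theta> * (real j * e + d) - \<Theta> * d * Gop s ?o x" .
  have "\<bar>\<theta> ^ j * Gop s w x - \<theta> ^ Suc j * w x\<bar> = \<theta> ^ j * \<bar>Gop s w x - \<theta> * w x\<bar>"
  proof -
    have "\<theta> ^ j * Gop s w x - \<theta> ^ Suc j * w x = \<theta> ^ j * (Gop s w x - \<theta> * w x)" by (simp add: algebra_simps)
    then show ?thesis using th(1) by (simp add: abs_mult)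
  qed
  also have "\<dots> \<le> \<Theta> * e" using G[OF Suc.prems(2)] Th th(1) e by (intro mult_mono) auto
  finally have 2: "\<bar>\<theta> ^ j * Gop s w x - \<theta> ^ Suc j * w x\<bar> \<le> \<Theta> * e" .
  have "\<bar>Gop s ?A x - \<theta> ^ Suc j * w x\<bar> \<le> (\<Theta> * (real j * e + d) - \<Theta> * d * Gop s ?o x) + \<Theta> * e"
    using 1 2 by linarith
  also have "\<dots> = \<Theta> * (real (Suc j) * e + d * (1 - Gop s ?o x))" by (simp add: algebra_simps)
  finally show ?case unfolding A1 o2 .
qed

lemma exp_linear_approx:
  assumes "\<bar>y::real\<bar> \<le> 1" shows "\<bar>exp y - (1 + y)\<bar> \<le> 3 * y\<^sup>2"
proof -
  have "norm (exp y - (\<Sum>i\<le>1. y ^ i / fact i)) \<le> exp (norm y) * (norm y ^ Suc 1) / fact 1"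
    by (rule Taylor_exp_field)
  then have "\<bar>exp y - (1 + y)\<bar> \<le> exp \<bar>y\<bar> * y\<^sup>2" by (simp add: numeral_2_eq_2)
  also have "\<dots> \<le> 3 * y\<^sup>2"
  proof (rule mult_right_mono)
    have "exp \<bar>y\<bar> \<le> exp 1" using assms by simp
    then show "exp \<bar>y\<bar> \<le> 3" using exp_le by linarith
  qed simp
  finally show ?thesis .
qed

text \<open>Overshooting the boundary in one time step does no harm, since \<open>w\<close> is small everywhere
  outside a large compact subset of \<open>Q\<close>.\<close>

lemma P_dirichlet_eigenfunction:
  assumes C2: "C2_on Q w" and w: "bm w" "continuous_on UNIV w" "\<And>x. x \<notin> Q \<Longrightarrow> w x = 0"
    and L: "\<And>x. x \<in> Q \<Longrightarrow> Lop w x = - l * w x"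
  shows "P k w x = exp (- l / 2 / 2 ^ k) * w x"
proof (cases "x \<in> Q")
  case False then show ?thesis using opc_off[OF P_opc w(1)] w(3) by simp
next
  case xQ: True
  define t :: real where "t = 1 / 2 ^ k"
  have t: "0 < t" by (simp add: t_def)
  define \<Theta> where "\<Theta> = exp (\<bar>l\<bar> * t / 2)"
  have Th: "1 \<le> \<Theta>" using t by (simp add: \<Theta>_def)
  obtain M where M: "0 \<le> M" "\<And>x. \<bar>w x\<bar> \<le> M" using bm_bounded[OF w(1)] by metis
  \<comment> \<open>For fixed \<open>m\<close> the step errors disappear as the grid is refined;
    what remains is the size \<open>d\<close> of \<open>w\<close> outside
    \<open>Kc m\<close>.\<close>
  have main: "\<bar>Pm m k w x - exp (- l * t / 2) * w x\<bar> \<le> \<Theta> * d"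
    if d: "0 \<le> d" "\<And>y. y \<notin> Kc m \<Longrightarrow> \<bar>w y\<bar> \<le> d" and x: "x \<in> Kc m" for m d
  proof (rule field_le_epsilon)
    fix e' :: real assume e': "0 < e'"
    define e where "e = e' / (\<Theta> * t)"
    have e: "0 < e" using e' Th t by (simp add: e_def)
    obtain s0 where s0: "0 < s0" "\<And>s x. 0 < s \<Longrightarrow> s \<le> s0 \<Longrightarrow> x \<in> Kc m \<Longrightarrow> \<bar>Gop s w x - w x - s / 2 * Lop w x\<bar> \<le> e / 2 * s"
      using Gop_expansion[OF C2 w(1) compact_Kc Kc_subset, of "e / 2"] e by (metis half_gt_zero)
    define c where "c = 3 * (l / 2)\<^sup>2 * M + 1"
    have c: "0 < c" using M by (simp add: c_def add_nonneg_pos)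
    \<comment> \<open>Three demands: validity of the Taylor estimate, an exponent of modulus at most
      1, and a second-order error of the exponential below \<open>e / 2 * s\<close>.\<close>
    define s1 where "s1 = min s0 (min (1 / (\<bar>l\<bar> + 1)) (e / (2 * c)))"
    have s1: "0 < s1" using s0 e c by (simp add: s1_def)
    have step: "\<bar>Gop s w y - exp (- l * s / 2) * w y\<bar> \<le> e * s" if s: "0 < s" "s \<le> s1" and y: "y \<in> Kc m" for s y
    proof -
      have yQ: "y \<in> Q" using y Kc_subset by auto
      have "\<bar>Gop s w y - w y - s / 2 * Lop w y\<bar> \<le> e / 2 * s" using s y by (intro s0(2)) (auto simp: s1_def)
      then have 1: "\<bar>Gop s w y - (1 + - l * s / 2) * w y\<bar> \<le> e / 2 * s" unfolding L[OF yQ] by (simp add: algebra_simps)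
      have "\<bar>l\<bar> * s \<le> \<bar>l\<bar> * (1 / (\<bar>l\<bar> + 1))" using s by (intro mult_left_mono) (auto simp: s1_def)
      also have "\<dots> \<le> 1" by simp
      finally have "\<bar>- l * s / 2\<bar> \<le> 1" using s by (simp add: abs_mult)
      then have "\<bar>exp (- l * s / 2) - (1 + - l * s / 2)\<bar> \<le> 3 * (- l * s / 2)\<^sup>2" by (rule exp_linear_approx)
      then have "\<bar>exp (- l * s / 2) - (1 + - l * s / 2)\<bar> * \<bar>w y\<bar> \<le> 3 * (- l * s / 2)\<^sup>2 * M"
        using M by (intro mult_mono) auto
      also have "\<dots> = (3 * (l / 2)\<^sup>2 * M) * s * s" by (simp add: power2_eq_square)
      also have "\<dots> \<le> c * s * s" using s by (intro mult_right_mono) (auto simp: c_def)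
      also have "\<dots> \<le> c * s * (e / (2 * c))" using s c by (intro mult_left_mono) (auto simp: s1_def)
      also have "\<dots> = e / 2 * s" using c by simp
      finally have "\<bar>(exp (- l * s / 2) - (1 + - l * s / 2)) * w y\<bar> \<le> e / 2 * s" by (simp add: abs_mult)
      then have 2: "\<bar>exp (- l * s / 2) * w y - (1 + - l * s / 2) * w y\<bar> \<le> e / 2 * s" by (simp add: left_diff_distrib)
      show ?thesis using 1 2 by linarith
    qed
    have "eventually (\<lambda>n. 1 / 2 ^ (n + k) \<le> s1) sequentially"
    proof -
      have "(\<lambda>n. (1 / 2) ^ (n + k)) \<longlonglongrightarrow> (0::real)" by (rule LIMSEQ_ignore_initial_segment) (rule LIMSEQ_realpow_zero, auto)
      then have "eventually (\<lambda>n. (1 / 2) ^ (n + k) < s1) sequentially" using s1 by (rule order_tendstoD)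
      then show ?thesis by (rule eventually_mono) (simp add: power_one_over)
    qed
    then have ev: "eventually (\<lambda>n. \<bar>Ap m n k w x - exp (- l * t / 2) * w x\<bar> \<le> \<Theta> * d + e') sequentially"
    proof (rule eventually_mono)
      fix n assume n: "1 / 2 ^ (n + k) \<le> s1"
      define s :: real where "s = 1 / 2 ^ (n + k)"
      have s: "0 < s" "s \<le> s1" "real (2 ^ n) * s = t" using n by (auto simp: s_def t_def power_add)
      define \<theta> where "\<theta> = exp (- l * s / 2)"
      have thj: "\<theta> ^ j = exp (real j * (- l * s / 2))" for j unfolding \<theta>_def by (rule exp_of_nat_mult[symmetric])
      have bnd: "\<theta> ^ j \<le> \<Theta>" if "j \<le> 2 ^ n" for j
      proof -
        have "real j * s \<le> real (2 ^ n) * s" using that s by (intro mult_right_mono) auto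
        then have js: "real j * s \<le> t" unfolding s(3) .
        have "real j * (- l * s / 2) \<le> \<bar>l\<bar> * (real j * s) / 2"
          using s abs_ge_minus_self[of l] mult_right_mono[of "-l" "\<bar>l\<bar>" "real j * s"] by (simp add: mult_ac)
        also have "\<dots> \<le> \<bar>l\<bar> * t / 2" using js by (intro divide_right_mono mult_left_mono) auto
        finally show ?thesis by (simp add: thj \<Theta>_def)
      qed
      have "\<bar>(Sop (Kc m) s ^^ (2 ^ n)) w x - \<theta> ^ (2 ^ n) * w x\<bar> \<le> \<Theta> * (real (2 ^ n) * (e * s) + d * (1 - (Sop (Kc m) s ^^ (2 ^ n)) (\<lambda>_. 1) x))"
        by (rule Sop_iterate_bound[OF Kc_measurable Kc_subset w(1) d(1), where N="2^n"])
          (use e s step d(2) bnd x in \<open>auto simp: \<theta>_def\<close>)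
      also have "\<dots> \<le> \<Theta> * (t * e + d * 1)"
      proof (intro mult_left_mono add_mono)
        show "real (2 ^ n) * (e * s) \<le> t * e" using s(3) by (simp add: mult_ac)
        have "0 \<le> Ap m n k (\<lambda>_. 1) x" by (rule opc_nonneg[OF Ap_opc]) auto
        then show "1 - (Sop (Kc m) s ^^ (2 ^ n)) (\<lambda>_. 1) x \<le> 1" by (simp add: Ap_def s_def)
      qed (use Th d in auto)
      also have "\<dots> = \<Theta> * d + e'" using Th t by (simp add: e_def field_simps)
      also have "\<theta> ^ (2 ^ n) = exp (- l * t / 2)" unfolding thj s(3)[symmetric] by (simp add: mult_ac)
      finally show "\<bar>Ap m n k w x - exp (- l * t / 2) * w x\<bar> \<le> \<Theta> * d + e'" by (simp add: Ap_def s_def)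
    qed
    have "(\<lambda>n. \<bar>Ap m n k w x - exp (- l * t / 2) * w x\<bar>) \<longlonglongrightarrow> \<bar>Pm m k w x - exp (- l * t / 2) * w x\<bar>"
      by (intro tendsto_intros Pm_tendsto w)
    then show "\<bar>Pm m k w x - exp (- l * t / 2) * w x\<bar> \<le> \<Theta> * d + e'"
      using ev by (rule tendsto_upperbound) simp
  qed
  have "\<bar>P k w x - exp (- l * t / 2) * w x\<bar> \<le> 0 + e'" if e': "0 < e'" for e'
  proof -
    define d where "d = e' / \<Theta>"
    have d: "0 < d" using e' Th by (simp add: d_def)
    \<comment> \<open>The level set is compact and inside \<open>Q\<close>, since \<open>w\<close>
      is continuous and vanishes off \<open>Q\<close>. Together with the point \<open>x\<close> it
      is contained in \<open>Kc m\<close> for all large \<open>m\<close>.\<close>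
    define C where "C = {y. d \<le> \<bar>w y\<bar>}"
    have CQ: "C \<subseteq> Q"
    proof
      fix y assume "y \<in> C" then show "y \<in> Q" using d w(3)[of y] by (cases "y \<in> Q") (auto simp: C_def)
    qed
    have "closed C" unfolding C_def by (intro closed_Collect_le continuous_intros w)
    then have "compact C" using bounded_subset[OF bounded_Q CQ] by (simp add: compact_eq_bounded_closed)
    then have "compact (insert x C)" by simp
    then obtain m0 where m0: "\<And>m. m0 \<le> m \<Longrightarrow> insert x C \<subseteq> Kc m"
      using compact_subset_Kc[of "insert x C"] CQ xQ by auto
    have ev: "\<bar>Pm m k w x - exp (- l * t / 2) * w x\<bar> \<le> e'" if "m0 \<le> m" for m
    proof -
      have "\<bar>Pm m k w x - exp (- l * t / 2) * w x\<bar> \<le> \<Theta> * d"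
      proof (rule main)
        fix y assume "y \<notin> Kc m"
        then have "y \<notin> C" using m0[OF that] by auto
        then show "\<bar>w y\<bar> \<le> d" by (simp add: C_def)
      qed (use d m0[OF that] in auto)
      then show ?thesis using Th by (simp add: d_def)
    qed
    have "(\<lambda>m. \<bar>Pm m k w x - exp (- l * t / 2) * w x\<bar>) \<longlonglongrightarrow> \<bar>P k w x - exp (- l * t / 2) * w x\<bar>"
      by (intro tendsto_intros P_tendsto w)
    then show ?thesis using ev by (intro LIMSEQ_le_const2[where a="0 + e'"]) auto
  qed
  then have "\<bar>P k w x - exp (- l * t / 2) * w x\<bar> \<le> 0" by (rule field_le_epsilon)
  then show ?thesis by (simp add: t_def)
qed

section \<open>Exit estimates at interior points\<close>

lemma Gop_iterate: "bm f \<Longrightarrow> 0 \<le> s \<Longrightarrow> (Gop s ^^ (2 ^ n)) f = Gop (2 ^ n * s) f"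
proof (induction n arbitrary: f)
  case (Suc n)
  have "(Gop s ^^ (2 ^ Suc n)) f = (Gop s ^^ (2 ^ n)) ((Gop s ^^ (2 ^ n)) f)"
    unfolding power_Suc mult_2 funpow_add by simp
  also have "\<dots> = Gop (2 ^ n * s) (Gop (2 ^ n * s) f)"
    using Suc.IH[OF Suc.prems] Suc.IH[OF Gop_bm[OF Suc.prems(1)] Suc.prems(2)] by simp
  also have "\<dots> = Gop (2 ^ Suc n * s) f"
    using Gop_double[OF Suc.prems(1), of "2 ^ n * s"] Suc.prems(2) by (auto simp: fun_eq_iff mult.assoc)
  finally show ?case .
qed simp

lemma nnG_iterate: "f \<in> borel_measurable borel \<Longrightarrow> 0 \<le> s \<Longrightarrow> (nnG s ^^ (2 ^ n)) f = nnG (2 ^ n * s) f"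
proof (induction n arbitrary: f)
  case (Suc n)
  have "(nnG s ^^ (2 ^ Suc n)) f = (nnG s ^^ (2 ^ n)) ((nnG s ^^ (2 ^ n)) f)"
    unfolding power_Suc mult_2 funpow_add by simp
  also have "\<dots> = nnG (2 ^ n * s) (nnG (2 ^ n * s) f)"
    using Suc.IH[OF Suc.prems] Suc.IH[OF nnG_measurable[OF Suc.prems(1)] Suc.prems(2)] by simp
  also have "\<dots> = nnG (2 ^ Suc n * s) f"
    using nnG_double[OF Suc.prems(1), of "2 ^ n * s"] Suc.prems(2) by (auto simp: fun_eq_iff mult.assoc)
  finally show ?case .
qed simp

lemma nnG_reflect:
  assumes [measurable]: "f \<in> borel_measurable borel"
  shows "nnG s f x = (\<integral>\<^sup>+z. f (x - sqrt s *\<^sub>R b z) \<partial>gauss)"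
proof -
  have "(\<integral>\<^sup>+z. f (x + sqrt s *\<^sub>R b (- z)) \<partial>gauss) = (\<integral>\<^sup>+z. f (x + sqrt s *\<^sub>R b z) \<partial>gauss)"
    by (rule nn_integral_gauss_uminus[where f="\<lambda>z. f (x + sqrt s *\<^sub>R b z)"]) measurable
  then show ?thesis by (simp add: nnG_def linear_neg[OF linear_b])
qed

text \<open>The convexity inequality is averaged over \<open>v\<close>; as the Gaussian measure is
  even, the two terms on its right have the same mean.\<close>

lemma nnG_convex:
  fixes W :: "real^'d \<Rightarrow> real"
  assumes [measurable]: "W \<in> borel_measurable borel" and W: "\<And>y. 0 \<le> W y" "\<And>y v. 2 * W y \<le> W (y + v) + W (y - v)"
  shows "ennreal (W y) \<le> nnG s (\<lambda>y. ennreal (W y)) y"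
proof -
  have "2 * ennreal (W y) = (\<integral>\<^sup>+z. ennreal (2 * W y) \<partial>(gauss :: (real^'d) measure))"
    by (simp add: gauss.emeasure_space_1[simplified] ennreal_mult W)
  also have "\<dots> \<le> (\<integral>\<^sup>+z. ennreal (W (y + sqrt s *\<^sub>R b z)) + ennreal (W (y - sqrt s *\<^sub>R b z)) \<partial>gauss)"
    using W by (intro nn_integral_mono) (simp add: ennreal_plus[symmetric] ennreal_leI del: ennreal_plus)
  also have "\<dots> = nnG s (\<lambda>y. ennreal (W y)) y + (\<integral>\<^sup>+z. ennreal (W (y - sqrt s *\<^sub>R b z)) \<partial>gauss)"
    by (subst nn_integral_add) (auto simp: nnG_def)
  also have "(\<integral>\<^sup>+z. ennreal (W (y - sqrt s *\<^sub>R b z)) \<partial>gauss) = nnG s (\<lambda>y. ennreal (W y)) y"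
    by (rule nnG_reflect[symmetric]) measurable
  finally have "2 * ennreal (W y) \<le> 2 * nnG s (\<lambda>y. ennreal (W y)) y" by (simp add: mult_2)
  then show ?thesis by (subst (asm) ennreal_mult_le_mult_iff) auto
qed

text \<open>Displacements over time \<open>s\<close> scale like \<open>sqrt s\<close>, so the sixth
  moment is what produces the factor \<open>s ^ 3\<close> in the exit estimates.\<close>

definition m6 :: real where "m6 = (\<integral>z. norm (b z) ^ 6 \<partial>gauss)"

lemma m6_nonneg: "0 \<le> m6"
  unfolding m6_def by (auto intro: integral_nonneg_AE)

text \<open>After the triangle inequality the sixth power is treated as the cube of a square, both
  being convex on nonnegative numbers.\<close>

lemma midpoint_power_convex:
  fixes p q :: "'a::real_normed_vector"
  shows "2 * norm p ^ 6 \<le> norm (p + q) ^ 6 + norm (p - q) ^ 6"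
proof -
  define u where "u = norm (p + q)"
  define v where "v = norm (p - q)"
  have uv: "0 \<le> u" "0 \<le> v" by (auto simp: u_def v_def)
  have "2 *\<^sub>R p = (p + q) + (p - q)" by (simp add: scaleR_2)
  then have "norm (2 *\<^sub>R p) \<le> u + v" unfolding u_def v_def by (metis norm_triangle_ineq)
  then have "norm p \<le> (u + v) / 2" by simp
  then have "norm p ^ 6 \<le> ((u + v) / 2) ^ 6" by (intro power_mono) auto
  also have "\<dots> \<le> (u ^ 6 + v ^ 6) / 2"
  proof -
    have c: "((x + y) / 2)\<^sup>2 \<le> (x\<^sup>2 + y\<^sup>2) / 2" for x y :: real
      using zero_le_power2[of "x - y"] by (simp add: power2_eq_square field_simps)
    have c3: "((x + y) / 2) ^ 3 \<le> (x ^ 3 + y ^ 3) / 2" if "0 \<le> x" "0 \<le> y" for x y :: real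
    proof -
      have "0 \<le> (x + y) * (x - y)\<^sup>2" using that by simp
      then show ?thesis by (simp add: power2_eq_square power3_eq_cube field_simps)
    qed
    have "((u + v) / 2) ^ 6 = (((u + v) / 2)\<^sup>2) ^ 3" by (simp flip: power_mult)
    also have "\<dots> \<le> ((u\<^sup>2 + v\<^sup>2) / 2) ^ 3" by (intro power_mono c) auto
    also have "\<dots> \<le> ((u\<^sup>2) ^ 3 + (v\<^sup>2) ^ 3) / 2" by (intro c3) auto
    finally show ?thesis by (simp flip: power_mult)
  qed
  finally show ?thesis by (simp add: u_def v_def)
qed

text \<open>An analogue of Doob's maximal inequality. The function \<open>W\<close> is convex, hence
  grows under averaging, and is at least \<open>C\<close> outside \<open>K\<close>. What killing
  removes is therefore at most the mean of \<open>W\<close> at the final time, a bound free of the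
  number of steps.\<close>

lemma Ap_exit:
  assumes x: "ball x \<delta> \<subseteq> Kc m" and \<delta>: "0 < \<delta>" and f: "bm f" "\<And>y. 0 \<le> f y" "\<And>y. f y \<le> C"
  shows "Gop (1 / 2 ^ k) f x - Ap m n k f x \<le> C * m6 * (1 / 2 ^ k) ^ 3 / \<delta> ^ 6"
proof -
  let ?K = "Kc m"
  define s :: real where "s = 1 / 2 ^ (n + k)"
  have s: "0 < s" "2 ^ n * s = 1 / 2 ^ k" by (auto simp: s_def power_add)
  have C0: "0 \<le> C" using f(2)[of x] f(3)[of x] by linarith
  define W where "W y = C / \<delta> ^ 6 * norm (y - x) ^ 6" for y
  have Wm[measurable]: "W \<in> borel_measurable borel" unfolding W_def by measurable
  have W0: "0 \<le> W y" for y using C0 \<delta> by (simp add: W_def)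
  have Wc: "2 * W y \<le> W (y + v) + W (y - v)" for y v
  proof -
    have "2 * norm (y - x) ^ 6 \<le> norm (y - x + v) ^ 6 + norm (y - x - v) ^ 6" by (rule midpoint_power_convex)
    then have "C / \<delta> ^ 6 * (2 * norm (y - x) ^ 6) \<le> C / \<delta> ^ 6 * (norm (y - x + v) ^ 6 + norm (y - x - v) ^ 6)"
      using C0 \<delta> by (intro mult_left_mono) auto
    then show ?thesis by (simp add: W_def algebra_simps)
  qed
  have Wo: "C \<le> W y" if "y \<notin> ?K" for y
  proof -
    have "y \<notin> ball x \<delta>" using that x by auto
    then have "\<delta> \<le> norm (y - x)" by (simp add: dist_norm norm_minus_commute)
    then have "\<delta> ^ 6 \<le> norm (y - x) ^ 6" using \<delta> by (intro power_mono) auto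
    then have "1 \<le> norm (y - x) ^ 6 / \<delta> ^ 6" using \<delta> by simp
    from mult_left_mono[OF this C0] show ?thesis by (simp add: W_def)
  qed
  let ?W = "\<lambda>y. ennreal (W y)"
  have itm[measurable]: "(nnG s ^^ j) ?W \<in> borel_measurable borel" for j
    by (induction j) (auto intro: nnG_measurable)
  have Wj: "?W y \<le> (nnG s ^^ j) ?W y" for j y
  proof (induction j arbitrary: y)
    case (Suc j)
    have "?W y \<le> nnG s ?W y" by (rule nnG_convex[OF Wm W0 Wc])
    also have "\<dots> \<le> nnG s ((nnG s ^^ j) ?W) y" by (rule nnG_mono) (rule Suc)
    finally show ?case by simp
  qed simp
  define g where "g j = (Gop s ^^ j) f" for j
  define h where "h j = (\<lambda>y. indicator ?K y * (Sop ?K s ^^ j) f y)" for j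
  have S: "opc s (Sop ?K s)" by (intro Sop_opc Kc_measurable Kc_subset)
  have bg: "bm (g j)" for j unfolding g_def by (induction j) (auto intro: Gop_bm f)
  have bh: "bm (h j)" for j unfolding h_def by (intro bm_indicator_mult Kc_measurable opc_funpow_bm[OF S] f)
  have g_le: "0 \<le> g j y \<and> g j y \<le> C" for j y
  proof (induction j arbitrary: y)
    case (Suc j)
    have "Gop s (g j) y \<le> Gop s (\<lambda>_. C) y" using Suc by (intro Gop_mono bg) auto
    then show ?case using Suc Gop_nonneg[of "g j" s y] by (simp add: g_def)
  qed (use f in \<open>auto simp: g_def\<close>)
  have h_Suc: "h (Suc j) y = indicator ?K y * Gop s (h j) y" for j y
    by (simp add: h_def Sop_def indicator_def)
  have g_Suc: "g (Suc j) y = Gop s (g j) y" for j y by (simp add: g_def)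
  have gh: "0 \<le> h j y \<and> h j y \<le> g j y" for j y
  proof (induction j arbitrary: y)
    case 0 show ?case using f by (auto simp: h_def g_def indicator_def)
  next
    case (Suc j)
    have "Gop s (h j) y \<le> Gop s (g j) y" using Suc by (intro Gop_mono bg bh) auto
    moreover have "0 \<le> Gop s (h j) y" using Suc by (intro Gop_nonneg) auto
    ultimately show ?case unfolding h_Suc g_Suc by (auto simp: indicator_def)
  qed
  \<comment> \<open>Inside \<open>K\<close> the loss is passed through one more Gaussian step.
    Outside it is at most \<open>C\<close>, hence at most \<open>W y\<close>, and \<open>Wj\<close>
    carries \<open>W\<close> through the remaining steps.\<close>
  have main: "ennreal (g j y - h j y) \<le> (nnG s ^^ j) ?W y" for j y
  proof (induction j arbitrary: y)
    case 0
    have "g 0 y - h 0 y \<le> W y"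
    proof (cases "y \<in> ?K")
      case False then show ?thesis using Wo[of y] f(3)[of y] by (simp add: g_def h_def)
    qed (use W0 in \<open>simp add: g_def h_def\<close>)
    then show ?case by (simp add: ennreal_leI)
  next
    case (Suc j)
    show ?case
    proof (cases "y \<in> ?K")
      case True
      have "g (Suc j) y - h (Suc j) y = Gop s (\<lambda>y. g j y + (-1) * h j y) y"
        using True Gop_lin[OF bg bh, of s j "-1" j] unfolding h_Suc g_Suc by simp
      also have "ennreal \<dots> = nnG s (\<lambda>y. ennreal (g j y + (-1) * h j y)) y"
        using gh by (intro nnG_Gop[symmetric] bm_lin bg bh) auto
      also have "\<dots> \<le> nnG s ((nnG s ^^ j) ?W) y" using Suc by (intro nnG_mono) simp
      finally show ?thesis by simp
    next
      case False
      have "g (Suc j) y - h (Suc j) y \<le> W y" using Wo[OF False] g_le[of "Suc j" y] False by (simp add: h_def)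
      then have "ennreal (g (Suc j) y - h (Suc j) y) \<le> ?W y" by (rule ennreal_leI)
      also have "\<dots> \<le> (nnG s ^^ Suc j) ?W y" by (rule Wj)
      finally show ?thesis .
    qed
  qed
  have "ennreal (g (2 ^ n) x - h (2 ^ n) x) \<le> nnG (1 / 2 ^ k) ?W x"
    using main[of "2 ^ n" x] s by (simp add: nnG_iterate)
  also have "\<dots> = (\<integral>\<^sup>+z. ennreal (C / \<delta> ^ 6 * (1 / 2 ^ k) ^ 3 * norm (b z) ^ 6) \<partial>gauss)"
    unfolding nnG_def
  proof (rule nn_integral_cong)
    fix z
    have "u ^ 6 = (u\<^sup>2) ^ 3" for u :: real by (simp flip: power_mult)
    from this[of "sqrt (1 / 2 ^ k)"] have "sqrt (1 / 2 ^ k) ^ 6 = (1 / 2 ^ k) ^ 3" by simp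
    then show "?W (x + sqrt (1 / 2 ^ k) *\<^sub>R b z) = ennreal (C / \<delta> ^ 6 * (1 / 2 ^ k) ^ 3 * norm (b z) ^ 6)"
      by (simp add: W_def power_mult_distrib mult.assoc)
  qed
  also have "\<dots> = ennreal (\<integral>z. C / \<delta> ^ 6 * (1 / 2 ^ k) ^ 3 * norm (b z) ^ 6 \<partial>gauss)"
    using C0 \<delta> by (intro nn_integral_eq_integral integrable_mult_right integrable_b_norm_power) auto
  also have "(\<integral>z. C / \<delta> ^ 6 * (1 / 2 ^ k) ^ 3 * norm (b z) ^ 6 \<partial>gauss) = C * m6 * (1 / 2 ^ k) ^ 3 / \<delta> ^ 6"
    by (simp add: m6_def)
  finally have "ennreal (g (2 ^ n) x - h (2 ^ n) x) \<le> ennreal (C * m6 * (1 / 2 ^ k) ^ 3 / \<delta> ^ 6)" .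
  moreover have "0 \<le> C * m6 * (1 / 2 ^ k) ^ 3 / \<delta> ^ 6" using C0 m6_nonneg \<delta> by simp
  ultimately have "g (2 ^ n) x - h (2 ^ n) x \<le> C * m6 * (1 / 2 ^ k) ^ 3 / \<delta> ^ 6"
    by (subst (asm) ennreal_le_iff) auto
  moreover have "x \<in> ?K" using x \<delta> by auto
  then have "h (2 ^ n) x = Ap m n k f x" by (simp add: h_def Ap_def s_def)
  moreover have "g (2 ^ n) x = Gop (1 / 2 ^ k) f x" unfolding g_def using Gop_iterate[OF f(1), of s n] s by simp
  ultimately show ?thesis by simp
qed

lemma P_exit_nonneg:
  assumes x: "cball x \<delta> \<subseteq> Q" and \<delta>: "0 < \<delta>" and f: "bm f" "\<And>y. 0 \<le> f y" "\<And>y. f y \<le> C"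
  shows "Gop (1 / 2 ^ k) f x - P k f x \<le> C * m6 * (1 / 2 ^ k) ^ 3 / \<delta> ^ 6"
proof -
  obtain m0 where m0: "\<And>m. m0 \<le> m \<Longrightarrow> cball x \<delta> \<subseteq> Kc m" using compact_subset_Kc[OF compact_cball x] by metis
  have "Gop (1 / 2 ^ k) f x - Pm m k f x \<le> C * m6 * (1 / 2 ^ k) ^ 3 / \<delta> ^ 6" if "m0 \<le> m" for m
  proof (rule LIMSEQ_le_const2)
    show "(\<lambda>n. Gop (1 / 2 ^ k) f x - Ap m n k f x) \<longlonglongrightarrow> Gop (1 / 2 ^ k) f x - Pm m k f x"
      by (intro tendsto_intros Pm_tendsto f)
    have "ball x \<delta> \<subseteq> Kc m" using m0[OF that] by auto
    then show "\<exists>N. \<forall>n\<ge>N. Gop (1 / 2 ^ k) f x - Ap m n k f x \<le> C * m6 * (1 / 2 ^ k) ^ 3 / \<delta> ^ 6"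
      using Ap_exit[OF _ \<delta> f] by blast
  qed
  moreover have "(\<lambda>m. Gop (1 / 2 ^ k) f x - Pm m k f x) \<longlonglongrightarrow> Gop (1 / 2 ^ k) f x - P k f x"
    by (intro tendsto_intros P_tendsto f)
  ultimately show ?thesis by (intro LIMSEQ_le_const2) blast+
qed

text \<open>Adding \<open>C\<close> gives a nonnegative function bounded by \<open>2 * C\<close>.
  The loss of the constant is subtracted and is itself smaller than the bound, so no further factor
  arises.\<close>

lemma P_exit:
  assumes x: "cball x \<delta> \<subseteq> Q" and \<delta>: "0 < \<delta>" and f: "bm f" "\<And>y. \<bar>f y\<bar> \<le> C"
  shows "\<bar>Gop (1 / 2 ^ k) f x - P k f x\<bar> \<le> 2 * C * m6 * (1 / 2 ^ k) ^ 3 / \<delta> ^ 6"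
proof -
  have C0: "0 \<le> C" using f(2)[of x] by linarith
  let ?g = "\<lambda>y. f y + C * 1"
  have g: "bm ?g" by (intro bm_lin f bm_const)
  have g0: "0 \<le> ?g y" "?g y \<le> 2 * C" for y using f(2)[of y] by (auto simp: abs_le_iff)
  have 1: "Gop (1 / 2 ^ k) ?g x - P k ?g x \<le> (2 * C) * m6 * (1 / 2 ^ k) ^ 3 / \<delta> ^ 6"
    by (rule P_exit_nonneg[OF x \<delta> g g0])
  have 2: "P k ?g x \<le> Gop (1 / 2 ^ k) ?g x" by (rule opc_le[OF P_opc g g0(1)])
  have 3: "1 - P k (\<lambda>_. 1) x \<le> 1 * m6 * (1 / 2 ^ k) ^ 3 / \<delta> ^ 6"
    using P_exit_nonneg[OF x \<delta> bm_const[of 1], of 1 k] by simp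
  have 4: "P k (\<lambda>_. 1) x \<le> 1" using opc_le[OF P_opc bm_const[of 1], of k x] by simp
  have eq: "Gop (1 / 2 ^ k) ?g x - P k ?g x = (Gop (1 / 2 ^ k) f x - P k f x) + C * (1 - P k (\<lambda>_. 1) x)"
    using Gop_lin[OF f(1) bm_const[of 1], of "1 / 2 ^ k" C] opc_lin[OF P_opc f(1) bm_const[of 1], of k C]
    by (simp add: algebra_simps)
  have 5: "0 \<le> C * (1 - P k (\<lambda>_. 1) x)" using C0 4 by simp
  have "C * (1 - P k (\<lambda>_. 1) x) \<le> C * (1 * m6 * (1 / 2 ^ k) ^ 3 / \<delta> ^ 6)" using C0 3 by (intro mult_left_mono) auto
  also have "\<dots> \<le> 2 * C * m6 * (1 / 2 ^ k) ^ 3 / \<delta> ^ 6"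
  proof -
    have "0 \<le> C * m6 * (1 / 2 ^ k) ^ 3 / \<delta> ^ 6" using C0 m6_nonneg \<delta> by simp
    moreover have "C * (1 * m6 * (1 / 2 ^ k) ^ 3 / \<delta> ^ 6) = C * m6 * (1 / 2 ^ k) ^ 3 / \<delta> ^ 6" by simp
    moreover have "2 * C * m6 * (1 / 2 ^ k) ^ 3 / \<delta> ^ 6 = 2 * (C * m6 * (1 / 2 ^ k) ^ 3 / \<delta> ^ 6)" by simp
    ultimately show ?thesis by linarith
  qed
  finally have 6: "C * (1 - P k (\<lambda>_. 1) x) \<le> 2 * C * m6 * (1 / 2 ^ k) ^ 3 / \<delta> ^ 6" .
  have "0 \<le> Gop (1 / 2 ^ k) ?g x - P k ?g x" using 2 by simp
  then show ?thesis using 1 5 6 unfolding eq by linarith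
qed

end

section \<open>Interior regularity\<close>

text \<open>Derivatives are going to be found as limits or integrals; uniqueness of derivatives
  identifies such candidates with \<open>pderiv_vec\<close>.\<close>

lemma C2_onI:
  fixes u :: "real^'d \<Rightarrow> real"
  assumes S: "open S"
    and 1: "\<And>x. x \<in> S \<Longrightarrow> (u has_derivative (\<lambda>v. \<Sum>j\<in>UNIV. v $ j * g j x)) (at x)"
    and 2: "\<And>j x. x \<in> S \<Longrightarrow> (g j has_derivative (\<lambda>v. \<Sum>i\<in>UNIV. v $ i * gg i j x)) (at x)"
    and 3: "\<And>i j. continuous_on S (gg i j)"
  shows "C2_on S u"
proof -
  have p1: "pderiv_vec j u x = g j x" if "x \<in> S" for j x by (rule pderiv_vec_eqI) (rule 1[OF that])
  have p2: "pderiv_vec i (pderiv_vec j u) x = gg i j x" if x: "x \<in> S" for i j x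
  proof -
    have "pderiv_vec i (pderiv_vec j u) x = pderiv_vec i (g j) x" by (rule pderiv_vec_cong[OF S x p1])
    also have "\<dots> = gg i j x" by (rule pderiv_vec_eqI) (rule 2[OF x])
    finally show ?thesis .
  qed
  show ?thesis unfolding C2_on_def
  proof (intro conjI allI)
    show "u differentiable_on S" unfolding differentiable_on_def
      using 1 by (auto simp: differentiable_def intro: has_derivative_at_withinI)
    show "pderiv_vec j u differentiable_on S" for j unfolding differentiable_on_def
    proof
      fix x assume x: "x \<in> S"
      have "(g j has_derivative (\<lambda>v. \<Sum>i\<in>UNIV. v $ i * gg i j x)) (at x within S)" by (rule has_derivative_at_withinI[OF 2[OF x]])
      then have "(pderiv_vec j u has_derivative (\<lambda>v. \<Sum>i\<in>UNIV. v $ i * gg i j x)) (at x within S)"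
        by (rule has_derivative_transform[OF x p1, rotated])
      then show "pderiv_vec j u differentiable (at x within S)" unfolding differentiable_def by blast
    qed
    show "continuous_on S (pderiv_vec i (pderiv_vec j u))" for i j
      by (rule continuous_on_eq[OF 3[of i j]]) (rule p2[symmetric])
  qed
qed

lemma geometric_limit:
  fixes f :: "nat \<Rightarrow> real"
  assumes "\<And>k. k0 \<le> k \<Longrightarrow> \<bar>f k - f (Suc k)\<bar> \<le> C / 2 ^ k" and k: "k0 \<le> k"
  shows "f \<longlonglongrightarrow> lim f" "\<bar>f k - lim f\<bar> \<le> 2 * C / 2 ^ k"
proof -
  have C: "0 \<le> C" using assms(1)[of k0] by (smt (verit) divide_less_0_iff order_refl zero_less_power)
  \<comment> \<open>The factor \<open>2 - 2 / 2 ^ j\<close> is the sum of the first \<open>j\<close>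
    terms of the geometric series.\<close>
  have b: "\<bar>f m - f (m + j)\<bar> \<le> C / 2 ^ m * (2 - 2 / 2 ^ j)" if "k0 \<le> m" for m j
  proof (induction j)
    case (Suc j)
    have "\<bar>f (m + j) - f (Suc (m + j))\<bar> \<le> C / 2 ^ (m + j)" using that by (intro assms) auto
    also have "C / 2 ^ (m + j) = C / 2 ^ m * (1 / 2 ^ j)" by (simp add: power_add)
    finally have "\<bar>f m - f (m + Suc j)\<bar> \<le> C / 2 ^ m * (2 - 2 / 2 ^ j) + C / 2 ^ m * (1 / 2 ^ j)" using Suc by simp
    also have "\<dots> = C / 2 ^ m * (2 - 2 / 2 ^ Suc j)" by (simp add: algebra_simps)
    finally show ?case .
  qed simp
  have b2: "\<bar>f m - f n\<bar> \<le> 2 * C / 2 ^ m" if "k0 \<le> m" "m \<le> n" for m n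
  proof -
    have "\<bar>f m - f n\<bar> \<le> C / 2 ^ m * (2 - 2 / 2 ^ (n - m))" using b[OF that(1), of "n - m"] that(2) by simp
    also have "\<dots> \<le> C / 2 ^ m * 2" using C by (intro mult_left_mono) auto
    finally show ?thesis by (simp add: mult.commute)
  qed
  have "Cauchy f"
  proof (rule metric_CauchyI)
    fix e :: real assume e: "0 < e"
    have "(\<lambda>n. 4 * C * (1 / 2) ^ n) \<longlonglongrightarrow> 4 * C * 0" by (intro tendsto_mult_left LIMSEQ_realpow_zero) auto
    then have "eventually (\<lambda>n. 4 * C * (1 / 2) ^ n < e) sequentially" using e by (intro order_tendstoD) auto
    then obtain N where N: "\<And>n. N \<le> n \<Longrightarrow> 4 * C * (1 / 2) ^ n < e" by (auto simp: eventually_sequentially)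
    define m where "m = max N k0"
    have m: "4 * C / 2 ^ m < e" using N[of m] by (simp add: m_def power_one_over)
    have "dist (f p) (f q) < e" if "m \<le> p" "m \<le> q" for p q
    proof -
      have "\<bar>f m - f p\<bar> \<le> 2 * C / 2 ^ m" "\<bar>f m - f q\<bar> \<le> 2 * C / 2 ^ m" using b2 that by (auto simp: m_def)
      moreover have "4 * C / 2 ^ m = 2 * C / 2 ^ m + 2 * C / 2 ^ m" by simp
      ultimately show ?thesis using m unfolding dist_real_def by linarith
    qed
    then show "\<exists>M. \<forall>p\<ge>M. \<forall>q\<ge>M. dist (f p) (f q) < e" by blast
  qed
  then show l: "f \<longlonglongrightarrow> lim f" by (simp add: Cauchy_convergent convergent_LIMSEQ_iff[symmetric])
  have "(\<lambda>n. \<bar>f k - f n\<bar>) \<longlonglongrightarrow> \<bar>f k - lim f\<bar>" by (intro tendsto_intros l)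
  then show "\<bar>f k - lim f\<bar> \<le> 2 * C / 2 ^ k" by (rule LIMSEQ_le_const2) (use b2 k in blast)
qed

text \<open>Dominated convergence is applied to the quotient in the definition of the Frechet
  derivative; the mean value inequality on the unit ball bounds this quotient by
  \<open>2 * CARD('d) * H\<close>.\<close>

lemma has_derivative_integral:
  fixes F :: "real^'d \<Rightarrow> 'z \<Rightarrow> real" and G :: "'d \<Rightarrow> real^'d \<Rightarrow> 'z \<Rightarrow> real"
  assumes d: "\<And>x y. x \<in> ball x0 1 \<Longrightarrow> ((\<lambda>x. F x y) has_derivative (\<lambda>v. \<Sum>j\<in>UNIV. v $ j * G j x y)) (at x)"
    and G: "\<And>j x y. x \<in> ball x0 1 \<Longrightarrow> \<bar>G j x y\<bar> \<le> H y" and H: "integrable M H"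
    and intF: "\<And>x. integrable M (F x)" and mG: "\<And>j. G j x0 \<in> borel_measurable M"
  shows "((\<lambda>x. \<integral>y. F x y \<partial>M) has_derivative (\<lambda>v. \<Sum>j\<in>UNIV. v $ j * (\<integral>y. G j x0 y \<partial>M))) (at x0)"
  unfolding has_derivative_at
proof
  let ?n = "real CARD('d)"
  have x0: "x0 \<in> ball x0 1" by simp
  have intG: "integrable M (G j x0)" for j
    by (rule Bochner_Integration.integrable_bound[OF H mG]) (use G[OF x0] in \<open>auto intro!: AE_I2 order_trans[OF G[OF x0]]\<close>)
  show "bounded_linear (\<lambda>v. \<Sum>j\<in>UNIV. v $ j * (\<integral>y. G j x0 y \<partial>M))"
    by (intro bounded_linear_sum bounded_linear_mult_left[THEN bounded_linear_compose] bounded_linear_vec_nth)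
  have H0: "0 \<le> H y" for y using G[OF x0, of undefined y] by linarith
  define q where "q v y = \<bar>F (x0 + v) y - F x0 y - (\<Sum>j\<in>UNIV. v $ j * G j x0 y)\<bar> / norm v" for v y
  have lip: "\<bar>\<Sum>j\<in>UNIV. v $ j * G j x y\<bar> \<le> (?n * H y) * norm v" if "x \<in> ball x0 1" for v x y
  proof -
    have "\<bar>\<Sum>j\<in>UNIV. v $ j * G j x y\<bar> \<le> (\<Sum>j\<in>UNIV. \<bar>v $ j * G j x y\<bar>)" by (rule sum_abs)
    also have "\<dots> \<le> (\<Sum>j\<in>(UNIV::'d set). norm v * H y)"
      unfolding abs_mult by (intro sum_mono mult_mono component_le_norm_cart G that) auto
    finally show ?thesis by (simp add: mult_ac)
  qed
  have qb: "q v y \<le> 2 * ?n * H y" if v: "norm v < 1" for v y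
  proof (cases "v = 0")
    case True then show ?thesis using H0 by (simp add: q_def)
  next
    case False
    have "norm (F (x0 + v) y - F x0 y) \<le> (?n * H y) * norm ((x0 + v) - x0)"
    proof (rule differentiable_bound[where S="ball x0 1" and f'="\<lambda>x v. \<Sum>j\<in>UNIV. v $ j * G j x y"])
      fix x assume x: "x \<in> ball x0 1"
      show "((\<lambda>x. F x y) has_derivative (\<lambda>v. \<Sum>j\<in>UNIV. v $ j * G j x y)) (at x within ball x0 1)"
        by (rule has_derivative_at_withinI[OF d[OF x]])
      show "onorm (\<lambda>v. \<Sum>j\<in>UNIV. v $ j * G j x y) \<le> ?n * H y"
        using lip[OF x] H0 by (intro onorm_le) auto
    qed (use v in \<open>auto simp: dist_norm\<close>)
    then have "\<bar>F (x0 + v) y - F x0 y - (\<Sum>j\<in>UNIV. v $ j * G j x0 y)\<bar> \<le> 2 * ?n * H y * norm v"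
      using lip[OF x0, of v y] by simp
    then show ?thesis using False by (simp add: q_def divide_le_eq)
  qed
  have mq: "q v \<in> borel_measurable M" for v
    unfolding q_def[abs_def] using borel_measurable_integrable[OF intF] borel_measurable_integrable[OF intG] by measurable
  show "(\<lambda>v. norm ((\<integral>y. F (x0 + v) y \<partial>M) - (\<integral>y. F x0 y \<partial>M) - (\<Sum>j\<in>UNIV. v $ j * (\<integral>y. G j x0 y \<partial>M))) / norm v) \<midarrow>0\<rightarrow> 0"
    unfolding tendsto_at_iff_sequentially
  proof (intro allI impI)
    fix X :: "nat \<Rightarrow> real^'d" assume X: "\<forall>i. X i \<in> UNIV - {0}" "X \<longlonglongrightarrow> 0"
    have "eventually (\<lambda>i. norm (X i) < 1) sequentially" using tendsto_norm[OF X(2)] by (intro order_tendstoD) auto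
    then obtain N where N: "\<And>i. N \<le> i \<Longrightarrow> norm (X i) < 1" by (auto simp: eventually_sequentially)
    have "(\<lambda>i. \<integral>y. q (X (i + N)) y \<partial>M) \<longlonglongrightarrow> (\<integral>y. 0 \<partial>M)"
    proof (rule integral_dominated_convergence[where w="\<lambda>y. 2 * ?n * H y"])
      show "AE y in M. (\<lambda>i. q (X (i + N)) y) \<longlonglongrightarrow> 0"
      proof (rule AE_I2)
        fix y
        have "(\<lambda>v. norm (F (x0 + v) y - F x0 y - (\<Sum>j\<in>UNIV. v $ j * G j x0 y)) / norm v) \<midarrow>0\<rightarrow> 0"
          using d[OF x0, of y] unfolding has_derivative_at by blast
        then have "(\<lambda>i. q (X i) y) \<longlonglongrightarrow> 0"
          using X unfolding tendsto_at_iff_sequentially q_def by (auto simp: comp_def)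
        then show "(\<lambda>i. q (X (i + N)) y) \<longlonglongrightarrow> 0" by (rule LIMSEQ_ignore_initial_segment)
      qed
      show "AE y in M. norm (q (X (i + N)) y) \<le> 2 * ?n * H y" for i
        using qb[OF N[of "i + N"]] by (intro AE_I2) (auto simp: q_def)
    qed (use H mq in auto)
    then have q0: "(\<lambda>i. \<integral>y. q (X i) y \<partial>M) \<longlonglongrightarrow> 0" by (simp add: LIMSEQ_offset)
    show "((\<lambda>v. norm ((\<integral>y. F (x0 + v) y \<partial>M) - (\<integral>y. F x0 y \<partial>M) - (\<Sum>j\<in>UNIV. v $ j * (\<integral>y. G j x0 y \<partial>M))) / norm v) \<circ> X) \<longlonglongrightarrow> 0"
    proof (rule tendsto_0_le[OF q0, of _ 1], rule always_eventually, rule allI)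
      fix i
      have "(\<integral>y. F (x0 + X i) y \<partial>M) - (\<integral>y. F x0 y \<partial>M) - (\<Sum>j\<in>UNIV. X i $ j * (\<integral>y. G j x0 y \<partial>M))
          = (\<integral>y. F (x0 + X i) y - F x0 y - (\<Sum>j\<in>UNIV. X i $ j * G j x0 y) \<partial>M)"
        by (simp add: intF intG)
      also have "\<bar>\<dots>\<bar> \<le> (\<integral>y. \<bar>F (x0 + X i) y - F x0 y - (\<Sum>j\<in>UNIV. X i $ j * G j x0 y)\<bar> \<partial>M)"
        by (rule integral_abs_bound)
      finally show "norm (((\<lambda>v. norm ((\<integral>y. F (x0 + v) y \<partial>M) - (\<integral>y. F x0 y \<partial>M) - (\<Sum>j\<in>UNIV. v $ j * (\<integral>y. G j x0 y \<partial>M))) / norm v) \<circ> X) i)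
          \<le> norm (\<integral>y. q (X i) y \<partial>M) * 1"
        unfolding q_def by (simp add: divide_right_mono)
    qed
  qed
qed

lemma isCont_integral_dominated:
  fixes F :: "real^'d \<Rightarrow> 'z \<Rightarrow> real"
  assumes c: "\<And>y. isCont (\<lambda>x. F x y) x0"
    and F: "\<And>x y. x \<in> ball x0 1 \<Longrightarrow> \<bar>F x y\<bar> \<le> H y" and H: "integrable M H" and m: "\<And>x. F x \<in> borel_measurable M"
  shows "isCont (\<lambda>x. \<integral>y. F x y \<partial>M) x0"
  unfolding continuous_at_sequentially comp_def
proof (intro allI impI)
  fix X :: "nat \<Rightarrow> real^'d" assume X: "X \<longlonglongrightarrow> x0"
  have "eventually (\<lambda>i. X i \<in> ball x0 1) sequentially" by (rule topological_tendstoD[OF X]) auto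
  then obtain N where N: "\<And>i. N \<le> i \<Longrightarrow> X i \<in> ball x0 1" by (auto simp: eventually_sequentially)
  have "(\<lambda>i. \<integral>y. F (X (i + N)) y \<partial>M) \<longlonglongrightarrow> (\<integral>y. F x0 y \<partial>M)"
  proof (rule integral_dominated_convergence[where w=H])
    show "AE y in M. (\<lambda>i. F (X (i + N)) y) \<longlonglongrightarrow> F x0 y"
    proof (rule AE_I2)
      fix y
      have "(\<lambda>i. F (X i) y) \<longlonglongrightarrow> F x0 y" by (rule isCont_tendsto_compose[OF c X])
      then show "(\<lambda>i. F (X (i + N)) y) \<longlonglongrightarrow> F x0 y" by (rule LIMSEQ_ignore_initial_segment)
    qed
    show "AE y in M. norm (F (X (i + N)) y) \<le> H y" for i using F[OF N[of "i + N"]] by (intro AE_I2) auto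
  qed (use H m in auto)
  then show "(\<lambda>i. \<integral>y. F (X i) y \<partial>M) \<longlonglongrightarrow> (\<integral>y. F x0 y \<partial>M)" by (rule LIMSEQ_offset)
qed

context elliptic_domain begin

section \<open>Derivatives of the heat kernel and of the Gaussian operators\<close>

lemma hk_exp: "0 < t \<Longrightarrow> hk t v = kap * (1 / sqrt t) ^ CARD('d) * (1 / sqrt (2 * pi)) ^ CARD('d) * exp (- (norm (a v))\<^sup>2 / (2 * t))"
  unfolding hk_def gauss_density_def linear_scale[OF linear_a] by (simp add: power_divide)

text \<open>Derivatives here and in \<open>hk2\<close> are taken with respect to \<open>x\<close> in
  \<open>hk t (y - x)\<close> and written at \<open>v = y - x\<close>, which determines the
  signs.\<close>

definition hk1 :: "real \<Rightarrow> 'd \<Rightarrow> real^'d \<Rightarrow> real" where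
  "hk1 t j v = (a v \<bullet> a (axis j 1)) / t * hk t v"

definition hk2 :: "real \<Rightarrow> 'd \<Rightarrow> 'd \<Rightarrow> real^'d \<Rightarrow> real" where
  "hk2 t i j v = ((a v \<bullet> a (axis i 1)) * (a v \<bullet> a (axis j 1)) / t\<^sup>2 - (a (axis i 1) \<bullet> a (axis j 1)) / t) * hk t v"

lemma a_inner_sum: "a v \<bullet> w = (\<Sum>j\<in>UNIV. v $ j * (a (axis j 1) \<bullet> w))"
proof -
  have "a v = a (\<Sum>k\<in>UNIV. v $ k *s axis k 1)" by (simp add: basis_expansion)
  also have "\<dots> = (\<Sum>k\<in>UNIV. v $ k *\<^sub>R a (axis k 1))"
    by (simp add: linear_sum[OF linear_a] linear_scale[OF linear_a] scalar_mult_eq_scaleR)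
  finally show ?thesis by (simp add: inner_sum_left)
qed

lemma bounded_linear_a: "bounded_linear a"
  using linear_a by (simp add: linear_conv_bounded_linear)

lemma has_derivative_a [derivative_intros]: "(f has_derivative f') F \<Longrightarrow> ((\<lambda>x. a (f x)) has_derivative (\<lambda>x. a (f' x))) F"
  by (rule bounded_linear.has_derivative[OF bounded_linear_a])

lemma sum_hk1: "(\<Sum>j\<in>UNIV. v $ j * hk1 t j u) = (a u \<bullet> a v) / t * hk t u"
proof -
  have "(\<Sum>j\<in>UNIV. v $ j * hk1 t j u) = (\<Sum>j\<in>UNIV. (v $ j * (a (axis j 1) \<bullet> a u)) * (hk t u / t))"
    unfolding hk1_def by (intro sum.cong) (auto simp: inner_commute)
  also have "\<dots> = (a v \<bullet> a u) * (hk t u / t)" unfolding a_inner_sum[of v] sum_distrib_right ..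
  finally show ?thesis by (simp add: inner_commute)
qed

lemma hk_has_derivative:
  assumes t: "0 < t"
  shows "((\<lambda>x. hk t (y - x)) has_derivative (\<lambda>v. \<Sum>j\<in>UNIV. v $ j * hk1 t j (y - x))) (at x)"
proof -
  have "((\<lambda>x. hk t (y - x)) has_derivative (\<lambda>v. (a (y - x) \<bullet> a v) / t * hk t (y - x))) (at x)"
    unfolding hk_exp[OF t] power2_norm_eq_inner
    by (rule derivative_eq_intros refl | use t in \<open>simp add: inner_commute linear_neg[OF linear_a] field_simps\<close>)+
  then show ?thesis by (simp add: sum_hk1)
qed

lemma hk1_has_derivative:
  assumes t: "0 < t"
  shows "((\<lambda>x. hk1 t j (y - x)) has_derivative (\<lambda>v. \<Sum>i\<in>UNIV. v $ i * hk2 t i j (y - x))) (at x)"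
proof -
  let ?e = "a (axis j 1)" and ?w = "a (y - x)"
  have 0: "((\<lambda>x. hk t (y - x)) has_derivative (\<lambda>v. (?w \<bullet> a v) / t * hk t (y - x))) (at x)"
    using hk_has_derivative[OF t, of y x] by (simp add: sum_hk1)
  have "((\<lambda>x. a (y - x) \<bullet> ?e / t) has_derivative (\<lambda>v. - (a v \<bullet> ?e) / t)) (at x)"
    using bounded_linear.has_derivative[OF bounded_linear_divide[of t] bounded_linear.has_derivative[OF bounded_linear_inner_left[of ?e]
      has_derivative_a[OF has_derivative_diff[OF has_derivative_const[of y] has_derivative_ident]]]]
    by (simp add: linear_neg[OF linear_a])
  from has_derivative_mult[OF this 0]
  have D1: "((\<lambda>x. hk1 t j (y - x)) has_derivative (\<lambda>v. (?w \<bullet> ?e / t) * ((?w \<bullet> a v) / t * hk t (y - x)) + (- (a v \<bullet> ?e) / t) * hk t (y - x))) (at x)"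
    unfolding hk1_def .
  have "(?w \<bullet> ?e / t) * ((?w \<bullet> a v) / t * hk t (y - x)) + (- (a v \<bullet> ?e) / t) * hk t (y - x) = (\<Sum>i\<in>UNIV. v $ i * hk2 t i j (y - x))" for v
  proof -
    have 1: "(\<Sum>i\<in>UNIV. v $ i * (?w \<bullet> a (axis i 1))) = ?w \<bullet> a v"
      unfolding inner_commute[of ?w] by (rule a_inner_sum[symmetric])
    have "(\<Sum>i\<in>UNIV. v $ i * hk2 t i j (y - x)) =
       (\<Sum>i\<in>UNIV. (v $ i * (?w \<bullet> a (axis i 1))) * ((?w \<bullet> ?e) / t\<^sup>2 * hk t (y - x)) - (v $ i * (a (axis i 1) \<bullet> ?e)) * (hk t (y - x) / t))"
      unfolding hk2_def by (intro sum.cong) (simp_all add: left_diff_distrib right_diff_distrib)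
    also have "\<dots> = (?w \<bullet> a v) * ((?w \<bullet> ?e) / t\<^sup>2 * hk t (y - x)) - (a v \<bullet> ?e) * (hk t (y - x) / t)"
      unfolding sum_subtractf sum_distrib_right[symmetric] 1 a_inner_sum[of v ?e, symmetric] ..
    finally have E: "(\<Sum>i\<in>UNIV. v $ i * hk2 t i j (y - x)) = (?w \<bullet> a v) * ((?w \<bullet> ?e) / t\<^sup>2 * hk t (y - x)) - (a v \<bullet> ?e) * (hk t (y - x) / t)" .
    have "(p / t) * (q / t * h) + (- r / t) * h = q * (p / t\<^sup>2 * h) - r * (h / t)" for p q r h :: real
      by (simp add: power2_eq_square)
    then show ?thesis unfolding E .
  qed
  then have e: "(\<lambda>v. (?w \<bullet> ?e / t) * ((?w \<bullet> a v) / t * hk t (y - x)) + (- (a v \<bullet> ?e) / t) * hk t (y - x)) = (\<lambda>v. \<Sum>i\<in>UNIV. v $ i * hk2 t i j (y - x))"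
    by (rule ext)
  show ?thesis unfolding e[symmetric] by (rule D1)
qed

lemma hk2_continuous: "0 < t \<Longrightarrow> isCont (\<lambda>x. hk2 t i j (y - x)) x"
  unfolding hk2_def
  by (intro continuous_intros has_derivative_continuous[OF hk_has_derivative]
      linear_continuous_at[OF bounded_linear_a, THEN isCont_o2[rotated]]) auto

lemma hk_measurables [measurable]:
  "hk1 t j \<in> borel_measurable borel" "hk2 t i j \<in> borel_measurable borel"
  unfolding hk1_def[abs_def] hk2_def[abs_def] by measurable

text \<open>With \<open>q = norm (a v) ^ 2 / t\<close>, the polynomial factors brought down by
  differentiation are absorbed by half of the Gaussian exponent \<open>- q / 2\<close>.\<close>

lemma Gauss_poly_bound:
  fixes q :: real
  assumes "0 \<le> q" shows "q * exp (- q / 4) \<le> 4" "sqrt q * exp (- q / 4) \<le> 5"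
proof -
  have 1: "q / 4 \<le> exp (q / 4)" using exp_ge_add_one_self[of "q / 4"] by linarith
  then have "q \<le> 4 * exp (q / 4)" by simp
  then have "q * exp (- q / 4) \<le> 4 * exp (q / 4) * exp (- q / 4)" by (intro mult_right_mono) auto
  also have "\<dots> = 4" by (simp add: mult.assoc mult_exp_exp)
  finally show *: "q * exp (- q / 4) \<le> 4" .
  have "sqrt q \<le> 1 + q"
  proof (rule real_le_lsqrt)
    show "q \<le> (1 + q)\<^sup>2" using assms by (simp add: power2_eq_square algebra_simps)
  qed (use assms in auto)
  then have "sqrt q * exp (- q / 4) \<le> (1 + q) * exp (- q / 4)" by (intro mult_right_mono) auto
  also have "\<dots> = exp (- q / 4) + q * exp (- q / 4)" by (simp add: algebra_simps)
  also have "\<dots> \<le> 1 + 4" using * assms by (intro add_mono) auto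
  finally show "sqrt q * exp (- q / 4) \<le> 5" by simp
qed

text \<open>The half of the exponent that is not spent on polynomial factors is again Gaussian, at
  twice the time.\<close>

lemma hk_double:
  assumes t: "0 < t"
  shows "hk t v = sqrt 2 ^ CARD('d) * exp (- (norm (a v))\<^sup>2 / t / 4) * hk (2 * t) v"
proof -
  have "(1 / sqrt t) ^ CARD('d) = sqrt 2 ^ CARD('d) * (1 / sqrt (2 * t)) ^ CARD('d)"
    using t by (simp add: real_sqrt_mult power_divide power_mult_distrib)
  moreover have "exp (- (norm (a v))\<^sup>2 / (2 * t)) = exp (- (norm (a v))\<^sup>2 / t / 4) * exp (- (norm (a v))\<^sup>2 / (2 * (2 * t)))"
    unfolding mult_exp_exp using t by (simp add: field_simps)
  ultimately show ?thesis using t by (simp add: hk_exp)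
qed

text \<open>Both orders of derivative receive the same factor \<open>1 / t ^ 2\<close>, cruder than
  their natural scaling for small \<open>t\<close>; the exit estimate of order \<open>t ^ 3\<close>
  leaves room for it.\<close>

lemma hk_derivative_bounds:
  obtains C where "0 < C"
    "\<And>t v j. 0 < t \<Longrightarrow> t \<le> 1 \<Longrightarrow> \<bar>hk1 t j v\<bar> \<le> C / t\<^sup>2 * hk (2 * t) v"
    "\<And>t v i j. 0 < t \<Longrightarrow> t \<le> 1 \<Longrightarrow> \<bar>hk2 t i j v\<bar> \<le> C / t\<^sup>2 * hk (2 * t) v"
proof -
  obtain A where A: "0 < A" "\<And>v. norm (a v) \<le> A * norm v" using linear_bounded_pos[OF linear_a] by blast
  have e: "norm (a (axis j 1)) \<le> A" for j using A(2)[of "axis j 1"] by simp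
  define S where "S = sqrt 2 ^ CARD('d)"
  have S: "0 < S" by (simp add: S_def)
  define C where "C = S * (5 * A + 5 * A\<^sup>2)"
  have C: "0 < C" using S A(1) by (simp add: C_def add_pos_pos)
  have nn: "0 \<le> hk (2 * t) v" if "0 < t" for t v using that by simp
  show ?thesis
  proof (rule that[OF C])
    fix t :: real and v j assume t: "0 < t" "t \<le> 1"
    define q where "q = (norm (a v))\<^sup>2 / t"
    have q: "0 \<le> q" using t by (simp add: q_def)
    have sq: "norm (a v) = sqrt q * sqrt t" using t by (simp add: q_def real_sqrt_divide)
    have tt: "t\<^sup>2 \<le> t" using t mult_left_mono[of t 1 t] by (simp add: power2_eq_square)
    have st: "sqrt t / t \<le> 1 / t\<^sup>2"
    proof -
      have "sqrt t \<le> 1" using t by simp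
      then have "sqrt t / t \<le> 1 / t" using t by (intro divide_right_mono) auto
      also have "\<dots> \<le> 1 / t\<^sup>2" using t tt by (intro divide_left_mono) auto
      finally show ?thesis .
    qed
    have it: "1 / t \<le> 1 / t\<^sup>2" using t tt by (intro divide_left_mono) auto
    have E: "hk t v = S * exp (- q / 4) * hk (2 * t) v" using hk_double[OF t(1), of v] by (simp add: S_def q_def)
    have "\<bar>a v \<bullet> a (axis j 1)\<bar> \<le> norm (a v) * A"
      using Cauchy_Schwarz_ineq2[of "a v" "a (axis j 1)"] e[of j] by (meson mult_left_mono norm_ge_zero order_trans)
    then have "\<bar>hk1 t j v\<bar> \<le> norm (a v) * A / t * hk t v"
      unfolding hk1_def using t by (simp add: abs_mult mult_right_mono divide_right_mono)
    also have "\<dots> = A * S * (sqrt t / t) * (sqrt q * exp (- q / 4)) * hk (2 * t) v" unfolding E sq by simp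
    also have "\<dots> \<le> A * S * (1 / t\<^sup>2) * 5 * hk (2 * t) v"
      using t A(1) S st Gauss_poly_bound(2)[OF q] nn[of t v] q by (intro mult_mono mult_nonneg_nonneg) auto
    also have "\<dots> = (S * (5 * A)) / t\<^sup>2 * hk (2 * t) v" by simp
    also have "\<dots> \<le> C / t\<^sup>2 * hk (2 * t) v"
      using nn[of t v] t S A(1) unfolding C_def by (intro mult_right_mono divide_right_mono mult_left_mono) auto
    finally show "\<bar>hk1 t j v\<bar> \<le> C / t\<^sup>2 * hk (2 * t) v" .
  next
    fix t :: real and v i j assume t: "0 < t" "t \<le> 1"
    define q where "q = (norm (a v))\<^sup>2 / t"
    have q: "0 \<le> q" using t by (simp add: q_def)
    have tt: "t\<^sup>2 \<le> t" using t mult_left_mono[of t 1 t] by (simp add: power2_eq_square)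
    have it: "1 / t \<le> 1 / t\<^sup>2" using t tt by (intro divide_left_mono) auto
    have E: "hk t v = S * exp (- q / 4) * hk (2 * t) v" using hk_double[OF t(1), of v] by (simp add: S_def q_def)
    have 1: "\<bar>a v \<bullet> a (axis i 1)\<bar> \<le> norm (a v) * A" for i
      using Cauchy_Schwarz_ineq2[of "a v" "a (axis i 1)"] e[of i] by (meson mult_left_mono norm_ge_zero order_trans)
    have 2: "\<bar>a (axis i 1) \<bullet> a (axis j 1)\<bar> \<le> A * A"
      using A(1) by (intro order_trans[OF Cauchy_Schwarz_ineq2 mult_mono[OF e[of i] e[of j]]]) auto
    have "\<bar>(a v \<bullet> a (axis i 1)) * (a v \<bullet> a (axis j 1))\<bar> \<le> (norm (a v) * A) * (norm (a v) * A)"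
      unfolding abs_mult by (rule mult_mono[OF 1[of i] 1[of j]]) (use A(1) in auto)
    then have "\<bar>(a v \<bullet> a (axis i 1)) * (a v \<bullet> a (axis j 1)) / t\<^sup>2\<bar> \<le> (norm (a v) * A) * (norm (a v) * A) / t\<^sup>2"
      unfolding abs_divide using t by (simp add: divide_right_mono)
    also have "\<dots> = A\<^sup>2 * q / t" unfolding q_def power2_eq_square by simp
    finally have 3: "\<bar>(a v \<bullet> a (axis i 1)) * (a v \<bullet> a (axis j 1)) / t\<^sup>2\<bar> \<le> A\<^sup>2 * q / t" .
    have 4: "\<bar>(a (axis i 1) \<bullet> a (axis j 1)) / t\<bar> \<le> A\<^sup>2 / t"
      using 2 t by (simp add: power2_eq_square divide_right_mono)
    define X where "X = (a v \<bullet> a (axis i 1)) * (a v \<bullet> a (axis j 1)) / t\<^sup>2"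
    define Y where "Y = (a (axis i 1) \<bullet> a (axis j 1)) / t"
    have "\<bar>hk2 t i j v\<bar> = \<bar>X - Y\<bar> * hk t v" using t by (simp add: hk2_def abs_mult X_def Y_def)
    also have "\<dots> \<le> (A\<^sup>2 * q / t + A\<^sup>2 / t) * hk t v"
    proof (rule mult_right_mono)
      show "\<bar>X - Y\<bar> \<le> A\<^sup>2 * q / t + A\<^sup>2 / t" using 3 4 abs_triangle_ineq4[of X Y] unfolding X_def[symmetric] Y_def[symmetric] by linarith
    qed (use t in auto)
    finally have "\<bar>hk2 t i j v\<bar> \<le> (A\<^sup>2 * q / t + A\<^sup>2 / t) * hk t v" .
    also have "\<dots> = A\<^sup>2 * S * (1 / t) * (q * exp (- q / 4) + exp (- q / 4)) * hk (2 * t) v"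
      unfolding E by (simp add: algebra_simps add_divide_distrib)
    also have "\<dots> \<le> A\<^sup>2 * S * (1 / t\<^sup>2) * (4 + 1) * hk (2 * t) v"
      using t A(1) S it Gauss_poly_bound(1)[OF q] nn[of t v] q by (intro mult_mono mult_nonneg_nonneg add_mono) (auto intro: add_nonneg_nonneg)
    also have "\<dots> = (S * (5 * A\<^sup>2)) / t\<^sup>2 * hk (2 * t) v" by simp
    also have "\<dots> \<le> C / t\<^sup>2 * hk (2 * t) v"
      using nn[of t v] t S A(1) unfolding C_def by (intro mult_right_mono divide_right_mono mult_left_mono) auto
    finally show "\<bar>hk2 t i j v\<bar> \<le> C / t\<^sup>2 * hk (2 * t) v" .
  qed
qed

text \<open>Since \<open>norm p ^ 2 <= 2 * norm (p - r) ^ 2 + 2 * norm r ^ 2\<close>, moving the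
  centre by less than 1 costs a constant factor once the time is doubled. This supplies majorants
  that are uniform on a ball.\<close>

lemma hk_local_bound:
  assumes t: "0 < t"
  obtains D where "0 < D" "\<And>x x0 y. x \<in> ball x0 1 \<Longrightarrow> hk t (y - x) \<le> D * hk (2 * t) (y - x0)"
proof -
  obtain A where A: "0 < A" "\<And>v. norm (a v) \<le> A * norm v" using linear_bounded_pos[OF linear_a] by blast
  define D where "D = sqrt 2 ^ CARD('d) * exp (A\<^sup>2 / (2 * t))"
  show ?thesis
  proof (rule that[of D])
    fix x x0 y :: "real^'d" assume x: "x \<in> ball x0 1"
    define p where "p = a (y - x0)"
    define r where "r = a (x - x0)"
    have yx: "a (y - x) = p - r" by (simp add: p_def r_def linear_diff[OF linear_a])
    have "norm r \<le> A * norm (x - x0)" unfolding r_def by (rule A)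
    also have "\<dots> \<le> A * 1" using x A(1) by (intro mult_left_mono) (auto simp: dist_norm norm_minus_commute)
    finally have "norm r \<le> A" by simp
    then have r: "(norm r)\<^sup>2 \<le> A\<^sup>2" by (intro power_mono) auto
    have "(norm p)\<^sup>2 \<le> 2 * (norm (p - r))\<^sup>2 + 2 * (norm r)\<^sup>2"
    proof -
      have "2 * (norm (p - r))\<^sup>2 + 2 * (norm r)\<^sup>2 - (norm p)\<^sup>2 = (norm (p - 2 *\<^sub>R r))\<^sup>2"
        by (simp add: power2_norm_eq_inner inner_diff_left inner_diff_right inner_commute algebra_simps)
      then show ?thesis by (metis diff_ge_0_iff_ge zero_le_power2)
    qed
    then have "- (norm (p - r))\<^sup>2 \<le> A\<^sup>2 - (norm p)\<^sup>2 / 2" using r by simp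
    then have "- (norm (p - r))\<^sup>2 / (2 * t) \<le> (A\<^sup>2 - (norm p)\<^sup>2 / 2) / (2 * t)" using t by (intro divide_right_mono) auto
    also have "\<dots> = A\<^sup>2 / (2 * t) + - (norm p)\<^sup>2 / (2 * (2 * t))" using t by (simp add: field_simps)
    finally have ex: "exp (- (norm (p - r))\<^sup>2 / (2 * t)) \<le> exp (A\<^sup>2 / (2 * t)) * exp (- (norm p)\<^sup>2 / (2 * (2 * t)))"
      unfolding mult_exp_exp by simp
    have s: "(1 / sqrt t) ^ CARD('d) = sqrt 2 ^ CARD('d) * (1 / sqrt (2 * t)) ^ CARD('d)"
      using t by (simp add: real_sqrt_mult power_divide power_mult_distrib)
    define c where "c = kap * (1 / sqrt t) ^ CARD('d) * (1 / sqrt (2 * pi)) ^ CARD('d)"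
    have c: "0 \<le> c" using kap(1) t by (simp add: c_def)
    have "hk t (y - x) = c * exp (- (norm (p - r))\<^sup>2 / (2 * t))" using t by (simp add: hk_exp yx c_def)
    also have "\<dots> \<le> c * (exp (A\<^sup>2 / (2 * t)) * exp (- (norm p)\<^sup>2 / (2 * (2 * t))))" by (rule mult_left_mono[OF ex c])
    also have "\<dots> = D * hk (2 * t) (y - x0)"
      using t unfolding c_def s by (simp add: hk_exp D_def p_def)
    finally show "hk t (y - x) \<le> D * hk (2 * t) (y - x0)" .
  qed (simp add: D_def)
qed

definition g1 :: "real \<Rightarrow> (real^'d \<Rightarrow> real) \<Rightarrow> 'd \<Rightarrow> real^'d \<Rightarrow> real" where
  "g1 t r j x = (\<integral>y. hk1 t j (y - x) * r y \<partial>lborel)"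

definition g2 :: "real \<Rightarrow> (real^'d \<Rightarrow> real) \<Rightarrow> 'd \<Rightarrow> 'd \<Rightarrow> real^'d \<Rightarrow> real" where
  "g2 t r i j x = (\<integral>y. hk2 t i j (y - x) * r y \<partial>lborel)"

lemma integrable_hk: "0 < t \<Longrightarrow> integrable lborel (\<lambda>y. hk t (y - x))"
  using Gop_hk(2)[OF bm_const[of 1], of t x] by simp

lemma integrable_hk12:
  assumes t: "0 < t" "t \<le> 1" and r: "bm r"
  shows "integrable lborel (\<lambda>y. hk1 t j (y - x) * r y)" "integrable lborel (\<lambda>y. hk2 t i j (y - x) * r y)"
proof -
  have [measurable]: "r \<in> borel_measurable borel" using r by (rule bm_measurable)
  obtain M where M: "0 \<le> M" "\<And>y. \<bar>r y\<bar> \<le> M" using bm_bounded[OF r] by metis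
  obtain C where C: "0 < C"
    "\<And>t v j. 0 < t \<Longrightarrow> t \<le> 1 \<Longrightarrow> \<bar>hk1 t j v\<bar> \<le> C / t\<^sup>2 * hk (2 * t) v"
    "\<And>t v i j. 0 < t \<Longrightarrow> t \<le> 1 \<Longrightarrow> \<bar>hk2 t i j v\<bar> \<le> C / t\<^sup>2 * hk (2 * t) v"
    using hk_derivative_bounds by blast
  have i: "integrable lborel (\<lambda>y. C / t\<^sup>2 * hk (2 * t) (y - x) * M)" using t by (intro integrable_mult_left integrable_mult_right integrable_hk) auto
  show "integrable lborel (\<lambda>y. hk1 t j (y - x) * r y)"
  proof (rule Bochner_Integration.integrable_bound[OF i], measurable, intro AE_I2)
    fix y have "\<bar>hk1 t j (y - x) * r y\<bar> \<le> C / t\<^sup>2 * hk (2 * t) (y - x) * M"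
      unfolding abs_mult using C(1) t by (intro mult_mono C(2) M mult_nonneg_nonneg) auto
    then show "norm (hk1 t j (y - x) * r y) \<le> norm (C / t\<^sup>2 * hk (2 * t) (y - x) * M)"
      using abs_ge_self[of "C / t\<^sup>2 * hk (2 * t) (y - x) * M"] unfolding real_norm_def by linarith
  qed
  show "integrable lborel (\<lambda>y. hk2 t i j (y - x) * r y)"
  proof (rule Bochner_Integration.integrable_bound[OF i], measurable, intro AE_I2)
    fix y have "\<bar>hk2 t i j (y - x) * r y\<bar> \<le> C / t\<^sup>2 * hk (2 * t) (y - x) * M"
      unfolding abs_mult using C(1) t by (intro mult_mono C(3) M mult_nonneg_nonneg) auto
    then show "norm (hk2 t i j (y - x) * r y) \<le> norm (C / t\<^sup>2 * hk (2 * t) (y - x) * M)"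
      using abs_ge_self[of "C / t\<^sup>2 * hk (2 * t) (y - x) * M"] unfolding real_norm_def by linarith
  qed
qed

lemma Gop_smooth:
  assumes t: "0 < t" "t \<le> 1" and r: "bm r"
  shows "(Gop t r has_derivative (\<lambda>v. \<Sum>j\<in>UNIV. v $ j * g1 t r j x)) (at x)"
    and "(g1 t r j has_derivative (\<lambda>v. \<Sum>i\<in>UNIV. v $ i * g2 t r i j x)) (at x)"
    and "isCont (g2 t r i j) x"
proof -
  have [measurable]: "r \<in> borel_measurable borel" using r by (rule bm_measurable)
  obtain M where M: "0 \<le> M" "\<And>y. \<bar>r y\<bar> \<le> M" using bm_bounded[OF r] by metis
  obtain C where C: "0 < C"
    "\<And>t v j. 0 < t \<Longrightarrow> t \<le> 1 \<Longrightarrow> \<bar>hk1 t j v\<bar> \<le> C / t\<^sup>2 * hk (2 * t) v"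
    "\<And>t v i j. 0 < t \<Longrightarrow> t \<le> 1 \<Longrightarrow> \<bar>hk2 t i j v\<bar> \<le> C / t\<^sup>2 * hk (2 * t) v"
    using hk_derivative_bounds by blast
  have t2: "0 < 2 * t" using t by simp
  obtain D where D: "0 < D" "\<And>x x0 y. x \<in> ball x0 1 \<Longrightarrow> hk (2 * t) (y - x) \<le> D * hk (2 * (2 * t)) (y - x0)"
    using hk_local_bound[OF t2] by blast
  \<comment> \<open>The time is doubled twice: once for the polynomial factor of a derivative, once
    for moving the centre within the unit ball.\<close>
  define H where "H y = C / t\<^sup>2 * (D * hk (2 * (2 * t)) (y - x)) * M" for y
  have H: "integrable lborel H" unfolding H_def[abs_def] using t by (intro integrable_mult_left integrable_mult_right integrable_hk) auto
  have dom: "\<bar>k * r y\<bar> \<le> H y" if "\<bar>k\<bar> \<le> C / t\<^sup>2 * hk (2 * t) (y - x')" "x' \<in> ball x 1" for k y x'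
  proof -
    have "\<bar>k\<bar> \<le> C / t\<^sup>2 * (D * hk (2 * (2 * t)) (y - x))"
      using that(1) mult_left_mono[OF D(2)[OF that(2), of y], of "C / t\<^sup>2"] C(1) t by simp
    then show ?thesis unfolding abs_mult H_def using M by (intro mult_mono) auto
  qed
  have "Gop t r = (\<lambda>x. \<integral>y. hk t (y - x) * r y \<partial>lborel)" using Gop_hk(1)[OF r t(1)] by auto
  moreover have "((\<lambda>x. \<integral>y. hk t (y - x) * r y \<partial>lborel) has_derivative (\<lambda>v. \<Sum>j\<in>UNIV. v $ j * (\<integral>y. hk1 t j (y - x) * r y \<partial>lborel))) (at x)"
  proof (rule has_derivative_integral[where H=H and G="\<lambda>j x y. hk1 t j (y - x) * r y"])
    fix x' y
    have "((\<lambda>x. hk t (y - x) * r y) has_derivative (\<lambda>v. (\<Sum>j\<in>UNIV. v $ j * hk1 t j (y - x')) * r y)) (at x')"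
      by (rule has_derivative_mult_left[OF hk_has_derivative[OF t(1)]])
    then show "((\<lambda>x. hk t (y - x) * r y) has_derivative (\<lambda>v. \<Sum>j\<in>UNIV. v $ j * (hk1 t j (y - x') * r y))) (at x')"
      by (simp add: sum_distrib_right mult.assoc)
    show "\<bar>hk1 t j (y - x') * r y\<bar> \<le> H y" if "x' \<in> ball x 1" for j by (rule dom[OF C(2)[OF t] that])
  qed (use Gop_hk(2)[OF r t(1)] H in auto)
  ultimately show "(Gop t r has_derivative (\<lambda>v. \<Sum>j\<in>UNIV. v $ j * g1 t r j x)) (at x)" by (simp add: g1_def)
  have "((\<lambda>x. \<integral>y. hk1 t j (y - x) * r y \<partial>lborel) has_derivative (\<lambda>v. \<Sum>i\<in>UNIV. v $ i * (\<integral>y. hk2 t i j (y - x) * r y \<partial>lborel))) (at x)"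
  proof (rule has_derivative_integral[where H=H and G="\<lambda>i x y. hk2 t i j (y - x) * r y"])
    fix x' y
    have "((\<lambda>x. hk1 t j (y - x) * r y) has_derivative (\<lambda>v. (\<Sum>i\<in>UNIV. v $ i * hk2 t i j (y - x')) * r y)) (at x')"
      by (rule has_derivative_mult_left[OF hk1_has_derivative[OF t(1)]])
    then show "((\<lambda>x. hk1 t j (y - x) * r y) has_derivative (\<lambda>v. \<Sum>i\<in>UNIV. v $ i * (hk2 t i j (y - x') * r y))) (at x')"
      by (simp add: sum_distrib_right mult.assoc)
    show "\<bar>hk2 t i j (y - x') * r y\<bar> \<le> H y" if "x' \<in> ball x 1" for i by (rule dom[OF C(3)[OF t] that])
  qed (use integrable_hk12(1)[OF t r] H in auto)
  then show "(g1 t r j has_derivative (\<lambda>v. \<Sum>i\<in>UNIV. v $ i * g2 t r i j x)) (at x)" unfolding g1_def[abs_def] g2_def .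
  have "isCont (\<lambda>x. \<integral>y. hk2 t i j (y - x) * r y \<partial>lborel) x"
  proof (rule isCont_integral_dominated[where H=H])
    show "isCont (\<lambda>x. hk2 t i j (y - x) * r y) x" for y by (intro isCont_mult hk2_continuous t(1) continuous_const)
    show "\<bar>hk2 t i j (y - x') * r y\<bar> \<le> H y" if "x' \<in> ball x 1" for x' y by (rule dom[OF C(3)[OF t] that])
  qed (use H in auto)
  then show "isCont (g2 t r i j) x" unfolding g2_def[abs_def] .
qed

lemma g12_bounds:
  obtains C where "0 < C"
    "\<And>t r j x. 0 < t \<Longrightarrow> t \<le> 1 \<Longrightarrow> bm r \<Longrightarrow> \<bar>g1 t r j x\<bar> \<le> C / t\<^sup>2 * Gop (2 * t) (\<lambda>y. \<bar>r y\<bar>) x"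
    "\<And>t r i j x. 0 < t \<Longrightarrow> t \<le> 1 \<Longrightarrow> bm r \<Longrightarrow> \<bar>g2 t r i j x\<bar> \<le> C / t\<^sup>2 * Gop (2 * t) (\<lambda>y. \<bar>r y\<bar>) x"
proof -
  obtain C where C: "0 < C"
    "\<And>t v j. 0 < t \<Longrightarrow> t \<le> 1 \<Longrightarrow> \<bar>hk1 t j v\<bar> \<le> C / t\<^sup>2 * hk (2 * t) v"
    "\<And>t v i j. 0 < t \<Longrightarrow> t \<le> 1 \<Longrightarrow> \<bar>hk2 t i j v\<bar> \<le> C / t\<^sup>2 * hk (2 * t) v"
    using hk_derivative_bounds by blast
  have main: "\<bar>\<integral>y. k y * r y \<partial>lborel\<bar> \<le> C / t\<^sup>2 * Gop (2 * t) (\<lambda>y. \<bar>r y\<bar>) x"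
    if k: "\<And>y. \<bar>k y\<bar> \<le> C / t\<^sup>2 * hk (2 * t) (y - x)" "integrable lborel (\<lambda>y. k y * r y)" and t: "0 < t" and r: "bm r"
    for k :: "real^'d \<Rightarrow> real" and t r x
  proof -
    have "\<bar>\<integral>y. k y * r y \<partial>lborel\<bar> \<le> (\<integral>y. \<bar>k y * r y\<bar> \<partial>lborel)" by (rule integral_abs_bound)
    also have "\<dots> \<le> (\<integral>y. C / t\<^sup>2 * (hk (2 * t) (y - x) * \<bar>r y\<bar>) \<partial>lborel)"
    proof (rule integral_mono)
      show "integrable lborel (\<lambda>y. C / t\<^sup>2 * (hk (2 * t) (y - x) * \<bar>r y\<bar>))"
        using t by (intro integrable_mult_right Gop_hk(2) bm_abs r) auto
      show "\<bar>k y * r y\<bar> \<le> C / t\<^sup>2 * (hk (2 * t) (y - x) * \<bar>r y\<bar>)" for y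
        using mult_right_mono[OF k(1)[of y], of "\<bar>r y\<bar>"] by (simp add: abs_mult mult.assoc)
    qed (use k(2) in auto)
    also have "\<dots> = C / t\<^sup>2 * Gop (2 * t) (\<lambda>y. \<bar>r y\<bar>) x" using Gop_hk(1)[OF bm_abs[OF r], of "2 * t" x] t by simp
    finally show ?thesis .
  qed
  show ?thesis
  proof (rule that[OF C(1)])
    fix t and r :: "real^'d \<Rightarrow> real" and i j x assume t: "0 < t" "t \<le> (1::real)" and r: "bm r"
    show "\<bar>g1 t r j x\<bar> \<le> C / t\<^sup>2 * Gop (2 * t) (\<lambda>y. \<bar>r y\<bar>) x"
      unfolding g1_def by (rule main[OF C(2)[OF t] integrable_hk12(1)[OF t r] t(1) r])
    show "\<bar>g2 t r i j x\<bar> \<le> C / t\<^sup>2 * Gop (2 * t) (\<lambda>y. \<bar>r y\<bar>) x"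
      unfolding g2_def by (rule main[OF C(3)[OF t] integrable_hk12(2)[OF t r] t(1) r])
  qed
qed

end

lemma limit_has_derivative:
  fixes f :: "nat \<Rightarrow> real^'d \<Rightarrow> real"
  assumes \<delta>: "0 < \<delta>"
    and d: "\<And>k x. k0 \<le> k \<Longrightarrow> x \<in> ball x0 \<delta> \<Longrightarrow> (f k has_derivative (\<lambda>v. \<Sum>j\<in>UNIV. v $ j * f' k j x)) (at x)"
    and c: "\<And>k x j. k0 \<le> k \<Longrightarrow> x \<in> ball x0 \<delta> \<Longrightarrow> \<bar>f' k j x - g j x\<bar> \<le> C / 2 ^ k"
    and l: "\<And>x. x \<in> ball x0 \<delta> \<Longrightarrow> (\<lambda>k. f k x) \<longlonglongrightarrow> F x"
  shows "(F has_derivative (\<lambda>v. \<Sum>j\<in>UNIV. v $ j * g j x0)) (at x0)"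
proof -
  let ?n = "real CARD('d)"
  have x0: "x0 \<in> ball x0 \<delta>" using \<delta> by simp
  have "\<exists>G. \<forall>x\<in>ball x0 \<delta>. (\<lambda>k. f (k + k0) x) \<longlonglongrightarrow> G x \<and>
      (G has_derivative (\<lambda>v. \<Sum>j\<in>UNIV. v $ j * g j x)) (at x within ball x0 \<delta>)"
  proof (rule has_derivative_sequence[where f'="\<lambda>k x v. \<Sum>j\<in>UNIV. v $ j * f' (k + k0) j x"])
    show "((\<lambda>x. f (k + k0) x) has_derivative (\<lambda>v. \<Sum>j\<in>UNIV. v $ j * f' (k + k0) j x)) (at x within ball x0 \<delta>)"
      if "x \<in> ball x0 \<delta>" for k x
      by (rule has_derivative_at_withinI[OF d[OF _ that]]) simp
    show "(\<lambda>k. f (k + k0) x0) \<longlonglongrightarrow> F x0" by (rule LIMSEQ_ignore_initial_segment[OF l[OF x0]])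
    fix e :: real assume e: "0 < e"
    have "(\<lambda>k. ?n * C * (1 / 2) ^ (k + k0)) \<longlonglongrightarrow> ?n * C * 0"
      by (intro tendsto_mult_left LIMSEQ_ignore_initial_segment LIMSEQ_realpow_zero) auto
    then have "eventually (\<lambda>k. ?n * C * (1 / 2) ^ (k + k0) < e) sequentially" using e by (intro order_tendstoD) auto
    then show "\<forall>\<^sub>F k in sequentially. \<forall>x\<in>ball x0 \<delta>. \<forall>v. norm ((\<Sum>j\<in>UNIV. v $ j * f' (k + k0) j x) - (\<Sum>j\<in>UNIV. v $ j * g j x)) \<le> e * norm v"
    proof (rule eventually_mono, intro ballI allI)
      fix k x and v :: "real^'d" assume k: "?n * C * (1 / 2) ^ (k + k0) < e" and x: "x \<in> ball x0 \<delta>"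
      have "norm ((\<Sum>j\<in>UNIV. v $ j * f' (k + k0) j x) - (\<Sum>j\<in>UNIV. v $ j * g j x)) = \<bar>\<Sum>j\<in>UNIV. v $ j * (f' (k + k0) j x - g j x)\<bar>"
        by (simp add: sum_subtractf right_diff_distrib)
      also have "\<dots> \<le> (\<Sum>j\<in>UNIV. \<bar>v $ j * (f' (k + k0) j x - g j x)\<bar>)" by (rule sum_abs)
      also have "\<dots> \<le> (\<Sum>j\<in>(UNIV::'d set). norm v * (C / 2 ^ (k + k0)))"
        unfolding abs_mult by (intro sum_mono mult_mono component_le_norm_cart c x) auto
      also have "\<dots> = (?n * C * (1 / 2) ^ (k + k0)) * norm v" by (simp add: power_one_over)
      also have "\<dots> \<le> e * norm v" using k by (intro mult_right_mono) auto
      finally show "norm ((\<Sum>j\<in>UNIV. v $ j * f' (k + k0) j x) - (\<Sum>j\<in>UNIV. v $ j * g j x)) \<le> e * norm v" .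
    qed
  qed (use x0 in auto)
  then obtain G where G: "\<And>x. x \<in> ball x0 \<delta> \<Longrightarrow> (\<lambda>k. f (k + k0) x) \<longlonglongrightarrow> G x"
    "\<And>x. x \<in> ball x0 \<delta> \<Longrightarrow> (G has_derivative (\<lambda>v. \<Sum>j\<in>UNIV. v $ j * g j x)) (at x within ball x0 \<delta>)" by blast
  have eq: "F x = G x" if "x \<in> ball x0 \<delta>" for x
    by (rule LIMSEQ_unique[OF LIMSEQ_ignore_initial_segment[OF l[OF that]] G(1)[OF that]])
  have "(F has_derivative (\<lambda>v. \<Sum>j\<in>UNIV. v $ j * g j x0)) (at x0 within ball x0 \<delta>)"
    by (rule has_derivative_transform[OF x0 eq G(2)[OF x0]])
  then show ?thesis using at_within_open[OF x0 open_ball] by simp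
qed

context elliptic_domain begin

text \<open>The smooth functions \<open>U k\<close> are within order \<open>t ^ 3\<close> of
  \<open>h\<close> inside \<open>Q\<close>. Now \<open>U k\<close> and \<open>U (k + 1)\<close> are
  the images of \<open>U (k + 1)\<close> and \<open>h\<close> under the same multiple of
  \<open>Gop (t (k + 1))\<close>, so their derivatives differ by kernel derivatives applied to
  \<open>U (k + 1) - h\<close>. These cost \<open>t ^ -2\<close>, which leaves one power of
  \<open>t\<close> and geometric convergence of the derivatives.\<close>

lemma P_eigenfunction_C2:
  assumes h: "bm h" and P: "\<And>k x. k0 \<le> k \<Longrightarrow> P k h x = exp (- \<mu> / 2 / 2 ^ k) * h x"
  shows "C2_on Q h"
proof -
  obtain M where M: "0 \<le> M" "\<And>x. \<bar>h x\<bar> \<le> M" using bm_bounded[OF h] by metis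
  define L where "L = exp (\<bar>\<mu>\<bar> / 2)"
  define lam where "lam k = exp (\<mu> / 2 / 2 ^ k)" for k :: nat
  define t :: "nat \<Rightarrow> real" where "t k = 1 / 2 ^ k" for k
  have t: "0 < t k" "t k \<le> 1" "2 * t (Suc k) = t k" for k by (auto simp: t_def)
  have L1: "1 \<le> L" by (simp add: L_def)
  have lam: "0 < lam k" "lam k \<le> L" for k
  proof -
    have "\<mu> / 2 / 2 ^ k \<le> \<bar>\<mu>\<bar> / 2 / 2 ^ k" by (intro divide_right_mono) auto
    also have "\<dots> \<le> \<bar>\<mu>\<bar> / 2" by (simp add: divide_le_eq mult_le_cancel_left1)
    finally show "lam k \<le> L" by (simp add: lam_def L_def)
  qed (simp add: lam_def)
  have lam2: "lam (Suc k) * lam (Suc k) = lam k" for k by (simp add: lam_def mult_exp_exp)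
  define U where "U k x = lam k * Gop (t k) h x" for k x
  have bU: "bm (U k)" for k unfolding U_def[abs_def] by (intro bm_cmult Gop_bm h)
  have UM: "\<bar>U k x\<bar> \<le> L * M" for k x
    unfolding U_def abs_mult using lam[of k] L1 by (intro mult_mono Gop_bound[OF h M(2)]) auto
  \<comment> \<open>The eigenvalue equation rewrites \<open>h\<close> as
    \<open>lam k * P k h\<close>, so that the exit estimate applies to the difference.\<close>
  have Uh: "\<bar>U k x - h x\<bar> \<le> L * (2 * M * m6 * t k ^ 3 / \<delta> ^ 6)" if x: "cball x \<delta> \<subseteq> Q" "0 < \<delta>" and k: "k0 \<le> k" for x \<delta> k
  proof -
    have "h x = lam k * P k h x" unfolding P[OF k] lam_def by (simp add: mult_exp_exp mult.assoc[symmetric])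
    then have "\<bar>U k x - h x\<bar> = lam k * \<bar>Gop (t k) h x - P k h x\<bar>"
      unfolding U_def using lam(1)[of k] by (simp add: right_diff_distrib[symmetric] abs_mult)
    also have "\<dots> \<le> L * (2 * M * m6 * t k ^ 3 / \<delta> ^ 6)"
      using P_exit[OF x h M(2), of k] lam[of k] L1 unfolding t_def by (intro mult_mono) auto
    finally show ?thesis .
  qed
  have Urec: "U k x = lam (Suc k) * Gop (t (Suc k)) (U (Suc k)) x" for k x
  proof -
    have "Gop (t (Suc k)) (U (Suc k)) x = lam (Suc k) * Gop (t (Suc k)) (Gop (t (Suc k)) h) x"
      using Gop_lin[OF bm_const[of 0] Gop_bm[OF h], of "t (Suc k)" "lam (Suc k)" "t (Suc k)"] unfolding U_def[abs_def] by simp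
    also have "\<dots> = lam (Suc k) * Gop (t k) h x" using Gop_double[OF h, of "t (Suc k)" x] t[of "Suc k"] t(3)[of k] by simp
    finally show ?thesis unfolding U_def[of k] lam2[of k, symmetric] by simp
  qed
  define r where "r k = (\<lambda>x. U (Suc k) x - h x)" for k
  have br: "bm (r k)" for k unfolding r_def by (intro bm_diff bU h)
  define R where "R = (L + 1) * M"
  have rR: "\<bar>r k x\<bar> \<le> R" for k x using UM[of "Suc k" x] M(2)[of x] by (simp add: r_def R_def algebra_simps)
  have R0: "0 \<le> R" using rR[of 0 undefined] by linarith
  \<comment> \<open>Near \<open>x\<close> the difference \<open>r k\<close> is of order
    \<open>t ^ 3\<close>. Far away it is merely bounded, but the sixth moment gives far Gaussian
    steps a weight of order \<open>t ^ 3\<close> as well.\<close>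
  have Gr: "\<exists>C2. 0 \<le> C2 \<and> (\<forall>x k. cball x (2 * \<delta>) \<subseteq> Q \<longrightarrow> k0 \<le> k \<longrightarrow> Gop (2 * t (Suc k)) (\<lambda>y. \<bar>r k y\<bar>) x \<le> C2 * t (Suc k) ^ 3)"
    if \<delta>: "0 < \<delta>" for \<delta>
  proof -
    define A where "A = L * (2 * M * m6 / \<delta> ^ 6)"
    define C2 where "C2 = A + 8 * R * m6 / \<delta> ^ 6"
    have A0: "0 \<le> A" using L1 M(1) m6_nonneg \<delta> by (simp add: A_def)
    have C20: "0 \<le> C2" using A0 R0 m6_nonneg \<delta> by (simp add: C2_def)
    show ?thesis
    proof (intro exI[of _ C2] conjI C20 allI impI)
      fix x k assume x: "cball x (2 * \<delta>) \<subseteq> Q" and k: "k0 \<le> k"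
      let ?t = "t (Suc k)"
      have pt: "\<bar>r k y\<bar> \<le> A * ?t ^ 3 + R / \<delta> ^ 6 * norm (y - x) ^ 6" for y
      proof (cases "dist x y \<le> \<delta>")
        case True
        have "cball y \<delta> \<subseteq> cball x (2 * \<delta>)"
        proof
          fix z assume "z \<in> cball y \<delta>"
          then show "z \<in> cball x (2 * \<delta>)" using True dist_triangle[of x z y] by simp
        qed
        then have "cball y \<delta> \<subseteq> Q" using x by blast
        then have "\<bar>r k y\<bar> \<le> L * (2 * M * m6 * ?t ^ 3 / \<delta> ^ 6)" unfolding r_def using \<delta> k by (intro Uh) auto
        also have "\<dots> = A * ?t ^ 3" by (simp add: A_def)
        also have "\<dots> \<le> A * ?t ^ 3 + R / \<delta> ^ 6 * norm (y - x) ^ 6" using R0 \<delta> by simp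
        finally show ?thesis .
      next
        case False
        then have "\<delta> ^ 6 \<le> norm (y - x) ^ 6" using \<delta> by (intro power_mono) (auto simp: dist_norm norm_minus_commute)
        then have "1 \<le> norm (y - x) ^ 6 / \<delta> ^ 6" using \<delta> by simp
        from mult_left_mono[OF this R0] have "R \<le> R / \<delta> ^ 6 * norm (y - x) ^ 6" by simp
        moreover have "0 \<le> A * ?t ^ 3" using A0 t(1)[of "Suc k"] by simp
        ultimately show ?thesis using rR[of k y] by linarith
      qed
      have s6: "sqrt (2 * ?t) ^ 6 = 8 * ?t ^ 3"
      proof -
        have "u ^ 6 = (u\<^sup>2) ^ 3" for u :: real by (simp flip: power_mult)
        from this[of "sqrt (2 * ?t)"] show ?thesis using t(1)[of "Suc k"] by (simp add: power_mult_distrib)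
      qed
      have "Gop (2 * ?t) (\<lambda>y. \<bar>r k y\<bar>) x \<le> (\<integral>z. A * ?t ^ 3 + (R / \<delta> ^ 6 * (8 * ?t ^ 3)) * norm (b z) ^ 6 \<partial>gauss)"
        unfolding Gop_def
      proof (rule integral_mono)
        show "integrable gauss (\<lambda>z. \<bar>r k (x + sqrt (2 * ?t) *\<^sub>R b z)\<bar>)" by (intro integrable_shift bm_abs br)
        show "integrable gauss (\<lambda>z. A * ?t ^ 3 + (R / \<delta> ^ 6 * (8 * ?t ^ 3)) * norm (b z) ^ 6)"
          by (intro Bochner_Integration.integrable_add integrable_mult_right integrable_b_norm_power) simp
        fix z
        have "norm (sqrt (2 * ?t) *\<^sub>R b z) ^ 6 = (8 * ?t ^ 3) * norm (b z) ^ 6"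
          using t(1)[of "Suc k"] by (simp add: power_mult_distrib s6)
        then show "\<bar>r k (x + sqrt (2 * ?t) *\<^sub>R b z)\<bar> \<le> A * ?t ^ 3 + (R / \<delta> ^ 6 * (8 * ?t ^ 3)) * norm (b z) ^ 6"
          using pt[of "x + sqrt (2 * ?t) *\<^sub>R b z"] by (simp only: add_diff_cancel_left' mult.assoc)
      qed
      also have "\<dots> = A * ?t ^ 3 + (R / \<delta> ^ 6 * (8 * ?t ^ 3)) * m6"
        using integrable_b_norm_power[of 6] by (subst Bochner_Integration.integral_add) (simp_all add: m6_def)
      also have "\<dots> = C2 * ?t ^ 3" by (simp add: C2_def algebra_simps)
      finally show "Gop (2 * ?t) (\<lambda>y. \<bar>r k y\<bar>) x \<le> C2 * ?t ^ 3" .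
    qed
  qed
  define dU where "dU k j x = lam k * g1 (t k) h j x" for k j x
  define ddU where "ddU k i j x = lam k * g2 (t k) h i j x" for k i j x
  have D1: "(U k has_derivative (\<lambda>v. \<Sum>j\<in>UNIV. v $ j * dU k j x)) (at x)" for k x
    unfolding U_def[abs_def] dU_def
    using has_derivative_mult_right[OF Gop_smooth(1)[OF t(1,2) h, of k x], of "lam k"] by (simp add: sum_distrib_left mult_ac)
  have D2: "(dU k j has_derivative (\<lambda>v. \<Sum>i\<in>UNIV. v $ i * ddU k i j x)) (at x)" for k j x
    unfolding dU_def[abs_def] ddU_def
    using has_derivative_mult_right[OF Gop_smooth(2)[OF t(1,2) h, of k j x], of "lam k"] by (simp add: sum_distrib_left mult_ac)
  have D3: "isCont (ddU k i j) x" for k i j x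
    unfolding ddU_def[abs_def] by (intro continuous_intros Gop_smooth(3) t h)
  \<comment> \<open>The definition of \<open>U k\<close> and the recursion \<open>Urec\<close> both
    yield its derivative; uniqueness makes the two formulas agree.\<close>
  have dU': "dU k j x = lam (Suc k) * g1 (t (Suc k)) (U (Suc k)) j x" for k j x
  proof -
    have "(U k has_derivative (\<lambda>v. \<Sum>j\<in>UNIV. v $ j * (lam (Suc k) * g1 (t (Suc k)) (U (Suc k)) j x))) (at x)"
      by (subst ext[OF Urec])
        (use has_derivative_mult_right[OF Gop_smooth(1)[OF t(1,2) bU, of "Suc k" "Suc k" x], of "lam (Suc k)"] in \<open>simp add: sum_distrib_left mult_ac\<close>)
    from pderiv_vec_eqI[OF this, of j] pderiv_vec_eqI[OF D1[of k x], of j] show ?thesis by (rule trans[OF sym, rotated])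
  qed
  have ddU': "ddU k i j x = lam (Suc k) * g2 (t (Suc k)) (U (Suc k)) i j x" for k i j x
  proof -
    have "(dU k j has_derivative (\<lambda>v. \<Sum>i\<in>UNIV. v $ i * (lam (Suc k) * g2 (t (Suc k)) (U (Suc k)) i j x))) (at x)"
      by (subst ext[OF dU'])
        (use has_derivative_mult_right[OF Gop_smooth(2)[OF t(1,2) bU, of "Suc k" "Suc k" j x], of "lam (Suc k)"] in \<open>simp add: sum_distrib_left mult_ac\<close>)
    from pderiv_vec_eqI[OF this, of i] pderiv_vec_eqI[OF D2[of k j x], of i] show ?thesis by (rule trans[OF sym, rotated])
  qed
  have g1d: "g1 (t (Suc k)) (U (Suc k)) j x - g1 (t (Suc k)) h j x = g1 (t (Suc k)) (r k) j x" for k j x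
    unfolding g1_def r_def using integrable_hk12(1)[OF t(1,2) bU] integrable_hk12(1)[OF t(1,2) h]
    by (simp add: right_diff_distrib)
  have g2d: "g2 (t (Suc k)) (U (Suc k)) i j x - g2 (t (Suc k)) h i j x = g2 (t (Suc k)) (r k) i j x" for k i j x
    unfolding g2_def r_def using integrable_hk12(2)[OF t(1,2) bU] integrable_hk12(2)[OF t(1,2) h]
    by (simp add: right_diff_distrib)
  obtain Cg where Cg: "0 < Cg"
    "\<And>t r j x. 0 < t \<Longrightarrow> t \<le> 1 \<Longrightarrow> bm r \<Longrightarrow> \<bar>g1 t r j x\<bar> \<le> Cg / t\<^sup>2 * Gop (2 * t) (\<lambda>y. \<bar>r y\<bar>) x"
    "\<And>t r i j x. 0 < t \<Longrightarrow> t \<le> 1 \<Longrightarrow> bm r \<Longrightarrow> \<bar>g2 t r i j x\<bar> \<le> Cg / t\<^sup>2 * Gop (2 * t) (\<lambda>y. \<bar>r y\<bar>) x"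
    using g12_bounds by blast
  have diffs: "\<exists>K. \<forall>x k i j. cball x (2 * \<delta>) \<subseteq> Q \<longrightarrow> k0 \<le> k \<longrightarrow>
      \<bar>dU k j x - dU (Suc k) j x\<bar> \<le> K / 2 ^ k \<and> \<bar>ddU k i j x - ddU (Suc k) i j x\<bar> \<le> K / 2 ^ k" if \<delta>: "0 < \<delta>" for \<delta>
  proof -
    obtain C2 where C2: "0 \<le> C2" "\<And>x k. cball x (2 * \<delta>) \<subseteq> Q \<Longrightarrow> k0 \<le> k \<Longrightarrow> Gop (2 * t (Suc k)) (\<lambda>y. \<bar>r k y\<bar>) x \<le> C2 * t (Suc k) ^ 3"
      using Gr[OF \<delta>] by blast
    define K where "K = L * (Cg * C2)"
    have bnd: "lam (Suc k) * \<bar>g\<bar> \<le> K / 2 ^ k"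
      if x: "cball x (2 * \<delta>) \<subseteq> Q" and k: "k0 \<le> k" and g: "\<bar>g\<bar> \<le> Cg / (t (Suc k))\<^sup>2 * Gop (2 * t (Suc k)) (\<lambda>y. \<bar>r k y\<bar>) x" for x k g
    proof -
      have "\<bar>g\<bar> \<le> Cg / (t (Suc k))\<^sup>2 * (C2 * t (Suc k) ^ 3)"
        by (rule order_trans[OF g mult_left_mono[OF C2(2)[OF x k]]]) (use Cg(1) in simp)
      also have "\<dots> = Cg * C2 * t (Suc k)"
      proof -
        have "Cg / s\<^sup>2 * (C2 * s ^ 3) = Cg * C2 * s" if "s \<noteq> 0" for s
          using that by (simp add: power2_eq_square power3_eq_cube)
        moreover have "t (Suc k) \<noteq> 0" using t(1)[of "Suc k"] by simp
        ultimately show ?thesis by blast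
      qed
      also have "\<dots> \<le> Cg * C2 * t k" using Cg(1) C2(1) t(1)[of "Suc k"] t(3)[of k] by (intro mult_left_mono) (linarith, simp)
      finally have "lam (Suc k) * \<bar>g\<bar> \<le> L * (Cg * C2 * t k)"
        by (rule mult_mono[OF lam(2)]) (use L1 in auto)
      also have "\<dots> = K / 2 ^ k" by (simp add: K_def t_def)
      finally show ?thesis .
    qed
    show ?thesis
    proof (intro exI[of _ K] allI impI conjI)
      fix x k i j assume x: "cball x (2 * \<delta>) \<subseteq> Q" and k: "k0 \<le> k"
      have "dU k j x - dU (Suc k) j x = lam (Suc k) * g1 (t (Suc k)) (r k) j x"
        unfolding g1d[of k j x, symmetric] right_diff_distrib dU'[of k j x] by (simp add: dU_def)
      then have "\<bar>dU k j x - dU (Suc k) j x\<bar> = lam (Suc k) * \<bar>g1 (t (Suc k)) (r k) j x\<bar>" using lam(1)[of "Suc k"] by (simp add: abs_mult)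
      then show "\<bar>dU k j x - dU (Suc k) j x\<bar> \<le> K / 2 ^ k" using bnd[OF x k Cg(2)[OF t(1,2) br]] by simp
      have "ddU k i j x - ddU (Suc k) i j x = lam (Suc k) * g2 (t (Suc k)) (r k) i j x"
        unfolding g2d[of k i j x, symmetric] right_diff_distrib ddU'[of k i j x] by (simp add: ddU_def)
      then have "\<bar>ddU k i j x - ddU (Suc k) i j x\<bar> = lam (Suc k) * \<bar>g2 (t (Suc k)) (r k) i j x\<bar>" using lam(1)[of "Suc k"] by (simp add: abs_mult)
      then show "\<bar>ddU k i j x - ddU (Suc k) i j x\<bar> \<le> K / 2 ^ k" using bnd[OF x k Cg(3)[OF t(1,2) br]] by simp
    qed
  qed
  define D where "D j x = lim (\<lambda>k. dU k j x)" for j x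
  define DD where "DD i j x = lim (\<lambda>k. ddU k i j x)" for i j x
  have loc: "\<exists>\<delta> K. 0 < \<delta> \<and> ball x0 \<delta> \<subseteq> Q \<and> (\<forall>x\<in>ball x0 \<delta>. (\<lambda>k. U k x) \<longlonglongrightarrow> h x) \<and>
     (\<forall>x\<in>ball x0 \<delta>. \<forall>k\<ge>k0. \<forall>i j. (\<lambda>k. dU k j x) \<longlonglongrightarrow> D j x \<and> \<bar>dU k j x - D j x\<bar> \<le> K / 2 ^ k \<and> \<bar>ddU k i j x - DD i j x\<bar> \<le> K / 2 ^ k)"
    if x0: "x0 \<in> Q" for x0
  proof -
    obtain e where e: "0 < e" "cball x0 e \<subseteq> Q" using open_contains_cball[of Q] open_Q x0 by blast
    define \<delta> where "\<delta> = e / 3"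
    have \<delta>: "0 < \<delta>" using e by (simp add: \<delta>_def)
    have cb: "cball x (2 * \<delta>) \<subseteq> Q" if "x \<in> ball x0 \<delta>" for x
    proof
      fix z assume "z \<in> cball x (2 * \<delta>)"
      then have "dist x0 z \<le> e" using that dist_triangle[of x0 z x] by (simp add: \<delta>_def)
      then show "z \<in> Q" using e(2) by auto
    qed
    obtain K where K: "\<And>x k i j. cball x (2 * \<delta>) \<subseteq> Q \<Longrightarrow> k0 \<le> k \<Longrightarrow> \<bar>dU k j x - dU (Suc k) j x\<bar> \<le> K / 2 ^ k"
      "\<And>x k i j. cball x (2 * \<delta>) \<subseteq> Q \<Longrightarrow> k0 \<le> k \<Longrightarrow> \<bar>ddU k i j x - ddU (Suc k) i j x\<bar> \<le> K / 2 ^ k"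
      using diffs[OF \<delta>] by blast
    have sub: "ball x0 \<delta> \<subseteq> Q"
      proof
        fix z assume "z \<in> ball x0 \<delta>"
        from cb[OF this] show "z \<in> Q" using \<delta> by auto
      qed
    have Ul: "(\<lambda>k. U k x) \<longlonglongrightarrow> h x" if x: "x \<in> ball x0 \<delta>" for x
      proof -
        have "(\<lambda>k. (1 / 2) ^ k) \<longlonglongrightarrow> (0::real)" by (rule LIMSEQ_realpow_zero) auto
        then have "(\<lambda>k. L * (2 * M * m6 * ((1 / 2) ^ k) ^ 3 / (2 * \<delta>) ^ 6)) \<longlonglongrightarrow> L * (2 * M * m6 * 0 ^ 3 / (2 * \<delta>) ^ 6)"
          using \<delta> by (intro tendsto_intros) auto
        then have z: "(\<lambda>k. L * (2 * M * m6 * t k ^ 3 / (2 * \<delta>) ^ 6)) \<longlonglongrightarrow> 0" by (simp add: t_def power_one_over)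
        have "(\<lambda>k. U k x - h x) \<longlonglongrightarrow> 0"
        proof (rule Lim_null_comparison[OF _ z])
          show "\<forall>\<^sub>F k in sequentially. norm (U k x - h x) \<le> L * (2 * M * m6 * t k ^ 3 / (2 * \<delta>) ^ 6)"
            unfolding eventually_sequentially using Uh[OF cb[OF x]] \<delta> by (intro exI[of _ k0]) auto
        qed
        then show ?thesis by (rule LIM_zero_cancel)
      qed
    have q: "(\<lambda>k. dU k j x) \<longlonglongrightarrow> D j x \<and> \<bar>dU k j x - D j x\<bar> \<le> 2 * K / 2 ^ k \<and> \<bar>ddU k i j x - DD i j x\<bar> \<le> 2 * K / 2 ^ k"
      if x: "x \<in> ball x0 \<delta>" and k: "k0 \<le> k" for x k i j
      unfolding D_def DD_def
      using geometric_limit[of k0 "\<lambda>k. dU k j x" K k, OF K(1)[OF cb[OF x]] k]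
        geometric_limit(2)[of k0 "\<lambda>k. ddU k i j x" K k, OF K(2)[OF cb[OF x]] k] by blast
    show ?thesis
      by (intro exI[of _ \<delta>] exI[of _ "2 * K"] conjI ballI allI impI \<delta> sub Ul) (use q in blast)+
  qed
  show ?thesis
  proof (rule C2_onI[OF open_Q])
    fix x0 assume "x0 \<in> Q"
    then obtain \<delta> K where \<delta>: "0 < \<delta>" and l: "\<And>x. x \<in> ball x0 \<delta> \<Longrightarrow> (\<lambda>k. U k x) \<longlonglongrightarrow> h x"
      and l1: "\<And>x j. x \<in> ball x0 \<delta> \<Longrightarrow> (\<lambda>k. dU k j x) \<longlonglongrightarrow> D j x"
      and b1: "\<And>x k j. x \<in> ball x0 \<delta> \<Longrightarrow> k0 \<le> k \<Longrightarrow> \<bar>dU k j x - D j x\<bar> \<le> K / 2 ^ k"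
      and b2: "\<And>x k i j. x \<in> ball x0 \<delta> \<Longrightarrow> k0 \<le> k \<Longrightarrow> \<bar>ddU k i j x - DD i j x\<bar> \<le> K / 2 ^ k"
      using loc by (metis order_refl)
    show "(h has_derivative (\<lambda>v. \<Sum>j\<in>UNIV. v $ j * D j x0)) (at x0)"
      by (rule limit_has_derivative[OF \<delta> D1 b1 l])
    show "(D j has_derivative (\<lambda>v. \<Sum>i\<in>UNIV. v $ i * DD i j x0)) (at x0)" for j
      by (rule limit_has_derivative[OF \<delta> D2 b2 l1])
  next
    fix i j
    show "continuous_on Q (DD i j)"
      unfolding continuous_on_eq_continuous_at[OF open_Q]
    proof
      fix x0 assume "x0 \<in> Q"
      then obtain \<delta> K where \<delta>: "0 < \<delta>"
        and b2: "\<And>x k. x \<in> ball x0 \<delta> \<Longrightarrow> k0 \<le> k \<Longrightarrow> \<bar>ddU k i j x - DD i j x\<bar> \<le> K / 2 ^ k"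
        using loc by (metis order_refl)
      have "continuous_on (ball x0 \<delta>) (DD i j)"
      proof (rule uniform_limit_theorem[where F=sequentially and f="\<lambda>k. ddU k i j"])
        show "\<forall>\<^sub>F k in sequentially. continuous_on (ball x0 \<delta>) (ddU k i j)"
          using D3 by (intro always_eventually allI continuous_at_imp_continuous_on) auto
        show "uniform_limit (ball x0 \<delta>) (\<lambda>k. ddU k i j) (DD i j) sequentially"
          unfolding uniform_limit_iff
        proof (intro allI impI)
          fix e :: real assume e: "0 < e"
          have "(\<lambda>k. K * (1 / 2) ^ k) \<longlonglongrightarrow> K * 0" by (intro tendsto_mult_left LIMSEQ_realpow_zero) auto
          then have "eventually (\<lambda>k. K * (1 / 2) ^ k < e) sequentially" using e by (intro order_tendstoD) auto
          with eventually_ge_at_top[of k0] show "\<forall>\<^sub>F k in sequentially. \<forall>x\<in>ball x0 \<delta>. dist (ddU k i j x) (DD i j x) < e"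
          proof eventually_elim
            case (elim k)
            show ?case
            proof
              fix x assume "x \<in> ball x0 \<delta>"
              from b2[OF this elim(1)] show "dist (ddU k i j x) (DD i j x) < e"
                using elim(2) by (simp add: dist_real_def power_one_over)
            qed
          qed
        qed
      qed simp
      then show "isCont (DD i j) x0" using \<delta> by (simp add: continuous_on_eq_continuous_at)
    qed
  qed
qed

text \<open>For small \<open>s\<close>, \<open>Gop s h x\<close> is expanded in two ways: by
  Taylor's formula, and by comparison with \<open>P k h x = exp (- \<mu> * s / 2) * h x\<close>.
  After division by \<open>s\<close> only the equation remains in the limit.\<close>

lemma P_eigenfunction_pde:
  assumes h: "bm h" and P: "\<And>k x. k0 \<le> k \<Longrightarrow> P k h x = exp (- \<mu> / 2 / 2 ^ k) * h x" and x: "x \<in> Q"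
  shows "Lop h x = - \<mu> * h x"
proof -
  obtain M where M: "0 \<le> M" "\<And>x. \<bar>h x\<bar> \<le> M" using bm_bounded[OF h] by metis
  obtain \<delta> where \<delta>: "0 < \<delta>" "cball x \<delta> \<subseteq> Q" using open_contains_cball[of Q] open_Q x by blast
  \<comment> \<open>Collects the terms of order \<open>s ^ 2\<close>, from the exit error and from
    linearising the exponential.\<close>
  define B where "B = 2 * M * m6 / \<delta> ^ 6 + 3 * (\<mu> / 2)\<^sup>2 * M"
  have C2: "C2_on Q h" using P_eigenfunction_C2[OF h P] .
  have "\<bar>Lop h x + \<mu> * h x\<bar> \<le> 0 + e" if e: "0 < e" for e
  proof -
    obtain s0 where s0: "0 < s0" "\<And>s y. 0 < s \<Longrightarrow> s \<le> s0 \<Longrightarrow> y \<in> {x} \<Longrightarrow> \<bar>Gop s h y - h y - s / 2 * Lop h y\<bar> \<le> e / 4 * s"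
      using Gop_expansion[OF C2 h, of "{x}" "e / 4"] x e by (auto simp: less_divide_eq)
    have B0: "0 \<le> B" using M m6_nonneg \<delta> by (simp add: B_def)
    define s1 where "s1 = min s0 (min (1 / (\<bar>\<mu>\<bar> + 1)) (e / (4 * (B + 1))))"
    have s1: "0 < s1" using s0 e B0 by (simp add: s1_def)
    have "(\<lambda>k. (1 / 2) ^ k) \<longlonglongrightarrow> (0::real)" by (rule LIMSEQ_realpow_zero) auto
    then have "eventually (\<lambda>k. (1 / 2) ^ k < s1) sequentially" using s1 by (rule order_tendstoD)
    then obtain k1 where k1: "\<And>k. k1 \<le> k \<Longrightarrow> (1 / 2) ^ k < s1" by (auto simp: eventually_sequentially)
    define k where "k = max k0 k1"
    define s :: real where "s = 1 / 2 ^ k"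
    have s: "0 < s" "s \<le> s1" "s \<le> 1" using k1[of k] by (auto simp: s_def k_def power_one_over)
    have 1: "\<bar>Gop s h x - h x - s / 2 * Lop h x\<bar> \<le> e / 4 * s" using s by (intro s0(2)) (auto simp: s1_def)
    have "\<bar>Gop s h x - exp (- \<mu> * s / 2) * h x\<bar> \<le> 2 * M * m6 * s ^ 3 / \<delta> ^ 6"
      using P_exit[OF \<delta>(2,1) h M(2), of k] P[of k x] by (simp add: s_def k_def mult.commute[of 2])
    also have "\<dots> \<le> 2 * M * m6 * s\<^sup>2 / \<delta> ^ 6"
      using s M m6_nonneg \<delta> by (intro divide_right_mono mult_left_mono power_decreasing) auto
    finally have 2: "\<bar>Gop s h x - exp (- \<mu> * s / 2) * h x\<bar> \<le> 2 * M * m6 / \<delta> ^ 6 * s\<^sup>2" by simp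
    have "\<bar>\<mu>\<bar> * s \<le> \<bar>\<mu>\<bar> * (1 / (\<bar>\<mu>\<bar> + 1))" using s by (intro mult_left_mono) (auto simp: s1_def)
    also have "\<dots> \<le> 1" by simp
    finally have "\<bar>- \<mu> * s / 2\<bar> \<le> 1" using s by (simp add: abs_mult)
    then have "\<bar>exp (- \<mu> * s / 2) - (1 + - \<mu> * s / 2)\<bar> \<le> 3 * (- \<mu> * s / 2)\<^sup>2" by (rule exp_linear_approx)
    then have "\<bar>exp (- \<mu> * s / 2) - (1 + - \<mu> * s / 2)\<bar> * \<bar>h x\<bar> \<le> 3 * (- \<mu> * s / 2)\<^sup>2 * M"
      using M by (intro mult_mono) auto
    also have "\<dots> = 3 * (\<mu> / 2)\<^sup>2 * M * s\<^sup>2" by (simp add: power2_eq_square)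
    finally have 3: "\<bar>exp (- \<mu> * s / 2) * h x - (1 + - \<mu> * s / 2) * h x\<bar> \<le> 3 * (\<mu> / 2)\<^sup>2 * M * s\<^sup>2"
      by (simp add: abs_mult[symmetric] left_diff_distrib)
    have "s / 2 * \<bar>Lop h x + \<mu> * h x\<bar> = \<bar>s / 2 * (Lop h x + \<mu> * h x)\<bar>" using s by (simp add: abs_mult)
    also have "s / 2 * (Lop h x + \<mu> * h x) = (exp (- \<mu> * s / 2) * h x - (1 + - \<mu> * s / 2) * h x) + (Gop s h x - exp (- \<mu> * s / 2) * h x) - (Gop s h x - h x - s / 2 * Lop h x)"
      by (simp add: algebra_simps)
    also have "\<bar>\<dots>\<bar> \<le> B * s\<^sup>2 + e / 4 * s" using 1 2 3 unfolding B_def distrib_right by linarith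
    also have "B * s\<^sup>2 \<le> e / 4 * s"
    proof -
      have "B * s \<le> (B + 1) * (e / (4 * (B + 1)))" using s B0 by (intro mult_mono) (auto simp: s1_def)
      also have "\<dots> = e / 4" using B0 by (simp add: field_simps add_nonneg_eq_0_iff)
      finally have "B * s * s \<le> e / 4 * s" using s by (intro mult_right_mono) auto
      then show ?thesis by (simp add: power2_eq_square mult.assoc)
    qed
    finally have "s / 2 * \<bar>Lop h x + \<mu> * h x\<bar> \<le> s / 2 * e" by (simp add: mult.commute)
    then show ?thesis using s by (simp add: mult_le_cancel_left_pos)
  qed
  then have "\<bar>Lop h x + \<mu> * h x\<bar> \<le> 0" by (rule field_le_epsilon)
  then show ?thesis by simp
qed

end

section \<open>The ground state\<close>

lemma zero_extension_continuous:
  fixes u :: "'a::topological_space \<Rightarrow> real"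
  assumes "open Q" "continuous_on (closure Q) u" "\<And>x. x \<in> frontier Q \<Longrightarrow> u x = 0"
  shows "continuous_on UNIV (\<lambda>x. indicator Q x * u x)"
proof -
  have eq: "indicator Q x * u x = u x" if "x \<in> closure Q" for x
    using that assms(1,3) by (cases "x \<in> Q") (auto simp: frontier_def interior_open)
  have "continuous_on (closure Q) (\<lambda>x. indicator Q x * u x)"
    using assms(2) by (rule continuous_on_eq) (simp add: eq)
  moreover have "continuous_on (- Q) (\<lambda>x. indicator Q x * u x)"
    by (rule continuous_on_eq[where f="\<lambda>_. 0"]) auto
  ultimately have "continuous_on (closure Q \<union> - Q) (\<lambda>x. indicator Q x * u x)"
    using assms(1) by (intro continuous_on_closed_Un) auto
  moreover have "closure Q \<union> - Q = UNIV" using closure_subset[of Q] by auto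
  ultimately show ?thesis by simp
qed

context elliptic_domain begin

lemma P_funpow_eigen:
  assumes u: "bm u" and P: "\<And>x. P k u x = \<theta> * u x"
  shows "(P k ^^ n) u x = \<theta> ^ n * u x"
proof (induction n arbitrary: x)
  case (Suc n)
  have "(P k ^^ n) u = (\<lambda>x. \<theta> ^ n * u x)" using Suc by auto
  then have "(P k ^^ Suc n) u x = P k (\<lambda>x. \<theta> ^ n * u x) x" by simp
  also have "\<dots> = \<theta> ^ n * P k u x" by (rule opc_cmult[OF P_opc u])
  finally show ?case by (simp add: P)
qed simp

lemma P_funpow_abs_le:
  assumes u: "bm u" and C: "\<And>y. \<bar>u y\<bar> \<le> C"
  shows "\<bar>(P k ^^ n) u x\<bar> \<le> C * (P k ^^ n) (\<lambda>_. 1) x"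
proof (induction n arbitrary: x)
  case 0 then show ?case using C by simp
next
  case (Suc n)
  have 1: "bm ((P k ^^ n) u)" and 2: "bm ((P k ^^ n) (\<lambda>_. 1))" by (auto intro!: opc_funpow_bm[OF P_opc] u)
  have "\<bar>P k ((P k ^^ n) u) x\<bar> \<le> P k (\<lambda>y. \<bar>(P k ^^ n) u y\<bar>) x" by (rule opc_abs[OF P_opc 1])
  also have "\<dots> \<le> P k (\<lambda>y. C * (P k ^^ n) (\<lambda>_. 1) y) x"
    using Suc by (intro opc_mono[OF P_opc] bm_abs bm_cmult 1 2)
  also have "\<dots> = C * P k ((P k ^^ n) (\<lambda>_. 1)) x" by (rule opc_cmult[OF P_opc 2])
  finally show ?case by simp
qed

text \<open>The modulus of \<open>u\<close> is at most a constant, so positivity bounds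
  \<open>\<theta> ^ n * |u x|\<close> by a multiple of \<open>(P k ^^ n) 1\<close> at
  \<open>x\<close>, which grows no faster than \<open>\<rho> ^ n\<close>.\<close>

lemma eigenvalue_le:
  assumes u: "bm u" "u x \<noteq> 0" and P: "\<And>x. P k u x = \<theta> * u x" and pos: "0 < \<theta>" "0 < \<rho>"
    and lim: "(\<lambda>n. (P k ^^ n) (\<lambda>_. 1) x / \<rho> ^ n) \<longlonglongrightarrow> h"
  shows "\<theta> \<le> \<rho>"
proof (rule ccontr)
  assume "\<not> \<theta> \<le> \<rho>"
  then have q: "1 < \<theta> / \<rho>" using pos by simp
  obtain C where C: "0 \<le> C" "\<And>y. \<bar>u y\<bar> \<le> C" using bm_bounded[OF u(1)] by metis
  have le: "(\<theta> / \<rho>) ^ n * \<bar>u x\<bar> \<le> C * ((P k ^^ n) (\<lambda>_. 1) x / \<rho> ^ n)" for n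
    using P_funpow_abs_le[OF u(1) C(2), where k=k and n=n and x=x] pos unfolding P_funpow_eigen[OF u(1) P]
    by (simp add: abs_mult power_divide divide_right_mono)
  have "(\<lambda>n. C * ((P k ^^ n) (\<lambda>_. 1) x / \<rho> ^ n)) \<longlonglongrightarrow> C * h" by (intro tendsto_intros lim)
  then have "Bseq (\<lambda>n. C * ((P k ^^ n) (\<lambda>_. 1) x / \<rho> ^ n))" by (intro convergent_imp_Bseq convergentI)
  then obtain B where B: "\<And>n. \<bar>C * ((P k ^^ n) (\<lambda>_. 1) x / \<rho> ^ n)\<bar> \<le> B" unfolding Bseq_def by auto
  obtain n where "B / \<bar>u x\<bar> < (\<theta> / \<rho>) ^ n" using real_arch_pow[OF q] by blast
  then have "B < (\<theta> / \<rho>) ^ n * \<bar>u x\<bar>" using u(2) by (simp add: divide_less_eq)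
  then show False using le[of n] B[of n] by linarith
qed

text \<open>From every point of the bounded set \<open>Q\<close>, a sufficiently long Gaussian step
  in one fixed direction leaves \<open>Q\<close>, and such steps fill a ball of positive
  measure.\<close>

lemma P_one_uniform_bound:
  obtains c where "0 < c" "c < 1" "\<And>x. P k (\<lambda>_. 1) x \<le> c"
proof -
  define t :: real where "t = 1 / 2 ^ k"
  have t: "0 < t" by (simp add: t_def)
  obtain D where D: "0 < D" "\<And>x. x \<in> Q \<Longrightarrow> norm x \<le> D" using bounded_Q unfolding bounded_pos by auto
  obtain A where A: "0 < A" "\<And>z. norm (b z) \<le> A * norm z" using linear_bounded_pos[OF linear_b] by blast
  \<comment> \<open>After scaling by \<open>sqrt t\<close> this exceeds the bound
    \<open>2 * D\<close> on displacements within \<open>Q\<close>; the summand \<open>A\<close> is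
    the reserve for the unit ball around \<open>a w\<close>.\<close>
  obtain w :: "real^'d" where w: "norm w = 3 * D / sqrt t + A"
    using vector_choose_size[of "3 * D / sqrt t + A"] D A t by (metis add_nonneg_nonneg divide_nonneg_nonneg less_imp_le mult_nonneg_nonneg real_sqrt_ge_zero zero_le_numeral)
  define E where "E = ball (a w) 1"
  have far: "x + sqrt t *\<^sub>R b z \<notin> Q" if x: "x \<in> Q" and z: "z \<in> E" for x z
  proof
    assume "x + sqrt t *\<^sub>R b z \<in> Q"
    then have 1: "norm (sqrt t *\<^sub>R b z) \<le> 2 * D"
      using D(2)[OF x] D(2)[of "x + sqrt t *\<^sub>R b z"] norm_triangle_ineq4[of "x + sqrt t *\<^sub>R b z" x] by simp
    have "norm (w - b z) = norm (b (a w - z))" by (simp add: linear_diff[OF linear_b])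
    also have "\<dots> \<le> A * norm (a w - z)" by (rule A)
    also have "\<dots> \<le> A * 1" using z A(1) by (intro mult_left_mono) (auto simp: E_def dist_norm)
    finally have "norm w - norm (b z) \<le> A" using norm_triangle_ineq2[of w "b z"] by linarith
    then have "3 * D / sqrt t \<le> norm (b z)" using w by linarith
    then have "3 * D \<le> sqrt t * norm (b z)" using t by (simp add: divide_le_eq mult.commute)
    then show False using 1 D(1) t by simp
  qed
  define c0 where "c0 = measure gauss E"
  have c0: "0 < c0" unfolding c0_def E_def by (rule gauss_ball_pos) simp
  have Em[measurable]: "E \<in> sets borel" by (simp add: E_def)
  have bound: "P k (\<lambda>_. 1) x \<le> 1 - c0" if x: "x \<in> Q" for x
  proof -
    have "P k (\<lambda>_. 1) x = P k (\<lambda>x. indicator Q x * 1) x" by (simp only: opc_ind[OF P_opc bm_const])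
    also have "\<dots> \<le> Gop t (\<lambda>x. indicator Q x * 1) x" unfolding t_def by (intro opc_le[OF P_opc] bm_indicator_mult Q_measurable bm_const) auto
    also have "\<dots> \<le> (\<integral>z. 1 - indicator E z \<partial>gauss)"
      unfolding Gop_def
    proof (rule integral_mono)
      show "integrable gauss (\<lambda>z. indicator Q (x + sqrt t *\<^sub>R b z) * 1 :: real)"
        by (rule integrable_shift[OF bm_indicator_mult[OF Q_measurable bm_const]])
      show "integrable gauss (\<lambda>z. 1 - indicator E z :: real)" by (intro integrable_gauss_bm bm_diff bm_const bm_indicator Em)
      show "indicator Q (x + sqrt t *\<^sub>R b z) * 1 \<le> (1 - indicator E z :: real)" for z using far[OF x, of z] by (auto simp: indicator_def)
    qed
    also have "\<dots> = 1 - c0"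
      using integrable_gauss_bm[OF bm_indicator[OF Em]] by (simp add: c0_def)
    finally show ?thesis .
  qed
  have "c0 \<le> 1" unfolding c0_def by (rule gauss.prob_le_1)
  show ?thesis
  \<comment> \<open>The maximum keeps the constant positive even when \<open>c0 = 1\<close>.\<close>
  proof (rule that[of "max (1 - c0) (1/2)"])
    show "P k (\<lambda>_. 1) x \<le> max (1 - c0) (1/2)" for x
      using bound[of x] opc_off[OF P_opc bm_const[of 1], of x k] by (cases "x \<in> Q") auto
  qed (use c0 in auto)
qed

lemma P_funpow_one_le:
  assumes "\<And>x. P k (\<lambda>_. 1) x \<le> c" "0 \<le> c"
  shows "(P k ^^ n) (\<lambda>_. 1) x \<le> c ^ n"
proof (induction n arbitrary: x)
  case (Suc n)
  have "P k ((P k ^^ n) (\<lambda>_. 1)) x \<le> P k (\<lambda>_. c ^ n * 1) x"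
    using Suc by (intro opc_mono[OF P_opc] opc_funpow_bm[OF P_opc] bm_const) auto
  also have "\<dots> = c ^ n * P k (\<lambda>_. 1) x" by (rule opc_cmult[OF P_opc bm_const])
  also have "\<dots> \<le> c ^ n * c" using assms by (intro mult_left_mono) auto
  finally show ?case by (simp add: mult.commute)
qed simp

text \<open>Lebesgue measure on \<open>Q\<close>, kept as a finite measure on all Borel sets so that
  functions on the whole space need no restriction.\<close>

definition muQ :: "(real^'d) measure" where
  "muQ = density lborel (\<lambda>x. ennreal (indicator Q x))"

lemma sets_muQ [simp]: "sets muQ = sets borel"
  by (simp add: muQ_def)

lemma finite_muQ: "finite_measure muQ"
proof
  have "emeasure muQ (space muQ) = emeasure lborel Q"
    unfolding muQ_def by (subst emeasure_density) (auto simp: ennreal_indicator)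
  also have "\<dots> < \<infinity>" by (rule emeasure_bounded_finite[OF bounded_Q])
  finally show "emeasure muQ (space muQ) \<noteq> \<infinity>" by simp
qed

lemma integral_muQ: "bm f \<Longrightarrow> (\<integral>x. f x \<partial>muQ) = (\<integral>x. indicator Q x * f x \<partial>lborel)"
  unfolding muQ_def by (subst integral_real_density) auto

lemma P_symm_muQ:
  assumes f: "bm f" and g: "bm g"
  shows "(\<integral>x. P k f x * g x \<partial>muQ) = (\<integral>x. f x * P k g x \<partial>muQ)"
proof -
  have Pf: "bm (P k f)" and Pg: "bm (P k g)" by (auto intro: opc_bm[OF P_opc] f g)
  have "(\<integral>x. P k f x * g x \<partial>muQ) = (\<integral>x. P k f x * (indicator Q x * g x) \<partial>lborel)"
    by (simp add: integral_muQ bm_mult Pf g mult_ac)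
  also have "\<dots> = (\<integral>x. f x * P k (\<lambda>x. indicator Q x * g x) x \<partial>lborel)"
    by (rule symmD[OF P_symm f bm_indicator_mult[OF Q_measurable g]])
  also have "\<dots> = (\<integral>x. f x * (indicator Q x * P k g x) \<partial>lborel)"
    unfolding opc_ind[OF P_opc g] using opc_off[OF P_opc g] by (intro Bochner_Integration.integral_cong) (auto simp: indicator_def)
  also have "\<dots> = (\<integral>x. f x * P k g x \<partial>muQ)" by (simp add: integral_muQ bm_mult Pg f mult_ac)
  finally show ?thesis .
qed

text \<open>Over a short time the exit estimate leaves a survival probability of at least
  \<open>1 / 2\<close> on a ball inside \<open>Q\<close>. This is the origin of the initial level
  \<open>k0\<close>.\<close>

lemma P_one_mass:
  assumes "Q \<noteq> {}" obtains k0 where "\<And>k. k0 \<le> k \<Longrightarrow> 0 < (\<integral>x. P k (\<lambda>_. 1) x \<partial>muQ)"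
proof -
  obtain x0 where x0: "x0 \<in> Q" using assms by auto
  obtain e where e: "0 < e" "cball x0 e \<subseteq> Q" using open_contains_cball[of Q] open_Q x0 by blast
  define \<delta> where "\<delta> = e / 2"
  have \<delta>: "0 < \<delta>" using e by (simp add: \<delta>_def)
  have cb: "cball x \<delta> \<subseteq> Q" if "x \<in> ball x0 \<delta>" for x
  proof
    fix z assume "z \<in> cball x \<delta>"
    then have "dist x0 z \<le> e" using that dist_triangle[of x0 z x] by (simp add: \<delta>_def)
    then show "z \<in> Q" using e(2) by auto
  qed
  have "(\<lambda>k. (1 / 2) ^ k) \<longlonglongrightarrow> (0::real)" by (rule LIMSEQ_realpow_zero) auto
  then have "(\<lambda>k. 1 * m6 * ((1 / 2) ^ k) ^ 3 / \<delta> ^ 6) \<longlonglongrightarrow> 1 * m6 * 0 ^ 3 / \<delta> ^ 6" using \<delta> by (intro tendsto_intros) auto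
  then have "eventually (\<lambda>k. 1 * m6 * ((1 / 2) ^ k) ^ 3 / \<delta> ^ 6 < 1 / 2) sequentially" by (intro order_tendstoD) auto
  then obtain k0 where k0: "\<And>k. k0 \<le> k \<Longrightarrow> 1 * m6 * (1 / 2 ^ k) ^ 3 / \<delta> ^ 6 < 1 / 2"
    by (auto simp: eventually_sequentially power_one_over)
  show ?thesis
  proof (rule that)
    fix k assume k: "k0 \<le> k"
    have low: "1 / 2 * indicator (ball x0 \<delta>) x \<le> indicator Q x * P k (\<lambda>_. 1) x" for x
    proof (cases "x \<in> ball x0 \<delta>")
      case True
      then have "x \<in> Q" using cb[OF True] \<delta> by auto
      moreover have "1 - P k (\<lambda>_. 1) x \<le> 1 * m6 * (1 / 2 ^ k) ^ 3 / \<delta> ^ 6"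
        using P_exit_nonneg[OF cb[OF True] \<delta> bm_const[of 1], of 1 k] by simp
      then have "1 / 2 \<le> P k (\<lambda>_. 1) x" using k0[OF k] by linarith
      ultimately show ?thesis using True by simp
    next
      case False then show ?thesis using opc_nonneg[OF P_opc bm_const[of 1], of k x] by simp
    qed
    have b1: "bm (\<lambda>x. indicator Q x * P k (\<lambda>_. 1) x)" by (intro bm_indicator_mult Q_measurable opc_bm[OF P_opc] bm_const)
    have "0 < 1 / 2 * measure lborel (ball x0 \<delta>)" using content_ball_pos[OF \<delta>, of x0] by simp
    also have "\<dots> = (\<integral>x. 1 / 2 * indicator (ball x0 \<delta>) x \<partial>lborel)" by simp
    also have "\<dots> \<le> (\<integral>x. indicator Q x * P k (\<lambda>_. 1) x \<partial>lborel)"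
    proof (rule integral_mono)
      show "integrable lborel (\<lambda>x. 1 / 2 * indicator (ball x0 \<delta>) x :: real)"
        by (rule integrable_bounded_support[where A="ball x0 \<delta>", OF bm_cmult[OF bm_indicator]]) auto
      show "integrable lborel (\<lambda>x. indicator Q x * P k (\<lambda>_. 1) x)"
        by (rule integrable_bounded_support[OF b1 bounded_Q Q_measurable]) simp
    qed (rule low)
    also have "\<dots> = (\<integral>x. P k (\<lambda>_. 1) x \<partial>muQ)" by (rule integral_muQ[symmetric]) (intro opc_bm[OF P_opc] bm_const)
    finally show "0 < (\<integral>x. P k (\<lambda>_. 1) x \<partial>muQ)" .
  qed
qed

lemma integral_pos_witness:
  fixes h :: "real^'d \<Rightarrow> real"
  assumes "0 < (\<integral>x. h x \<partial>muQ)" obtains x where "h x \<noteq> 0"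
proof (rule ccontr)
  assume "\<not> thesis"
  then have "h = (\<lambda>_. 0)" using that by blast
  then show False using assms by simp
qed

text \<open>The operator of the next level, at half the time, serves as the symmetric square root of
  \<open>P k\<close>.\<close>

lemma level_principal:
  assumes "0 < (\<integral>x. P k (\<lambda>_. 1) x \<partial>muQ)"
  obtains \<rho> h where "0 < \<rho>" "\<rho> < 1" "bm h" "\<And>x. 0 \<le> h x" "0 < (\<integral>x. h x \<partial>muQ)"
    "uniform_limit UNIV (\<lambda>n x. (P k ^^ n) (\<lambda>_. 1) x / \<rho> ^ n) h sequentially"
    "\<And>x. P k h x = \<rho> * h x"
proof -
  obtain C where C: "0 < C" "\<And>T f x. opc (1 / 2 ^ k) T \<Longrightarrow> bm f \<Longrightarrow> \<bar>T f x\<bar> \<le> C * sqrt (\<integral>x. indicator Q x * (f x)\<^sup>2 \<partial>lborel)"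
    by (rule opc_L2_bound[of "1 / 2 ^ k"]; simp; blast)
  note O = P_opc[of "Suc k"]
  \<comment> \<open>The semigroup law holds on bounded measurable functions. There \<open>PP\<close>
    agrees with \<open>P k\<close>, while by definition it is \<open>R\<close> applied
    twice.\<close>
  define R where "R f = (if bm f then P (Suc k) f else f)" for f
  define PP where "PP f = R (R f)" for f
  have R: "R f = P (Suc k) f" if "bm f" for f using that by (simp add: R_def)
  have PP: "PP f = P k f" if "bm f" for f
    using that R[OF opc_bm[OF O that]] P_semigroup[OF that, of k] by (auto simp: PP_def R)
  have it: "(PP ^^ n) (\<lambda>_. 1) = (P k ^^ n) (\<lambda>_. 1)" for n
    by (induction n) (auto simp: PP[OF opc_funpow_bm[OF P_opc bm_const]])
  obtain \<rho> h where rh: "0 < \<rho>" "\<rho> \<le> 1" "bm h" "\<And>x. 0 \<le> h x" "0 < (\<integral>x. h x \<partial>muQ)"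
    "uniform_limit UNIV (\<lambda>n x. (PP ^^ n) (\<lambda>_. 1) x / \<rho> ^ n) h sequentially"
    "\<And>x. PP h x = \<rho> * h x"
  proof (rule principal_eigenfunction[of muQ R PP C])
    show "finite_measure muQ" by (rule finite_muQ)
    show "sets muQ = sets borel" by simp
    show "bm (R f)" if "bm f" for f using that by (simp add: R opc_bm[OF O])
    show "R (\<lambda>x. f x + c * g x) = (\<lambda>x. R f x + c * R g x)" if "bm f" "bm g" for f g c
      using that by (simp add: R bm_lin opc_lin[OF O])
    show "0 \<le> R f x" if "bm f" "\<And>y. 0 \<le> f y" for f x using that by (simp add: R opc_nonneg[OF O])
    show "R (\<lambda>_. 1) x \<le> 1" for x using opc_le[OF O bm_const[of 1], of x] by (simp add: R)
    show "(\<integral>x. R f x * g x \<partial>muQ) = (\<integral>x. f x * R g x \<partial>muQ)" if "bm f" "bm g" for f g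
      using P_symm_muQ[OF that] that by (simp add: R)
    show "PP = (\<lambda>f. R (R f))" by (simp add: PP_def[abs_def])
    show "\<bar>PP f x\<bar> \<le> C * sqrt (\<integral>x. (f x)\<^sup>2 \<partial>muQ)" if f: "bm f" for f x
      using C(2)[OF P_opc f] f by (simp add: PP integral_muQ power2_eq_square bm_mult)
    show "0 < (\<integral>x. PP (\<lambda>_. 1) x \<partial>muQ)" using assms by (simp add: PP)
  qed blast
  have Ph: "P k h x = \<rho> * h x" for x using rh(7)[of x] PP[OF rh(3)] by simp
  have ul: "uniform_limit UNIV (\<lambda>n x. (P k ^^ n) (\<lambda>_. 1) x / \<rho> ^ n) h sequentially" using rh(6) by (simp add: it)
  \<comment> \<open>With \<open>\<rho> = 1\<close> the normalised iterates would be at most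
    \<open>c ^ n\<close>, forcing \<open>h\<close> to vanish. The strict inequality makes
    \<open>\<mu>\<close> positive later.\<close>
  have "\<rho> < 1"
  proof -
    obtain c where c: "0 < c" "c < 1" "\<And>x. P k (\<lambda>_. 1) x \<le> c" using P_one_uniform_bound[of k] by blast
    obtain x where x: "h x \<noteq> 0" using integral_pos_witness[OF rh(5)] by blast
    have "(\<lambda>n. (P k ^^ n) (\<lambda>_. 1) x / \<rho> ^ n) \<longlonglongrightarrow> h x" using tendsto_uniform_limitI[OF ul] by simp
    show ?thesis
    proof (rule ccontr)
      assume "\<not> \<rho> < 1"
      then have r1: "\<rho> = 1" using rh(2) by simp
      have z: "(\<lambda>n. c ^ n) \<longlonglongrightarrow> 0" using c by (intro LIMSEQ_realpow_zero) auto
      have "h x \<le> 0"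
      proof (rule LIMSEQ_le)
        show "(\<lambda>n. (P k ^^ n) (\<lambda>_. 1) x / \<rho> ^ n) \<longlonglongrightarrow> h x" by fact
        show "(\<lambda>n. c ^ n) \<longlonglongrightarrow> 0" by (rule z)
        show "\<exists>N. \<forall>n\<ge>N. (P k ^^ n) (\<lambda>_. 1) x / \<rho> ^ n \<le> c ^ n"
          using P_funpow_one_le[OF c(3)] c(1) r1 by auto
      qed
      then show False using rh(4)[of x] x by simp
    qed
  qed
  then show ?thesis using that[OF rh(1) _ rh(3,4,5) ul Ph] by blast
qed

text \<open>Even iterates of \<open>P (k + 1)\<close> are iterates of \<open>P k\<close>. The growth
  rate and the limit are unique, so passing from level \<open>k + 1\<close> to level
  \<open>k\<close> squares \<open>\<rho>\<close> and keeps \<open>h\<close>.\<close>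

lemma ground_state:
  assumes "Q \<noteq> {}"
  obtains k0 \<mu> h where "0 < \<mu>" "bm h" "\<And>x. 0 \<le> h x" "0 < (\<integral>x. h x \<partial>muQ)"
    "\<And>k. k0 \<le> k \<Longrightarrow> uniform_limit UNIV (\<lambda>n x. (P k ^^ n) (\<lambda>_. 1) x / exp (- \<mu> / 2 / 2 ^ k) ^ n) h sequentially"
    "\<And>k x. k0 \<le> k \<Longrightarrow> P k h x = exp (- \<mu> / 2 / 2 ^ k) * h x"
proof -
  obtain k0 where k0: "\<And>k. k0 \<le> k \<Longrightarrow> 0 < (\<integral>x. P k (\<lambda>_. 1) x \<partial>muQ)" using P_one_mass[OF assms] by blast
  define good where "good k \<rho> h \<longleftrightarrow> 0 < \<rho> \<and> \<rho> < 1 \<and> bm h \<and> (\<forall>x. 0 \<le> h x) \<and> 0 < (\<integral>x. h x \<partial>muQ) \<and>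
    uniform_limit UNIV (\<lambda>n x. (P k ^^ n) (\<lambda>_. 1) x / \<rho> ^ n) h sequentially \<and> (\<forall>x. P k h x = \<rho> * h x)" for k \<rho> h
  have ex: "\<exists>\<rho> h. good k \<rho> h" if "k0 \<le> k" for k
    using level_principal[OF k0[OF that]] unfolding good_def by (smt (verit, best))
  have step: "\<rho> = \<rho>' * \<rho>' \<and> h = h'" if g: "good k \<rho> h" and g': "good (Suc k) \<rho>' h'" for k \<rho> h \<rho>' h'
  proof -
    have A: "(P k ^^ n) (\<lambda>_. 1) = (P (Suc k) ^^ (2 * n)) (\<lambda>_. 1)" for n
    proof (induction n)
      case (Suc n)
      have "bm ((P (Suc k) ^^ (2 * n)) (\<lambda>_. 1))" by (intro opc_funpow_bm[OF P_opc] bm_const)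
      from P_semigroup[OF this, of k] show ?case by (simp add: Suc fun_eq_iff)
    qed simp
    have "uniform_limit UNIV (\<lambda>n x. (P k ^^ n) (\<lambda>_. 1) x / \<rho> ^ n) h sequentially" using g by (simp add: good_def)
    then have l: "(\<lambda>n. (P k ^^ n) (\<lambda>_. 1) x / \<rho> ^ n) \<longlonglongrightarrow> h x" for x
      by (rule tendsto_uniform_limitI) simp
    have "uniform_limit UNIV (\<lambda>n x. (P (Suc k) ^^ n) (\<lambda>_. 1) x / \<rho>' ^ n) h' sequentially" using g' by (simp add: good_def)
    then have l0: "(\<lambda>n. (P (Suc k) ^^ n) (\<lambda>_. 1) x / \<rho>' ^ n) \<longlonglongrightarrow> h' x" for x
      by (rule tendsto_uniform_limitI) simp
    have "strict_mono (\<lambda>n::nat. 2 * n)" by (simp add: strict_mono_def)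
    from LIMSEQ_subseq_LIMSEQ[OF l0 this]
    have l': "(\<lambda>n. (P k ^^ n) (\<lambda>_. 1) x / (\<rho>' * \<rho>') ^ n) \<longlonglongrightarrow> h' x" for x
      unfolding A by (simp add: comp_def power_mult power2_eq_square)
    have pos: "0 < \<rho>" "0 < \<rho>'" using g g' by (auto simp: good_def)
    have "0 < (\<integral>x. h' x \<partial>muQ)" "0 < (\<integral>x. h x \<partial>muQ)" using g g' by (auto simp: good_def)
    then obtain x' x where x': "h' x' \<noteq> 0" and x: "h x \<noteq> 0" by (meson integral_pos_witness)
    \<comment> \<open>\<open>h'\<close> is a nonzero eigenfunction of \<open>P k\<close>, and its
      eigenvalue cannot exceed the growth rate.\<close>
    have "\<rho>' * \<rho>' \<le> \<rho>"
    proof (rule eigenvalue_le[where u=h' and x=x' and k=k and h="h x'"])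
      show "h' x' \<noteq> 0" by (rule x')
      show "(\<lambda>n. (P k ^^ n) (\<lambda>_. 1) x' / \<rho> ^ n) \<longlonglongrightarrow> h x'" by (rule l)
      show "bm h'" using g' by (simp add: good_def)
      have "P (Suc k) h' = (\<lambda>x. \<rho>' * h' x)" using g' by (auto simp: good_def)
      then show "P k h' x = \<rho>' * \<rho>' * h' x" for x
        using P_semigroup[OF \<open>bm h'\<close>, of k x] opc_cmult[OF P_opc \<open>bm h'\<close>, of "Suc k" \<rho>' x] by simp
    qed (use pos in auto)
    \<comment> \<open>If the finer level had the smaller rate, the iterates normalised by
      \<open>\<rho>\<close> would tend to 0, contrary to \<open>h x\<close> being nonzero.\<close>
    moreover have "\<not> \<rho>' * \<rho>' < \<rho>"
    proof
      assume lt: "\<rho>' * \<rho>' < \<rho>"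
      have "(\<lambda>n. ((\<rho>' * \<rho>') / \<rho>) ^ n) \<longlonglongrightarrow> 0" using lt pos by (intro LIMSEQ_realpow_zero) auto
      from tendsto_mult[OF l'[of x] this]
      have "(\<lambda>n. (P k ^^ n) (\<lambda>_. 1) x / (\<rho>' * \<rho>') ^ n * ((\<rho>' * \<rho>') / \<rho>) ^ n) \<longlonglongrightarrow> 0" by simp
      moreover have "(P k ^^ n) (\<lambda>_. 1) x / (\<rho>' * \<rho>') ^ n * ((\<rho>' * \<rho>') / \<rho>) ^ n = (P k ^^ n) (\<lambda>_. 1) x / \<rho> ^ n" for n
        using pos by (simp add: power_divide)
      ultimately have "(\<lambda>n. (P k ^^ n) (\<lambda>_. 1) x / \<rho> ^ n) \<longlonglongrightarrow> 0" by simp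
      then show False using LIMSEQ_unique[OF l[of x]] x by blast
    qed
    ultimately have r: "\<rho> = \<rho>' * \<rho>'" by simp
    have "h x = h' x" for x using LIMSEQ_unique[OF l[of x]] l'[of x] r by blast
    then show ?thesis using r by auto
  qed
  obtain \<rho>0 h where g0: "good k0 \<rho>0 h" using ex[of k0] by blast
  \<comment> \<open>Solves \<open>exp (- \<mu> / 2 / 2 ^ k0) = \<rho>0\<close>; the factor
    \<open>1 / 2\<close> matches the generator, half of \<open>Lop\<close>.\<close>
  define \<mu> where "\<mu> = - 2 * 2 ^ k0 * ln \<rho>0"
  have r0: "0 < \<rho>0" "\<rho>0 < 1" using g0 by (auto simp: good_def)
  have mu: "0 < \<mu>" using r0 by (simp add: \<mu>_def mult_pos_neg)
  have all: "good (k0 + j) (exp (- \<mu> / 2 / 2 ^ (k0 + j))) h" for j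
  proof (induction j)
    case 0
    have "- \<mu> / 2 / 2 ^ k0 = ln \<rho>0" by (simp add: \<mu>_def)
    then have "exp (- \<mu> / 2 / 2 ^ k0) = \<rho>0" using r0 by (simp only: exp_ln)
    then show ?case using g0 by simp
  next
    case (Suc j)
    obtain \<rho>' h' where g': "good (Suc (k0 + j)) \<rho>' h'" using ex[of "Suc (k0 + j)"] by auto
    have eq: "exp (- \<mu> / 2 / 2 ^ (k0 + j)) = \<rho>' * \<rho>'" "h = h'" using step[OF Suc g'] by auto
    have "\<rho>' = exp (- \<mu> / 2 / 2 ^ Suc (k0 + j))"
    proof (rule power2_eq_imp_eq)
      have "(exp (- \<mu> / 2 / 2 ^ Suc (k0 + j)))\<^sup>2 = exp (- \<mu> / 2 / 2 ^ (k0 + j))"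
        by (simp add: power2_eq_square mult_exp_exp)
      then show "\<rho>'\<^sup>2 = (exp (- \<mu> / 2 / 2 ^ Suc (k0 + j)))\<^sup>2" using eq(1) by (simp add: power2_eq_square)
    qed (use g' in \<open>auto simp: good_def\<close>)
    then show ?case using g' eq(2) by simp
  qed
  have "good k (exp (- \<mu> / 2 / 2 ^ k)) h" if "k0 \<le> k" for k using all[of "k - k0"] that by simp
  note G = this
  show ?thesis
  proof (rule that[of \<mu> h k0])
    show "uniform_limit UNIV (\<lambda>n x. (P k ^^ n) (\<lambda>_. 1) x / exp (- \<mu> / 2 / 2 ^ k) ^ n) h sequentially"
      "P k h x = exp (- \<mu> / 2 / 2 ^ k) * h x" if "k0 \<le> k" for k x
      using G[OF that] unfolding good_def by blast+
  qed (use G[of k0] mu in \<open>auto simp: good_def\<close>)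
qed

text \<open>From near \<open>p\<close> a Gaussian step of size \<open>sqrt s\<close> lands in the
  exterior cone with probability at least \<open>c\<close>, whatever the scale. A bound
  \<open>A\<close> for \<open>h\<close> near \<open>p\<close> therefore improves to
  \<open>(1 - c / 2) * A\<close> on a smaller ball, and iteration reaches every
  \<open>e\<close>.\<close>

lemma boundary_decay:
  assumes h: "bm h" "\<And>x. 0 \<le> h x" "\<And>x. x \<notin> Q \<Longrightarrow> h x = 0"
    and P: "\<And>k x. k0 \<le> k \<Longrightarrow> P k h x = exp (- \<mu> / 2 / 2 ^ k) * h x"
    and \<eta>: "0 < \<eta>" and s0: "0 < s0" and cone: "\<And>s v. 0 < s \<Longrightarrow> s \<le> s0 \<Longrightarrow> norm (v - v0) < \<eta> \<Longrightarrow> p + s *\<^sub>R v \<notin> Q"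
    and e: "0 < e"
  shows "\<exists>r>0. \<forall>x\<in>ball p r. h x \<le> e"
proof -
  obtain M where M: "0 \<le> M" "\<And>x. \<bar>h x\<bar> \<le> M" using bm_bounded[OF h(1)] by metis
  obtain A0 where A0: "0 < A0" "\<And>z. norm (b z) \<le> A0 * norm z" using linear_bounded_pos[OF linear_b] by blast
  \<comment> \<open>Steps whose image stays within \<open>\<eta> / 2\<close> of the axis
    \<open>v0\<close>; the other half of \<open>\<eta>\<close> is reserved for the offset of the
    starting point from \<open>p\<close>.\<close>
  define E where "E = ball (a v0) (\<eta> / (2 * A0))"
  have Em[measurable]: "E \<in> sets borel" by (simp add: E_def)
  have E: "norm (b z - v0) < \<eta> / 2" if "z \<in> E" for z
  proof -
    have "norm (b z - v0) = norm (b (z - a v0))" by (simp add: linear_diff[OF linear_b])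
    also have "\<dots> \<le> A0 * norm (z - a v0)" by (rule A0)
    also have "\<dots> < A0 * (\<eta> / (2 * A0))" using that A0(1) by (intro mult_strict_left_mono) (auto simp: E_def dist_norm norm_minus_commute)
    also have "\<dots> = \<eta> / 2" using A0(1) by simp
    finally show ?thesis .
  qed
  define c where "c = measure gauss E"
  have c: "0 < c" unfolding c_def E_def using \<eta> A0 by (intro gauss_ball_pos) auto
  have c1: "c \<le> 1" unfolding c_def by (rule gauss.prob_le_1)
  define m2 where "m2 = (\<integral>z. norm (b z) ^ 2 \<partial>gauss)"
  have improve: "\<exists>r'>0. \<forall>x\<in>ball p r'. h x \<le> (1 - c / 2) * A" if A: "0 < A" and r: "0 < r" "\<And>x. x \<in> ball p r \<Longrightarrow> h x \<le> A" for A r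
  proof -
    \<comment> \<open>The bound on \<open>h\<close> obtained at time \<open>s\<close>:
      \<open>A\<close> off the cone, plus a second-moment bound for leaving the ball of radius
      \<open>r\<close>. Its limit \<open>A * (1 - c)\<close> is below the target.\<close>
    define F where "F s = exp (\<mu> * s / 2) * (A * (1 - c) + 2 * M * s / r\<^sup>2 * (\<eta>\<^sup>2 + m2))" for s
    have "(F \<longlongrightarrow> exp (\<mu> * 0 / 2) * (A * (1 - c) + 2 * M * 0 / r\<^sup>2 * (\<eta>\<^sup>2 + m2))) (at 0)"
      unfolding F_def using r by (intro tendsto_intros) auto
    then have F0: "(F \<longlongrightarrow> A * (1 - c)) (at 0)" by simp
    have "(\<lambda>k. (1 / 2) ^ k) \<longlonglongrightarrow> (0::real)" by (rule LIMSEQ_realpow_zero) auto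
    then have tk: "(\<lambda>k. 1 / 2 ^ k) \<longlonglongrightarrow> (0::real)" by (simp add: power_one_over)
    then have "filterlim (\<lambda>k. 1 / 2 ^ k :: real) (at 0) sequentially" by (simp add: filterlim_at)
    then have "(\<lambda>k. F (1 / 2 ^ k)) \<longlonglongrightarrow> A * (1 - c)" by (rule filterlim_compose[OF F0])
    moreover have "A * (1 - c) < (1 - c / 2) * A" using A c by (simp add: algebra_simps)
    ultimately have ev1: "eventually (\<lambda>k. F (1 / 2 ^ k) < (1 - c / 2) * A) sequentially" by (rule order_tendstoD(2))
    have "(\<lambda>k. sqrt (1 / 2 ^ k)) \<longlonglongrightarrow> sqrt 0" by (intro tendsto_real_sqrt tk)
    then have ev2: "eventually (\<lambda>k. sqrt (1 / 2 ^ k) < s0) sequentially" using s0 by (intro order_tendstoD(2)) auto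
    obtain k where k: "k0 \<le> k" "F (1 / 2 ^ k) < (1 - c / 2) * A" "sqrt (1 / 2 ^ k) < s0"
      using eventually_happens[OF eventually_conj[OF eventually_ge_at_top[of k0] eventually_conj[OF ev1 ev2]]] by auto
    define s :: real where "s = 1 / 2 ^ k"
    have s: "0 < s" "sqrt s \<le> s0" using k by (auto simp: s_def)
    define r' where "r' = sqrt s * (\<eta> / 2)"
    show ?thesis
    proof (intro exI[of _ r'] conjI ballI)
      show "0 < r'" using s \<eta> by (simp add: r'_def)
      fix x assume x: "x \<in> ball p r'"
      define u where "u = (1 / sqrt s) *\<^sub>R (x - p)"
      have u: "norm u < \<eta> / 2" using x s by (simp add: u_def r'_def dist_norm norm_minus_commute divide_less_eq mult.commute)
      have xu: "x = p + sqrt s *\<^sub>R u" using s by (simp add: u_def)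
      have pt: "h (x + sqrt s *\<^sub>R b z) \<le> A * (1 - indicator E z) + 2 * M * s / r\<^sup>2 * (\<eta>\<^sup>2 + norm (b z) ^ 2)" for z
      proof -
        have eq: "x + sqrt s *\<^sub>R b z = p + sqrt s *\<^sub>R (u + b z)" by (simp add: xu scaleR_add_right)
        have nn: "0 \<le> 2 * M * s / r\<^sup>2 * (\<eta>\<^sup>2 + norm (b z) ^ 2)" using M s by simp
        \<comment> \<open>The step hits the cone, where \<open>h\<close> vanishes, or ends in the
          ball, where \<open>h\<close> is at most \<open>A\<close>, or leaves the ball, where the
          second-moment term exceeds \<open>M\<close>.\<close>
        consider "z \<in> E" | "z \<notin> E" "x + sqrt s *\<^sub>R b z \<in> ball p r" | "z \<notin> E" "x + sqrt s *\<^sub>R b z \<notin> ball p r" by blast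
        then show ?thesis
        proof cases
          case 1
          have "norm ((u + b z) - v0) \<le> norm u + norm (b z - v0)" using norm_triangle_ineq[of u "b z - v0"] by (simp add: algebra_simps)
          also have "\<dots> < \<eta>" using u E[OF 1] by simp
          finally have "x + sqrt s *\<^sub>R b z \<notin> Q" unfolding eq using s by (intro cone) auto
          then show ?thesis using h(3) 1 nn by simp
        next
          case 2 then show ?thesis using r(2)[OF 2(2)] nn by simp
        next
          case 3
          then have "r \<le> norm (sqrt s *\<^sub>R (u + b z))" unfolding eq by (simp add: dist_norm)
          then have "r\<^sup>2 \<le> (norm (sqrt s *\<^sub>R (u + b z)))\<^sup>2" using r by (intro power_mono) auto
          also have "\<dots> = s * (norm (u + b z))\<^sup>2" using s by (simp add: power_mult_distrib)
          also have "\<dots> \<le> s * (2 * (\<eta>\<^sup>2 + norm (b z) ^ 2))"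
          proof (intro mult_left_mono)
            have "(norm (u + b z))\<^sup>2 \<le> (norm u + norm (b z))\<^sup>2" by (intro power_mono norm_triangle_ineq) auto
            also have "\<dots> \<le> 2 * ((norm u)\<^sup>2 + norm (b z) ^ 2)"
              using zero_le_power2[of "norm u - norm (b z)"] by (simp add: power2_eq_square algebra_simps)
            also have "(norm u)\<^sup>2 \<le> \<eta>\<^sup>2" using u \<eta> by (intro power_mono) auto
            finally show "(norm (u + b z))\<^sup>2 \<le> 2 * (\<eta>\<^sup>2 + norm (b z) ^ 2)" by simp
          qed (use s in auto)
          finally have "1 \<le> s * (2 * (\<eta>\<^sup>2 + norm (b z) ^ 2)) / r\<^sup>2" using r by simp
          from mult_left_mono[OF this M(1)] have "M \<le> 2 * M * s / r\<^sup>2 * (\<eta>\<^sup>2 + norm (b z) ^ 2)" by (simp add: mult_ac)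
          moreover have "h (x + sqrt s *\<^sub>R b z) \<le> M" using M(2)[of "x + sqrt s *\<^sub>R b z"] by linarith
          ultimately show ?thesis using 3 A by simp
        qed
      qed
      have ii: "integrable gauss (\<lambda>z. indicator E z :: real)" by (intro integrable_gauss_bm bm_indicator Em)
      have i2: "integrable gauss (\<lambda>z. norm (b z) ^ 2)" by (rule integrable_b_norm_power)
      have "Gop s h x \<le> (\<integral>z. A * (1 - indicator E z) + 2 * M * s / r\<^sup>2 * (\<eta>\<^sup>2 + norm (b z) ^ 2) \<partial>gauss)"
        unfolding Gop_def using ii i2 by (intro integral_mono pt integrable_shift h(1)) auto
      also have "\<dots> = A * (1 - c) + 2 * M * s / r\<^sup>2 * (\<eta>\<^sup>2 + m2)"
        using ii i2 by (simp add: c_def m2_def)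
      finally have G: "Gop s h x \<le> A * (1 - c) + 2 * M * s / r\<^sup>2 * (\<eta>\<^sup>2 + m2)" .
      have "P k h x \<le> Gop s h x" unfolding s_def by (rule opc_le[OF P_opc h(1,2)])
      then have "exp (- \<mu> * s / 2) * h x \<le> Gop s h x" using P[OF k(1), of x] by (simp add: s_def mult.commute)
      then have le: "exp (- \<mu> * s / 2) * h x \<le> A * (1 - c) + 2 * M * s / r\<^sup>2 * (\<eta>\<^sup>2 + m2)" using G by linarith
      have "h x = exp (\<mu> * s / 2) * (exp (- \<mu> * s / 2) * h x)" by (simp add: mult.assoc[symmetric] mult_exp_exp)
      also have "\<dots> \<le> F s" unfolding F_def by (rule mult_left_mono[OF le]) simp
      finally have "h x \<le> F s" .
      then show "h x \<le> (1 - c / 2) * A" using k(2) unfolding s_def by linarith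
    qed
  qed
  have it: "\<exists>r>0. \<forall>x\<in>ball p r. h x \<le> (1 - c / 2) ^ j * (M + 1)" for j
  proof (induction j)
    case 0
    have "\<forall>x\<in>ball p 1. h x \<le> M + 1" using M(2) by (smt (verit))
    then show ?case by (intro exI[of _ 1]) auto
  next
    case (Suc j)
    then obtain r where r: "0 < r" "\<And>x. x \<in> ball p r \<Longrightarrow> h x \<le> (1 - c / 2) ^ j * (M + 1)" by blast
    have "0 < (1 - c / 2) ^ j * (M + 1)" using c1 M(1) by simp
    from improve[OF this r] show ?case by (simp add: mult.assoc)
  qed
  have "(\<lambda>j. (1 - c / 2) ^ j * (M + 1)) \<longlonglongrightarrow> 0 * (M + 1)"
    using c c1 by (intro tendsto_mult_right LIMSEQ_realpow_zero) auto
  then have "eventually (\<lambda>j. (1 - c / 2) ^ j * (M + 1) < e) sequentially" using e by (intro order_tendstoD) auto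
  then obtain j where "(1 - c / 2) ^ j * (M + 1) < e" using eventually_happens[of _ sequentially] by auto
  then show ?thesis using it[of j] by (meson less_imp_le order_trans)
qed

end

section \<open>The ground state and the principal eigenspace\<close>

text \<open>The gradient \<open>g p\<close> points outwards: along directions close to it
  \<open>\<phi>\<close> increases at first order from a nonnegative value, so the points reached lie
  outside \<open>Q\<close>.\<close>

lemma lyapunov_cone:
  fixes Q :: "(real^'d::finite) set"
  assumes L: "lyapunov_boundary Q lam" and Q: "open Q" and p: "p \<in> frontier Q"
  obtains v0 \<eta> s0 where "0 < \<eta>" "0 < s0" "\<And>s v. 0 < s \<Longrightarrow> s \<le> s0 \<Longrightarrow> norm (v - v0) < \<eta> \<Longrightarrow> p + s *\<^sub>R v \<notin> Q"
proof -
  have "\<exists>r>0. \<exists>(\<phi>::real^'d \<Rightarrow> real) (g::real^'d \<Rightarrow> real^'d). (\<forall>x\<in>ball p r. (\<phi> has_derivative (\<lambda>h. g x \<bullet> h)) (at x)) \<and>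
      g p \<noteq> 0 \<and> Q \<inter> ball p r = {x \<in> ball p r. \<phi> x < 0}"
    using bspec[OF conjunct2[OF conjunct2[OF L[unfolded lyapunov_boundary_def]]] p]
    by (elim exE conjE) (intro exI conjI; assumption)
  then obtain r and \<phi> :: "real^'d \<Rightarrow> real" and g where r: "0 < r" and der: "\<And>x. x \<in> ball p r \<Longrightarrow> (\<phi> has_derivative (\<lambda>h. g x \<bullet> h)) (at x)"
    and g: "g p \<noteq> 0" and Qr: "Q \<inter> ball p r = {x \<in> ball p r. \<phi> x < (0::real)}"
    by blast
  have "p \<notin> Q" using p Q by (simp add: frontier_def interior_open)
  then have p0: "0 \<le> \<phi> p" using Qr r by (metis (mono_tags, lifting) Int_iff centre_in_ball mem_Collect_eq not_less)
  define n where "n = norm (g p)"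
  have n: "0 < n" using g by (simp add: n_def)
  have "(\<phi> has_derivative (\<lambda>h. g p \<bullet> h)) (at p)" using der r by simp
  then obtain d where d: "0 < d" "\<And>y. norm (y - p) < d \<Longrightarrow> \<bar>\<phi> y - \<phi> p - g p \<bullet> (y - p)\<bar> \<le> n / 4 * norm (y - p)"
    using n unfolding has_derivative_at_alt real_norm_def by (elim conjE allE[of _ "n / 4"]) auto
  show ?thesis
  \<comment> \<open>Directions within \<open>n / 2\<close> of \<open>g p\<close> satisfy
    \<open>g p \<bullet> v > n ^ 2 / 2\<close>, while the derivative error per unit of
    \<open>s\<close> is at most \<open>3 / 8 * n ^ 2\<close>. The bound on \<open>s\<close> keeps
    \<open>s *\<^sub>R v\<close> shorter than \<open>d\<close> and \<open>r\<close>, as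
    \<open>norm v\<close> is below \<open>2 * n\<close>.\<close>
  proof (rule that[of "n / 2" "min d r / (2 * n)" "g p"])
    fix s v assume s: "0 < s" "s \<le> min d r / (2 * n)" and v: "norm (v - g p) < n / 2"
    have nv: "norm v \<le> 3 / 2 * n" using norm_triangle_sub[of v "g p"] v by (simp add: n_def)
    have "norm (s *\<^sub>R v) \<le> s * (3 / 2 * n)" using s nv by (simp add: mult_left_mono)
    also have "\<dots> < s * (2 * n)" using s n by simp
    also have "\<dots> \<le> min d r" using s(2) n by (simp add: le_divide_eq)
    finally have small: "norm (s *\<^sub>R v) < d" "p + s *\<^sub>R v \<in> ball p r" by (auto simp: dist_norm)
    have "\<bar>g p \<bullet> (v - g p)\<bar> \<le> n * norm (v - g p)" unfolding n_def by (rule Cauchy_Schwarz_ineq2)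
    also have "\<dots> < n * (n / 2)" using v n by simp
    also have "n * (n / 2) = n * n / 2" by simp
    finally have ab: "\<bar>g p \<bullet> (v - g p)\<bar> < n * n / 2" .
    have "g p \<bullet> g p = n * n" unfolding n_def by (simp add: dot_square_norm power2_eq_square)
    then have "g p \<bullet> (v - g p) = g p \<bullet> v - n * n" by (simp add: inner_diff_right)
    with ab have "n * n / 2 < g p \<bullet> v" by linarith
    then have "s * (n * n / 2) < s * (g p \<bullet> v)" by (rule mult_strict_left_mono[OF _ s(1)])
    moreover have "\<bar>\<phi> (p + s *\<^sub>R v) - \<phi> p - s * (g p \<bullet> v)\<bar> \<le> n / 4 * (s * norm v)"
      using d(2)[of "p + s *\<^sub>R v"] small(1) s(1) by (simp add: inner_scaleR_right)
    moreover have "n / 4 * (s * norm v) \<le> n / 4 * (s * (3 / 2 * n))" using n s nv by (intro mult_left_mono) auto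
    moreover have "n / 4 * (s * (3 / 2 * n)) = 3 / 4 * (s * (n * n / 2))" by simp
    moreover have "0 < s * (n * n / 2)" using s(1) n by simp
    ultimately have "0 < \<phi> (p + s *\<^sub>R v)" using p0 by linarith
    then show "p + s *\<^sub>R v \<notin> Q" using Qr small(2) by force
  qed (use n d r in auto)
qed

context elliptic_domain begin

lemma dirichlet_solution_eigen:
  assumes u: "dirichlet_solution \<sigma> Q l u" and \<sigma>: "\<And>i j. \<sigma> $ i $ j = sg i j"
  shows "bm (\<lambda>x. indicator Q x * u x)" (is "bm ?w")
    and "P k (\<lambda>x. indicator Q x * u x) x = exp (- l / 2 / 2 ^ k) * (indicator Q x * u x)"
proof -
  note * = u[unfolded dirichlet_solution_def]
  have cont: "continuous_on UNIV ?w" by (rule zero_extension_continuous) (use open_Q * in auto)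
  have "compact (closure Q)" using bounded_Q by simp
  then have "bounded (u ` closure Q)" using * by (intro compact_imp_bounded compact_continuous_image) auto
  then obtain C where C: "\<And>x. x \<in> closure Q \<Longrightarrow> \<bar>u x\<bar> \<le> C" unfolding bounded_iff by auto
  have "\<bar>?w x\<bar> \<le> max C 0" for x using C[of x] closure_subset[of Q] by (cases "x \<in> Q") (auto simp: le_max_iff_disj)
  then show bm: "bm ?w" unfolding bm_def using borel_measurable_continuous_onI[OF cont] by blast
  have e: "u y = ?w y" if "y \<in> Q" for y using that by simp
  show "P k ?w x = exp (- l / 2 / 2 ^ k) * ?w x"
  proof (rule P_dirichlet_eigenfunction[OF _ bm cont])
    show "C2_on Q ?w" by (rule C2_on_cong(1)[OF open_Q e]) (use * in auto)
    show "?w x = 0" if "x \<notin> Q" for x using that by simp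
    show "Lop ?w x = - l * ?w x" if x: "x \<in> Q" for x
    proof -
      have "pderiv_vec i (pderiv_vec j ?w) x = pderiv_vec i (pderiv_vec j u) x" for i j
        by (rule C2_on_cong(2)[OF open_Q e _ x]) (use * in auto)
      then show ?thesis using * x by (simp add: Lop_def \<sigma>)
    qed
  qed
qed

text \<open>Inside \<open>Q\<close> continuity comes from regularity and off the closure from
  vanishing; at boundary points the exterior cone forces \<open>h\<close> to decay.\<close>

lemma ground_state_dirichlet:
  assumes L: "lyapunov_boundary Q lam" and \<sigma>: "\<And>i j. \<sigma> $ i $ j = sg i j"
    and h: "bm h" "\<And>x. 0 \<le> h x" and P: "\<And>k x. k0 \<le> k \<Longrightarrow> P k h x = exp (- \<mu> / 2 / 2 ^ k) * h x"
  shows "\<And>x. x \<notin> Q \<Longrightarrow> h x = 0" "continuous_on UNIV h" "dirichlet_solution \<sigma> Q \<mu> h"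
proof -
  show off: "h x = 0" if "x \<notin> Q" for x using P[of k0 x] opc_off[OF P_opc h(1) that, of k0] by simp
  have C2: "C2_on Q h" by (rule P_eigenfunction_C2[OF h(1) P])
  have "isCont h x" for x
  proof (cases "x \<in> Q")
    case True
    have "continuous_on Q h" using C2 by (auto simp: C2_on_def intro: differentiable_imp_continuous_on)
    then show ?thesis using True open_Q by (simp add: continuous_on_eq_continuous_at)
  next
    case xQ: False
    show ?thesis
    proof (cases "x \<in> closure Q")
      case True
      then have "x \<in> frontier Q" using xQ open_Q by (simp add: frontier_def interior_open)
      from lyapunov_cone[OF L open_Q this] obtain v0 \<eta> s0 where c: "0 < \<eta>" "0 < s0"
        "\<And>s v. 0 < s \<Longrightarrow> s \<le> s0 \<Longrightarrow> norm (v - v0) < \<eta> \<Longrightarrow> x + s *\<^sub>R v \<notin> Q" by metis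
      have "\<exists>d>0. \<forall>y. norm (y - x) < d \<longrightarrow> norm (h y - h x) < e" if e: "0 < e" for e
      proof -
        obtain r where r: "0 < r" "\<forall>y\<in>ball x r. h y \<le> e / 2"
          using boundary_decay[OF h, of k0 \<mu> \<eta> s0 v0 x "e / 2"] off P c e by auto
        show ?thesis
        proof (intro exI[of _ r] conjI allI impI)
          fix y assume "norm (y - x) < r"
          then have "h y \<le> e / 2" using r by (auto simp: dist_norm norm_minus_commute)
          then show "norm (h y - h x) < e" using h(2)[of y] e off[OF xQ] by simp
        qed (rule r)
      qed
      then show ?thesis by (subst continuous_at_eps_delta) (simp add: dist_norm)
    next
      case False
      have "continuous_on (- closure Q) h" by (rule continuous_on_eq[where f="\<lambda>_. 0"]) (use off closure_subset[of Q] in auto)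
      then show ?thesis using False by (simp add: continuous_on_eq_continuous_at open_Compl)
    qed
  qed
  then show cont: "continuous_on UNIV h" by (simp add: continuous_on_eq_continuous_at)
  show "dirichlet_solution \<sigma> Q \<mu> h"
    unfolding dirichlet_solution_def
  proof (intro conjI ballI)
    fix x assume "x \<in> Q"
    from P_eigenfunction_pde[OF h(1) P this]
    show "(\<Sum>i\<in>UNIV. \<Sum>j\<in>UNIV. \<sigma> $ i $ j * pderiv_vec i (pderiv_vec j h) x) = - \<mu> * h x" by (simp add: Lop_def \<sigma>)
  next
    fix x assume "x \<in> frontier Q"
    then show "h x = 0" using open_Q by (intro off) (simp add: frontier_def interior_open)
  qed (use C2 cont in \<open>auto intro: continuous_on_subset\<close>)
qed

lemma P_funpow_symm:
  assumes f: "bm f" and g: "bm g"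
  shows "(\<integral>x. (P k ^^ n) f x * g x \<partial>muQ) = (\<integral>x. f x * (P k ^^ n) g x \<partial>muQ)"
  using f
proof (induction n arbitrary: f)
  case (Suc n)
  have "(\<integral>x. (P k ^^ Suc n) f x * g x \<partial>muQ) = (\<integral>x. (P k ^^ n) (P k f) x * g x \<partial>muQ)" by (simp add: funpow_swap1)
  also have "\<dots> = (\<integral>x. P k f x * (P k ^^ n) g x \<partial>muQ)" using Suc.prems by (intro Suc.IH opc_bm[OF P_opc])
  also have "\<dots> = (\<integral>x. f x * P k ((P k ^^ n) g) x \<partial>muQ)" by (intro P_symm_muQ Suc.prems opc_funpow_bm[OF P_opc] g)
  finally show ?case by simp
qed simp

text \<open>Symmetry moves the iterates from 1 onto the eigenfunction \<open>w\<close>, where they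
  multiply by \<open>\<rho> ^ n\<close> and cancel the normalisation; the inner product is therefore
  the same for all \<open>n\<close>.\<close>

lemma ground_state_inner:
  assumes h: "bm h" and \<rho>: "0 < \<rho>"
    and ul: "uniform_limit UNIV (\<lambda>n x. (P k ^^ n) (\<lambda>_. 1) x / \<rho> ^ n) h sequentially"
    and w: "bm w" and Pw: "\<And>x. P k w x = \<rho> * w x"
  shows "(\<integral>x. h x * w x \<partial>muQ) = (\<integral>x. w x \<partial>muQ)"
proof -
  interpret mu: finite_measure muQ by (rule finite_muQ)
  define v where "v n x = (P k ^^ n) (\<lambda>_. 1) x / \<rho> ^ n" for n x
  have bv: "bm (v n)" for n
    using bm_cmult[OF opc_funpow_bm[OF P_opc bm_const[of 1]], of "1 / \<rho> ^ n" n k] by (simp add: v_def[abs_def])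
  have eq: "(\<integral>x. v n x * w x \<partial>muQ) = (\<integral>x. w x \<partial>muQ)" for n
  proof -
    have "(\<integral>x. v n x * w x \<partial>muQ) = (\<integral>x. (P k ^^ n) (\<lambda>_. 1) x * w x \<partial>muQ) / \<rho> ^ n" by (simp add: v_def)
    also have "\<dots> = (\<integral>x. 1 * (\<rho> ^ n * w x) \<partial>muQ) / \<rho> ^ n"
      unfolding P_funpow_symm[OF bm_const w] P_funpow_eigen[OF w Pw] ..
    finally show ?thesis using \<rho> by simp
  qed
  obtain C where C: "0 \<le> C" "\<And>x. \<bar>h x\<bar> \<le> C" using bm_bounded[OF h] by metis
  obtain D where D: "0 \<le> D" "\<And>x. \<bar>w x\<bar> \<le> D" using bm_bounded[OF w] by metis
  have "eventually (\<lambda>n. \<forall>x\<in>UNIV. dist (v n x) (h x) < 1) sequentially" using uniform_limitD[OF ul, of 1] by (simp add: v_def)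
  then obtain N where N: "\<And>n x. N \<le> n \<Longrightarrow> \<bar>v n x - h x\<bar> < 1" unfolding eventually_sequentially dist_real_def by blast
  have "(\<lambda>n. \<integral>x. v (n + N) x * w x \<partial>muQ) \<longlonglongrightarrow> (\<integral>x. h x * w x \<partial>muQ)"
  proof (rule integral_dominated_convergence[where w="\<lambda>_. (C + 1) * D"])
    have "(\<lambda>n. v n x) \<longlonglongrightarrow> h x" for x unfolding v_def using tendsto_uniform_limitI[OF ul] by simp
    then have "(\<lambda>n. v (n + N) x) \<longlonglongrightarrow> h x" for x by (rule LIMSEQ_ignore_initial_segment)
    then show "AE x in muQ. (\<lambda>n. v (n + N) x * w x) \<longlonglongrightarrow> h x * w x" by (intro AE_I2 tendsto_mult tendsto_const)
    show "AE x in muQ. norm (v (n + N) x * w x) \<le> (C + 1) * D" for n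
    proof (rule AE_I2)
      fix x
      have "\<bar>v (n + N) x\<bar> \<le> C + 1" using N[of "n + N" x] C(2)[of x] by linarith
      then show "norm (v (n + N) x * w x) \<le> (C + 1) * D" using C D by (simp add: abs_mult mult_mono)
    qed
    show "(\<lambda>x. h x * w x) \<in> borel_measurable muQ" "\<And>n. (\<lambda>x. v (n + N) x * w x) \<in> borel_measurable muQ"
      unfolding measurable_cong_sets[OF sets_muQ refl] by (intro bm_measurable bm_mult h w bv)+
  qed simp
  then show ?thesis by (simp add: eq LIMSEQ_const_iff)
qed

lemma set_integral_lebesgue_muQ:
  assumes w: "bm w" and f: "\<And>x. x \<in> Q \<Longrightarrow> f x = w x"
  shows "(LINT x:Q|lebesgue. f x) = (\<integral>x. w x \<partial>muQ)"
proof -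
  have "(LINT x:Q|lebesgue. f x) = (\<integral>x. indicator Q x * w x \<partial>completion lborel)"
    unfolding set_lebesgue_integral_def by (intro Bochner_Integration.integral_cong) (auto simp: f indicator_def)
  also have "\<dots> = (\<integral>x. indicator Q x * w x \<partial>lborel)"
    using bm_measurable[OF bm_indicator_mult[OF Q_measurable w]] by (intro integral_completion) simp
  finally show ?thesis by (simp add: integral_muQ[OF w])
qed

lemma principal_projection:
  assumes L: "lyapunov_boundary Q lam" and \<sigma>: "\<And>i j. \<sigma> $ i $ j = sg i j"
    and l1: "dirichlet_eigenvalue \<sigma> Q l1" "\<And>l. dirichlet_eigenvalue \<sigma> Q l \<Longrightarrow> l1 \<le> l"
    and on: "\<And>i j. i < n1 \<Longrightarrow> j < n1 \<Longrightarrow> (LINT x:Q|lebesgue. f i x * f j x) = (if i = j then 1 else 0)"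
    and basis: "\<And>u. dirichlet_solution \<sigma> Q l1 u \<longleftrightarrow> (\<exists>c::nat \<Rightarrow> real. \<forall>x\<in>closure Q. u x = (\<Sum>i<n1. c i * f i x))"
  obtains k0 h where "0 < l1" "bm h" "\<And>x. 0 \<le> h x" "continuous_on UNIV h" "\<And>x. x \<notin> Q \<Longrightarrow> h x = 0"
    "\<And>k. k0 \<le> k \<Longrightarrow> uniform_limit UNIV (\<lambda>n x. (P k ^^ n) (\<lambda>_. 1) x / exp (- l1 / 2 / 2 ^ k) ^ n) h sequentially"
    "\<And>k x. k0 \<le> k \<Longrightarrow> P k h x = exp (- l1 / 2 / 2 ^ k) * h x"
    "\<And>x. x \<in> Q \<Longrightarrow> (\<Sum>i<n1. (LINT x:Q|lebesgue. f i x) * f i x) = h x"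
proof -
  obtain u x1 where u: "dirichlet_solution \<sigma> Q l1 u" "x1 \<in> Q" "u x1 \<noteq> 0"
    using l1(1) unfolding dirichlet_eigenvalue_def by blast
  have Qne: "Q \<noteq> {}" using u(2) by blast
  obtain k0 \<mu> h where mu: "0 < \<mu>" and h: "bm h" "\<And>x. 0 \<le> h x" and hpos: "0 < (\<integral>x. h x \<partial>muQ)"
    and ul: "\<And>k. k0 \<le> k \<Longrightarrow> uniform_limit UNIV (\<lambda>n x. (P k ^^ n) (\<lambda>_. 1) x / exp (- \<mu> / 2 / 2 ^ k) ^ n) h sequentially"
    and Ph: "\<And>k x. k0 \<le> k \<Longrightarrow> P k h x = exp (- \<mu> / 2 / 2 ^ k) * h x"
    by (rule ground_state[OF Qne]) blast
  note hd = ground_state_dirichlet[OF L \<sigma> h Ph, simplified]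
  obtain x0 where "h x0 \<noteq> 0" by (rule integral_pos_witness[OF hpos])
  then have "dirichlet_eigenvalue \<sigma> Q \<mu>" unfolding dirichlet_eigenvalue_def using hd(1,3) by blast
  then have "l1 \<le> \<mu>" by (rule l1(2))
  \<comment> \<open>Otherwise the eigenfunction \<open>u\<close> for \<open>l1\<close> would outgrow
    the survival probabilities.\<close>
  moreover have "\<mu> \<le> l1"
  proof -
    have "exp (- l1 / 2 / 2 ^ k0) \<le> exp (- \<mu> / 2 / 2 ^ k0)"
    proof (rule eigenvalue_le[where u="\<lambda>x. indicator Q x * u x" and x=x1 and k=k0 and h="h x1"])
      show "bm (\<lambda>x. indicator Q x * u x)" "\<And>x. P k0 (\<lambda>x. indicator Q x * u x) x = exp (- l1 / 2 / 2 ^ k0) * (indicator Q x * u x)"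
        by (rule dirichlet_solution_eigen[OF u(1) \<sigma>])+
      show "(\<lambda>n. (P k0 ^^ n) (\<lambda>_. 1) x1 / exp (- \<mu> / 2 / 2 ^ k0) ^ n) \<longlonglongrightarrow> h x1"
        using tendsto_uniform_limitI[OF ul[OF order_refl]] by simp
    qed (use u in auto)
    then show ?thesis by (simp add: divide_le_cancel)
  qed
  ultimately have l1mu: "l1 = \<mu>" by simp
  \<comment> \<open>Each \<open>f i\<close> is a solution because it is the combination with
    coefficient 1 at \<open>i\<close> and 0 elsewhere.\<close>
  have fi: "dirichlet_solution \<sigma> Q l1 (f i)" if "i < n1" for i
    unfolding basis
  proof (intro exI ballI)
    show "f i x = (\<Sum>j<n1. (if j = i then 1 else 0) * f j x)" for x
      using that by (simp add: if_distrib[where f="\<lambda>c. c * _"] sum.delta cong: if_cong)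
  qed
  define w where "w i x = indicator Q x * f i x" for i x
  have w: "bm (w i)" "\<And>x. P k (w i) x = exp (- l1 / 2 / 2 ^ k) * w i x" if "i < n1" for i k
    using dirichlet_solution_eigen[OF fi[OF that] \<sigma>] by (simp_all add: w_def[abs_def])
  have wi: "x \<in> Q \<Longrightarrow> f i x = w i x" for i x by (simp add: w_def)
  have "dirichlet_solution \<sigma> Q l1 h" using hd(3) l1mu by simp
  then obtain d :: "nat \<Rightarrow> real" where d: "\<And>x. x \<in> closure Q \<Longrightarrow> h x = (\<Sum>i<n1. d i * f i x)" unfolding basis by blast
  have hw: "h x = (\<Sum>i<n1. d i * w i x)" for x
    using d[of x] hd(1)[where x=x] closure_subset[of Q] by (cases "x \<in> Q") (auto simp: w_def)
  interpret mu: finite_measure muQ by (rule finite_muQ)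
  have int: "integrable muQ g" if "bm g" for g :: "real^'d \<Rightarrow> real"
    by (rule bm_integrable[OF finite_muQ sets_muQ that])
  \<comment> \<open>Orthonormality isolates \<open>d i\<close> as the inner product of
    \<open>h\<close> with \<open>w i\<close>, and \<open>ground_state_inner\<close> replaces
    \<open>h\<close> by 1 in it.\<close>
  have d_eq: "d i = (LINT x:Q|lebesgue. f i x)" if i: "i < n1" for i
  proof -
    have "(LINT x:Q|lebesgue. f i x) = (\<integral>x. w i x \<partial>muQ)"
      by (rule set_integral_lebesgue_muQ[OF w(1)[OF i] wi])
    also have "\<dots> = (\<integral>x. h x * w i x \<partial>muQ)"
      using ground_state_inner[OF h(1) _ ul[OF order_refl] w(1)[OF i]] w(2)[OF i] l1mu by simp
    also have "\<dots> = (\<integral>x. (\<Sum>j<n1. d j * (w j x * w i x)) \<partial>muQ)" by (simp add: hw sum_distrib_right mult.assoc)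
    also have "\<dots> = (\<Sum>j<n1. d j * (\<integral>x. w j x * w i x \<partial>muQ))"
      using i by (subst Bochner_Integration.integral_sum) (auto intro!: int bm_mult bm_cmult w(1))
    also have "\<dots> = (\<Sum>j<n1. d j * (if j = i then 1 else 0))"
    proof (intro sum.cong refl)
      fix j assume "j \<in> {..<n1}"
      then have j: "j < n1" by simp
      have "(\<integral>x. w j x * w i x \<partial>muQ) = (LINT x:Q|lebesgue. f j x * f i x)"
        by (rule set_integral_lebesgue_muQ[OF bm_mult[OF w(1)[OF j] w(1)[OF i]], symmetric]) (simp add: w_def)
      then show "d j * (\<integral>x. w j x * w i x \<partial>muQ) = d j * (if j = i then 1 else 0)" using on[OF j i] by simp
    qed
    also have "\<dots> = d i" using i by (simp add: if_distrib[where f="\<lambda>c. _ * c"] sum.delta cong: if_cong)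
    finally show ?thesis by simp
  qed
  show ?thesis
  proof (rule that[of h k0])
    show "(\<Sum>i<n1. (LINT x:Q|lebesgue. f i x) * f i x) = h x" if "x \<in> Q" for x
      using d[of x] that closure_subset[of Q] d_eq by (auto intro!: sum.cong)
  qed (use h hd mu l1mu ul Ph in auto)
qed

end

section \<open>Wiener paths and the killed semigroup\<close>

text \<open>On rectangles the outer independence factors the probability over \<open>i\<close> and
  the inner one factors each part over \<open>j\<close>. In the application \<open>i\<close> is a
  coordinate and \<open>j\<close> a time step.\<close>

lemma (in prob_space) indep_vars_Times:
  fixes X :: "'i \<Rightarrow> 'j \<Rightarrow> 'a \<Rightarrow> 'b"
  assumes I: "I \<noteq> {}" "finite I" and J: "J \<noteq> {}" "finite J"
    and outer: "indep_vars (\<lambda>_. PiM J (\<lambda>_. N)) (\<lambda>i \<omega>. \<lambda>j\<in>J. X i j \<omega>) I"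
    and inner: "\<And>i. i \<in> I \<Longrightarrow> indep_vars (\<lambda>_. N) (X i) J"
  shows "indep_vars (\<lambda>_. N) (\<lambda>p. X (fst p) (snd p)) (I \<times> J)"
proof (subst indep_vars_finite[where E="\<lambda>_. sets N"])
  have rv: "random_variable N (X i j)" if "i \<in> I" "j \<in> J" for i j
    using inner[OF that(1)] that(2) by (simp add: indep_vars_def)
  show "random_variable N (X (fst p) (snd p))" if "p \<in> I \<times> J" for p using that by (auto intro: rv)
  show "\<forall>A\<in>I \<times> J \<rightarrow> sets N. prob (\<Inter>p\<in>I \<times> J. X (fst p) (snd p) -` A p \<inter> space M) =
     (\<Prod>p\<in>I \<times> J. prob (X (fst p) (snd p) -` A p \<inter> space M))"
  proof
    fix A assume A: "A \<in> I \<times> J \<rightarrow> sets N"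
    define R where "R i = (\<lambda>\<omega>. \<lambda>j\<in>J. X i j \<omega>)" for i
    have eq: "R i -` (PiE J (\<lambda>j. A (i, j))) \<inter> space M = (\<Inter>j\<in>J. X i j -` A (i, j) \<inter> space M)" for i
      using J(1) by (auto simp: R_def PiE_iff extensional_def)
    have "(\<Inter>p\<in>I \<times> J. X (fst p) (snd p) -` A p \<inter> space M) = (\<Inter>i\<in>I. R i -` (PiE J (\<lambda>j. A (i, j))) \<inter> space M)"
      unfolding eq by auto
    also have "prob \<dots> = (\<Prod>i\<in>I. prob (R i -` (PiE J (\<lambda>j. A (i, j))) \<inter> space M))"
      by (rule indep_varsD_finite[OF outer[folded R_def] I]) (use A J in \<open>auto intro!: sets_PiM_I_finite\<close>)
    also have "\<dots> = (\<Prod>i\<in>I. \<Prod>j\<in>J. prob (X i j -` A (i, j) \<inter> space M))"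
      unfolding eq by (intro prod.cong refl indep_varsD_finite[OF inner J]) (use A in auto)
    also have "\<dots> = (\<Prod>p\<in>I \<times> J. prob (X (fst p) (snd p) -` A p \<inter> space M))"
      by (simp add: prod.cartesian_product case_prod_beta)
    finally show "prob (\<Inter>p\<in>I \<times> J. X (fst p) (snd p) -` A p \<inter> space M) =
       (\<Prod>p\<in>I \<times> J. prob (X (fst p) (snd p) -` A p \<inter> space M))" .
  qed
qed (use I J in \<open>auto simp: sets.sigma_sets_eq Int_stable_def sets.sets_into_space[THEN subsetD]\<close>)

lemma measurable_vec_proj:
  assumes "\<And>i. p i \<in> I"
  shows "(\<lambda>g. \<chi> i. g (p i)) \<in> measurable (PiM I (\<lambda>_. borel :: real measure)) (borel :: (real^'d::finite) measure)"
proof (rule measurable_compose[OF _ measurable_vec_PiM])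
  show "(\<lambda>g i. g (p i)) \<in> measurable (PiM I (\<lambda>_. borel)) (PiM UNIV (\<lambda>_. borel))"
    by (rule measurable_PiM_single') (use assms in \<open>auto intro: measurable_component_singleton\<close>)
qed

text \<open>The coordinates are independent processes and each has independent increments, so all
  entries are jointly independent; regrouped by time step they form independent vectors.\<close>

lemma (in prob_space) wiener_increments:
  fixes W :: "real \<Rightarrow> 'a \<Rightarrow> real^'d::finite"
  assumes W: "std_wiener M W" and s: "0 < s"
  defines "Z \<equiv> \<lambda>l \<omega>. (1 / sqrt s) *\<^sub>R (W (real (Suc l) * s) \<omega> - W (real l * s) \<omega>)"
  shows "indep_vars (\<lambda>_. borel) Z {..<N}" and "distr M borel (Z l) = gauss"
proof -
  define X where "X i l \<omega> = (W (real (Suc l) * s) \<omega> $ i - W (real l * s) \<omega> $ i) / sqrt s" for i l \<omega>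
  have Zi: "Z l \<omega> = (\<chi> i. X i l \<omega>)" for l \<omega> by (simp add: vec_eq_iff Z_def X_def)
  have w: "std_wiener_1d M (\<lambda>t \<omega>. W t \<omega> $ i)" for i using W by (simp add: std_wiener_def)
  have ind: "indep_vars (\<lambda>_. PiM UNIV (\<lambda>_::real. borel :: real measure)) (\<lambda>i \<omega> t. W t \<omega> $ i) (UNIV :: 'd set)"
    using W by (simp add: std_wiener_def)
  have rX [measurable]: "X i l \<in> borel_measurable M" for i l
    using w[of i] unfolding X_def std_wiener_1d_def by (intro borel_measurable_divide borel_measurable_diff) auto
  show "indep_vars (\<lambda>_. borel) Z {..<N}"
  proof (cases "N = 0")
    case True
    then show ?thesis by (simp add: indep_vars_def indep_sets_def)
  next
    case False
    have outer: "indep_vars (\<lambda>_. PiM {..<N} (\<lambda>_. borel)) (\<lambda>i \<omega>. \<lambda>l\<in>{..<N}. X i l \<omega>) UNIV"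
      unfolding X_def
      by (rule indep_vars_compose2[OF ind, where Y="\<lambda>_ p. \<lambda>l\<in>{..<N}. (p (real (Suc l) * s) - p (real l * s)) / sqrt s"]) measurable
    have inner: "indep_vars (\<lambda>_. borel) (X i) {..<N}" for i
    proof -
      define ts where "ts = map (\<lambda>l. real l * s) [0..<Suc N]"
      have len: "length ts - 1 = N" by (simp add: ts_def)
      have nth: "ts ! l = real l * s" if "l \<le> N" for l using that by (simp add: ts_def nth_map del: upt_Suc)
      have "sorted ts" unfolding ts_def sorted_map by (rule sorted_wrt_mono_rel[OF _ sorted_upt]) (use s in \<open>auto intro: mult_right_mono\<close>)
      moreover have "distinct ts" using s by (simp add: ts_def distinct_map inj_on_def del: upt_Suc)
      moreover have "\<forall>t\<in>set ts. 0 \<le> t" using s by (auto simp: ts_def)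
      ultimately have "sorted ts \<and> distinct ts \<and> (\<forall>t\<in>set ts. 0 \<le> t)" by blast
      from mp[OF spec[OF conjunct2[OF conjunct2[OF conjunct2[OF w[of i, unfolded std_wiener_1d_def]]]]] this]
      have "indep_vars (\<lambda>_. borel) (\<lambda>l \<omega>. W (ts ! Suc l) \<omega> $ i - W (ts ! l) \<omega> $ i) {..<N}"
        unfolding len .
      from indep_vars_compose2[OF this, where Y="\<lambda>_ y. y / sqrt s" and N="\<lambda>_. borel"]
      have "indep_vars (\<lambda>_. borel) (\<lambda>l \<omega>. (W (ts ! Suc l) \<omega> $ i - W (ts ! l) \<omega> $ i) / sqrt s) {..<N}" by simp
      then show ?thesis by (subst indep_vars_cong[OF refl _ refl]) (auto simp: X_def[abs_def] nth)
    qed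
    have "indep_vars (\<lambda>_. borel) (\<lambda>p. X (fst p) (snd p)) (UNIV \<times> {..<N})"
      using False by (intro indep_vars_Times outer inner) auto
    \<comment> \<open>The block with second index \<open>l\<close> collects the coordinates of one
      increment vector.\<close>
    from indep_vars_restrict[OF this, of "{..<N}" "\<lambda>l. UNIV \<times> {l}"]
    have "indep_vars (\<lambda>l. PiM (UNIV \<times> {l}) (\<lambda>_. borel)) (\<lambda>l \<omega>. \<lambda>p\<in>UNIV \<times> {l}. X (fst p) (snd p) \<omega>) {..<N}"
      by (auto simp: disjoint_family_on_def)
    from indep_vars_compose2[OF this, where Y="\<lambda>l g. \<chi> i. g (i, l)" and N="\<lambda>_. borel"]
    have "indep_vars (\<lambda>_. borel) (\<lambda>l \<omega>. \<chi> i. (\<lambda>p\<in>UNIV \<times> {l}. X (fst p) (snd p) \<omega>) (i, l) :: real^'d) {..<N}"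
      by (simp add: measurable_vec_proj)
    then show ?thesis by (simp add: Zi[abs_def])
  qed
  have dX: "distr M borel (X i l) = density lborel std_normal_density" for i
  proof -
    have "distributed M lborel (\<lambda>\<omega>. W (real (Suc l) * s) \<omega> $ i - W (real l * s) \<omega> $ i) (normal_density 0 (sqrt (real (Suc l) * s - real l * s)))"
      using w[of i] s unfolding std_wiener_1d_def by simp
    moreover have "real (Suc l) * s - real l * s = s" by (simp add: algebra_simps)
    ultimately have "distributed M lborel (X i l) std_normal_density"
      using s normal_standard_normal_convert[of "sqrt s" "\<lambda>\<omega>. W (real (Suc l) * s) \<omega> $ i - W (real l * s) \<omega> $ i" 0]
      by (simp add: X_def[abs_def])
    from distributed_distr_eq_density[OF this] show ?thesis by (metis distr_cong sets_lborel)
  qed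
  have indX: "indep_vars (\<lambda>_. borel) (\<lambda>i. X i l) UNIV"
    unfolding X_def
    by (rule indep_vars_compose2[OF ind, where Y="\<lambda>_ p. (p (real (Suc l) * s) - p (real l * s)) / sqrt s"]) measurable
  have "distr M borel (Z l) = distr M borel (\<lambda>\<omega>. \<chi> i. (\<lambda>i. X i l \<omega>) i)" by (simp add: Zi[abs_def])
  also have "\<dots> = distr (distr M (PiM UNIV (\<lambda>_. borel)) (\<lambda>\<omega> i. X i l \<omega>)) borel (\<lambda>f. \<chi> i. f i)"
    using measurable_PiM_single'[of UNIV "\<lambda>i. X i l" M "\<lambda>_. borel"] by (subst distr_distr) (auto simp: comp_def)
  also have "distr M (PiM UNIV (\<lambda>_. borel)) (\<lambda>\<omega> i. X i l \<omega>) = PiM UNIV (\<lambda>i. distr M borel (X i l))"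
    using indX indep_vars_iff_distr_eq_PiM[where I=UNIV and M'="\<lambda>_. borel" and X="\<lambda>i. X i l"] by (simp add: restrict_def)
  also have "\<dots> = PiM UNIV (\<lambda>_. density lborel std_normal_density)" by (simp add: dX)
  finally show "distr M borel (Z l) = gauss" by (simp add: gauss_PiM)
qed

context elliptic_domain begin

section \<open>Survival of Wiener paths on grids and in continuous time\<close>

definition walk :: "real \<Rightarrow> real^'d \<Rightarrow> nat \<Rightarrow> (nat \<Rightarrow> real^'d) \<Rightarrow> real^'d" where
  "walk s x l z = x + sqrt s *\<^sub>R (\<Sum>m<l. b (z m))"

lemma walk_measurable [measurable]:
  assumes "l \<le> N" shows "walk s x l \<in> borel_measurable (PiM {..<N} (\<lambda>_. gauss))"
proof -
  have b: "b \<in> borel_measurable borel" by (rule borel_measurable_continuous_onI[OF continuous_b])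
  have "(\<lambda>z. z m) \<in> borel_measurable (PiM {..<N} (\<lambda>_. gauss))" if "m < l" for m
    using measurable_component_singleton[of m "{..<N}" "\<lambda>_. gauss"] that assms by (simp cong: measurable_cong_sets)
  from measurable_compose[OF this b] have [measurable]: "(\<lambda>z. b (z m)) \<in> borel_measurable (PiM {..<N} (\<lambda>_. gauss))" if "m < l" for m
    using that .
  show ?thesis unfolding walk_def[abs_def]
    by (intro borel_measurable_add borel_measurable_scaleR borel_measurable_sum) auto
qed

text \<open>Integrating out the last step replaces \<open>f\<close> by \<open>Sop K s f\<close>, so
  the induction runs over all \<open>f\<close>. The product includes \<open>l = 0\<close>, whence
  the factor \<open>indicator K x\<close>.\<close>

lemma Sop_walk:
  assumes K: "K \<in> sets borel" "K \<subseteq> Q" and f: "bm f"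
  shows "(\<integral>z. (\<Prod>l\<le>N. indicator K (walk s x l z)) * f (walk s x N z) \<partial>PiM {..<N} (\<lambda>_. gauss)) = indicator K x * (Sop K s ^^ N) f x"
  using f
proof (induction N arbitrary: f)
  case 0
  interpret p: prob_space "PiM {..<0::nat} (\<lambda>_. gauss :: (real^'d) measure)" by (intro prob_space_PiM prob_space_gauss)
  show ?case using p.prob_space by (simp add: walk_def)
next
  case (Suc N)
  interpret ps: product_sigma_finite "\<lambda>_::nat. gauss :: (real^'d) measure" by (simp add: product_sigma_finite_def gauss.sigma_finite_measure_axioms)
  interpret p: prob_space "PiM {..<Suc N} (\<lambda>_. gauss :: (real^'d) measure)" by (intro prob_space_PiM prob_space_gauss)
  note [measurable] = K(1) bm_measurable[OF Suc.prems]
  define g where "g z = (\<Prod>l\<le>Suc N. indicator K (walk s x l z)) * f (walk s x (Suc N) z)" for z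
  obtain C where C: "0 \<le> C" "\<And>x. \<bar>f x\<bar> \<le> C" using bm_bounded[OF Suc.prems] by metis
  have pr: "(\<Prod>l\<le>Suc N. indicator K (walk s x l z)) \<in> {0..1::real}" for z
    by (auto intro!: prod_nonneg prod_le_1 simp del: prod.atMost_Suc)
  have int: "integrable (PiM (insert N {..<N}) (\<lambda>_. gauss)) g"
    unfolding lessThan_Suc[symmetric]
  proof (rule p.integrable_const_bound[where B=C])
    show "AE z in PiM {..<Suc N} (\<lambda>_. gauss). norm (g z) \<le> C"
    proof (rule AE_I2)
      fix z
      have "norm (g z) \<le> 1 * C" unfolding g_def real_norm_def abs_mult
        by (rule mult_mono) (use pr[of z] C in \<open>auto simp del: prod.atMost_Suc\<close>)
      then show "norm (g z) \<le> C" by simp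
    qed
    have "walk s x l \<in> borel_measurable (PiM {..<Suc N} (\<lambda>_. gauss))" if "l \<in> {..Suc N}" for l using that by (intro walk_measurable) auto
    note [measurable] = this
    show "g \<in> borel_measurable (PiM {..<Suc N} (\<lambda>_. gauss))"
      unfolding g_def[abs_def] by (intro borel_measurable_times borel_measurable_prod) measurable
  qed
  have upd: "walk s x l (z(N := y)) = walk s x l z" if "l \<le> N" for l z y
    unfolding walk_def using that by (auto intro!: sum.cong)
  have upd': "walk s x (Suc N) (z(N := y)) = walk s x N z + sqrt s *\<^sub>R b y" for z y
    using upd[OF order_refl, of z y] by (simp add: walk_def scaleR_add_right)
  have inner: "(\<integral>y. g (z(N := y)) \<partial>gauss) = (\<Prod>l\<le>N. indicator K (walk s x l z)) * Sop K s f (walk s x N z)" for z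
  proof -
    have "(\<integral>y. g (z(N := y)) \<partial>gauss) = (\<integral>y. (\<Prod>l\<le>N. indicator K (walk s x l z)) *
        (indicator K (walk s x N z + sqrt s *\<^sub>R b y) * f (walk s x N z + sqrt s *\<^sub>R b y)) \<partial>gauss)"
      by (simp add: g_def upd upd' mult_ac cong: prod.cong_simp)
    also have "\<dots> = (\<Prod>l\<le>N. indicator K (walk s x l z)) * Gop s (\<lambda>y. indicator K y * f y) (walk s x N z)"
      by (simp add: Gop_def)
    also have "\<dots> = (\<Prod>l\<le>N. indicator K (walk s x l z)) * Sop K s f (walk s x N z)"
    proof (cases "walk s x N z \<in> K")
      case False
      then have "(\<Prod>l\<le>N. indicator K (walk s x l z)) = (0::real)" by (intro prod_zero) (auto intro!: bexI[of _ N])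
      then show ?thesis by simp
    qed (simp add: Sop_def)
    finally show ?thesis .
  qed
  have "(\<integral>z. g z \<partial>PiM {..<Suc N} (\<lambda>_. gauss)) = (\<integral>z. (\<integral>y. g (z(N := y)) \<partial>gauss) \<partial>PiM {..<N} (\<lambda>_. gauss))"
    unfolding lessThan_Suc using int by (intro ps.product_integral_insert) auto
  also have "\<dots> = indicator K x * (Sop K s ^^ N) (Sop K s f) x"
    unfolding inner by (rule Suc.IH[OF opc_bm[OF Sop_opc[OF K] Suc.prems]])
  also have "(Sop K s ^^ N) (Sop K s f) = (Sop K s ^^ Suc N) f" by (simp add: funpow_swap1)
  finally show ?case unfolding g_def .
qed

lemma wiener_grid_prob:
  fixes W :: "real \<Rightarrow> 'a \<Rightarrow> real^'d"
  assumes M: "prob_space M" and W: "std_wiener M W" and s: "0 < s" and N: "0 < N" and K: "K \<in> sets borel" "K \<subseteq> Q"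
  shows "measure M {\<omega> \<in> space M. \<forall>l\<le>N. x + b (W (real l * s) \<omega>) \<in> K} = (Sop K s ^^ N) (\<lambda>_. 1) x"
proof -
  interpret prob_space M by (rule M)
  define Z where "Z l \<omega> = (1 / sqrt s) *\<^sub>R (W (real (Suc l) * s) \<omega> - W (real l * s) \<omega>)" for l \<omega>
  have ind: "indep_vars (\<lambda>_. borel) Z {..<N}" and dZ: "\<And>l. distr M borel (Z l) = gauss"
    using wiener_increments[OF W s] by (auto simp: Z_def[abs_def])
  have rZ [measurable]: "Z l \<in> borel_measurable M" if "l \<in> {..<N}" for l using ind that by (auto simp: indep_vars_def)
  define R where "R \<omega> = (\<lambda>l\<in>{..<N}. Z l \<omega>)" for \<omega>
  have Rm: "R \<in> measurable M (PiM {..<N} (\<lambda>_. borel))" unfolding R_def[abs_def] by (rule measurable_restrict[OF rZ])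
  have dR: "distr M (PiM {..<N} (\<lambda>_. borel)) R = PiM {..<N} (\<lambda>_. gauss)"
    using ind indep_vars_iff_distr_eq_PiM'[where I="{..<N}" and M'="\<lambda>_. borel" and X=Z] rZ N unfolding R_def[abs_def] dZ by auto
  have W0: "W 0 \<omega> = 0" if "\<omega> \<in> space M" for \<omega>
    using W that by (auto simp: std_wiener_def std_wiener_1d_def vec_eq_iff)
  have walk: "walk s x l (R \<omega>) = x + b (W (real l * s) \<omega>)" if "\<omega> \<in> space M" "l \<le> N" for l \<omega>
  proof -
    have "(\<Sum>m<l. b (R \<omega> m)) = (\<Sum>m<l. b (Z m \<omega>))" using that by (intro sum.cong) (auto simp: R_def)
    also have "\<dots> = b (\<Sum>m<l. Z m \<omega>)" by (rule linear_sum[OF linear_b, symmetric])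
    also have "(\<Sum>m<l. Z m \<omega>) = (1 / sqrt s) *\<^sub>R W (real l * s) \<omega>"
      unfolding Z_def scaleR_right.sum[symmetric] sum_lessThan_telescope[of "\<lambda>m. W (real m * s) \<omega>"] by (simp add: W0[OF that(1)])
    finally show ?thesis using s by (simp add: walk_def linear_scale[OF linear_b])
  qed
  let ?E = "{\<omega> \<in> space M. \<forall>l\<le>N. x + b (W (real l * s) \<omega>) \<in> K}"
  have g: "(\<lambda>z. (\<Prod>l\<le>N. indicator K (walk s x l z)) * 1 :: real) \<in> borel_measurable (PiM {..<N} (\<lambda>_. borel))"
  proof -
    have "walk s x l \<in> borel_measurable (PiM {..<N} (\<lambda>_. borel))" if "l \<in> {..N}" for l
      using walk_measurable[of l N s x] that by (simp cong: sets_PiM_cong measurable_cong_sets)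
    note [measurable] = this K(1)
    show ?thesis by (intro borel_measurable_times borel_measurable_prod) measurable
  qed
  have pt: "(\<Prod>l\<le>N. indicator K (walk s x l (R \<omega>))) * 1 = (indicator ?E \<omega> :: real)" if "\<omega> \<in> space M" for \<omega>
  proof (cases "\<forall>l\<le>N. x + b (W (real l * s) \<omega>) \<in> K")
    case True
    then show ?thesis using that by (auto simp: walk intro!: prod.neutral)
  next
    case False
    then obtain l where "l \<le> N" "walk s x l (R \<omega>) \<notin> K" using walk[OF \<open>\<omega> \<in> space M\<close>] by auto
    then have "(\<Prod>l\<le>N. indicator K (walk s x l (R \<omega>))) = (0::real)" by (intro prod_zero) (auto intro!: bexI[of _ l])
    then show ?thesis using False by simp
  qed
  have "?E \<inter> space M = ?E" by (rule Int_absorb2) (rule Collect_restrict)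
  then have "measure M ?E = (\<integral>\<omega>. indicator ?E \<omega> \<partial>M)" by (subst Bochner_Integration.integral_indicator) (rule arg_cong[symmetric])
  also have "\<dots> = (\<integral>\<omega>. (\<Prod>l\<le>N. indicator K (walk s x l (R \<omega>))) * 1 \<partial>M)"
    by (rule Bochner_Integration.integral_cong[OF refl pt[symmetric]])
  also have "\<dots> = (\<integral>z. (\<Prod>l\<le>N. indicator K (walk s x l z)) * 1 \<partial>PiM {..<N} (\<lambda>_. gauss))"
    unfolding dR[symmetric] by (rule integral_distr[OF Rm g, symmetric])
  also have "\<dots> = indicator K x * (Sop K s ^^ N) (\<lambda>_. 1) x" by (rule Sop_walk[OF K bm_const])
  also have "\<dots> = (Sop K s ^^ N) (\<lambda>_. 1) x"
  proof -
    \<comment> \<open>With at least one step, \<open>Sop\<close> already carries the indicator of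
      the starting point.\<close>
    obtain n where n: "N = Suc n" using N by (cases N) auto
    show ?thesis unfolding n funpow.simps comp_apply Sop_def[of K s _ x] by (cases "x \<in> K") simp_all
  qed
  finally show ?thesis .
qed

end

text \<open>Dyadic approximation from below stays within the interval up to \<open>T\<close>, and a
  closed set retains the limit.\<close>

lemma dyadic_path_closed:
  fixes \<xi> :: "real \<Rightarrow> 'b::metric_space"
  assumes cont: "continuous_on {0..} \<xi>" and K: "closed K"
    and g: "\<And>n l. real l / 2 ^ n \<le> T \<Longrightarrow> \<xi> (real l / 2 ^ n) \<in> K" and t: "0 \<le> t" "t \<le> T"
  shows "\<xi> t \<in> K"
proof -
  define q where "q n = real (nat \<lfloor>t * 2 ^ n\<rfloor>) / 2 ^ n" for n :: nat
  have fl: "real (nat \<lfloor>t * 2 ^ n\<rfloor>) = of_int \<lfloor>t * 2 ^ n\<rfloor>" for n using t by simp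
  have q: "q n \<le> t" "t - 1 / 2 ^ n \<le> q n" "0 \<le> q n" for n
  proof -
    have "real (nat \<lfloor>t * 2 ^ n\<rfloor>) \<le> t * 2 ^ n" "t * 2 ^ n - 1 \<le> real (nat \<lfloor>t * 2 ^ n\<rfloor>)"
      unfolding fl by linarith+
    from divide_right_mono[OF this(1), of "2 ^ n"] divide_right_mono[OF this(2), of "2 ^ n"]
    show "q n \<le> t" "t - 1 / 2 ^ n \<le> q n" unfolding q_def by (simp_all add: diff_divide_distrib)
    show "0 \<le> q n" by (simp add: q_def)
  qed
  have "(\<lambda>n. (1 / 2) ^ n) \<longlonglongrightarrow> (0::real)" by (rule LIMSEQ_realpow_zero) auto
  then have "(\<lambda>n. t - (1 / 2) ^ n) \<longlonglongrightarrow> t - 0" by (rule tendsto_diff[OF tendsto_const])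
  then have "(\<lambda>n. t - 1 / 2 ^ n) \<longlonglongrightarrow> t" by (simp add: power_one_over)
  then have "q \<longlonglongrightarrow> t" by (rule tendsto_sandwich[rotated 2, OF _ tendsto_const]) (rule always_eventually allI q)+
  then have lim: "(\<lambda>n. \<xi> (q n)) \<longlonglongrightarrow> \<xi> t" by (rule continuous_on_tendsto_compose[OF cont]) (use q(3) t in simp_all)
  have "\<xi> (q n) \<in> K" for n unfolding q_def by (rule g[OF order_trans[OF q(1)[of n, unfolded q_def] t(2)]])
  then show ?thesis by (intro Lim_in_closed_set[OF K _ _ lim]) auto
qed

lemma (in prob_space) indep_vars_cong_space:
  assumes "indep_vars N X I" and eq: "\<And>i \<omega>. i \<in> I \<Longrightarrow> \<omega> \<in> space M \<Longrightarrow> X i \<omega> = Y i \<omega>"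
  shows "indep_vars N Y I"
proof -
  have "X i -` A \<inter> space M = Y i -` A \<inter> space M" if "i \<in> I" for i A using eq[OF that] by auto
  then have "{X i -` A \<inter> space M |A. A \<in> sets (N i)} = {Y i -` A \<inter> space M |A. A \<in> sets (N i)}" if "i \<in> I" for i
    using that by (simp add: conj_commute)
  then have "indep_sets (\<lambda>i. {X i -` A \<inter> space M |A. A \<in> sets (N i)}) I = indep_sets (\<lambda>i. {Y i -` A \<inter> space M |A. A \<in> sets (N i)}) I"
    by (intro indep_sets_cong refl)
  moreover have "random_variable (N i) (X i) \<longleftrightarrow> random_variable (N i) (Y i)" if "i \<in> I" for i
    by (rule measurable_cong) (rule eq[OF that])
  ultimately show ?thesis using assms(1) unfolding indep_vars_def2 by blast
qed

context elliptic_domain begin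

text \<open>A countable description of staying in \<open>Q\<close>, valid for continuous paths; it makes the survival event
  measurable with respect to the path in the product sigma algebra.\<close>

definition survives :: "real \<Rightarrow> real^'d \<Rightarrow> (real \<Rightarrow> real^'d) set" where
  "survives \<tau> x = {w. \<exists>m. \<forall>n l. real l / 2 ^ n \<le> \<tau> \<longrightarrow> x + b (w (real l / 2 ^ n)) \<in> Kc m}"

lemma survives_measurable: "survives \<tau> x \<in> sets (PiM UNIV (\<lambda>_::real. borel :: (real^'d) measure))"
proof -
  have "{w \<in> space (PiM UNIV (\<lambda>_::real. borel :: (real^'d) measure)).
      \<exists>m. \<forall>n l. real l / 2 ^ n \<le> \<tau> \<longrightarrow> x + b (w (real l / 2 ^ n)) \<in> Kc m} \<in> sets (PiM UNIV (\<lambda>_. borel))"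
    by measurable
  then show ?thesis by (simp add: survives_def space_PiM)
qed

lemma dyadic_in_Kc_iff:
  assumes w: "continuous_on {0..} w"
  shows "(\<forall>n l. real l / 2 ^ n \<le> \<tau> \<longrightarrow> x + b (w (real l / 2 ^ n)) \<in> Kc m) \<longleftrightarrow> (\<forall>t\<in>{0..\<tau>}. x + b (w t) \<in> Kc m)"
proof
  assume *: "\<forall>n l. real l / 2 ^ n \<le> \<tau> \<longrightarrow> x + b (w (real l / 2 ^ n)) \<in> Kc m"
  have "continuous_on {0..} (\<lambda>t. x + b (w t))"
    by (intro continuous_intros continuous_on_compose2[OF continuous_b w]) auto
  note c = this
  show "\<forall>t\<in>{0..\<tau>}. x + b (w t) \<in> Kc m"
  proof
    fix t assume "t \<in> {0..\<tau>}"
    then have t: "0 \<le> t" "t \<le> \<tau>" by auto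
    show "x + b (w t) \<in> Kc m" by (rule dyadic_path_closed[OF c closed_Kc _ t]) (use * in blast)
  qed
qed auto

text \<open>A continuous path maps the compact time interval to a compact set, so a path that stays
  in \<open>Q\<close> stays in a single \<open>Kc m\<close>; this justifies the existential
  quantifier over \<open>m\<close> in front.\<close>

lemma survives_iff:
  assumes w: "continuous_on {0..} w"
  shows "w \<in> survives \<tau> x \<longleftrightarrow> (\<forall>t\<in>{0..\<tau>}. x + b (w t) \<in> Q)"
  unfolding survives_def mem_Collect_eq dyadic_in_Kc_iff[OF w]
proof
  assume *: "\<forall>t\<in>{0..\<tau>}. x + b (w t) \<in> Q"
  have "continuous_on {0..\<tau>} (\<lambda>t. x + b (w t))"
    by (intro continuous_intros continuous_on_compose2[OF continuous_b continuous_on_subset[OF w]]) auto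
  then have "compact ((\<lambda>t. x + b (w t)) ` {0..\<tau>})" by (intro compact_continuous_image) auto
  moreover have "(\<lambda>t. x + b (w t)) ` {0..\<tau>} \<subseteq> Q" using * unfolding image_subset_iff .
  ultimately obtain m where "(\<lambda>t. x + b (w t)) ` {0..\<tau>} \<subseteq> Kc m" by (metis compact_subset_Kc order_refl)
  then have "\<forall>t\<in>{0..\<tau>}. x + b (w t) \<in> Kc m" unfolding image_subset_iff .
  then show "\<exists>m. \<forall>t\<in>{0..\<tau>}. x + b (w t) \<in> Kc m" ..
next
  assume "\<exists>m. \<forall>t\<in>{0..\<tau>}. x + b (w t) \<in> Kc m"
  then show "\<forall>t\<in>{0..\<tau>}. x + b (w t) \<in> Q" using subsetD[OF Kc_subset] by metis
qed

lemma std_wiener_path: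
  assumes "std_wiener M W"
  shows std_wiener_measurable: "(\<lambda>\<omega>. W t \<omega>) \<in> borel_measurable M"
    and std_wiener_continuous: "\<omega> \<in> space M \<Longrightarrow> continuous_on {0..} (\<lambda>t. W t \<omega> :: real^'d)"
proof -
  have W: "std_wiener_1d M (\<lambda>t \<omega>. W t \<omega> $ i)" for i using assms by (simp add: std_wiener_def)
  then have "(\<lambda>\<omega>. W t \<omega> $ i) \<in> borel_measurable M" for i by (simp add: std_wiener_1d_def)
  then have "(\<lambda>\<omega> i. W t \<omega> $ i) \<in> measurable M (PiM UNIV (\<lambda>_. borel))" by (intro measurable_PiM_single') auto
  from measurable_compose[OF this measurable_vec_PiM] show "(\<lambda>\<omega>. W t \<omega>) \<in> borel_measurable M" by simp
  show "continuous_on {0..} (\<lambda>t. W t \<omega>)" if "\<omega> \<in> space M"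
    using W that unfolding std_wiener_1d_def by (subst continuous_on_componentwise) (auto simp: Basis_vec_def inner_axis)
qed

lemma survival_event_eq:
  assumes "std_wiener M W"
  shows "{\<omega> \<in> space M. \<forall>t\<in>{0..\<tau>}. x + b (W t \<omega>) \<in> Q} = (\<lambda>\<omega> t. W t \<omega>) -` survives \<tau> x \<inter> space M"
  using survives_iff[OF std_wiener_continuous[OF assms]] by blast

lemma survival_event_measurable:
  assumes W: "std_wiener M W"
  shows "{\<omega> \<in> space M. \<forall>t\<in>{0..\<tau>}. x + b (W t \<omega>) \<in> Q} \<in> sets M"
  unfolding survival_event_eq[OF W]
  by (rule measurable_sets[OF _ survives_measurable]) (intro measurable_PiM_single' std_wiener_measurable[OF W], auto)

text \<open>The limits defining \<open>P\<close> are mirrored by events: for fixed \<open>m\<close>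
  the grid events decrease to \<open>E m\<close>, as in \<open>Pm\<close>, and the
  \<open>E m\<close> increase to survival in \<open>Q\<close>, as in \<open>P\<close>.\<close>

lemma survival_prob:
  assumes M: "prob_space M" and W: "std_wiener M W" and j: "0 < j"
  shows "measure M {\<omega> \<in> space M. \<forall>t\<in>{0..real j / 2 ^ k}. x + b (W t \<omega>) \<in> Q} = (P k ^^ j) (\<lambda>_. 1) x"
proof -
  interpret prob_space M by (rule M)
  have [measurable]: "(\<lambda>\<omega>. W t \<omega>) \<in> borel_measurable M" for t by (rule std_wiener_measurable[OF W])
  define E where "E m = {\<omega> \<in> space M. \<forall>n l. real l / 2 ^ n \<le> real j / 2 ^ k \<longrightarrow> x + b (W (real l / 2 ^ n) \<omega>) \<in> Kc m}" for m
  define G where "G m n = {\<omega> \<in> space M. \<forall>l\<le>j * 2 ^ n. x + b (W (real l * (1 / 2 ^ (n + k))) \<omega>) \<in> Kc m}" for m n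
  have Em: "E m \<in> sets M" for m unfolding E_def by measurable
  have Gm: "G m n \<in> sets M" for m n unfolding G_def by measurable
  have mono: "G m (Suc n) \<subseteq> G m n" for m n
  proof
    fix \<omega> assume w: "\<omega> \<in> G m (Suc n)"
    have "x + b (W (real l * (1 / 2 ^ (n + k))) \<omega>) \<in> Kc m" if "l \<le> j * 2 ^ n" for l
    proof -
      have "real (2 * l) * (1 / 2 ^ (Suc n + k)) = real l * (1 / 2 ^ (n + k))" by simp
      moreover have "2 * l \<le> j * 2 ^ Suc n" using that by simp
      ultimately show ?thesis using w unfolding G_def by (metis (no_types, lifting) mem_Collect_eq)
    qed
    then show "\<omega> \<in> G m n" using w unfolding G_def by blast
  qed
  \<comment> \<open>A dyadic time \<open>l / 2 ^ n\<close> up to \<open>j / 2 ^ k\<close> has index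
    \<open>l * 2 ^ k\<close> on the grid of mesh \<open>1 / 2 ^ (n + k)\<close>.\<close>
  have EG: "(\<Inter>n. G m n) = E m" for m
  proof (intro equalityI subsetI)
    fix \<omega> assume w: "\<omega> \<in> (\<Inter>n. G m n)"
    have "x + b (W (real l / 2 ^ n) \<omega>) \<in> Kc m" if "real l / 2 ^ n \<le> real j / 2 ^ k" for n l
    proof -
      have "real (l * 2 ^ k) \<le> real (j * 2 ^ n)" using that by (simp add: field_simps)
      then have "l * 2 ^ k \<le> j * 2 ^ n" by (simp only: of_nat_le_iff)
      moreover have "real (l * 2 ^ k) * (1 / 2 ^ (n + k)) = real l / 2 ^ n" by (simp add: power_add)
      moreover have "\<omega> \<in> G m n" using w by blast
      ultimately show ?thesis unfolding G_def by (metis (no_types, lifting) mem_Collect_eq)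
    qed
    then show "\<omega> \<in> E m" using w unfolding E_def G_def by blast
  next
    fix \<omega> assume w: "\<omega> \<in> E m"
    have "x + b (W (real l * (1 / 2 ^ (n + k))) \<omega>) \<in> Kc m" if "l \<le> j * 2 ^ n" for l n
    proof -
      have "real l \<le> real (j * 2 ^ n)" using that by (simp only: of_nat_le_iff)
      then have "real l / 2 ^ (n + k) \<le> real j / 2 ^ k" by (simp add: power_add field_simps)
      moreover have "real l / 2 ^ (n + k) = real l * (1 / 2 ^ (n + k))" by simp
      ultimately show ?thesis using w unfolding E_def by (metis (no_types, lifting) mem_Collect_eq)
    qed
    then show "\<omega> \<in> (\<Inter>n. G m n)" using w unfolding E_def G_def by blast
  qed
  have pG: "prob (G m n) = (Ap m n k ^^ j) (\<lambda>_. 1) x" for m n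
  proof -
    have "prob (G m n) = (Sop (Kc m) (1 / 2 ^ (n + k)) ^^ (j * 2 ^ n)) (\<lambda>_. 1) x"
      unfolding G_def by (rule wiener_grid_prob[OF M W]) (use j Kc_subset in auto)
    then show ?thesis by (simp add: Ap_def funpow_mult mult.commute)
  qed
  have pE: "prob (E m) = (Pm m k ^^ j) (\<lambda>_. 1) x" for m
  proof (rule LIMSEQ_unique)
    show "(\<lambda>n. prob (G m n)) \<longlonglongrightarrow> prob (E m)"
      unfolding EG[symmetric] by (rule finite_Lim_measure_decseq) (use Gm mono in \<open>auto simp: decseq_Suc_iff\<close>)
    show "(\<lambda>n. prob (G m n)) \<longlonglongrightarrow> (Pm m k ^^ j) (\<lambda>_. 1) x"
      unfolding pG by (rule Pm_power_tendsto[OF bm_const])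
  qed
  have Emono: "E m \<subseteq> E (Suc m)" for m unfolding E_def by (auto intro: subsetD[OF Kc_mono[OF le_SucI[OF order_refl]]])
  have UE: "(\<Union>m. E m) = {\<omega> \<in> space M. \<forall>t\<in>{0..real j / 2 ^ k}. x + b (W t \<omega>) \<in> Q}"
    unfolding survival_event_eq[OF W] by (auto simp: E_def survives_def)
  show ?thesis
  proof (rule LIMSEQ_unique)
    show "(\<lambda>m. prob (E m)) \<longlonglongrightarrow> prob {\<omega> \<in> space M. \<forall>t\<in>{0..real j / 2 ^ k}. x + b (W t \<omega>) \<in> Q}"
      unfolding UE[symmetric] by (rule finite_Lim_measure_incseq) (use Em Emono in \<open>auto simp: incseq_Suc_iff\<close>)
    show "(\<lambda>m. prob (E m)) \<longlonglongrightarrow> (P k ^^ j) (\<lambda>_. 1) x"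
      unfolding pE by (rule P_power_tendsto[OF bm_const])
  qed
qed

lemma P_funpow_one_nonneg: "0 \<le> (P k ^^ n) (\<lambda>_. 1) x"
proof (induction n arbitrary: x)
  case (Suc n) then show ?case by (simp add: opc_nonneg[OF P_opc opc_funpow_bm[OF P_opc bm_const]])
qed simp

text \<open>Survival probabilities decrease in time, so an arbitrary \<open>\<tau>\<close> can be
  caught between neighbouring dyadic times. They enter as a number \<open>p\<close> with bounds from
  both sides, which makes \<open>T\<close> independent of the starting point and of the
  process.\<close>

lemma dyadic_sandwich_asymptotics:
  assumes l: "0 \<le> l" and h: "bm h" and e: "0 < e"
    and ul: "\<And>k. k0 \<le> k \<Longrightarrow> uniform_limit UNIV (\<lambda>n x. (P k ^^ n) (\<lambda>_. 1) x / exp (- l / 2 / 2 ^ k) ^ n) h sequentially"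
  obtains T where "0 < T"
    "\<And>\<tau> x p. T \<le> \<tau> \<Longrightarrow> (\<And>k j. 0 < j \<Longrightarrow> real j / 2 ^ k \<le> \<tau> \<Longrightarrow> p \<le> (P k ^^ j) (\<lambda>_. 1) x) \<Longrightarrow>
      (\<And>k j. 0 < j \<Longrightarrow> \<tau> \<le> real j / 2 ^ k \<Longrightarrow> (P k ^^ j) (\<lambda>_. 1) x \<le> p) \<Longrightarrow> \<bar>exp (\<tau> * l / 2) * p - h x\<bar> \<le> e"
proof -
  obtain C where C: "0 \<le> C" "\<And>x. \<bar>h x\<bar> \<le> C" using bm_bounded[OF h] by metis
  have "(\<lambda>k. (1 / 2) ^ k) \<longlonglongrightarrow> (0::real)" by (rule LIMSEQ_realpow_zero) auto
  then have "(\<lambda>k. exp (l / 2 * (1 / 2) ^ k)) \<longlonglongrightarrow> exp (l / 2 * 0)" by (rule tendsto_exp[OF tendsto_mult[OF tendsto_const]])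
  then have lim: "(\<lambda>k. exp (l / 2 / 2 ^ k)) \<longlonglongrightarrow> 1" by (simp add: power_one_over)
  then have "(\<lambda>k. (exp (l / 2 / 2 ^ k) - 1) * C) \<longlonglongrightarrow> (1 - 1) * C" by (intro tendsto_intros)
  then have ev1: "eventually (\<lambda>k. (exp (l / 2 / 2 ^ k) - 1) * C < e / 2) sequentially" using e by (intro order_tendstoD) auto
  have ev2: "eventually (\<lambda>k. exp (l / 2 / 2 ^ k) < 2) sequentially" by (rule order_tendstoD[OF lim]) simp
  \<comment> \<open>The level is fixed first, so fine that one time step changes the normalisation
    by a factor close to 1; only then is the number \<open>J\<close> of steps chosen.\<close>
  obtain k where k: "k0 \<le> k" "(exp (l / 2 / 2 ^ k) - 1) * C < e / 2" "exp (l / 2 / 2 ^ k) < 2"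
    using eventually_happens[OF eventually_conj[OF eventually_ge_at_top[of k0] eventually_conj[OF ev1 ev2]]] by auto
  define E where "E = exp (l / 2 / 2 ^ k)"
  have E: "1 \<le> E" "E < 2" "(E - 1) * C < e / 2" using k l by (auto simp: E_def)
  define v where "v n x = (P k ^^ n) (\<lambda>_. 1) x / exp (- l / 2 / 2 ^ k) ^ n" for n x
  have "eventually (\<lambda>n. \<forall>x\<in>UNIV. dist (v n x) (h x) < e / 4) sequentially"
    using uniform_limitD[OF ul[OF k(1)], of "e / 4"] e by (simp add: v_def)
  then obtain J where J: "\<And>n x. J \<le> n \<Longrightarrow> \<bar>v n x - h x\<bar> < e / 4" unfolding eventually_sequentially dist_real_def by blast
  have v0: "0 \<le> v n x" for n x
    unfolding v_def by (intro divide_nonneg_nonneg P_funpow_one_nonneg) simp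
  show ?thesis
  proof (rule that[of "real (J + 1) / 2 ^ k"])
    fix \<tau> x p assume T: "real (J + 1) / 2 ^ k \<le> \<tau>"
      and up: "\<And>k j. 0 < j \<Longrightarrow> real j / 2 ^ k \<le> \<tau> \<Longrightarrow> p \<le> (P k ^^ j) (\<lambda>_. 1) x"
      and lo: "\<And>k j. 0 < j \<Longrightarrow> \<tau> \<le> real j / 2 ^ k \<Longrightarrow> (P k ^^ j) (\<lambda>_. 1) x \<le> p"
    \<comment> \<open>\<open>\<tau>\<close> lies between \<open>j / 2 ^ k\<close> and
      \<open>(j + 1) / 2 ^ k\<close>.\<close>
    define j where "j = nat \<lfloor>\<tau> * 2 ^ k\<rfloor>"
    have T': "real (J + 1) \<le> \<tau> * 2 ^ k" using T by (simp add: field_simps)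
    then have "int (J + 1) \<le> \<lfloor>\<tau> * 2 ^ k\<rfloor>" by (simp add: le_floor_iff)
    then have jJ: "J + 1 \<le> j" unfolding j_def by linarith
    have rj: "real j = of_int \<lfloor>\<tau> * 2 ^ k\<rfloor>" using T' unfolding j_def by simp
    have "real j \<le> \<tau> * 2 ^ k" "\<tau> * 2 ^ k \<le> real (Suc j)" unfolding of_nat_Suc rj by linarith+
    then have jt: "real j / 2 ^ k \<le> \<tau>" "\<tau> \<le> real (Suc j) / 2 ^ k" by (simp_all add: field_simps)
    have Pv: "(P k ^^ n) (\<lambda>_. 1) x = exp (- (l / 2) * (real n / 2 ^ k)) * v n x" for n
      by (simp add: v_def exp_of_nat_mult[symmetric] mult_ac)
    have ex: "exp (\<tau> * l / 2) * (exp (- (l / 2) * (real n / 2 ^ k)) * y) = exp (l / 2 * (\<tau> - real n / 2 ^ k)) * y" for n y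
      by (simp add: mult.assoc[symmetric] mult_exp_exp algebra_simps)
    have "exp (\<tau> * l / 2) * p \<le> exp (\<tau> * l / 2) * (P k ^^ j) (\<lambda>_. 1) x" using up[OF _ jt(1)] jJ by (intro mult_left_mono) auto
    also have "\<dots> = exp (l / 2 * (\<tau> - real j / 2 ^ k)) * v j x" unfolding Pv ex ..
    also have "\<dots> \<le> E * v j x"
    proof (rule mult_right_mono[OF _ v0])
      have "\<tau> - real j / 2 ^ k \<le> 1 / 2 ^ k" using jt(2) by (simp add: add_divide_distrib)
      then have "l / 2 * (\<tau> - real j / 2 ^ k) \<le> l / 2 * (1 / 2 ^ k)" using l by (intro mult_left_mono) auto
      then show "exp (l / 2 * (\<tau> - real j / 2 ^ k)) \<le> E" by (simp add: E_def)
    qed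
    also have "\<dots> \<le> E * (h x + e / 4)"
    proof (rule mult_left_mono)
      show "v j x \<le> h x + e / 4" using J[of j x] jJ by linarith
    qed (use E in simp)
    also have "\<dots> = h x + (E - 1) * h x + E * (e / 4)" by (simp add: algebra_simps)
    also have "\<dots> \<le> h x + (E - 1) * C + 2 * (e / 4)"
      using E C(2)[of x] e by (intro add_mono mult_left_mono mult_right_mono order_refl) auto
    also have "\<dots> \<le> h x + e" using E(3) by simp
    finally have U: "exp (\<tau> * l / 2) * p \<le> h x + e" .
    have "h x - e \<le> h x - (E - 1) * C - e / 4" using E(3) e by simp
    also have "\<dots> \<le> h x - (1 - 1 / E) * h x - e / 4"
    proof -
      have "1 - 1 / E \<le> E - 1" using E(1) zero_le_power2[of "E - 1"] by (simp add: field_simps power2_eq_square)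
      then have "(1 - 1 / E) * \<bar>h x\<bar> \<le> (E - 1) * C" using E(1) C by (intro mult_mono) auto
      moreover have "(1 - 1 / E) * h x \<le> (1 - 1 / E) * \<bar>h x\<bar>" using E(1) by (intro mult_left_mono) auto
      ultimately show ?thesis by linarith
    qed
    also have "\<dots> = 1 / E * h x - e / 4" by (simp add: algebra_simps)
    also have "\<dots> \<le> 1 / E * h x - 1 / E * (e / 4)"
    proof -
      have "1 / E * (e / 4) \<le> 1 * (e / 4)" using E e by (intro mult_right_mono) auto
      then show ?thesis by simp
    qed
    also have "\<dots> = 1 / E * (h x - e / 4)" by (simp add: right_diff_distrib)
    also have "\<dots> \<le> 1 / E * v (Suc j) x"
    proof (rule mult_left_mono)
      show "h x - e / 4 \<le> v (Suc j) x" using J[of "Suc j" x] jJ by linarith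
    qed (use E in simp)
    also have "\<dots> \<le> exp (l / 2 * (\<tau> - real (Suc j) / 2 ^ k)) * v (Suc j) x"
    proof (rule mult_right_mono[OF _ v0])
      have "- (1 / 2 ^ k) \<le> \<tau> - real (Suc j) / 2 ^ k" using jt(1) by (simp add: add_divide_distrib)
      then have "l / 2 * (- (1 / 2 ^ k)) \<le> l / 2 * (\<tau> - real (Suc j) / 2 ^ k)" using l by (intro mult_left_mono) auto
      then have "exp (- (l / 2 / 2 ^ k)) \<le> exp (l / 2 * (\<tau> - real (Suc j) / 2 ^ k))" by simp
      then show "1 / E \<le> exp (l / 2 * (\<tau> - real (Suc j) / 2 ^ k))" by (simp add: E_def exp_minus inverse_eq_divide)
    qed
    also have "\<dots> = exp (\<tau> * l / 2) * (P k ^^ Suc j) (\<lambda>_. 1) x" unfolding Pv ex ..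
    also have "\<dots> \<le> exp (\<tau> * l / 2) * p" using lo[OF _ jt(2)] by (intro mult_left_mono) auto
    finally show "\<bar>exp (\<tau> * l / 2) * p - h x\<bar> \<le> e" using U by linarith
  qed simp
qed

end

section \<open>Convergence to the Poisson distribution\<close>

context elliptic_domain begin

text \<open>Uniformity of the asymptotics over starting points permits summation: the total error is
  at most the uniform error times the mass of the scaled counting measure, and this mass converges,
  as the test function 1 shows.\<close>

lemma survivors_poisson:
  fixes n :: "real \<Rightarrow> nat" and \<gamma> :: "real \<Rightarrow> nat \<Rightarrow> real^'d" and W :: "real \<Rightarrow> nat \<Rightarrow> real \<Rightarrow> 'a \<Rightarrow> real^'d"
  assumes M: "prob_space M"
    and W: "\<And>\<tau> k. 0 < \<tau> \<Longrightarrow> k < n \<tau> \<Longrightarrow> std_wiener M (W \<tau> k)"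
    and ind: "\<And>\<tau>. 0 < \<tau> \<Longrightarrow> indep_processes M (W \<tau>) {..<n \<tau>}"
    and l: "0 < l" and h: "bm h" "continuous_on UNIV h"
    and ul: "\<And>k. k0 \<le> k \<Longrightarrow> uniform_limit UNIV (\<lambda>n x. (P k ^^ n) (\<lambda>_. 1) x / exp (- l / 2 / 2 ^ k) ^ n) h sequentially"
    and weak: "\<And>g::real^'d \<Rightarrow> real. continuous_on UNIV g \<Longrightarrow> bounded (range g) \<Longrightarrow>
        ((\<lambda>\<tau>. exp (- \<tau> * l / 2) * (\<Sum>k<n \<tau>. g (\<gamma> \<tau> k))) \<longlongrightarrow> integral\<^sup>L \<nu> g) at_top"
    and \<phi>: "continuous_on UNIV \<phi>" "bounded (range (\<phi> :: real \<Rightarrow> real))"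
  shows "((\<lambda>\<tau>. prob_space.expectation M (\<lambda>\<omega>. \<phi> (real (card {k. k < n \<tau> \<and> (\<forall>t\<in>{0..\<tau>}. \<gamma> \<tau> k + b (W \<tau> k t \<omega>) \<in> Q)}))))
     \<longlongrightarrow> (\<Sum>m. \<phi> (real m) * integral\<^sup>L \<nu> h ^ m / fact m * exp (- integral\<^sup>L \<nu> h))) at_top"
proof -
  interpret prob_space M by (rule M)
  define A where "A = integral\<^sup>L \<nu> h"
  define E where "E \<tau> k = {\<omega> \<in> space M. \<forall>t\<in>{0..\<tau>}. \<gamma> \<tau> k + b (W \<tau> k t \<omega>) \<in> Q}" for \<tau> k
  define N where "N \<tau> = exp (- \<tau> * l / 2) * real (n \<tau>)" for \<tau>
  obtain C where C: "0 \<le> C" "\<And>x. \<bar>h x\<bar> \<le> C" using bm_bounded[OF h(1)] by metis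
  have Em: "E \<tau> k \<in> events" if "0 < \<tau>" "k < n \<tau>" for \<tau> k
    unfolding E_def by (rule survival_event_measurable[OF W[OF that]])
  have asym: thesis if e: "0 < e" and that: "\<And>T. (\<And>\<tau> k. T \<le> \<tau> \<Longrightarrow> k < n \<tau> \<Longrightarrow> \<bar>exp (\<tau> * l / 2) * prob (E \<tau> k) - h (\<gamma> \<tau> k)\<bar> \<le> e) \<Longrightarrow> thesis" for e thesis
  proof -
    from dyadic_sandwich_asymptotics[OF less_imp_le[OF l] h(1) e ul] obtain T where T: "0 < T"
      "\<And>\<tau> x p. T \<le> \<tau> \<Longrightarrow> (\<And>k j. 0 < j \<Longrightarrow> real j / 2 ^ k \<le> \<tau> \<Longrightarrow> p \<le> (P k ^^ j) (\<lambda>_. 1) x) \<Longrightarrow>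
        (\<And>k j. 0 < j \<Longrightarrow> \<tau> \<le> real j / 2 ^ k \<Longrightarrow> (P k ^^ j) (\<lambda>_. 1) x \<le> p) \<Longrightarrow> \<bar>exp (\<tau> * l / 2) * p - h x\<bar> \<le> e" by blast
    show thesis
    proof (rule that[of T])
      fix \<tau> k assume tk: "T \<le> \<tau>" "k < n \<tau>"
      then have w: "std_wiener M (W \<tau> k)" using T(1) W by simp
      show "\<bar>exp (\<tau> * l / 2) * prob (E \<tau> k) - h (\<gamma> \<tau> k)\<bar> \<le> e"
      proof (rule T(2)[OF tk(1)])
        fix i j :: nat assume j: "0 < j"
        have m: "{\<omega> \<in> space M. \<forall>t\<in>{0..real j / 2 ^ i}. \<gamma> \<tau> k + b (W \<tau> k t \<omega>) \<in> Q} \<in> events"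
          "E \<tau> k \<in> events" unfolding E_def by (rule survival_event_measurable[OF w])+
        show "prob (E \<tau> k) \<le> (P i ^^ j) (\<lambda>_. 1) (\<gamma> \<tau> k)" if "real j / 2 ^ i \<le> \<tau>"
          unfolding survival_prob[OF M w j, symmetric] by (rule finite_measure_mono[OF _ m(1)]) (use that in \<open>auto simp: E_def\<close>)
        show "(P i ^^ j) (\<lambda>_. 1) (\<gamma> \<tau> k) \<le> prob (E \<tau> k)" if "\<tau> \<le> real j / 2 ^ i"
          unfolding survival_prob[OF M w j, symmetric] by (rule finite_measure_mono[OF _ m(2)]) (use that in \<open>auto simp: E_def\<close>)
      qed
    qed
  qed
  have Nlim: "(N \<longlongrightarrow> integral\<^sup>L \<nu> (\<lambda>_. 1)) at_top"
    using weak[of "\<lambda>_. 1"] by (simp add: N_def[abs_def])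
  define V where "V = integral\<^sup>L \<nu> (\<lambda>_. 1 :: real)"
  have Nev: "eventually (\<lambda>\<tau>. N \<tau> < V + 1) at_top" using Nlim by (intro order_tendstoD) (auto simp: V_def)
  have N0: "0 \<le> N \<tau>" for \<tau> by (simp add: N_def)
  have V0: "0 \<le> V" by (simp add: V_def)
  have hb: "bounded (range h)" unfolding bounded_iff by (rule exI[of _ C]) (simp add: C(2))
  have hlim: "((\<lambda>\<tau>. exp (- \<tau> * l / 2) * (\<Sum>k<n \<tau>. h (\<gamma> \<tau> k))) \<longlongrightarrow> A) at_top" unfolding A_def by (rule weak[OF h(2) hb])
  define D where "D \<tau> = (\<Sum>k<n \<tau>. prob (E \<tau> k)) - exp (- \<tau> * l / 2) * (\<Sum>k<n \<tau>. h (\<gamma> \<tau> k))" for \<tau>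
  have cancel: "exp (- \<tau> * l / 2) * (exp (\<tau> * l / 2) * y - z) = y - exp (- \<tau> * l / 2) * z" for \<tau> y z
  proof -
    have "exp (- \<tau> * l / 2) * exp (\<tau> * l / 2) = 1" by (simp add: mult_exp_exp)
    then show ?thesis by (simp add: right_diff_distrib mult.assoc[symmetric])
  qed
  have D: "(D \<longlongrightarrow> 0) at_top"
  proof (rule tendstoI)
    fix e :: real assume e: "0 < e"
    \<comment> \<open>The scaled mass \<open>N \<tau>\<close> is eventually below
      \<open>V + 1\<close>, so an error \<open>d\<close> per unit of mass adds up to less than
      \<open>e\<close>.\<close>
    define d where "d = e / (V + 1)"
    have d: "0 < d" using e V0 by (simp add: d_def)
    obtain T where T: "\<And>\<tau> k. T \<le> \<tau> \<Longrightarrow> k < n \<tau> \<Longrightarrow> \<bar>exp (\<tau> * l / 2) * prob (E \<tau> k) - h (\<gamma> \<tau> k)\<bar> \<le> d"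
      by (rule asym[OF d, OF that])
    show "eventually (\<lambda>\<tau>. dist (D \<tau>) 0 < e) at_top"
      using eventually_conj[OF eventually_ge_at_top[of T] Nev]
    proof (rule eventually_mono)
      fix \<tau> assume t: "T \<le> \<tau> \<and> N \<tau> < V + 1"
      have Deq: "D \<tau> = (\<Sum>k<n \<tau>. exp (- \<tau> * l / 2) * (exp (\<tau> * l / 2) * prob (E \<tau> k) - h (\<gamma> \<tau> k)))"
        unfolding D_def cancel sum_subtractf sum_distrib_left ..
      have "\<bar>D \<tau>\<bar> \<le> (\<Sum>k<n \<tau>. \<bar>exp (- \<tau> * l / 2) * (exp (\<tau> * l / 2) * prob (E \<tau> k) - h (\<gamma> \<tau> k))\<bar>)" unfolding Deq by (rule sum_abs)
      also have "\<dots> \<le> (\<Sum>k<n \<tau>. exp (- \<tau> * l / 2) * d)"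
      proof (rule sum_mono)
        fix k assume "k \<in> {..<n \<tau>}"
        then have "k < n \<tau>" by simp
        note bd = T[OF conjunct1[OF t] this]
        show "\<bar>exp (- \<tau> * l / 2) * (exp (\<tau> * l / 2) * prob (E \<tau> k) - h (\<gamma> \<tau> k))\<bar> \<le> exp (- \<tau> * l / 2) * d"
          unfolding abs_mult abs_exp_cancel by (rule mult_left_mono[OF bd]) simp
      qed
      also have "\<dots> = N \<tau> * d" by (simp add: N_def)
      also have "\<dots> < (V + 1) * d" by (rule mult_strict_right_mono[OF conjunct2[OF t] d])
      also have "\<dots> = e" unfolding d_def using V0 by simp
      finally show "dist (D \<tau>) 0 < e" unfolding dist_real_def diff_0_right .
    qed
  qed
  have sumlim: "((\<lambda>\<tau>. \<Sum>k<n \<tau>. prob (E \<tau> k)) \<longlongrightarrow> A) at_top"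
    using tendsto_add[OF D hlim] by (simp add: D_def)
  obtain T1 where T1: "\<And>\<tau> k. T1 \<le> \<tau> \<Longrightarrow> k < n \<tau> \<Longrightarrow> \<bar>exp (\<tau> * l / 2) * prob (E \<tau> k) - h (\<gamma> \<tau> k)\<bar> \<le> 1"
    by (rule asym[OF zero_less_one, OF that])
  \<comment> \<open>A single survival probability is eventually at most
    \<open>exp (- (l / 2 * \<tau>)) * (C + 1)\<close>, uniformly over the starting points.\<close>
  have small: "eventually (\<lambda>\<tau>. \<forall>k<n \<tau>. prob (E \<tau> k) \<le> e) at_top" if e: "0 < e" for e
  proof -
    have "filterlim (\<lambda>\<tau>. l / 2 * \<tau>) at_top at_top"
      using l by (intro filterlim_tendsto_pos_mult_at_top[OF tendsto_const] filterlim_ident) auto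
    then have "filterlim (\<lambda>\<tau>. - (l / 2 * \<tau>)) at_bot at_top" by (simp add: filterlim_uminus_at_top)
    then have "((\<lambda>\<tau>. exp (- (l / 2 * \<tau>))) \<longlongrightarrow> 0) at_top" by (rule filterlim_compose[OF exp_at_bot])
    then have "((\<lambda>\<tau>. exp (- (l / 2 * \<tau>)) * (C + 1)) \<longlongrightarrow> 0 * (C + 1)) at_top" by (rule tendsto_mult_right)
    then have "eventually (\<lambda>\<tau>. exp (- (l / 2 * \<tau>)) * (C + 1) < e) at_top" using e by (intro order_tendstoD) auto
    from eventually_conj[OF eventually_ge_at_top[of T1] this] show ?thesis
    proof (rule eventually_mono, intro allI impI)
      fix \<tau> k assume t: "T1 \<le> \<tau> \<and> exp (- (l / 2 * \<tau>)) * (C + 1) < e" and k: "k < n \<tau>"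
      have "exp (\<tau> * l / 2) * prob (E \<tau> k) \<le> C + 1" using T1[OF conjunct1[OF t] k] C(2)[of "\<gamma> \<tau> k"] by linarith
      then have "exp (- (l / 2 * \<tau>)) * (exp (\<tau> * l / 2) * prob (E \<tau> k)) \<le> exp (- (l / 2 * \<tau>)) * (C + 1)" by (intro mult_left_mono) auto
      moreover have "exp (- (l / 2 * \<tau>)) * (exp (\<tau> * l / 2) * prob (E \<tau> k)) = prob (E \<tau> k)"
      proof -
        have "exp (- (l / 2 * \<tau>)) * exp (\<tau> * l / 2) = exp (- (l / 2 * \<tau>) + \<tau> * l / 2)" by (rule exp_add[symmetric])
        also have "- (l / 2 * \<tau>) + \<tau> * l / 2 = 0" by simp
        finally show ?thesis unfolding mult.assoc[symmetric] by simp
      qed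
      ultimately show "prob (E \<tau> k) \<le> e" using conjunct2[OF t] by linarith
    qed
  qed
  \<comment> \<open>Survival is a measurable function of the whole path, so independence of the
    processes passes to the indicators.\<close>
  have indE: "indep_vars (\<lambda>_. borel) (\<lambda>k. indicator (E \<tau> k) :: 'a \<Rightarrow> real) {..<n \<tau>}" if t: "0 < \<tau>" for \<tau>
  proof -
    have "indep_vars (\<lambda>_. borel) (\<lambda>k \<omega>. indicator (survives \<tau> (\<gamma> \<tau> k)) (\<lambda>t. W \<tau> k t \<omega>) :: real) {..<n \<tau>}"
      using ind[OF t] unfolding indep_processes_def
      by (rule indep_vars_compose2) (intro borel_measurable_indicator survives_measurable)
    then show ?thesis
    proof (rule indep_vars_cong_space)
      fix k \<omega> assume k: "k \<in> {..<n \<tau>}" and w: "\<omega> \<in> space M"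
      then have "k < n \<tau>" by simp
      from survival_event_eq[OF W[OF t this]] w show "indicator (survives \<tau> (\<gamma> \<tau> k)) (\<lambda>t. W \<tau> k t \<omega>) = (indicator (E \<tau> k) \<omega> :: real)"
        unfolding E_def by (simp add: indicator_def)
    qed
  qed
  have card: "real (card {k. k < n \<tau> \<and> (\<forall>t\<in>{0..\<tau>}. \<gamma> \<tau> k + b (W \<tau> k t \<omega>) \<in> Q)}) = (\<Sum>k<n \<tau>. indicator (E \<tau> k) \<omega>)"
    if "\<omega> \<in> space M" for \<tau> \<omega>
  proof -
    have "(\<Sum>k<n \<tau>. indicator (E \<tau> k) \<omega> :: real) = (\<Sum>k<n \<tau>. indicator {k. \<omega> \<in> E \<tau> k} k)"
      by (rule sum.cong) (simp_all add: indicator_def)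
    also have "\<dots> = real (card ({..<n \<tau>} \<inter> {k. \<omega> \<in> E \<tau> k}))"
      unfolding indicator_def of_bool_def by (subst sum.If_cases) simp_all
    also have "{..<n \<tau>} \<inter> {k. \<omega> \<in> E \<tau> k} = {k. k < n \<tau> \<and> (\<forall>t\<in>{0..\<tau>}. \<gamma> \<tau> k + b (W \<tau> k t \<omega>) \<in> Q)}"
      unfolding E_def using that by blast
    finally show ?thesis by (rule sym)
  qed
  define G where "G \<tau> = expectation (\<lambda>\<omega>. \<phi> (\<Sum>k<n \<tau>. indicator (E \<tau> k) \<omega>))" for \<tau>
  have "(G \<longlongrightarrow> (\<Sum>m. \<phi> (real m) * A ^ m / fact m * exp (- A))) at_top"
  \<comment> \<open>The limit theorem concerns sequences, so the limit along real
    \<open>\<tau>\<close> is tested on sequences tending to infinity.\<close>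
  proof (rule tendsto_at_topI_sequentially)
    fix X :: "nat \<Rightarrow> real" assume X: "filterlim X at_top sequentially"
    \<comment> \<open>The hypotheses on the processes concern positive times. Only finitely many
      terms of the sequence are replaced by 1, which does not affect the limit.\<close>
    define Y where "Y i = (if 0 < X i then X i else 1)" for i
    have Y0: "0 < Y i" for i by (simp add: Y_def)
    have "eventually (\<lambda>i. 0 < X i) sequentially" using X unfolding filterlim_at_top_dense ..
    then have XY: "eventually (\<lambda>i. Y i = X i) sequentially" by (rule eventually_mono) (simp add: Y_def)
    have Y: "filterlim Y at_top sequentially" by (rule filterlim_cong[THEN iffD2, OF refl refl XY X])
    have "(\<lambda>i. expectation (\<lambda>\<omega>. \<phi> (\<Sum>k<n (Y i). indicator (E (Y i) k) \<omega>))) \<longlonglongrightarrow> (\<Sum>m. \<phi> (real m) * A ^ m / fact m * exp (- A))"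
    proof (rule poisson_limit_sequence)
      show "E (Y i) k \<in> events" if "k < n (Y i)" for i k by (rule Em[OF Y0 that])
      show "indep_vars (\<lambda>_. borel) (\<lambda>k. indicator (E (Y i) k) :: 'a \<Rightarrow> real) {..<n (Y i)}" for i by (rule indE[OF Y0])
      show "(\<lambda>i. \<Sum>k<n (Y i). prob (E (Y i) k)) \<longlonglongrightarrow> A" by (rule filterlim_compose[OF sumlim Y])
      show "eventually (\<lambda>i. \<forall>k<n (Y i). prob (E (Y i) k) \<le> e) sequentially" if "0 < e" for e
        by (rule eventually_compose_filterlim[OF small[OF that] Y])
    qed (rule \<phi>)+
    then have "(\<lambda>i. G (Y i)) \<longlonglongrightarrow> (\<Sum>m. \<phi> (real m) * A ^ m / fact m * exp (- A))" by (simp add: G_def)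
    then show "(\<lambda>i. G (X i)) \<longlonglongrightarrow> (\<Sum>m. \<phi> (real m) * A ^ m / fact m * exp (- A))"
    proof (rule Lim_transform_eventually)
      show "eventually (\<lambda>i. G (Y i) = G (X i)) sequentially" using XY by (rule eventually_mono) simp
    qed
  qed
  moreover have "G = (\<lambda>\<tau>. expectation (\<lambda>\<omega>. \<phi> (real (card {k. k < n \<tau> \<and> (\<forall>t\<in>{0..\<tau>}. \<gamma> \<tau> k + b (W \<tau> k t \<omega>) \<in> Q)}))))"
    unfolding G_def by (intro ext Bochner_Integration.integral_cong refl) (simp only: card)
  ultimately show ?thesis unfolding A_def by simp
qed

end

theorem theorem1:
  fixes Q :: "(real^'d) set" and lam :: real
    and B :: "real^'d^'d" and \<mu> :: real
    and n :: "real \<Rightarrow> nat" and \<gamma> :: "real \<Rightarrow> nat \<Rightarrow> real^'d"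
    and M :: "'a measure" and W :: "real \<Rightarrow> nat \<Rightarrow> real \<Rightarrow> 'a \<Rightarrow> real^'d"
    and l1 :: real and n1 :: nat and f :: "nat \<Rightarrow> real^'d \<Rightarrow> real"
    and \<nu> :: "(real^'d) measure"
  assumes Q: "bounded Q" "open Q" "connected Q" "lyapunov_boundary Q lam"
    and ellip: "\<mu> > 0"
      "\<forall>z::real^'d. (\<Sum>i\<in>UNIV. \<Sum>j\<in>UNIV. (transpose B ** B) $ i $ j * z $ i * z $ j) \<ge> \<mu> * (norm z)\<^sup>2"
    and pts: "\<forall>\<tau>>0. \<forall>k<n \<tau>. \<gamma> \<tau> k \<in> Q"
    and M: "prob_space M"
    and W: "\<forall>\<tau>>0. (\<forall>k<n \<tau>. std_wiener M (W \<tau> k)) \<and> indep_processes M (W \<tau>) {..<n \<tau>}"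
    and l1: "dirichlet_eigenvalue (transpose B ** B) Q l1"
      "\<forall>l. dirichlet_eigenvalue (transpose B ** B) Q l \<longrightarrow> l1 \<le> l"
    and onb: "\<forall>i<n1. \<forall>j<n1. (LINT x:Q|lebesgue. f i x * f j x) = (if i = j then 1 else 0)"
      "\<forall>u. dirichlet_solution (transpose B ** B) Q l1 u \<longleftrightarrow>
            (\<exists>c::nat \<Rightarrow> real. \<forall>x\<in>closure Q. u x = (\<Sum>i<n1. c i * f i x))"
    and \<nu>: "finite_measure \<nu>" "sets \<nu> = sets (borel :: (real^'d) measure)" "emeasure \<nu> (- Q) = 0"
    and weak: "\<forall>g::real^'d \<Rightarrow> real. continuous_on UNIV g \<and> bounded (range g) \<longrightarrow>
        ((\<lambda>\<tau>. exp (- \<tau> * l1 / 2) * (\<Sum>k<n \<tau>. g (\<gamma> \<tau> k))) \<longlongrightarrow> integral\<^sup>L \<nu> g) at_top"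
  shows "let c = (\<lambda>i. LINT x:Q|lebesgue. f i x);
             F = (\<lambda>x. \<Sum>i<n1. c i * f i x);
             a = (LINT x:Q|\<nu>. F x);
             \<xi> = (\<lambda>\<tau> k t \<omega>. \<gamma> \<tau> k + (\<Sum>i\<in>UNIV. W \<tau> k t \<omega> $ i *\<^sub>R B $ i));
             \<eta> = (\<lambda>\<tau> \<omega>. card {k. k < n \<tau> \<and> (\<forall>t\<in>{0..\<tau>}. \<xi> \<tau> k t \<omega> \<in> Q)})
         in \<forall>h::real \<Rightarrow> real. continuous_on UNIV h \<and> bounded (range h) \<longrightarrow>
              ((\<lambda>\<tau>. prob_space.expectation M (\<lambda>\<omega>. h (real (\<eta> \<tau> \<omega>))))
                 \<longlongrightarrow> (\<Sum>m. h (real m) * a ^ m / fact m * exp (- a))) at_top"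
proof -
  \<comment> \<open>The displacement map of the process: it sends the unit vectors to the rows of
    \<open>B\<close>.\<close>
  define b where "b z = (\<Sum>i\<in>UNIV. z $ i *\<^sub>R B $ i)" for z :: "real^'d"
  have lin: "linear b" unfolding b_def
    by (intro linearI) (simp_all add: scaleR_add_left sum.distrib scaleR_sum_right)
  have bT: "b z = transpose B *v z" for z
    by (simp add: b_def vec_eq_iff matrix_vector_mult_def transpose_def mult.commute)
  have BB: "(transpose B ** B) $ i $ j = (\<Sum>k\<in>UNIV. B $ k $ i * B $ k $ j)" for i j
    by (simp add: matrix_matrix_mult_def transpose_def)
  \<comment> \<open>On the kernel of \<open>B\<close> the quadratic form of
    \<open>transpose B ** B\<close> vanishes, so ellipticity makes the kernel trivial; for a square
    matrix invertibility then passes to the transpose.\<close>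
  have "inj ((*v) B)"
    unfolding linear_injective_0[OF matrix_vector_mul_linear]
  proof (intro allI impI)
    fix z :: "real^'d" assume z: "B *v z = 0"
    have "(\<Sum>i\<in>UNIV. \<Sum>j\<in>UNIV. (transpose B ** B) $ i $ j * z $ i * z $ j) = z \<bullet> ((transpose B ** B) *v z)"
      by (simp add: inner_vec_def matrix_vector_mult_def sum_distrib_left mult_ac)
    also have "\<dots> = 0" using z by (simp add: matrix_vector_mul_assoc[symmetric])
    finally have "\<mu> * (norm z)\<^sup>2 \<le> 0" using ellip(2)[THEN spec, of z] by (simp only:)
    then have "\<not> 0 < (norm z)\<^sup>2" using mult_pos_pos[OF ellip(1)] by (meson not_less)
    then show "z = 0" by simp
  qed
  then have "invertible B" unfolding invertible_left_inverse matrix_left_invertible_injective .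
  then have "invertible (transpose B)" by (rule transpose_invertible)
  then have "inj ((*v) (transpose B))" unfolding invertible_left_inverse matrix_left_invertible_injective .
  moreover have "b = (*v) (transpose B)" by (rule ext) (rule bT)
  ultimately have inj: "inj b" by (simp only:)
  interpret elliptic_domain b Q using lin inj Q(1,2) by (simp add: elliptic_domain_def)
  have b_axis: "b (axis k 1) = B $ k" for k
    by (simp add: b_def axis_def if_distrib[where f="\<lambda>c. c *\<^sub>R _"] sum.delta cong: if_cong)
  have sg: "(transpose B ** B) $ i $ j = sg i j" for i j by (simp add: BB sg_def b_axis)
  obtain k0 h where h: "0 < l1" "bm h" "continuous_on UNIV h" "\<And>x. x \<notin> Q \<Longrightarrow> h x = 0"
    "\<And>k. k0 \<le> k \<Longrightarrow> uniform_limit UNIV (\<lambda>n x. (P k ^^ n) (\<lambda>_. 1) x / exp (- l1 / 2 / 2 ^ k) ^ n) h sequentially"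
    "\<And>x. x \<in> Q \<Longrightarrow> (\<Sum>i<n1. (LINT x:Q|lebesgue. f i x) * f i x) = h x"
  proof (rule principal_projection[OF Q(4) sg l1(1)])
    show "l1 \<le> l" if "dirichlet_eigenvalue (transpose B ** B) Q l" for l using l1(2) that by blast
    show "(LINT x:Q|lebesgue. f i x * f j x) = (if i = j then 1 else 0)" if "i < n1" "j < n1" for i j using onb(1) that by blast
    show "dirichlet_solution (transpose B ** B) Q l1 u \<longleftrightarrow> (\<exists>c::nat \<Rightarrow> real. \<forall>x\<in>closure Q. u x = (\<Sum>i<n1. c i * f i x))" for u
      by (rule onb(2)[THEN spec])
  qed blast
  \<comment> \<open>The set integral ignores the complement of \<open>Q\<close>, and there
    \<open>h\<close> vanishes.\<close>
  have "(LINT x:Q|\<nu>. F x) = integral\<^sup>L \<nu> h" if "\<And>x. x \<in> Q \<Longrightarrow> F x = h x" for F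
    unfolding set_lebesgue_integral_def using that h(4)
    by (intro Bochner_Integration.integral_cong) (auto simp: indicator_def)
  then have a: "(LINT x:Q|\<nu>. (\<Sum>i<n1. (LINT x:Q|lebesgue. f i x) * f i x)) = integral\<^sup>L \<nu> h" using h(6) .
  have "((\<lambda>\<tau>. prob_space.expectation M (\<lambda>\<omega>. \<phi> (real (card {k. k < n \<tau> \<and> (\<forall>t\<in>{0..\<tau>}. \<gamma> \<tau> k + b (W \<tau> k t \<omega>) \<in> Q)}))))
       \<longlongrightarrow> (\<Sum>m. \<phi> (real m) * integral\<^sup>L \<nu> h ^ m / fact m * exp (- integral\<^sup>L \<nu> h))) at_top"
    if \<phi>: "continuous_on UNIV \<phi>" "bounded (range \<phi>)" for \<phi> :: "real \<Rightarrow> real"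
  proof (rule survivors_poisson[OF M _ _ h(1-3,5) _ \<phi>])
    show "std_wiener M (W \<tau> k)" if "0 < \<tau>" "k < n \<tau>" for \<tau> k using W that by blast
    show "indep_processes M (W \<tau>) {..<n \<tau>}" if "0 < \<tau>" for \<tau> using W that by blast
    show "((\<lambda>\<tau>. exp (- \<tau> * l1 / 2) * (\<Sum>k<n \<tau>. g (\<gamma> \<tau> k))) \<longlongrightarrow> integral\<^sup>L \<nu> g) at_top"
      if "continuous_on UNIV g" "bounded (range g)" for g :: "real^'d \<Rightarrow> real"
      by (rule weak[THEN spec, THEN mp, OF conjI[OF that]])
  qed
  then show ?thesis unfolding Let_def a b_def by (intro allI impI) (elim conjE)
qed

end
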